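(* Let $n\ge1$ and let $f_n\in\hat L^2(\mathbb R_+^n)$ be a symmetric function satisfying $\int_{2k}^{2k+2}f_n(t,* )\,dt=0$ for all $k\in\mathbb N$. Assume that $$\widehat G^n_kf_n( * ):=\frac12\int_0^\infty G^{n-1}_kf_n(t,* )\,dt$$ belongs to $L^2(\mathbb R_+^k)$ for all $1\le k\le 2n-2$. Then $$d_W(I_n(f_n),\mathcal N)\le\sqrt{\Big(1-n!\|f_n\|^2_{L^2(\mathbb R_+,dx/2)^{\circ n}}\Big)^2+n^2\sum_{k=1}^{2n-2}k!\,\big\|\widehat G^n_kf_n\big\|^2_{L^2(\mathbb R_+,dx/2)^{\circ k}}}$$ $$\qquad+\,n^2\sqrt{2(n-1)!}\;\|f_n\|_{L^2(\mathbb R_+,dx/2)^{\circ n}}\sqrt{\sum_{k=0}^{2n-2}k!\int_0^\infty\big\|G^{n-1}_kf_n(t,\cdot)\big\|^2_{L^2(\mathbb R_+,dx/2)^{\circ k}}dt}.$$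
   Context: $\mathbb N=\{0,1,2,\ldots\}$, $\mathbb R_+=[0,\infty)$. $(U_k)_{k\in\mathbb N}$ is an i.i.d. sequence uniformly distributed on $[-1,1]$. $\Delta_n:=\bigcup [2k_1,2k_1+2]\times\cdots\times[2k_n,2k_n+2]$, the union being over pairwise distinct $k_1,\ldots,k_n\in\mathbb N$; $\hat L^2(\mathbb R_+^n)$ is the space of symmetric square-integrable functions on $\mathbb R_+^n$ vanishing outside $\Delta_n$. For $f_n\in\hat L^2(\mathbb R_+^n)$ satisfying $\int_{2k}^{2k+2}f_n(t,* )dt=0$ for all $k\in\mathbb N$ (where $*$ stands for the remaining variables), the multiple stochastic integral is $$I_n(f_n)=\sum_{k_1,\ldots,k_n\ge0\text{ distinct}}f_n(2k_1+1+U_{k_1},\ldots,2k_n+1+U_{k_n}),$$ (extended by $L^2$-continuity, with $\mathbb E[I_n(f_n)^2]=n!\|f_n\|^2_{L^2(\mathbb R_+,dx/2)^{\circ n}}$). The norm $\|\cdot\|_{L^2(\mathbb R_+,dx/2)^{\circ k}}$ is that of $L^2(\mathbb R_+^k,(dx/2)^{\otimes k})$ (absolute value if $k=0$). For functions $f$ of $n$ and $g$ of $m$ variables and $0\le i\le k\le n\wedge m$, $$f\star^i_kg(\gamma_1,\ldots,\gamma_{k-i},t_1,\ldots,t_{n-k},s_1,\ldots,s_{m-k}):=\frac1{2^i}\int_{\mathbb R_+^i}f(z_1,\ldots,z_i,\gamma_1,\ldots,\gamma_{k-i},t_1,\ldots,t_{n-k})\,g(z_1,\ldots,z_i,\gamma_1,\ldots,\gamma_{k-i},s_1,\ldots,s_{m-k})\,dz_1\cdots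 dz_i,$$ and $f\,\widetilde\star^i_k\,g$ is the symmetrization of $f\star^i_kg$ in all its $m+n-k-i$ variables. For a symmetric function $g$ of $n$ variables and $0\le k\le2n$, $$G^n_kg(z_1,\ldots,z_k):=\mathbf 1_{\Delta_k}(z_1,\ldots,z_k)\sum_{r=0}^n\sum_{l=0}^r\mathbf 1_{\{2n-r-l=k\}}\,r!\binom nr^2\binom rl\,g\,\widetilde\star^l_r\,g(z_1,\ldots,z_k).$$ $G^{n-1}_kf_n(t,\cdot)$ denotes $G^{n-1}_k$ applied to the function $f_n(t,\cdot)$ of $n-1$ variables, $t$ being fixed. $\mathcal N$ is a standard normal random variable, and $d_W(X,Y)=\sup_h|\mathbb E[h(X)]-\mathbb E[h(Y)]|$ over Lipschitz $h:\mathbb R\to\mathbb R$ with constant at most $1$. The right-hand side may be $+\infty$. *)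

theory Defs
  imports "HOL-Probability.Probability"
begin

text \<open>
  A function of \<open>n\<close> real variables is a function on \<^typ>\<open>nat \<Rightarrow> real\<close>, evaluated only at points of
  \<open>{..<n} \<rightarrow>\<^sub>E UNIV\<close>, the space of the product measures over \<open>{..<n}\<close>.  This space has
  exactly one point for \<open>n = 0\<close>, so that \<open>L2norm 0\<close> is the absolute value.  The variables are
  numbered from \<open>0\<close>, and \<open>case_nat t x\<close> is the tuple \<open>(t, x)\<close>.
\<close>

definition leb_plus :: "real measure" where
  "leb_plus = density lborel (indicator {0..})"

definition half_leb :: "real measure" where
  "half_leb = density lborel (\<lambda>x. ennreal (1 / 2) * indicator {0..} x)"

definition esqrt :: "ennreal \<Rightarrow> ennreal" where
  "esqrt x = (if x = \<top> then \<top> else ennreal (sqrt (enn2real x)))"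

definition L2 :: "nat \<Rightarrow> ((nat \<Rightarrow> real) \<Rightarrow> real) \<Rightarrow> bool" where
  "L2 n f \<longleftrightarrow> f \<in> borel_measurable (\<Pi>\<^sub>M i\<in>{..<n}. leb_plus)
      \<and> integrable (\<Pi>\<^sub>M i\<in>{..<n}. leb_plus) (\<lambda>x. (f x)\<^sup>2)"

definition L2norm :: "nat \<Rightarrow> ((nat \<Rightarrow> real) \<Rightarrow> real) \<Rightarrow> ennreal" where
  "L2norm n f = esqrt (\<integral>\<^sup>+ x. ennreal ((f x)\<^sup>2) \<partial>(\<Pi>\<^sub>M i\<in>{..<n}. half_leb))"

definition Delta :: "nat \<Rightarrow> (nat \<Rightarrow> real) set" where
  "Delta n = (\<Union>k\<in>{k :: nat \<Rightarrow> nat. inj_on k {..<n}}.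
      \<Pi>\<^sub>E i\<in>{..<n}. {2 * real (k i) .. 2 * real (k i) + 2})"

definition symmetric_fun :: "nat \<Rightarrow> ((nat \<Rightarrow> real) \<Rightarrow> real) \<Rightarrow> bool" where
  "symmetric_fun n f \<longleftrightarrow>
     (\<forall>p x. p permutes {..<n} \<longrightarrow> x \<in> {..<n} \<rightarrow>\<^sub>E UNIV \<longrightarrow> f (x \<circ> p) = f x)"

definition L2hat :: "nat \<Rightarrow> ((nat \<Rightarrow> real) \<Rightarrow> real) \<Rightarrow> bool" where
  "L2hat n f \<longleftrightarrow> L2 n f \<and> symmetric_fun n f
      \<and> (\<forall>x \<in> {..<n} \<rightarrow>\<^sub>E UNIV. x \<notin> Delta n \<longrightarrow> f x = 0)"

text \<open>
  For an \<open>L\<^sup>2\<close> function the integral over one variable exists for almost all values of the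
  remaining ones only, so the centering condition is an almost everywhere statement.
\<close>

definition centered :: "nat \<Rightarrow> ((nat \<Rightarrow> real) \<Rightarrow> real) \<Rightarrow> bool" where
  "centered n f \<longleftrightarrow>
     (\<forall>k::nat. AE y in (\<Pi>\<^sub>M i\<in>{..<n-1}. leb_plus).
        (LBINT t:{2 * real k .. 2 * real k + 2}. f (case_nat t y)) = 0)"

definition stoch_sum ::
  "(nat \<Rightarrow> 'a \<Rightarrow> real) \<Rightarrow> nat \<Rightarrow> ((nat \<Rightarrow> real) \<Rightarrow> real) \<Rightarrow> 'a \<Rightarrow> real" where
  "stoch_sum U n f \<omega> =
     (\<Sum>\<^sub>\<infinity>k\<in>{k \<in> {..<n} \<rightarrow>\<^sub>E (UNIV :: nat set). inj_on k {..<n}}.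
        f (\<lambda>i\<in>{..<n}. 2 * real (k i) + 1 + U (k i) \<omega>))"

definition bounded_support :: "nat \<Rightarrow> ((nat \<Rightarrow> real) \<Rightarrow> real) \<Rightarrow> bool" where
  "bounded_support n f \<longleftrightarrow>
     (\<exists>b. \<forall>x \<in> {..<n} \<rightarrow>\<^sub>E UNIV. f x \<noteq> 0 \<longrightarrow> (\<forall>i<n. x i \<le> b))"

text \<open>
  For centered functions in \<open>L2hat\<close> with bounded support the sum \<^const>\<open>stoch_sum\<close> has almost
  surely finitely many nonzero terms.  The multiple stochastic integral is the continuous
  extension of it: its graph is the closure, in \<open>L\<^sup>2 \<times> L\<^sup>2\<close>, of the graph on these functions.
\<close>

definition is_stoch_int ::
  "'a measure \<Rightarrow> (nat \<Rightarrow> 'a \<Rightarrow> real) \<Rightarrow> nat \<Rightarrow> ((nat \<Rightarrow> real) \<Rightarrow> real) \<Rightarrow> ('a \<Rightarrow> real) \<Rightarrow> bool" where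
  "is_stoch_int M U n f X \<longleftrightarrow>
     X \<in> borel_measurable M \<and> integrable M (\<lambda>\<omega>. (X \<omega>)\<^sup>2) \<and>
     (\<exists>g :: nat \<Rightarrow> (nat \<Rightarrow> real) \<Rightarrow> real.
        (\<forall>j. L2hat n (g j) \<and> centered n (g j) \<and> bounded_support n (g j)) \<and>
        (\<lambda>j. L2norm n (\<lambda>x. g j x - f x)) \<longlonglongrightarrow> 0 \<and>
        (\<lambda>j. \<integral>\<^sup>+ \<omega>. ennreal ((stoch_sum U n (g j) \<omega> - X \<omega>)\<^sup>2) \<partial>M) \<longlonglongrightarrow> 0)"

definition stoch_int ::
  "'a measure \<Rightarrow> (nat \<Rightarrow> 'a \<Rightarrow> real) \<Rightarrow> nat \<Rightarrow> ((nat \<Rightarrow> real) \<Rightarrow> real) \<Rightarrow> 'a \<Rightarrow> real" where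
  "stoch_int M U n f = (SOME X. is_stoch_int M U n f X)"

text \<open>
  \<open>star n f m g i k\<close> is \<open>f \<star>\<^sup>i\<^sub>k g\<close> for \<open>f\<close> of \<open>n\<close> and \<open>g\<close> of \<open>m\<close> variables.  Its argument
  \<open>x\<close> lists \<open>\<gamma>\<close> (indices below \<open>k - i\<close>), then \<open>t\<close> (below \<open>n - i\<close>), then \<open>s\<close>.
\<close>

definition star ::
  "nat \<Rightarrow> ((nat \<Rightarrow> real) \<Rightarrow> real) \<Rightarrow> nat \<Rightarrow> ((nat \<Rightarrow> real) \<Rightarrow> real) \<Rightarrow> nat \<Rightarrow> nat
    \<Rightarrow> (nat \<Rightarrow> real) \<Rightarrow> real" where
  "star n f m g i k x = 1 / 2 ^ i *
     (\<integral>z. f (\<lambda>j\<in>{..<n}. if j < i then z j else x (j - i))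
         * g (\<lambda>j\<in>{..<m}. if j < i then z j
                         else if j < k then x (j - i)
                         else x (n - i + (j - k)))
       \<partial>(\<Pi>\<^sub>M j\<in>{..<i}. leb_plus))"

definition symmetrize :: "nat \<Rightarrow> ((nat \<Rightarrow> real) \<Rightarrow> real) \<Rightarrow> (nat \<Rightarrow> real) \<Rightarrow> real" where
  "symmetrize d F x = (\<Sum>p | p permutes {..<d}. F (x \<circ> p)) / fact d"

definition G :: "nat \<Rightarrow> nat \<Rightarrow> ((nat \<Rightarrow> real) \<Rightarrow> real) \<Rightarrow> (nat \<Rightarrow> real) \<Rightarrow> real" where
  "G n k g z = indicator (Delta k) z *
     (\<Sum>r\<le>n. \<Sum>l\<le>r. of_bool (2 * n - r - l = k) * fact r * (real (n choose r))\<^sup>2 * real (r choose l)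
        * symmetrize (2 * n - r - l) (star n g n g l r) z)"

definition Ghat :: "nat \<Rightarrow> nat \<Rightarrow> ((nat \<Rightarrow> real) \<Rightarrow> real) \<Rightarrow> (nat \<Rightarrow> real) \<Rightarrow> real" where
  "Ghat n k f z = 1 / 2 * (\<integral>t. G (n - 1) k (\<lambda>y. f (case_nat t y)) z \<partial>leb_plus)"

definition d_W :: "'a measure \<Rightarrow> ('a \<Rightarrow> real) \<Rightarrow> 'b measure \<Rightarrow> ('b \<Rightarrow> real) \<Rightarrow> ennreal" where
  "d_W M X N Y = (SUP h\<in>{h :: real \<Rightarrow> real. lipschitz_on 1 UNIV h}.
      ennreal \<bar>(\<integral>\<omega>. h (X \<omega>) \<partial>M) - (\<integral>\<omega>. h (Y \<omega>) \<partial>N)\<bar>)"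

end

theory Submission
  imports Defs "HOL-Combinatorics.Permutations"
begin

text \<open>
  The points \<open>x\<^sub>k = 2k + 1 + U\<^sub>k\<close> are independent and uniform on the blocks \<open>[2k, 2k + 2]\<close>, and
  \<open>I\<^sub>n(f)\<close> is the \<open>L\<^sup>2\<close> limit of the sums \<open>S\<close> of \<open>u\<^sub>A = n! f(x\<^sub>k)\<^bsub>k \<in> A\<^esub>\<close> over the \<open>n\<close>-element sets \<open>A\<close> of the
  first \<open>N\<close> blocks.  By the centering condition these summands are degenerate, so the part
  \<open>D\<^sub>i = (\<Sum>A \<ni> i. u\<^sub>A)\<close> averages to \<open>0\<close> over \<open>x\<^sub>i\<close>.  For a solution \<open>h\<close> of Stein's equation, replacing
  \<open>x\<^sub>i\<close> by an independent copy shows that \<open>E(S h(S)) = E(h'(S) \<Gamma>)\<close> up to \<open>2/n \<Sum>\<^sub>i E\<bar>D\<^sub>i\<bar>\<^sup>3\<close>, where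
  \<open>\<Gamma> = 1/n \<Sum>\<^sub>i E\<^sub>i(D\<^sub>i\<^sup>2)\<close>, \<open>E\<^sub>i\<close> being the average over \<open>x\<^sub>i\<close>.  In the Hoeffding decompositions of \<open>D\<^sub>i\<^sup>2\<close> and of \<open>\<Gamma>\<close> the component of
  a set \<open>K\<close> of \<open>k\<close> blocks is a projection of a function which, as \<open>N\<close> grows, converges to the value
  of \<open>n\<^sup>2 k! G\<^sub>k\<close>, respectively \<open>n k! Ghat\<^sub>k\<close>, at \<open>(x\<^sub>j)\<^bsub>j \<in> K\<^esub>\<close>.  Since projections are contractions,
  orthogonality of the components bounds the second moments of \<open>1 - \<Gamma>\<close> and of \<open>D\<^sub>i\<^sup>2\<close>; the
  Cauchy-Schwarz inequality then controls the third moments.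
\<close>

subsection \<open>Stein's equation for the normal distribution\<close>

text \<open>The obstacle is that the hypotheses concern contractions of the full kernel, integrated
  over the whole half-line, whereas the exchange argument needs finitely many blocks. Contractions
  of a truncated kernel need not be dominated by those of the kernel itself, because of cancellation
  in the integrated variables. Hence \<open>N\<close> blocks are compared with \<open>m >= N\<close>
  blocks: averaging over the blocks from \<open>N\<close> on maps D_i for \<open>m\<close> to D_i
  for \<open>N\<close>, so by Jensen the square for \<open>N\<close> lies below a conditional
  average of the square for \<open>m\<close>. The Hoeffding components of that average are indexed
  by subsets of a fixed set, and they converge one by one as \<open>m\<close> grows. The convergence
  is in L1 only, since products of square-integrable kernels are merely integrable; square
  integrability enters through the limits. For \<Gamma> the comparison costs the missing variance
  \<open>aL - a {..<N}\<close>, which disappears at the very end. The constants 1 and 2 in the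
  bounds on the Stein solution are what the final constant requires: 2 / n * sqrt (n * n! * F^2) *
  sqrt (n^4 / 2 * g) = n^2 * sqrt (2 * (n - 1)!) * F * sqrt g, where F is the norm of the kernel and
  g the sum of the norms of the G_k.\<close>

lemma std_normal_density_deriv:
  "(std_normal_density has_real_derivative - x * std_normal_density x) (at x)"
proof -
  have "((\<lambda>x. 1 / sqrt (2 * pi) * exp (- x\<^sup>2 / 2)) has_real_derivative
      1 / sqrt (2 * pi) * (exp (- x\<^sup>2 / 2) * (- x))) (at x)"
    by (rule DERIV_cmult) (auto intro!: derivative_eq_intros)
  then show ?thesis
    unfolding std_normal_density_def[abs_def] by (simp add: mult_ac)
qed

lemma std_normal_density_pos: "std_normal_density x > 0"
  by (simp add: std_normal_density_def)

lemma continuous_std_normal_density: "continuous_on A std_normal_density"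
  by (rule DERIV_continuous_on[OF has_field_derivative_at_within[OF std_normal_density_deriv]])

lemma integral_greaterThan_FTC:
  fixes F f :: "real \<Rightarrow> real"
  assumes F: "\<And>y. (F has_real_derivative f y) (at y)" and f: "continuous_on UNIV f"
    and i: "integrable lborel f" and lim: "(F \<longlongrightarrow> B) at_top"
  shows "(LBINT y:{x<..}. f y) = B - F x"
proof -
  have c: "isCont F x" using F by (meson DERIV_isCont)
  have "(LBINT y=ereal x..\<infinity>. f y) = B - F x"
  proof (rule interval_integral_FTC_integrable)
    show "set_integrable lborel (einterval (ereal x) \<infinity>) f"
      unfolding set_integrable_def using i by (intro integrable_mult_indicator) auto
    show "((F \<circ> real_of_ereal) \<longlongrightarrow> F x) (at_right (ereal x))"
      using c by (auto simp: ereal_tendsto_simps1 continuous_within tendsto_mono[OF at_le] intro: tendsto_mono[OF at_le])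
    show "((F \<circ> real_of_ereal) \<longlongrightarrow> B) (at_left \<infinity>)"
      using lim by (simp add: ereal_tendsto_simps1)
  qed (use F f in \<open>auto simp: has_real_derivative_iff_has_vector_derivative continuous_on_eq_continuous_at\<close>)
  then show ?thesis
    by (simp add: interval_integral_to_infinity_eq)
qed

lemma std_normal_density_tendsto_0: "(std_normal_density \<longlongrightarrow> 0) at_top"
  and mult_std_normal_density_tendsto_0: "((\<lambda>x. x * std_normal_density x) \<longlongrightarrow> 0) at_top"
proof -
  show "(std_normal_density \<longlongrightarrow> 0) at_top" unfolding std_normal_density_def by real_asymp
  show "((\<lambda>x. x * std_normal_density x) \<longlongrightarrow> 0) at_top" unfolding std_normal_density_def by real_asymp
qed

lemma std_normal_moments:
  shows "integrable lborel (\<lambda>x. x * std_normal_density x)"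
    "integrable lborel (\<lambda>x. x\<^sup>2 * std_normal_density x)"
    "(\<integral>x. x * std_normal_density x \<partial>lborel) = 0"
    "(\<integral>x. x\<^sup>2 * std_normal_density x \<partial>lborel) = 1"
  using integrable_std_normal_moment[of 1] integrable_std_normal_moment[of 2]
    integral_std_normal_moment_odd[of 0] integral_std_normal_moment_even[of 1]
  by (simp_all add: mult.commute)

lemma normal_tail_mean: "(LBINT y:{x<..}. y * std_normal_density y) = std_normal_density x"
proof -
  have "(LBINT y:{x<..}. y * std_normal_density y) = 0 - (- std_normal_density x)"
  proof (rule integral_greaterThan_FTC[where F="\<lambda>y. - std_normal_density y"])
    show "((\<lambda>y. - std_normal_density y) has_real_derivative y * std_normal_density y) (at y)" for y
      using DERIV_minus[OF std_normal_density_deriv] by simp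
    show "((\<lambda>y. - std_normal_density y) \<longlongrightarrow> 0) at_top"
      using tendsto_minus[OF std_normal_density_tendsto_0] by simp
    show "continuous_on UNIV (\<lambda>y. y * std_normal_density y)"
      by (intro continuous_on_mult continuous_on_id continuous_std_normal_density)
  qed (fact std_normal_moments)
  then show ?thesis by simp
qed

lemma set_integrable_of_integrable:
  fixes f :: "real \<Rightarrow> real"
  shows "integrable lborel f \<Longrightarrow> A \<in> sets borel \<Longrightarrow> set_integrable lborel A f"
  unfolding set_integrable_def by (rule integrable_mult_indicator) auto

text \<open>The function y^2 - 1 times the density has the antiderivative -y times the density, so
  its tail integral is a boundary term.\<close>

lemma normal_tail_second:
  "(LBINT y:{x<..}. y\<^sup>2 * std_normal_density y) = x * std_normal_density x + (LBINT y:{x<..}. std_normal_density y)"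
proof -
  have n: "integrable lborel std_normal_density" by simp
  have i: "integrable lborel (\<lambda>y. y\<^sup>2 * std_normal_density y - std_normal_density y)"
    by (rule Bochner_Integration.integrable_diff[OF std_normal_moments(2) n])
  have "(LBINT y:{x<..}. y\<^sup>2 * std_normal_density y - std_normal_density y) = 0 - (- (x * std_normal_density x))"
  proof (rule integral_greaterThan_FTC[where F="\<lambda>y. - (y * std_normal_density y)", OF _ _ i])
    show "((\<lambda>y. - (y * std_normal_density y)) has_real_derivative y\<^sup>2 * std_normal_density y - std_normal_density y) (at y)" for y
      using DERIV_minus[OF DERIV_mult[OF DERIV_ident std_normal_density_deriv[of y]]]
      by (simp add: power2_eq_square algebra_simps)
    show "((\<lambda>y. - (y * std_normal_density y)) \<longlongrightarrow> 0) at_top"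
      using tendsto_minus[OF mult_std_normal_density_tendsto_0] by simp
    show "continuous_on UNIV (\<lambda>y. y\<^sup>2 * std_normal_density y - std_normal_density y)"
      by (intro continuous_on_mult continuous_on_diff continuous_on_power continuous_on_id continuous_std_normal_density)
  qed
  moreover have "(LBINT y:{x<..}. y\<^sup>2 * std_normal_density y - std_normal_density y)
     = (LBINT y:{x<..}. y\<^sup>2 * std_normal_density y) - (LBINT y:{x<..}. std_normal_density y)"
    by (rule set_integral_diff(2)[OF set_integrable_of_integrable[OF std_normal_moments(2)] set_integrable_of_integrable[OF n]]) auto
  ultimately show ?thesis by simp
qed

section \<open>Tail integrals against the normal density and the Mills ratio\<close>

definition ntail :: "(real \<Rightarrow> real) \<Rightarrow> real \<Rightarrow> real" where
  "ntail g x = (LBINT y:{x<..}. g y * std_normal_density y)"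

lemma lipschitz_normal_integrable:
  assumes "1-lipschitz_on UNIV \<phi>"
  shows "integrable lborel (\<lambda>y. \<phi> y * std_normal_density y)"
proof -
  have [measurable]: "\<phi> \<in> borel_measurable borel"
    using lipschitz_on_continuous_on[OF assms] by (rule borel_measurable_continuous_onI)
  have i: "integrable lborel (\<lambda>y. \<bar>\<phi> 0\<bar> * std_normal_density y + std_normal_density y * \<bar>y\<bar>)"
    using integrable_std_normal_moment_abs[of 1]
    by (intro Bochner_Integration.integrable_add integrable_mult_right) auto
  have "\<bar>\<phi> y\<bar> \<le> \<bar>\<phi> 0\<bar> + \<bar>y\<bar>" for y
    using lipschitz_onD[OF assms, of y 0] by (auto simp: dist_real_def)
  then have "\<bar>\<phi> y * std_normal_density y\<bar> \<le> \<bar>\<phi> 0\<bar> * std_normal_density y + std_normal_density y * \<bar>y\<bar>" for y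
    using mult_right_mono[of "\<bar>\<phi> y\<bar>" "\<bar>\<phi> 0\<bar> + \<bar>y\<bar>" "std_normal_density y"]
    by (simp add: abs_mult algebra_simps)
  then show ?thesis
    by (intro Bochner_Integration.integrable_bound[OF i]) (auto intro: order_trans)
qed

lemma ntail_add:
  "integrable lborel (\<lambda>y. f y * std_normal_density y) \<Longrightarrow> integrable lborel (\<lambda>y. g y * std_normal_density y)
    \<Longrightarrow> ntail (\<lambda>y. f y + g y) x = ntail f x + ntail g x"
  unfolding ntail_def distrib_right
  by (rule set_integral_add(2)[OF set_integrable_of_integrable set_integrable_of_integrable]) auto

lemma ntail_cmult: "ntail (\<lambda>y. c * g y) x = c * ntail g x"
  unfolding ntail_def mult.assoc by simp

lemma ntail_id: "ntail (\<lambda>y. y) x = std_normal_density x"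
  unfolding ntail_def by (rule normal_tail_mean)

lemma ntail_mono:
  "integrable lborel (\<lambda>y. f y * std_normal_density y) \<Longrightarrow> integrable lborel (\<lambda>y. g y * std_normal_density y)
    \<Longrightarrow> (\<And>y. y > x \<Longrightarrow> f y \<le> g y) \<Longrightarrow> ntail f x \<le> ntail g x"
  unfolding ntail_def
  by (rule set_integral_mono[OF set_integrable_of_integrable set_integrable_of_integrable])
     (auto intro: mult_right_mono)

lemma integrable_const_normal: "integrable lborel (\<lambda>y. c * std_normal_density y)"
  by simp

lemma ntail_const: "ntail (\<lambda>y. c) x = c * ntail (\<lambda>_. 1) x"
  using ntail_cmult[of c "\<lambda>_. 1"] by simp

text \<open>If the tail had mass zero, the density would vanish almost everywhere on it, and with it
  the tail mean; but the tail mean is the positive density at \<open>x\<close>.\<close>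

lemma ntail_one_pos: "ntail (\<lambda>_. 1) x > 0"
proof -
  have "ntail (\<lambda>_. 1) x \<ge> 0"
    using ntail_mono[of "\<lambda>_. 0" "\<lambda>_. 1" x] ntail_const[of 0 x] by simp
  moreover have "ntail (\<lambda>_. 1) x \<noteq> 0"
  proof
    assume "ntail (\<lambda>_. 1) x = 0"
    then have 0: "(LBINT y. indicator {x<..} y *\<^sub>R std_normal_density y) = 0"
      by (simp add: ntail_def set_lebesgue_integral_def)
    have "integrable lborel (\<lambda>y. indicator {x<..} y *\<^sub>R std_normal_density y)"
      by (rule integrable_mult_indicator) auto
    then have "AE y in lborel. indicator {x<..} y *\<^sub>R std_normal_density y = 0"
      using 0 by (subst (asm) integral_nonneg_eq_0_iff_AE) auto
    then have "AE y in lborel. indicator {x<..} y *\<^sub>R (y * std_normal_density y) = 0"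
      by eventually_elim auto
    then have "(LBINT y:{x<..}. y * std_normal_density y) = 0"
      unfolding set_lebesgue_integral_def by (rule integral_eq_zero_AE)
    then show False using normal_tail_mean[of x] std_normal_density_pos[of x] by simp
  qed
  ultimately show ?thesis by simp
qed

text \<open>Upper Mills bound: on the tail the constant \<open>x\<close> lies below
  \<open>y\<close>, whose tail integral is the density.\<close>

lemma ntail_one_le: "x * ntail (\<lambda>_. 1) x \<le> std_normal_density x"
  using ntail_mono[of "\<lambda>_. x" "\<lambda>y. y" x] ntail_const[of x x] std_normal_moments(1) by (simp add: ntail_id)

text \<open>Nonnegativity of the tail integral of \<open>(m y - n)\<^sup>2\<close>, where \<open>m\<close> is the tail mass and \<open>n\<close> the density.\<close>

lemma birnbaum_mills:
  "(std_normal_density x)\<^sup>2 \<le> (ntail (\<lambda>_. 1) x)\<^sup>2 + x * ntail (\<lambda>_. 1) x * std_normal_density x"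
proof -
  define m where "m = ntail (\<lambda>_. 1) x"
  define n where "n = std_normal_density x"
  have i: "integrable lborel (\<lambda>y. m\<^sup>2 * y\<^sup>2 * std_normal_density y)" "integrable lborel (\<lambda>y. -2 * m * n * y * std_normal_density y)"
    "integrable lborel (\<lambda>y. n\<^sup>2 * std_normal_density y)"
    using integrable_mult_right[OF std_normal_moments(2), of "m\<^sup>2"] integrable_mult_right[OF std_normal_moments(1), of "-2*m*n"]
    by (auto simp: mult_ac)
  have i': "integrable lborel (\<lambda>y. (m\<^sup>2 * y\<^sup>2 + -2 * m * n * y) * std_normal_density y)"
    using Bochner_Integration.integrable_add[OF i(1,2)] by (simp add: algebra_simps)
  have sq: "(m * y - n)\<^sup>2 = m\<^sup>2 * y\<^sup>2 + -2 * m * n * y + n\<^sup>2" for y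
    by (simp add: power2_eq_square algebra_simps)
  have nn: "0 \<le> m\<^sup>2 * y\<^sup>2 + -2 * m * n * y + n\<^sup>2" for y
    unfolding sq[symmetric] by simp
  have "0 = ntail (\<lambda>_. 0) x" by (simp add: ntail_def)
  also have "\<dots> \<le> ntail (\<lambda>y. m\<^sup>2 * y\<^sup>2 + -2 * m * n * y + n\<^sup>2) x"
    using Bochner_Integration.integrable_add[OF i' i(3)] nn
    by (intro ntail_mono) (auto simp: distrib_right)
  also have "\<dots> = m\<^sup>2 * (x * n + m) + -2 * m * n * n + n\<^sup>2 * m"
    using ntail_add[OF i' i(3), of x] ntail_add[OF i(1,2), of x] ntail_const[of "n\<^sup>2" x]
      ntail_cmult[of "-2 * m * n" "\<lambda>y. y" x] ntail_cmult[of "m\<^sup>2" "\<lambda>y. y\<^sup>2" x] normal_tail_second[of x]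
    by (simp add: ntail_id n_def[symmetric] m_def[symmetric]) (simp add: ntail_def m_def n_def)
  also have "\<dots> = m * (m\<^sup>2 + x * m * n - n\<^sup>2)"
    by (simp add: power2_eq_square algebra_simps)
  finally show ?thesis
    using ntail_one_pos[of x] by (simp add: zero_le_mult_iff m_def n_def)
qed

definition mills :: "real \<Rightarrow> real" where "mills x = ntail (\<lambda>_. 1) x / std_normal_density x"

lemma mills: "mills x > 0" "x * mills x \<le> 1" "(mills x)\<^sup>2 + x * mills x \<ge> 1"
proof -
  note p = std_normal_density_pos[of x]
  show "mills x > 0" "x * mills x \<le> 1"
    using ntail_one_pos[of x] ntail_one_le[of x] p by (auto simp: mills_def field_simps)
  have "((std_normal_density x)\<^sup>2) / (std_normal_density x)\<^sup>2
      \<le> ((ntail (\<lambda>_. 1) x)\<^sup>2 + x * ntail (\<lambda>_. 1) x * std_normal_density x) / (std_normal_density x)\<^sup>2"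
    using birnbaum_mills[of x] by (intro divide_right_mono) auto
  then show "(mills x)\<^sup>2 + x * mills x \<ge> 1"
    using p by (simp add: mills_def add_divide_distrib power2_eq_square)
qed

text \<open>The polynomial r * (r + x) increases for positive r. It is at most 1 at r = x / (1 +
  x^2) and at least 1 at r = \<open>mills x\<close>, which fixes the order of the two
  arguments.\<close>

lemma mills_lower: assumes "x \<ge> 0" shows "x \<le> (1 + x\<^sup>2) * mills x"
proof (rule ccontr)
  assume "\<not> ?thesis"
  then have "mills x < x / (1 + x\<^sup>2)" by (simp add: pos_less_divide_eq add_pos_nonneg mult.commute not_le)
  moreover have "x / (1 + x\<^sup>2) > 0" using calculation mills(1)[of x] by linarith
  ultimately have "mills x * (mills x + x) < x / (1 + x\<^sup>2) * (x / (1 + x\<^sup>2) + x)"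
    using mills(1)[of x] assms by (intro mult_strict_mono) auto
  also have "\<dots> = x\<^sup>2 * (2 + x\<^sup>2) / (1 + x\<^sup>2)\<^sup>2"
    by (simp add: field_simps power2_eq_square add_nonneg_eq_0_iff)
  also have "\<dots> \<le> 1"
    using assms by (subst divide_le_eq_1_pos) (auto simp: power2_eq_square algebra_simps intro!: mult_pos_pos add_pos_nonneg)
  finally show False using mills(3)[of x] by (simp add: power2_eq_square algebra_simps)
qed

text \<open>This is what gives the constant 1 in the bound on the derivative of the Stein solution.
  With s = sqrt (1 + x^2), the comparison value 2 / (1 + x + s) is chosen because x times it
  simplifies to 1 + x - s; then 1 - x * mills x is at most s - x = 1 / (s + x).\<close>

lemma mills_lower_sqrt:
  assumes "x \<ge> 0" shows "(sqrt (1 + x\<^sup>2) + x) * (1 - x * mills x) \<le> 1"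
proof -
  define s where "s = sqrt (1 + x\<^sup>2)"
  have s: "s \<ge> 1" "s\<^sup>2 = 1 + x\<^sup>2" "s \<ge> x" "s \<ge> 0"
    using real_le_rsqrt[of x "1 + x\<^sup>2"] by (auto simp: s_def)
  have "mills x \<ge> 2 / (1 + x + s)"
  proof (rule ccontr)
    assume l: "\<not> ?thesis"
    have "mills x * (mills x + x) < 2 / (1 + x + s) * (2 / (1 + x + s) + x)"
      using mills(1)[of x] assms l s by (intro mult_strict_mono) auto
    also have "\<dots> = (4 + 2 * x * (1 + x + s)) / (1 + x + s)\<^sup>2"
      using s assms by (simp add: field_simps power2_eq_square)
    also have "\<dots> \<le> 1"
    proof -
      have "4 + 2 * x * (1 + x + s) \<le> (1 + x + s)\<^sup>2"
        using s by (simp add: power2_eq_square algebra_simps)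
      then show ?thesis by (simp add: divide_le_eq_1 s assms)
    qed
    finally show False using mills(3)[of x] by (simp add: power2_eq_square algebra_simps)
  qed
  then have "x * (2 / (1 + x + s)) \<le> x * mills x" using assms by (rule mult_left_mono)
  moreover have "x * (2 / (1 + x + s)) = 1 + x - s"
  proof -
    have "(1 + x - s) * (1 + x + s) = 2 * x" using s(2) by (simp add: power2_eq_square algebra_simps)
    then show ?thesis using s assms by (simp add: field_simps)
  qed
  ultimately have "1 - x * mills x \<le> s - x" by simp
  then have "(s + x) * (1 - x * mills x) \<le> (s + x) * (s - x)"
    using s assms by (intro mult_left_mono) auto
  also have "\<dots> = 1" using s(2) by (simp add: power2_eq_square algebra_simps)
  finally show ?thesis by (simp add: s_def)
qed

text \<open>If g(x) is nonnegative, monotonicity puts g above g(x) on the whole tail. If g(x) is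
  negative, then g is negative on the left half-line, and the vanishing total integral forces a
  nonnegative tail.\<close>

lemma ntail_centered_mono:
  assumes i: "integrable lborel (\<lambda>y. g y * std_normal_density y)" and m: "mono g"
    and c: "(\<integral>y. g y * std_normal_density y \<partial>lborel) = 0"
  shows "ntail g x \<ge> 0" "g x \<ge> 0 \<Longrightarrow> ntail g x \<ge> g x * ntail (\<lambda>_. 1) x"
proof -
  show *: "ntail g x \<ge> g x * ntail (\<lambda>_. 1) x" if "g x \<ge> 0"
    using ntail_mono[OF integrable_const_normal i, of x "g x"] ntail_const[of "g x" x] monoD[OF m] by (auto simp: less_imp_le)
  show "ntail g x \<ge> 0"
  proof (cases "g x \<ge> 0")
    case True
    moreover have "0 \<le> g x * ntail (\<lambda>_. 1) x" using True ntail_one_pos[of x] by simp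
    ultimately show ?thesis using * by linarith
  next
    case False
    have "0 = (LBINT y:UNIV. g y * std_normal_density y)" using c by (simp add: set_lebesgue_integral_def)
    also have "UNIV = {..x} \<union> {x<..}" by auto
    also have "(LBINT y:{..x} \<union> {x<..}. g y * std_normal_density y)
      = (LBINT y:{..x}. g y * std_normal_density y) + ntail g x"
      unfolding ntail_def by (rule set_integral_Un) (auto intro: set_integrable_of_integrable i)
    finally have "ntail g x = - (LBINT y:{..x}. g y * std_normal_density y)" by simp
    also have "\<dots> = (LBINT y:{..x}. - (g y * std_normal_density y))"
      by (simp add: set_lebesgue_integral_def)
    also have "\<dots> \<ge> 0"
      unfolding set_lebesgue_integral_def using False monoD[OF m, of _ x]
      by (intro Bochner_Integration.integral_nonneg)
        (auto simp: indicator_def mult_nonneg_nonneg mult_nonpos_nonneg order_trans[of _ "g x" 0])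
    finally show ?thesis .
  qed
qed

text \<open>For Lipschitz \<phi> this is the bounded solution of Stein's equation h'(x) - x h(x) =
  \<phi>(x) - E \<phi>(Z) with Z standard normal. The right tail, with a minus sign, replaces the
  customary integral over the left half-line; both agree since the integrand has total integral
  zero.\<close>

definition stein_sol :: "(real \<Rightarrow> real) \<Rightarrow> real \<Rightarrow> real" where
  "stein_sol \<phi> x = - ntail (\<lambda>y. \<phi> y - (\<integral>y. \<phi> y * std_normal_density y \<partial>lborel)) x / std_normal_density x"

text \<open>By Stein's equation the second expression is the derivative of x h(x). Where g(x) - E
  g(Z) is nonnegative, \<open>mills_lower\<close> lets the negative first term dominate; elsewhere
  both terms are nonpositive.\<close>

lemma stein_sol_mono:
  assumes i: "integrable lborel (\<lambda>y. g y * std_normal_density y)" and m: "mono g"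
    and x: "x \<ge> 0"
  shows "stein_sol g x \<le> 0"
    "(1 + x\<^sup>2) * stein_sol g x + x * (g x - (\<integral>y. g y * std_normal_density y \<partial>lborel)) \<le> 0"
proof -
  define \<mu> where "\<mu> = (\<integral>y. g y * std_normal_density y \<partial>lborel)"
  define \<psi> where "\<psi> y = g y - \<mu>" for y
  have i': "integrable lborel (\<lambda>y. \<psi> y * std_normal_density y)"
    using Bochner_Integration.integrable_diff[OF i integrable_const_normal[of \<mu>]] by (simp add: \<psi>_def left_diff_distrib)
  have m': "mono \<psi>" using m by (auto simp: mono_def \<psi>_def)
  have c': "(\<integral>y. \<psi> y * std_normal_density y \<partial>lborel) = 0"
    using Bochner_Integration.integral_diff[OF i integrable_const_normal[of \<mu>]] by (simp add: \<psi>_def left_diff_distrib \<mu>_def)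
  note c = ntail_centered_mono[OF i' m' c', of x]
  note p = std_normal_density_pos[of x]
  have e: "stein_sol g x = - ntail \<psi> x / std_normal_density x" by (simp add: stein_sol_def \<psi>_def[abs_def] \<mu>_def)
  show 1: "stein_sol g x \<le> 0" using c(1) p by (simp add: e)
  have "(1 + x\<^sup>2) * stein_sol g x + x * \<psi> x \<le> 0"
  proof (cases "\<psi> x \<ge> 0")
    case True
    have "\<psi> x * mills x \<le> ntail \<psi> x / std_normal_density x"
      using c(2)[OF True] p by (simp add: mills_def divide_right_mono)
    then have "(1 + x\<^sup>2) * (\<psi> x * mills x) \<le> (1 + x\<^sup>2) * - stein_sol g x"
      by (intro mult_left_mono) (auto simp: e)
    moreover have "\<psi> x * x \<le> \<psi> x * ((1 + x\<^sup>2) * mills x)"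
      using mills_lower[OF x] True by (rule mult_left_mono)
    ultimately show ?thesis by (simp add: algebra_simps)
  next
    case False
    have "(1 + x\<^sup>2) * stein_sol g x \<le> 0" using 1 by (simp add: mult_nonneg_nonpos)
    moreover have "x * \<psi> x \<le> 0" using x False by (simp add: mult_nonneg_nonpos)
    ultimately show ?thesis by linarith
  qed
  then show "(1 + x\<^sup>2) * stein_sol g x + x * (g x - (\<integral>y. g y * std_normal_density y \<partial>lborel)) \<le> 0"
    by (simp add: \<psi>_def \<mu>_def)
qed

text \<open>The identity function has the constant Stein solution -1. Since c \<phi> + id is
  monotone for c = 1 and c = -1, one-sided bounds for monotone functions become two-sided bounds
  with constant 1 for Lipschitz ones.\<close>

lemma stein_sol_add_id:
  assumes i: "integrable lborel (\<lambda>y. \<phi> y * std_normal_density y)"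
  shows "stein_sol (\<lambda>y. c * \<phi> y + y) x = c * stein_sol \<phi> x - 1"
    "(\<integral>y. (c * \<phi> y + y) * std_normal_density y \<partial>lborel) = c * (\<integral>y. \<phi> y * std_normal_density y \<partial>lborel)"
    "integrable lborel (\<lambda>y. (c * \<phi> y + y) * std_normal_density y)"
proof -
  have i1: "integrable lborel (\<lambda>y. c * \<phi> y * std_normal_density y)"
    using integrable_mult_right[OF i, of c] by (simp add: mult.assoc)
  note i2 = std_normal_moments(1)
  show "integrable lborel (\<lambda>y. (c * \<phi> y + y) * std_normal_density y)"
    using Bochner_Integration.integrable_add[OF i1 i2] by (simp add: algebra_simps)
  show mu: "(\<integral>y. (c * \<phi> y + y) * std_normal_density y \<partial>lborel) = c * (\<integral>y. \<phi> y * std_normal_density y \<partial>lborel)"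
    using Bochner_Integration.integral_add[OF i1 i2] std_normal_moments(3)
    by (simp add: distrib_right mult.assoc)
  define \<mu> where "\<mu> = (\<integral>y. \<phi> y * std_normal_density y \<partial>lborel)"
  have i': "integrable lborel (\<lambda>y. c * (\<phi> y - \<mu>) * std_normal_density y)"
    using integrable_mult_right[OF Bochner_Integration.integrable_diff[OF i integrable_const_normal[of \<mu>]], of c]
    by (simp add: algebra_simps)
  have "ntail (\<lambda>y. c * \<phi> y + y - c * \<mu>) x = ntail (\<lambda>y. c * (\<phi> y - \<mu>) + y) x"
    by (simp add: algebra_simps)
  also have "\<dots> = c * ntail (\<lambda>y. \<phi> y - \<mu>) x + std_normal_density x"
    using ntail_add[OF i' i2] by (simp add: ntail_id ntail_cmult)
  finally show "stein_sol (\<lambda>y. c * \<phi> y + y) x = c * stein_sol \<phi> x - 1"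
    using std_normal_density_pos[of x] mu unfolding stein_sol_def by (simp add: field_simps \<mu>_def[symmetric])
qed

lemma lipschitz_add_id_mono:
  assumes "1-lipschitz_on UNIV \<phi>" and c: "\<bar>c\<bar> = 1"
  shows "mono (\<lambda>y::real. c * \<phi> y + y)"
proof (rule monoI)
  fix a b :: real assume "a \<le> b"
  then have "\<bar>\<phi> b - \<phi> a\<bar> \<le> b - a" using lipschitz_onD[OF assms(1), of b a] by (simp add: dist_real_def)
  then show "c * \<phi> a + a \<le> c * \<phi> b + b" using c by (auto simp: abs_if split: if_splits)
qed

text \<open>Jensen's inequality carried out pointwise: |x - y| is at most ((x - y)^2 + s^2) / (2 s),
  and s^2 = 1 + x^2 is the mean of (x - Z)^2.\<close>

lemma abs_moment_le_sqrt: "(\<integral>y. \<bar>x - y\<bar> * std_normal_density y \<partial>lborel) \<le> sqrt (1 + x\<^sup>2)"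
proof -
  define s where "s = sqrt (1 + x\<^sup>2)"
  have s: "s > 0" "s\<^sup>2 = 1 + x\<^sup>2" by (auto simp: s_def add_pos_nonneg)
  have i: "integrable lborel (\<lambda>y. ((x - y)\<^sup>2 + s\<^sup>2) / (2 * s) * std_normal_density y)"
    and e: "(\<integral>y. ((x - y)\<^sup>2 + s\<^sup>2) / (2 * s) * std_normal_density y \<partial>lborel) = s"
  proof -
    have "has_bochner_integral lborel (\<lambda>y. (y\<^sup>2 * std_normal_density y - 2 * x * (y * std_normal_density y) + (x\<^sup>2 + s\<^sup>2) * std_normal_density y) / (2 * s))
       ((1 - 2 * x * 0 + (x\<^sup>2 + s\<^sup>2) * 1) / (2 * s))"
      using std_normal_moments
      by (intro has_bochner_integral_divide_zero has_bochner_integral_add has_bochner_integral_diff has_bochner_integral_mult_right)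
         (auto simp: has_bochner_integral_iff)
    moreover have "(1 - 2 * x * 0 + (x\<^sup>2 + s\<^sup>2) * 1) / (2 * s) = s"
      using s by (simp add: field_simps power2_eq_square)
    moreover have "(y\<^sup>2 * std_normal_density y - 2 * x * (y * std_normal_density y) + (x\<^sup>2 + s\<^sup>2) * std_normal_density y) / (2 * s)
       = ((x - y)\<^sup>2 + s\<^sup>2) / (2 * s) * std_normal_density y" for y
      by (simp add: power2_eq_square algebra_simps)
    ultimately show "integrable lborel (\<lambda>y. ((x - y)\<^sup>2 + s\<^sup>2) / (2 * s) * std_normal_density y)"
      "(\<integral>y. ((x - y)\<^sup>2 + s\<^sup>2) / (2 * s) * std_normal_density y \<partial>lborel) = s"
      by (auto simp: has_bochner_integral_iff)
  qed
  have "\<bar>x - y\<bar> \<le> ((x - y)\<^sup>2 + s\<^sup>2) / (2 * s)" for y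
    using s(1) zero_le_power2[of "\<bar>x - y\<bar> - s"] by (simp add: field_simps power2_eq_square)
  then have le: "\<bar>x - y\<bar> * std_normal_density y \<le> ((x - y)\<^sup>2 + s\<^sup>2) / (2 * s) * std_normal_density y" for y
    by (rule mult_right_mono) simp
  have "integrable lborel (\<lambda>y. \<bar>x - y\<bar> * std_normal_density y)"
    using le s by (intro Bochner_Integration.integrable_bound[OF i]) (auto simp: abs_mult)
  then have "(\<integral>y. \<bar>x - y\<bar> * std_normal_density y \<partial>lborel) \<le> (\<integral>y. ((x - y)\<^sup>2 + s\<^sup>2) / (2 * s) * std_normal_density y \<partial>lborel)"
    using i le by (intro integral_mono) auto
  then show ?thesis using e by (simp add: s_def)
qed

text \<open>The first and third bounds come from the monotone case with c = 1 and c = -1. For h' the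
  solution is split into the part with \<phi>(x) - E \<phi>(Z), controlled by E |x - Z|, and the
  tail integral of \<phi> - \<phi>(x), controlled by the Lipschitz condition; the two bounds add up
  to the left side of \<open>mills_lower_sqrt\<close>.\<close>

lemma stein_sol_bounds_nonneg:
  assumes L: "1-lipschitz_on UNIV \<phi>" and x: "x \<ge> 0"
  defines "h' \<equiv> x * stein_sol \<phi> x + (\<phi> x - (\<integral>y. \<phi> y * std_normal_density y \<partial>lborel))"
  shows "\<bar>stein_sol \<phi> x\<bar> \<le> 1" "\<bar>h'\<bar> \<le> 1" "\<bar>stein_sol \<phi> x + x * h'\<bar> \<le> 1"
proof -
  note i = lipschitz_normal_integrable[OF L]
  define \<mu> where "\<mu> = (\<integral>y. \<phi> y * std_normal_density y \<partial>lborel)"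
  note p = std_normal_density_pos[of x]
  have m: "mono (\<lambda>y. c * \<phi> y + y)" if "\<bar>c\<bar> = 1" for c using lipschitz_add_id_mono[OF L that] .
  have *: "c * stein_sol \<phi> x - 1 \<le> 0" "(1 + x\<^sup>2) * (c * stein_sol \<phi> x - 1) + x * (c * \<phi> x + x - c * \<mu>) \<le> 0" if "\<bar>c\<bar> = 1" for c
    using stein_sol_mono[OF stein_sol_add_id(3)[OF i] m[OF that] x]
    unfolding stein_sol_add_id(1,2)[OF i] \<mu>_def[symmetric] by auto
  show "\<bar>stein_sol \<phi> x\<bar> \<le> 1" using *(1)[of 1] *(1)[of "-1"] by auto
  \<comment> \<open>The identity contributes -(1 + x^2) through its solution and x^2 through its
    value, which leaves exactly the constant 1.\<close>
  have "stein_sol \<phi> x + x * h' \<le> 1"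
    using *(2)[of 1] by (simp add: h'_def \<mu>_def[symmetric] power2_eq_square algebra_simps)
  moreover have "stein_sol \<phi> x + x * h' \<ge> -1"
    using *(2)[of "-1"] by (simp add: h'_def \<mu>_def[symmetric] power2_eq_square algebra_simps)
  ultimately show "\<bar>stein_sol \<phi> x + x * h'\<bar> \<le> 1" by linarith
  define a where "a = \<phi> x - \<mu>"
  define m1 where "m1 = ntail (\<lambda>_. 1) x"
  define n where "n = std_normal_density x"
  have "\<bar>a\<bar> \<le> (\<integral>y. \<bar>x - y\<bar> * std_normal_density y \<partial>lborel)"
  proof -
    have "a = (\<integral>y. \<phi> x * std_normal_density y - \<phi> y * std_normal_density y \<partial>lborel)"
      unfolding a_def \<mu>_def using i integrable_const_normal[of "\<phi> x"] by (subst Bochner_Integration.integral_diff) auto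
    also have "\<bar>\<dots>\<bar> \<le> (\<integral>y. \<bar>\<phi> x * std_normal_density y - \<phi> y * std_normal_density y\<bar> \<partial>lborel)"
      by (rule integral_abs_bound)
    also have "\<dots> \<le> (\<integral>y. \<bar>x - y\<bar> * std_normal_density y \<partial>lborel)"
    proof (rule integral_mono)
      show "integrable lborel (\<lambda>y. \<bar>\<phi> x * std_normal_density y - \<phi> y * std_normal_density y\<bar>)"
        using i integrable_const_normal[of "\<phi> x"] by auto
      have "integrable lborel (\<lambda>y. x * std_normal_density y - y * std_normal_density y)"
        using std_normal_moments(1) integrable_const_normal[of x] by (rule Bochner_Integration.integrable_diff[rotated])
      then have "integrable lborel (\<lambda>y. \<bar>x * std_normal_density y - y * std_normal_density y\<bar>)" by (rule integrable_abs)
      then show "integrable lborel (\<lambda>y. \<bar>x - y\<bar> * std_normal_density y)"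
        by (simp add: left_diff_distrib[symmetric] abs_mult)
      show "\<bar>\<phi> x * std_normal_density y - \<phi> y * std_normal_density y\<bar> \<le> \<bar>x - y\<bar> * std_normal_density y" for y
        using lipschitz_onD[OF L, of x y]
        by (simp add: left_diff_distrib[symmetric] abs_mult dist_real_def mult_right_mono)
    qed
    finally show ?thesis .
  qed
  also note abs_moment_le_sqrt
  finally have a: "\<bar>a\<bar> \<le> sqrt (1 + x\<^sup>2)" .
  define R where "R = ntail (\<lambda>y. \<phi> y - \<phi> x) x"
  have iphi: "integrable lborel (\<lambda>y. (\<phi> y - \<phi> x) * std_normal_density y)"
    using i integrable_const_normal[of "\<phi> x"] by (auto simp: left_diff_distrib)
  have T: "ntail (\<lambda>y. \<phi> y - \<mu>) x = R + a * m1"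
    using ntail_add[OF iphi integrable_const_normal[of a]] ntail_const[of a x] by (simp add: a_def R_def m1_def)
  have i3: "integrable lborel (\<lambda>y. c * (y - x) * std_normal_density y)" for c
    using integrable_mult_right[OF Bochner_Integration.integrable_diff[OF std_normal_moments(1) integrable_const_normal[of x]], of c]
    by (simp add: algebra_simps)
  have T3: "ntail (\<lambda>y. c * (y - x)) x = c * (n - x * m1)" for c
  proof -
    have "ntail (\<lambda>y. y - x) x = n - x * m1"
      using ntail_add[OF std_normal_moments(1) integrable_const_normal[of "-x"], of x] ntail_const[of "-x" x]
      by (simp add: ntail_id n_def m1_def)
    then show ?thesis using ntail_cmult[of c "\<lambda>y. y - x" x] by simp
  qed
  have "\<phi> y - \<phi> x \<le> 1 * (y - x)" "-1 * (y - x) \<le> \<phi> y - \<phi> x" if "y > x" for y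
    using lipschitz_onD[OF L, of y x] that by (auto simp: dist_real_def)
  then have "R \<le> 1 * (n - x * m1)" "-1 * (n - x * m1) \<le> R"
    unfolding R_def T3[symmetric] by (auto intro!: ntail_mono iphi i3[of 1, simplified] i3[of "-1", simplified])
  then have R: "\<bar>R\<bar> \<le> n - x * m1" by auto
  have M: "mills x = m1 / n" by (simp add: mills_def m1_def n_def)
  have n: "n > 0" using p by (simp add: n_def)
  \<comment> \<open>Here \<open>n\<close> is the density at \<open>x\<close>. As |R| / n is at most
    1 - x * mills x, this factor can be taken out of both terms.\<close>
  have "h' = a * (1 - x * mills x) - x * (R / n)"
    using n unfolding h'_def stein_sol_def \<mu>_def[symmetric] T M n_def[symmetric] a_def[symmetric] by (simp add: field_simps)
  also have "\<bar>\<dots>\<bar> \<le> \<bar>a * (1 - x * mills x)\<bar> + \<bar>x * (R / n)\<bar>" by (rule abs_triangle_ineq4)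
  also have "\<bar>a * (1 - x * mills x)\<bar> \<le> sqrt (1 + x\<^sup>2) * (1 - x * mills x)"
    using a mills(2)[of x] by (simp add: abs_mult mult_right_mono)
  also have "\<bar>x * (R / n)\<bar> \<le> x * (1 - x * mills x)"
  proof -
    have "\<bar>R / n\<bar> \<le> (n - x * m1) / n" using R n by (simp add: divide_right_mono)
    also have "\<dots> = 1 - x * mills x" using n by (simp add: M diff_divide_distrib)
    finally have "x * \<bar>R / n\<bar> \<le> x * (1 - x * mills x)" using x by (rule mult_left_mono)
    then show ?thesis using x by (simp add: abs_mult)
  qed
  also have "sqrt (1 + x\<^sup>2) * (1 - x * mills x) + x * (1 - x * mills x) \<le> 1"
    using mills_lower_sqrt[OF x] by (simp add: algebra_simps)
  finally show "\<bar>h'\<bar> \<le> 1" by simp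
qed

text \<open>If h solves Stein's equation for \<phi>, then x \<mapsto> h(-x) solves it for y
  \<mapsto> -\<phi>(-y), which has the same Lipschitz constant. Bounds on the nonnegative half-line
  thus carry over to the whole line. In terms of tails, the integrand has mean zero, so its left and
  right tails are opposite.\<close>

lemma stein_sol_reflect:
  assumes i: "integrable lborel (\<lambda>y. \<phi> y * std_normal_density y)"
  shows "(\<integral>y. - \<phi> (- y) * std_normal_density y \<partial>lborel) = - (\<integral>y. \<phi> y * std_normal_density y \<partial>lborel)"
    "stein_sol (\<lambda>y. - \<phi> (- y)) x = stein_sol \<phi> (- x)"
proof -
  define \<mu> where "\<mu> = (\<integral>y. \<phi> y * std_normal_density y \<partial>lborel)"
  have ev: "std_normal_density (- y) = std_normal_density y" for y by (simp add: std_normal_density_def)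
  have r: "(\<integral>y. g (- y) \<partial>lborel) = (\<integral>y. g y \<partial>lborel)" for g :: "real \<Rightarrow> real"
    using lborel_integral_real_affine[of "-1" g 0] by simp
  show mu: "(\<integral>y. - \<phi> (- y) * std_normal_density y \<partial>lborel) = - (\<integral>y. \<phi> y * std_normal_density y \<partial>lborel)"
    using r[of "\<lambda>y. \<phi> y * std_normal_density y"] by (simp add: ev)
  have i2: "integrable lborel (\<lambda>y. (\<phi> y - \<mu>) * std_normal_density y)"
    using i integrable_const_normal[of \<mu>] by (auto simp: left_diff_distrib)
  have "0 = (LBINT y:UNIV. (\<phi> y - \<mu>) * std_normal_density y)"
    using Bochner_Integration.integral_diff[OF i integrable_const_normal[of \<mu>]]
    by (simp add: set_lebesgue_integral_def left_diff_distrib \<mu>_def)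
  also have "UNIV = {..-x} \<union> {-x<..}" by auto
  also have "(LBINT y:{..-x} \<union> {-x<..}. (\<phi> y - \<mu>) * std_normal_density y)
      = (LBINT y:{..-x}. (\<phi> y - \<mu>) * std_normal_density y) + ntail (\<lambda>y. \<phi> y - \<mu>) (-x)"
    unfolding ntail_def by (rule set_integral_Un) (auto intro: set_integrable_of_integrable i2)
  finally have 1: "ntail (\<lambda>y. \<phi> y - \<mu>) (-x) = - (LBINT y:{..-x}. (\<phi> y - \<mu>) * std_normal_density y)" by simp
  have "ntail (\<lambda>y. - \<phi> (- y) - (- \<mu>)) x = (\<integral>y. - (indicator {x<..} (- (- y)) * ((\<phi> (- y) - \<mu>) * std_normal_density (- y))) \<partial>lborel)"
    unfolding ntail_def set_lebesgue_integral_def by (intro Bochner_Integration.integral_cong) (auto simp: ev algebra_simps)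
  also have "\<dots> = (\<integral>y. - (indicator {x<..} (- y) * ((\<phi> y - \<mu>) * std_normal_density y)) \<partial>lborel)"
    by (rule r)
  also have "\<dots> = - (\<integral>y. indicator {x<..} (- y) * ((\<phi> y - \<mu>) * std_normal_density y) \<partial>lborel)" by simp
  also have "(\<integral>y. indicator {x<..} (- y) * ((\<phi> y - \<mu>) * std_normal_density y) \<partial>lborel) = (LBINT y:{..-x}. (\<phi> y - \<mu>) * std_normal_density y)"
    unfolding set_lebesgue_integral_def
  proof (rule integral_cong_AE)
    have "AE y in lborel. y \<noteq> - x" by (rule AE_lborel_singleton)
    then show "AE y in lborel. indicator {x<..} (- y) * ((\<phi> y - \<mu>) * std_normal_density y) = indicator {..-x} y *\<^sub>R ((\<phi> y - \<mu>) * std_normal_density y)"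
      by eventually_elim (auto simp: indicator_def)
  qed (use borel_measurable_integrable[OF i2] in \<open>auto intro!: borel_measurable_times\<close>)
  finally show "stein_sol (\<lambda>y. - \<phi> (- y)) x = stein_sol \<phi> (- x)"
    unfolding stein_sol_def mu using 1 by (simp add: \<mu>_def[symmetric] ev)
qed

lemma stein_sol_bounds:
  assumes L: "1-lipschitz_on UNIV \<phi>"
  defines "h' \<equiv> \<lambda>x. x * stein_sol \<phi> x + (\<phi> x - (\<integral>y. \<phi> y * std_normal_density y \<partial>lborel))"
  shows "\<bar>stein_sol \<phi> x\<bar> \<le> 1" "\<bar>h' x\<bar> \<le> 1" "\<bar>stein_sol \<phi> x + x * h' x\<bar> \<le> 1"
proof -
  note i = lipschitz_normal_integrable[OF L]
  have L': "1-lipschitz_on UNIV (\<lambda>y. - \<phi> (- y))"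
  proof (rule lipschitz_onI)
    show "dist (- \<phi> (- x)) (- \<phi> (- y)) \<le> 1 * dist x y" for x y
      using lipschitz_onD[OF L, of "- x" "- y"] by (simp add: dist_real_def abs_minus_commute)
  qed simp
  have e: "- x * S + (- \<phi> x - - \<mu>) = - (x * S + (\<phi> x - \<mu>))"
    "S + - x * (- (x * S + (\<phi> x - \<mu>))) = S + x * (x * S + (\<phi> x - \<mu>))" for S \<mu> :: real
    by (simp_all add: algebra_simps)
  show "\<bar>stein_sol \<phi> x\<bar> \<le> 1" "\<bar>h' x\<bar> \<le> 1" "\<bar>stein_sol \<phi> x + x * h' x\<bar> \<le> 1"
    using stein_sol_bounds_nonneg[OF L, of x] stein_sol_bounds_nonneg[OF L', of "- x"]
    unfolding h'_def stein_sol_reflect[OF i] minus_minus e by (cases "x \<ge> 0"; simp)+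
qed

lemma stein_sol_deriv:
  assumes L: "1-lipschitz_on UNIV \<phi>"
  shows "(stein_sol \<phi> has_real_derivative x * stein_sol \<phi> x + (\<phi> x - (\<integral>y. \<phi> y * std_normal_density y \<partial>lborel))) (at x)"
proof -
  note i = lipschitz_normal_integrable[OF L]
  define \<mu> where "\<mu> = (\<integral>y. \<phi> y * std_normal_density y \<partial>lborel)"
  define q where "q y = (\<phi> y - \<mu>) * std_normal_density y" for y
  define T where "T = ntail (\<lambda>y. \<phi> y - \<mu>)"
  have iq: "integrable lborel q"
    using i integrable_const_normal[of \<mu>] by (auto simp: left_diff_distrib q_def[abs_def])
  have cq: "continuous_on A q" for A
    unfolding q_def[abs_def]
    by (intro continuous_on_mult continuous_on_diff continuous_on_const continuous_std_normal_density)
       (rule continuous_on_subset[OF lipschitz_on_continuous_on[OF L]], simp)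
  \<comment> \<open>Near \<open>x\<close> the tail integral is a constant minus an integral starting
    at x - 1, and to the latter the fundamental theorem applies.\<close>
  have "((\<lambda>u. LBINT y=x - 1..u. q y) has_vector_derivative q x) (at x within {x-1..x+1})"
    by (rule interval_integral_FTC2) (auto intro: cq)
  then have "((\<lambda>u. LBINT y=x - 1..u. q y) has_vector_derivative q x) (at x)"
    by (subst (asm) at_within_interior) auto
  then have "((\<lambda>u. LBINT y=x - 1..u. q y) has_real_derivative q x) (at x)"
    by (simp add: has_real_derivative_iff_has_vector_derivative)
  then have "((\<lambda>u. T (x - 1) - (LBINT y=x - 1..u. q y)) has_real_derivative 0 - q x) (at x)"
    by (intro DERIV_diff DERIV_const)
  moreover have "T (x - 1) - (LBINT y=x - 1..u. q y) = T u" if "u \<in> {x-1<..}" for u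
  proof -
    have "T (x - 1) = (LBINT y:{x-1<..u} \<union> {u<..}. q y)"
      using that unfolding T_def ntail_def q_def[symmetric] by (intro arg_cong[where f="\<lambda>A. set_lebesgue_integral lborel A q"]) auto
    also have "\<dots> = (LBINT y:{x-1<..u}. q y) + T u"
      unfolding T_def ntail_def q_def[symmetric] by (rule set_integral_Un) (auto intro: set_integrable_of_integrable iq)
    also have "(LBINT y:{x-1<..u}. q y) = (LBINT y=x - 1..u. q y)"
      using that by (subst interval_integral_Ioc) auto
    finally show ?thesis by simp
  qed
  ultimately have dT: "(T has_real_derivative - q x) (at x)"
    by (subst DERIV_cong_ev[OF refl _ refl, symmetric]) (auto intro!: eventually_nhds_in_open[THEN eventually_mono, of "{x-1<..}"])
  have p: "std_normal_density x \<noteq> 0" using std_normal_density_pos[of x] by simp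
  have "((\<lambda>x. - T x / std_normal_density x) has_real_derivative
     ((- (- q x)) * std_normal_density x - (- T x) * (- x * std_normal_density x)) / (std_normal_density x * std_normal_density x)) (at x)"
    by (rule DERIV_divide[OF DERIV_minus[OF dT] std_normal_density_deriv p])
  moreover have "stein_sol \<phi> = (\<lambda>x. - T x / std_normal_density x)"
    by (auto simp: stein_sol_def T_def \<mu>_def)
  moreover have "((- (- q x)) * std_normal_density x - (- T x) * (- x * std_normal_density x)) / (std_normal_density x * std_normal_density x)
     = x * (- T x / std_normal_density x) + (\<phi> x - \<mu>)"
    using p by (simp add: q_def field_simps)
  ultimately show ?thesis by (simp add: \<mu>_def)
qed

text \<open>The constant is 2 / 2. The auxiliary function \<open>k\<close> has a derivative of sign
  opposite to t - a, so it is largest at \<open>a\<close>, where it is 0; the sign \<open>s\<close>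
  covers the upper and the lower bound at once.\<close>

lemma second_order_bound:
  fixes h h' :: "real \<Rightarrow> real"
  assumes d: "\<And>x. (h has_real_derivative h' x) (at x)" and L: "\<And>x y. \<bar>h' x - h' y\<bar> \<le> 2 * \<bar>x - y\<bar>"
  shows "\<bar>h b - h a - (b - a) * h' a\<bar> \<le> (b - a)\<^sup>2"
proof -
  have key: "s * (h b - h a - (b - a) * h' a) \<le> (b - a)\<^sup>2" if s: "\<bar>s\<bar> = 1" for s
  proof -
    define k where "k t = s * (h t - h a - (t - a) * h' a) - (t - a)\<^sup>2" for t
    have dk: "(k has_real_derivative s * (h' t - h' a) - 2 * (t - a)) (at t)" for t
      unfolding k_def[abs_def] by (auto intro!: derivative_eq_intros d)
    have b: "\<bar>s * (h' t - h' a)\<bar> \<le> 2 * \<bar>t - a\<bar>" for t using L[of t a] s by (simp add: abs_mult)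
    have "k b \<le> k a"
    proof (cases "a \<le> b")
      case True
      then show ?thesis
      proof (rule DERIV_nonpos_imp_nonincreasing)
        fix t assume "a \<le> t" then show "\<exists>y. (k has_real_derivative y) (at t) \<and> y \<le> 0"
          using dk[of t] b[of t] by (intro exI[of _ "s * (h' t - h' a) - 2 * (t - a)"]) auto
      qed
    next
      case False
      then have "b \<le> a" by simp
      then show ?thesis
      proof (rule DERIV_nonneg_imp_nondecreasing)
        fix t assume "t \<le> a" then show "\<exists>y. (k has_real_derivative y) (at t) \<and> y \<ge> 0"
          using dk[of t] b[of t] by (intro exI[of _ "s * (h' t - h' a) - 2 * (t - a)"]) auto
      qed
    qed
    then show ?thesis by (simp add: k_def)
  qed
  show ?thesis using key[of 1] key[of "-1"] by auto
qed

text \<open>As \<phi> is only Lipschitz, h' may fail to be differentiable. It is however x h(x) +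
  \<phi>(x) up to a constant, and both summands are 1-Lipschitz: the first because its derivative is
  the third quantity bounded in \<open>stein_sol_bounds\<close>. So h' is 2-Lipschitz, which is all
  that the Taylor estimate uses.\<close>

theorem stein_equation:
  assumes L: "1-lipschitz_on UNIV \<phi>"
  obtains h h' where "\<And>x. h' x - x * h x = \<phi> x - (\<integral>y. \<phi> y * std_normal_density y \<partial>lborel)"
    "\<And>x. \<bar>h x\<bar> \<le> 1" "\<And>x. \<bar>h' x\<bar> \<le> 1" "\<And>a b. \<bar>h b - h a - (b - a) * h' a\<bar> \<le> (b - a)\<^sup>2"
    "continuous_on UNIV h" "continuous_on UNIV h'"
proof -
  define h where "h = stein_sol \<phi>"
  define \<mu> where "\<mu> = (\<integral>y. \<phi> y * std_normal_density y \<partial>lborel)"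
  define h' where "h' = (\<lambda>x. x * h x + (\<phi> x - \<mu>))"
  have d: "(h has_real_derivative h' x) (at x)" for x
    using stein_sol_deriv[OF L] by (simp add: h'_def h_def \<mu>_def)
  have b: "\<bar>h x\<bar> \<le> 1" "\<bar>h' x\<bar> \<le> 1" "\<bar>h x + x * h' x\<bar> \<le> 1" for x
    using stein_sol_bounds[OF L, of x] by (auto simp: h'_def h_def \<mu>_def)
  have dx: "((\<lambda>x. x * h x) has_real_derivative h x + x * h' x) (at x)" for x
    using DERIV_mult[OF DERIV_ident d] by (simp add: mult.commute add.commute)
  have 1: "\<bar>x * h x - y * h y\<bar> \<le> \<bar>x - y\<bar>" for x y
    using field_differentiable_bound[of UNIV "\<lambda>x. x * h x" "\<lambda>x. h x + x * h' x" 1 x y] dx b(3) by auto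
  have 2: "\<bar>\<phi> x - \<phi> y\<bar> \<le> \<bar>x - y\<bar>" for x y using lipschitz_onD[OF L, of x y] by (simp add: dist_real_def)
  have L': "\<bar>h' x - h' y\<bar> \<le> 2 * \<bar>x - y\<bar>" for x y
  proof -
    have "h' x - h' y = (x * h x - y * h y) + (\<phi> x - \<phi> y)" by (simp add: h'_def)
    then have "\<bar>h' x - h' y\<bar> \<le> \<bar>x * h x - y * h y\<bar> + \<bar>\<phi> x - \<phi> y\<bar>"
      using abs_triangle_ineq by metis
    also have "\<dots> \<le> \<bar>x - y\<bar> + \<bar>x - y\<bar>" by (rule add_mono[OF 1 2])
    finally show ?thesis by simp
  qed
  have ch: "continuous_on UNIV h" using d by (intro DERIV_continuous_on) (auto intro: has_field_derivative_at_within)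
  show thesis
  proof (rule that[of h' h])
    show "continuous_on UNIV h'" unfolding h'_def
      using lipschitz_on_continuous_on[OF L] ch by (intro continuous_intros) auto
  qed (use b second_order_bound[OF d L'] ch in \<open>auto simp: h'_def \<mu>_def\<close>)
qed

subsection \<open>Hoeffding decompositions on product spaces\<close>

locale real_product_space =
  fixes \<nu> :: "'i \<Rightarrow> real measure"
  assumes prob_nu: "\<And>i. prob_space (\<nu> i)" and sets_nu [measurable_cong, simp]: "\<And>i. sets (\<nu> i) = sets borel"
begin

definition P where "P = (\<Pi>\<^sub>M i\<in>UNIV. \<nu> i)"

sublocale P: prob_space P
  unfolding P_def by (intro prob_space_PiM prob_nu)

lemma space_P [simp]: "space P = UNIV"
  by (auto simp: P_def space_PiM PiE_def Pi_def sets_eq_imp_space_eq[OF sets_nu])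

lemma prob_UNIV [simp]: "P.prob UNIV = 1"
  using P.prob_space by simp

lemma sets_P: "sets P = sets (\<Pi>\<^sub>M i\<in>UNIV. borel)"
  unfolding P_def by (intro sets_PiM_cong) auto

lemma measurable_component_P [measurable]: "(\<lambda>x. x i) \<in> borel_measurable P"
  unfolding measurable_cong_sets[OF sets_P refl] by simp

lemma measurable_into_P: "(\<And>i. (\<lambda>x. f x i) \<in> borel_measurable M) \<Longrightarrow> f \<in> measurable M P"
  unfolding measurable_cong_sets[OF refl sets_P]
  by (intro measurable_PiM_single') (auto simp: space_PiM)

lemma measurable_override_on [measurable]:
  "f \<in> measurable M P \<Longrightarrow> g \<in> measurable M P \<Longrightarrow> (\<lambda>z. override_on (f z) (g z) A) \<in> measurable M P"
  by (rule measurable_into_P)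
     (auto simp: override_on_def intro: measurable_compose[OF _ measurable_component_P])

text \<open>A cylinder set splits into conditions on the coordinates in \<open>A\<close> and on the
  others; these refer to different factors of the pair, and their probabilities multiply to the
  product measure. All rules for averages below rest on this invariance.\<close>

lemma distr_override_on: "distr (P \<Otimes>\<^sub>M P) P (\<lambda>(x, y). override_on x y A) = P"
proof -
  interpret PP: pair_prob_space P P ..
  have [measurable]: "(\<lambda>(x, y). override_on x y A) \<in> P \<Otimes>\<^sub>M P \<rightarrow>\<^sub>M P"
    by measurable
  have "P = distr (P \<Otimes>\<^sub>M P) P (\<lambda>(x, y). override_on x y A)"
    unfolding P_def
  proof (rule measure_eqI_PiM_infinite, fold P_def)
    fix B :: "'i \<Rightarrow> real set" and J assume J: "finite J" and B': "\<And>i. i \<in> J \<Longrightarrow> B i \<in> sets (\<nu> i)"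
    have B: "\<And>i. i \<in> J \<Longrightarrow> B i \<in> sets borel" using B' by simp
    have emb: "prod_emb UNIV \<nu> J' (Pi\<^sub>E J' B) = {x. \<forall>i\<in>J'. x i \<in> B i}" for J'
      by (auto simp: prod_emb_def PiE_iff sets_eq_imp_space_eq[OF sets_nu])
    have em: "emeasure P {x. \<forall>i\<in>J'. x i \<in> B i} = (\<Prod>i\<in>J'. emeasure (\<nu> i) (B i))" if "J' \<subseteq> J" for J'
      unfolding emb[symmetric] P_def using that J B
      by (intro emeasure_PiM_emb prob_nu) (auto intro: finite_subset)
    have ms: "{x. \<forall>i\<in>J'. x i \<in> B i} \<in> sets P" if "J' \<subseteq> J" for J'
    proof -
      have "Measurable.pred P (\<lambda>x. \<forall>i\<in>J'. x i \<in> B i)"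
        using that J B by (intro pred_intros_finite) (auto intro: finite_subset measurable_compose[OF measurable_component_P])
      then show ?thesis by (simp add: pred_def)
    qed
    have "(\<lambda>(x, y). override_on x y A) -` {x. \<forall>i\<in>J. x i \<in> B i} \<inter> space (P \<Otimes>\<^sub>M P)
       = {x. \<forall>i\<in>J - A. x i \<in> B i} \<times> {x. \<forall>i\<in>J \<inter> A. x i \<in> B i}"
      by (auto simp: override_on_def space_pair_measure split: if_splits)
    then have "emeasure (distr (P \<Otimes>\<^sub>M P) P (\<lambda>(x, y). override_on x y A)) {x. \<forall>i\<in>J. x i \<in> B i}
       = emeasure P {x. \<forall>i\<in>J - A. x i \<in> B i} * emeasure P {x. \<forall>i\<in>J \<inter> A. x i \<in> B i}"
      using ms[of J] ms[of "J - A"] ms[of "J \<inter> A"]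
      by (subst emeasure_distr) (auto intro!: P.emeasure_pair_measure_Times)
    also have "\<dots> = (\<Prod>i\<in>J. emeasure (\<nu> i) (B i))"
      using J prod.Int_Diff[of J "\<lambda>i. emeasure (\<nu> i) (B i)" A]
      by (simp add: em mult.commute)
    also have "\<dots> = emeasure P {x. \<forall>i\<in>J. x i \<in> B i}" by (simp add: em)
    finally show "emeasure P (prod_emb UNIV \<nu> J (Pi\<^sub>E J B)) =
       emeasure (distr (P \<Otimes>\<^sub>M P) P (\<lambda>(x, y). override_on x y A)) (prod_emb UNIV \<nu> J (Pi\<^sub>E J B))"
      unfolding emb by simp
  qed (auto simp: P_def[symmetric] P.finite_measure_axioms)
  then show ?thesis ..
qed

lemma integrable_override_on:
  fixes f :: "('i \<Rightarrow> real) \<Rightarrow> real"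
  assumes f: "integrable P f"
  shows "integrable (P \<Otimes>\<^sub>M P) (\<lambda>(x, y). f (override_on x y A))"
    "(\<integral>(x, y). f (override_on x y A) \<partial>(P \<Otimes>\<^sub>M P)) = (\<integral>x. f x \<partial>P)"
proof -
  have m: "(\<lambda>(x, y). override_on x y A) \<in> P \<Otimes>\<^sub>M P \<rightarrow>\<^sub>M P" by measurable
  have [measurable]: "f \<in> borel_measurable P" using f by auto
  have "integrable (distr (P \<Otimes>\<^sub>M P) P (\<lambda>(x, y). override_on x y A)) f" using f by (simp add: distr_override_on)
  then show "integrable (P \<Otimes>\<^sub>M P) (\<lambda>(x, y). f (override_on x y A))"
    using integrable_distr_eq[OF m, of f] by (simp add: split_def)
  have "(\<integral>x. f x \<partial>P) = (\<integral>x. f x \<partial>(distr (P \<Otimes>\<^sub>M P) P (\<lambda>(x, y). override_on x y A)))" by (simp add: distr_override_on)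
  also have "\<dots> = (\<integral>(x, y). f (override_on x y A) \<partial>(P \<Otimes>\<^sub>M P))"
    using integral_distr[OF m, of f] by (simp add: split_def)
  finally show "(\<integral>(x, y). f (override_on x y A) \<partial>(P \<Otimes>\<^sub>M P)) = (\<integral>x. f x \<partial>P)" ..
qed

lemma AE_override_on:
  assumes "AE x in P. R x"
  shows "AE x in P. AE y in P. R (override_on x y A)"
proof -
  have m: "(\<lambda>(x, y). override_on x y A) \<in> P \<Otimes>\<^sub>M P \<rightarrow>\<^sub>M P" by measurable
  have "AE x in distr (P \<Otimes>\<^sub>M P) P (\<lambda>(x, y). override_on x y A). R x" by (subst distr_override_on) (rule assms)
  from AE_distrD[OF m this] have *: "AE z in P \<Otimes>\<^sub>M P. R (override_on (fst z) (snd z) A)"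
    by (simp add: split_def)
  interpret PP: pair_sigma_finite P P ..
  from PP.AE_pair[OF *] show ?thesis by simp
qed

text \<open>A version of the conditional expectation given the coordinates outside \<open>A\<close>,
  realised pointwise by resampling the coordinates in \<open>A\<close>. Its algebraic rules hold
  only where the sections are integrable, hence the many almost everywhere statements.\<close>

definition Ex :: "'i set \<Rightarrow> (('i \<Rightarrow> real) \<Rightarrow> real) \<Rightarrow> ('i \<Rightarrow> real) \<Rightarrow> real" where
  "Ex A f x = (\<integral>y. f (override_on x y A) \<partial>P)"

lemma measurable_Ex [measurable]:
  assumes [measurable]: "f \<in> borel_measurable P"
  shows "Ex A f \<in> borel_measurable P"
  unfolding Ex_def[abs_def] by (rule P.borel_measurable_lebesgue_integral) (simp add: split_def)

lemma integrable_Ex: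
  assumes "integrable P f" shows "integrable P (Ex A f)" "(\<integral>x. Ex A f x \<partial>P) = (\<integral>x. f x \<partial>P)"
proof -
  interpret PP: pair_sigma_finite P P ..
  note i = integrable_override_on[OF assms, of A]
  show "integrable P (Ex A f)" unfolding Ex_def[abs_def] using PP.integrable_fst[OF i(1)] by simp
  show "(\<integral>x. Ex A f x \<partial>P) = (\<integral>x. f x \<partial>P)" unfolding Ex_def[abs_def] using PP.integral_fst[OF i(1)] i(2) by simp
qed

lemma AE_integrable_section:
  fixes f :: "('i \<Rightarrow> real) \<Rightarrow> real"
  assumes "integrable P f" shows "AE x in P. integrable P (\<lambda>y. f (override_on x y A))"
proof -
  interpret PP: pair_sigma_finite P P ..
  show ?thesis using PP.AE_integrable_fst[OF integrable_override_on(1)[OF assms, of A]] by simp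
qed

lemma Ex_cong_AE:
  assumes "AE x in P. f x = g x" and [measurable]: "f \<in> borel_measurable P" "g \<in> borel_measurable P"
  shows "AE x in P. Ex A f x = Ex A g x"
  using AE_override_on[OF assms(1), of A]
proof eventually_elim
  case (elim x)
  then show ?case unfolding Ex_def by (intro integral_cong_AE) auto
qed

lemma Ex_mono_AE:
  assumes "AE x in P. f x \<le> g x" "integrable P f" "integrable P g"
  shows "AE x in P. Ex A f x \<le> Ex A g x"
  using AE_override_on[OF assms(1), of A] AE_integrable_section[OF assms(2), of A] AE_integrable_section[OF assms(3), of A]
proof eventually_elim
  case (elim x)
  then show ?case unfolding Ex_def by (intro integral_mono_AE) auto
qed

lemma Ex_sum_AE:
  assumes "\<And>i. i \<in> I \<Longrightarrow> integrable P (f i)"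
  shows "AE x in P. Ex A (\<lambda>x. \<Sum>i\<in>I. c i * f i x) x = (\<Sum>i\<in>I. c i * Ex A (f i) x)"
proof (cases "finite I")
  case True
  have "AE x in P. \<forall>i\<in>I. integrable P (\<lambda>y. f i (override_on x y A))"
    using assms AE_integrable_section True by (intro AE_finite_allI) auto
  then show ?thesis
    by eventually_elim (simp add: Ex_def)
qed (simp add: Ex_def)

text \<open>With \<open>x\<close> fixed both averages act on one section over
  \<open>A \<union> B\<close>; resampling \<open>B\<close> once more inside it does not change the
  law.\<close>

lemma Ex_Ex_AE:
  assumes f: "integrable P f"
  shows "AE x in P. Ex A (Ex B f) x = Ex (A \<union> B) f x"
  using AE_integrable_section[OF f, of "A \<union> B"]
proof eventually_elim
  case (elim x)
  define g where "g w = f (override_on x w (A \<union> B))" for w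
  have g: "integrable P g" using elim by (simp add: g_def[abs_def])
  interpret PP: pair_sigma_finite P P ..
  have "Ex A (Ex B f) x = (\<integral>y. \<integral>y'. g (override_on y y' B) \<partial>P \<partial>P)"
    unfolding Ex_def g_def by (intro Bochner_Integration.integral_cong refl arg_cong[where f=f]) (auto simp: override_on_def)
  also have "\<dots> = (\<integral>(y, y'). g (override_on y y' B) \<partial>(P \<Otimes>\<^sub>M P))"
    using PP.integral_fst[OF integrable_override_on(1)[OF g, of B]] by simp
  also have "\<dots> = (\<integral>w. g w \<partial>P)" by (rule integrable_override_on(2)[OF g])
  finally show ?case by (simp add: Ex_def g_def)
qed

definition dep :: "'i set \<Rightarrow> (('i \<Rightarrow> real) \<Rightarrow> 'b) \<Rightarrow> bool" where
  "dep A f \<longleftrightarrow> (\<forall>x y. (\<forall>i\<in>A. x i = y i) \<longrightarrow> f x = f y)"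

lemma depD: "dep A f \<Longrightarrow> (\<And>i. i \<in> A \<Longrightarrow> x i = y i) \<Longrightarrow> f x = f y"
  by (auto simp: dep_def)

lemma dep_mono: "dep A f \<Longrightarrow> A \<subseteq> B \<Longrightarrow> dep B f"
  unfolding dep_def by blast

lemma dep_Ex: assumes "dep B f" shows "dep (B - A) (Ex A f)"
  unfolding dep_def Ex_def
  by (intro allI impI Bochner_Integration.integral_cong refl depD[OF assms]) (auto simp: override_on_def)

lemma dep_override: "dep B f \<Longrightarrow> A \<inter> B = {} \<Longrightarrow> f (override_on x y A) = f x"
  by (erule depD) (auto simp: override_on_def)

lemma Ex_dep: "dep B f \<Longrightarrow> A \<inter> B = {} \<Longrightarrow> Ex A f x = f x"
  by (simp add: Ex_def dep_override)

lemma Ex_mult_dep: "dep B g \<Longrightarrow> A \<inter> B = {} \<Longrightarrow> Ex A (\<lambda>x. g x * f x) x = g x * Ex A f x"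
  by (simp add: Ex_def dep_override)

lemma Ex_empty: "Ex {} f x = f x"
  by (simp add: Ex_def)

lemma Ex_UNIV: "Ex UNIV f x = (\<integral>y. f y \<partial>P)"
  by (simp add: Ex_def override_on_def)

text \<open>The operator \<open>\<Prod>\<^sub>i\<^sub>\<in>\<^sub>K (1 - E\<^sub>i)\<close>, expanded.\<close>

definition hoef :: "'i set \<Rightarrow> (('i \<Rightarrow> real) \<Rightarrow> real) \<Rightarrow> ('i \<Rightarrow> real) \<Rightarrow> real" where
  "hoef K f x = (\<Sum>S\<in>Pow K. (-1) ^ card S * Ex S f x)"

lemma measurable_hoef [measurable]: "f \<in> borel_measurable P \<Longrightarrow> hoef K f \<in> borel_measurable P"
  unfolding hoef_def[abs_def] by (intro borel_measurable_sum borel_measurable_times borel_measurable_const measurable_Ex)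

lemma integrable_hoef: "integrable P f \<Longrightarrow> integrable P (hoef K f)"
  unfolding hoef_def[abs_def] by (intro Bochner_Integration.integrable_sum integrable_mult_right integrable_Ex)

lemma dep_hoef: assumes "dep B f" shows "dep B (hoef K f)"
proof -
  have "Ex S f x = Ex S f y" if "\<forall>i\<in>B. x i = y i" for S x y
    using dep_mono[OF dep_Ex[OF assms], of S B] that by (auto simp: dep_def)
  then show ?thesis unfolding dep_def hoef_def by (auto intro!: sum.cong)
qed

lemma hoef_empty: "hoef {} f x = f x"
  by (simp add: hoef_def Ex_empty)

lemma hoef_cong_AE:
  assumes "AE x in P. f x = g x" "f \<in> borel_measurable P" "g \<in> borel_measurable P" "finite K"
  shows "AE x in P. hoef K f x = hoef K g x"
proof -
  have "AE x in P. \<forall>S\<in>Pow K. Ex S f x = Ex S g x"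
    using assms by (intro AE_finite_allI Ex_cong_AE) auto
  then show ?thesis by eventually_elim (simp add: hoef_def)
qed

lemma hoef_sum_AE:
  assumes "\<And>i. i \<in> I \<Longrightarrow> integrable P (f i)" "finite K"
  shows "AE x in P. hoef K (\<lambda>x. \<Sum>i\<in>I. c i * f i x) x = (\<Sum>i\<in>I. c i * hoef K (f i) x)"
proof -
  have "AE x in P. \<forall>S\<in>Pow K. Ex S (\<lambda>x. \<Sum>i\<in>I. c i * f i x) x = (\<Sum>i\<in>I. c i * Ex S (f i) x)"
    using assms by (intro AE_finite_allI Ex_sum_AE) auto
  then show ?thesis
  proof eventually_elim
    case (elim x)
    then have "hoef K (\<lambda>x. \<Sum>i\<in>I. c i * f i x) x = (\<Sum>S\<in>Pow K. \<Sum>i\<in>I. (-1) ^ card S * (c i * Ex S (f i) x))"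
      by (simp add: hoef_def sum_distrib_left)
    also have "\<dots> = (\<Sum>i\<in>I. c i * hoef K (f i) x)"
      by (subst sum.swap) (simp add: hoef_def sum_distrib_left mult_ac)
    finally show ?case .
  qed
qed

lemma Ex_hoef_AE:
  assumes f: "integrable P f" and K: "finite K"
  shows "AE x in P. Ex A (hoef K f) x = (\<Sum>S\<in>Pow K. (-1) ^ card S * Ex (A \<union> S) f x)"
proof -
  have "AE x in P. Ex A (\<lambda>x. \<Sum>S\<in>Pow K. (-1) ^ card S * Ex S f x) x = (\<Sum>S\<in>Pow K. (-1) ^ card S * Ex A (Ex S f) x)"
    by (intro Ex_sum_AE integrable_Ex f)
  moreover have "AE x in P. \<forall>S\<in>Pow K. Ex A (Ex S f) x = Ex (A \<union> S) f x"
    using K by (intro AE_finite_allI Ex_Ex_AE f) auto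
  ultimately show ?thesis
    by eventually_elim (simp add: hoef_def[abs_def])
qed

lemma hoef_Ex_AE:
  assumes f: "integrable P f" and K: "finite K"
  shows "AE x in P. hoef K (Ex A f) x = (\<Sum>S\<in>Pow K. (-1) ^ card S * Ex (A \<union> S) f x)"
proof -
  have "AE x in P. \<forall>S\<in>Pow K. Ex S (Ex A f) x = Ex (S \<union> A) f x"
    using K by (intro AE_finite_allI Ex_Ex_AE f) auto
  then show ?thesis
    by eventually_elim (simp add: hoef_def[abs_def] Un_commute)
qed

text \<open>The subsets with and without \<open>j\<close> cancel in pairs.\<close>

lemma sum_alternating_Pow_insert:
  fixes g :: "'i set \<Rightarrow> real"
  assumes "finite K" "j \<in> K" "\<And>S. S \<subseteq> K - {j} \<Longrightarrow> g (insert j S) = g S"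
  shows "(\<Sum>S\<in>Pow K. (-1) ^ card S * g S) = 0"
proof -
  have K: "K = insert j (K - {j})" using assms by auto
  have "Pow K = Pow (K - {j}) \<union> insert j ` Pow (K - {j})" by (subst K) (rule Pow_insert)
  then have "(\<Sum>S\<in>Pow K. (-1) ^ card S * g S) = (\<Sum>S\<in>Pow (K - {j}) \<union> insert j ` Pow (K - {j}). (-1) ^ card S * g S)" by simp
  also have "\<dots> = (\<Sum>S\<in>Pow (K - {j}). (-1) ^ card S * g S) + (\<Sum>S\<in>insert j ` Pow (K - {j}). (-1) ^ card S * g S)"
    using assms by (intro sum.union_disjoint) auto
  also have "(\<Sum>S\<in>insert j ` Pow (K - {j}). (-1) ^ card S * g S) = (\<Sum>S\<in>Pow (K - {j}). (-1) ^ card (insert j S) * g (insert j S))"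
    by (subst sum.reindex) (auto intro!: inj_onI simp: o_def)
  also have "\<dots> = (\<Sum>S\<in>Pow (K - {j}). - ((-1) ^ card S * g S))"
  proof (rule sum.cong)
    fix S assume S: "S \<in> Pow (K - {j})"
    then have "finite S" "j \<notin> S" using assms(1) by (auto intro: finite_subset)
    then show "(-1) ^ card (insert j S) * g (insert j S) = - ((-1) ^ card S * g S)"
      using assms(3)[of S] S by simp
  qed simp
  finally show ?thesis by (simp add: sum_negf)
qed

text \<open>After expansion, \<open>A \<union> S\<close> does not reveal whether \<open>j\<close>
  belongs to \<open>S\<close>, so the alternating sum cancels. This is the degeneracy of Hoeffding
  components.\<close>

lemma Ex_hoef_0:
  assumes f: "integrable P f" and K: "finite K" "j \<in> K" "j \<in> A"
  shows "AE x in P. Ex A (hoef K f) x = 0"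
  using Ex_hoef_AE[OF f K(1), of A]
proof eventually_elim
  case (elim x)
  have "A \<union> insert j S = A \<union> S" for S using K by auto
  then show ?case unfolding elim by (intro sum_alternating_Pow_insert[where j=j] K) simp
qed

text \<open>A function that ignores coordinate \<open>j\<close> equals its own average over
  \<open>j\<close>, and the factor 1 - E_j of the component removes it.\<close>

lemma hoef_kill:
  assumes f: "integrable P f" and K: "finite K" "j \<in> K" and d: "dep B f" "j \<notin> B"
  shows "AE x in P. hoef K f x = 0"
proof -
  have e: "Ex {j} f = f" using d by (auto intro!: Ex_dep)
  have "AE x in P. hoef K (Ex {j} f) x = 0"
    using hoef_Ex_AE[OF f K(1), of "{j}"]
  proof eventually_elim
    case (elim x)
    have "{j} \<union> insert j S = {j} \<union> S" for S by auto
    then show ?case unfolding elim by (intro sum_alternating_Pow_insert[where j=j] K) simp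
  qed
  then show ?thesis unfolding e .
qed

text \<open>This expands the product over i in \<open>N\<close> of E_i + (1 - E_i), which is the
  identity. The function may still depend on coordinates outside \<open>N\<close>; they act as
  parameters.\<close>

lemma hoeffding:
  assumes f: "integrable P f" and N: "finite N"
  shows "AE x in P. f x = (\<Sum>K\<in>Pow N. hoef K (Ex (N - K) f) x)"
proof -
  have "AE x in P. \<forall>K\<in>Pow N. hoef K (Ex (N - K) f) x = (\<Sum>S\<in>Pow K. (-1) ^ card S * Ex ((N - K) \<union> S) f x)"
    using N by (intro AE_finite_allI hoef_Ex_AE f) (auto intro: finite_subset)
  then show ?thesis
  proof eventually_elim
    case (elim x)
    have "(\<Sum>K\<in>Pow N. hoef K (Ex (N - K) f) x) = (\<Sum>K\<in>Pow N. \<Sum>S\<in>Pow K. (-1) ^ card S * Ex ((N - K) \<union> S) f x)"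
      using elim by simp
    also have "\<dots> = (\<Sum>(K, S)\<in>(SIGMA K:Pow N. Pow K). (-1) ^ card S * Ex ((N - K) \<union> S) f x)"
      using N by (intro sum.Sigma) (auto intro: finite_subset)
    \<comment> \<open>Terms are collected by the set T = (N - K) \<union> S of averaged coordinates;
      for fixed T the signs over S \<subseteq> T cancel unless T is empty.\<close>
    also have "\<dots> = (\<Sum>(T, S)\<in>(SIGMA T:Pow N. Pow T). (-1) ^ card S * Ex T f x)"
      by (rule sum.reindex_bij_witness[where j="\<lambda>(K, S). ((N - K) \<union> S, S)" and i="\<lambda>(T, S). ((N - T) \<union> S, S)"]) auto
    also have "\<dots> = (\<Sum>T\<in>Pow N. \<Sum>S\<in>Pow T. (-1) ^ card S * Ex T f x)"
      using N by (intro sum.Sigma[symmetric]) (auto intro: finite_subset)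
    also have "\<dots> = (\<Sum>T\<in>Pow N. if T = {} then Ex T f x else 0)"
    proof (rule sum.cong)
      fix T assume T: "T \<in> Pow N"
      show "(\<Sum>S\<in>Pow T. (-1) ^ card S * Ex T f x) = (if T = {} then Ex T f x else 0)"
      proof (cases "T = {}")
        case False
        then obtain j where "j \<in> T" by auto
        then show ?thesis using T N False
          by (simp add: sum_alternating_Pow_insert[where j=j and K=T and g="\<lambda>_. Ex T f x"] finite_subset)
      qed simp
    qed simp
    also have "\<dots> = Ex {} f x" using N by (simp add: sum.delta)
    finally show ?case by (simp add: Ex_empty)
  qed
qed

lemma Ex_restrict: "dep B f \<Longrightarrow> Ex A f x = Ex (A \<inter> B) f x"
  unfolding Ex_def by (intro Bochner_Integration.integral_cong refl) (erule depD, auto simp: override_on_def)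

definition sqi :: "(('i \<Rightarrow> real) \<Rightarrow> real) \<Rightarrow> bool" where
  "sqi f \<longleftrightarrow> f \<in> borel_measurable P \<and> integrable P (\<lambda>x. (f x)\<^sup>2)"

lemma sqi_measurable: "sqi f \<Longrightarrow> f \<in> borel_measurable P"
  by (simp add: sqi_def)

lemma sqi_integrable: "sqi f \<Longrightarrow> integrable P f"
  unfolding sqi_def using P.square_integrable_imp_integrable by blast

lemma sqi_mult_integrable:
  assumes "sqi f" "sqi g" shows "integrable P (\<lambda>x. f x * g x)"
proof (rule Bochner_Integration.integrable_bound)
  show "integrable P (\<lambda>x. (f x)\<^sup>2 + (g x)\<^sup>2)" using assms by (simp add: sqi_def)
  show "(\<lambda>x. f x * g x) \<in> borel_measurable P" using assms by (auto simp: sqi_def intro!: borel_measurable_times)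
  have "\<bar>a * b\<bar> \<le> a\<^sup>2 + b\<^sup>2" for a b :: real
    using sum_squares_bound[of "\<bar>a\<bar>" "\<bar>b\<bar>"] mult_nonneg_nonneg[of "\<bar>a\<bar>" "\<bar>b\<bar>"]
    unfolding abs_mult power2_abs by linarith
  then show "AE x in P. norm (f x * g x) \<le> norm ((f x)\<^sup>2 + (g x)\<^sup>2)" by simp
qed

lemma sqi_cmult: "sqi f \<Longrightarrow> sqi (\<lambda>x. c * f x)"
  by (auto simp: sqi_def power_mult_distrib intro!: borel_measurable_times)

lemma sqi_add: assumes "sqi f" "sqi g" shows "sqi (\<lambda>x. f x + g x)"
proof -
  have "integrable P (\<lambda>x. (f x)\<^sup>2 + 2 * (f x * g x) + (g x)\<^sup>2)"
    using assms sqi_mult_integrable[OF assms] by (simp add: sqi_def)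
  then show ?thesis using assms by (auto simp: sqi_def power2_sum algebra_simps intro!: borel_measurable_add)
qed

lemma sqi_const: "sqi (\<lambda>x. c)"
  by (simp add: sqi_def)

lemma sqi_sum: "(\<And>i. i \<in> I \<Longrightarrow> sqi (f i)) \<Longrightarrow> sqi (\<lambda>x. \<Sum>i\<in>I. f i x)"
  by (induction I rule: infinite_finite_induct) (auto intro: sqi_add sqi_const)

lemma square_integral_le: assumes "sqi f" shows "(\<integral>x. f x \<partial>P)\<^sup>2 \<le> (\<integral>x. (f x)\<^sup>2 \<partial>P)"
proof -
  have "0 \<le> (\<integral>x. (f x - (\<integral>x. f x \<partial>P))\<^sup>2 \<partial>P)" by simp
  also have "\<dots> = (\<integral>x. (f x)\<^sup>2 \<partial>P) - (\<integral>x. f x \<partial>P)\<^sup>2"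
    using P.variance_eq[OF sqi_integrable[OF assms]] assms by (simp add: sqi_def)
  finally show ?thesis by simp
qed

lemma sqi_Ex:
  assumes f: "sqi f"
  shows "sqi (Ex A f)" "AE x in P. (Ex A f x)\<^sup>2 \<le> Ex A (\<lambda>x. (f x)\<^sup>2) x" "(\<integral>x. (Ex A f x)\<^sup>2 \<partial>P) \<le> (\<integral>x. (f x)\<^sup>2 \<partial>P)"
proof -
  have [measurable]: "f \<in> borel_measurable P" and i: "integrable P (\<lambda>x. (f x)\<^sup>2)" using f by (auto simp: sqi_def)
  show 1: "AE x in P. (Ex A f x)\<^sup>2 \<le> Ex A (\<lambda>x. (f x)\<^sup>2) x"
    using AE_integrable_section[OF i, of A]
  proof eventually_elim
    case (elim x)
    then have "sqi (\<lambda>y. f (override_on x y A))" by (simp add: sqi_def)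
    from square_integral_le[OF this] show ?case by (simp add: Ex_def)
  qed
  have ii: "integrable P (\<lambda>x. (Ex A f x)\<^sup>2)"
    by (rule Bochner_Integration.integrable_bound[OF integrable_Ex(1)[OF i, of A]])
      (use 1 in \<open>auto elim!: eventually_mono\<close>)
  then show "sqi (Ex A f)" by (simp add: sqi_def)
  show "(\<integral>x. (Ex A f x)\<^sup>2 \<partial>P) \<le> (\<integral>x. (f x)\<^sup>2 \<partial>P)"
    using integral_mono_AE[OF ii integrable_Ex(1)[OF i, of A] 1] integrable_Ex(2)[OF i, of A] by simp
qed

text \<open>\<open>Ex A f\<close> does not depend on the coordinates in \<open>A\<close>, so
  averaging the product over them pulls it out and leaves the average of \<open>g\<close>.\<close>

lemma Ex_selfadjoint:
  assumes "sqi f" "sqi g"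
  shows "(\<integral>x. Ex A f x * g x \<partial>P) = (\<integral>x. Ex A f x * Ex A g x \<partial>P)"
proof -
  have i: "integrable P (\<lambda>x. Ex A f x * g x)" using assms by (intro sqi_mult_integrable sqi_Ex)
  have d: "dep (- A) (Ex A f)" using dep_Ex[of UNIV f A] by (auto simp: Compl_eq_Diff_UNIV dep_def fun_eq_iff[symmetric])
  have "(\<integral>x. Ex A f x * g x \<partial>P) = (\<integral>x. Ex A (\<lambda>x. Ex A f x * g x) x \<partial>P)"
    using integrable_Ex(2)[OF i, of A] by simp
  also have "\<dots> = (\<integral>x. Ex A f x * Ex A g x \<partial>P)"
    using Ex_mult_dep[OF d, of A g] by simp
  finally show ?thesis .
qed

lemma sqi_hoef: "sqi f \<Longrightarrow> sqi (hoef K f)"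
  unfolding hoef_def[abs_def] by (intro sqi_sum sqi_cmult sqi_Ex)

text \<open>The component is orthogonal to every average \<open>Ex S f\<close> with nonempty S
  \<subseteq> K, hence its squared norm is its inner product with \<open>f\<close>. Expanding the
  squared norm of f - hoef K f gives the inequality.\<close>

lemma hoef_norm_le:
  assumes f: "sqi f" and K: "finite K"
  shows "(\<integral>x. (hoef K f x)\<^sup>2 \<partial>P) \<le> (\<integral>x. (f x)\<^sup>2 \<partial>P)"
proof -
  note h = sqi_hoef[OF f, of K]
  have S: "(\<integral>x. hoef K f x * Ex S f x \<partial>P) = 0" if S: "S \<subseteq> K" "S \<noteq> {}" for S
  proof -
    obtain j where j: "j \<in> S" using S by auto
    have "(\<integral>x. hoef K f x * Ex S f x \<partial>P) = (\<integral>x. Ex S (hoef K f) x * Ex S f x \<partial>P)"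
      using Ex_selfadjoint[OF f h, of S] by (simp add: mult.commute)
    also have "\<dots> = (\<integral>x. 0 \<partial>P)"
    proof (rule integral_cong_AE)
      show "AE x in P. Ex S (hoef K f) x * Ex S f x = 0"
        using j S by (intro eventually_mono[OF Ex_hoef_0[OF sqi_integrable[OF f] K, of j S]]) auto
    qed (auto intro!: borel_measurable_times measurable_Ex sqi_measurable[OF f] sqi_measurable[OF h])
    finally show ?thesis by simp
  qed
  have "(\<integral>x. (hoef K f x)\<^sup>2 \<partial>P) = (\<integral>x. (\<Sum>S\<in>Pow K. (-1) ^ card S * (hoef K f x * Ex S f x)) \<partial>P)"
    by (intro Bochner_Integration.integral_cong refl)
      (simp add: power2_eq_square, subst (2) hoef_def, simp add: sum_distrib_left mult_ac)
  also have "\<dots> = (\<Sum>S\<in>Pow K. (-1) ^ card S * (\<integral>x. hoef K f x * Ex S f x \<partial>P))"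
    using f h by (subst Bochner_Integration.integral_sum) (auto intro!: integrable_mult_right sqi_mult_integrable sqi_Ex)
  also have "\<dots> = (\<Sum>S\<in>Pow K. if S = {} then (\<integral>x. hoef K f x * f x \<partial>P) else 0)"
    using S by (intro sum.cong) (auto simp: Ex_empty)
  also have "\<dots> = (\<integral>x. hoef K f x * f x \<partial>P)" using K by (simp add: sum.delta)
  finally have eq: "(\<integral>x. (hoef K f x)\<^sup>2 \<partial>P) = (\<integral>x. hoef K f x * f x \<partial>P)" .
  have "0 \<le> (\<integral>x. (f x - hoef K f x)\<^sup>2 \<partial>P)" by simp
  also have "\<dots> = (\<integral>x. (f x)\<^sup>2 + (hoef K f x)\<^sup>2 - 2 * (hoef K f x * f x) \<partial>P)"
    by (simp add: power2_diff algebra_simps)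
  also have "\<dots> = (\<integral>x. (f x)\<^sup>2 \<partial>P) + (\<integral>x. (hoef K f x)\<^sup>2 \<partial>P) - 2 * (\<integral>x. hoef K f x * f x \<partial>P)"
    using f h sqi_mult_integrable[OF h f] by (simp add: sqi_def)
  finally show ?thesis using eq by simp
qed

text \<open>The second component does not depend on the coordinate \<open>j\<close>, so averaging
  the product over \<open>j\<close> only affects the first one, which is degenerate in
  \<open>j\<close>.\<close>

lemma hoef_orthogonal:
  assumes f: "sqi f" and g: "sqi g" "dep B g" and K: "finite K" "j \<in> K" "j \<notin> B"
  shows "(\<integral>x. hoef K f x * hoef K' g x \<partial>P) = 0"
proof -
  have i: "integrable P (\<lambda>x. hoef K' g x * hoef K f x)" using f g by (intro sqi_mult_integrable sqi_hoef)
  have "(\<integral>x. hoef K' g x * hoef K f x \<partial>P) = (\<integral>x. Ex {j} (\<lambda>x. hoef K' g x * hoef K f x) x \<partial>P)"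
    using integrable_Ex(2)[OF i, of "{j}"] by simp
  also have "\<dots> = (\<integral>x. hoef K' g x * Ex {j} (hoef K f) x \<partial>P)"
    using Ex_mult_dep[OF dep_hoef[OF g(2)], of "{j}" K' "hoef K f"] K by simp
  also have "\<dots> = (\<integral>x. 0 \<partial>P)"
  proof (rule integral_cong_AE)
    show "AE x in P. hoef K' g x * Ex {j} (hoef K f) x = 0"
      by (rule eventually_mono[OF Ex_hoef_0[OF sqi_integrable[OF f] K(1,2), of "{j}"]]) auto
  qed (use f g in \<open>auto intro!: borel_measurable_times measurable_Ex measurable_hoef sqi_measurable[OF f] sqi_measurable[OF g(1)]\<close>)
  finally show ?thesis by (simp add: mult.commute)
qed

text \<open>All functions may share the unprojected coordinates in \<open>C\<close>, because a point
  of the symmetric difference of two sets \<open>K\<close> still separates their components. The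
  case C = {i} serves the squares of D_i, and C = {} serves \<Gamma>.\<close>

lemma hoef_sum_norm_le:
  assumes I: "finite I" "\<And>K. K \<in> I \<Longrightarrow> finite K" "\<And>K. K \<in> I \<Longrightarrow> K \<inter> C = {}"
    and g: "\<And>K. K \<in> I \<Longrightarrow> sqi (g K)" "\<And>K. K \<in> I \<Longrightarrow> dep (K \<union> C) (g K)"
  shows "(\<integral>x. (\<Sum>K\<in>I. hoef K (g K) x)\<^sup>2 \<partial>P) \<le> (\<Sum>K\<in>I. \<integral>x. (g K x)\<^sup>2 \<partial>P)"
proof -
  have o: "(\<integral>x. hoef K (g K) x * hoef K' (g K') x \<partial>P) = 0" if K: "K \<in> I" "K' \<in> I" "K \<noteq> K'" for K K'
  proof -
    consider j where "j \<in> K" "j \<notin> K'" | j where "j \<in> K'" "j \<notin> K" using K(3) by auto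
    then show ?thesis
    proof cases
      case 1
      then show ?thesis using K I(2,3) g by (intro hoef_orthogonal[where j=j and B="K' \<union> C"]) auto
    next
      case 2
      then have "(\<integral>x. hoef K' (g K') x * hoef K (g K) x \<partial>P) = 0"
        using K I(2,3) g by (intro hoef_orthogonal[where j=j and B="K \<union> C"]) auto
      then show ?thesis by (simp add: mult.commute)
    qed
  qed
  have "(\<integral>x. (\<Sum>K\<in>I. hoef K (g K) x)\<^sup>2 \<partial>P) = (\<integral>x. (\<Sum>K\<in>I. \<Sum>K'\<in>I. hoef K (g K) x * hoef K' (g K') x) \<partial>P)"
    by (simp add: power2_eq_square sum_product)
  also have "\<dots> = (\<Sum>K\<in>I. \<Sum>K'\<in>I. \<integral>x. hoef K (g K) x * hoef K' (g K') x \<partial>P)"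
    using g(1) by (simp add: sqi_mult_integrable sqi_hoef)
  also have "\<dots> = (\<Sum>K\<in>I. \<Sum>K'\<in>I. if K' = K then \<integral>x. (hoef K (g K) x)\<^sup>2 \<partial>P else 0)"
    using o by (intro sum.cong refl) (auto simp: power2_eq_square)
  also have "\<dots> = (\<Sum>K\<in>I. \<integral>x. (hoef K (g K) x)\<^sup>2 \<partial>P)" using I(1) by (simp add: sum.delta)
  also have "\<dots> \<le> (\<Sum>K\<in>I. \<integral>x. (g K x)\<^sup>2 \<partial>P)"
    using g I by (intro sum_mono hoef_norm_le) auto
  finally show ?thesis .
qed

lemma Ex_L1:
  assumes f: "integrable P f" shows "(\<integral>x. \<bar>Ex A f x\<bar> \<partial>P) \<le> (\<integral>x. \<bar>f x\<bar> \<partial>P)"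
proof -
  have "(\<integral>x. \<bar>Ex A f x\<bar> \<partial>P) \<le> (\<integral>x. Ex A (\<lambda>x. \<bar>f x\<bar>) x \<partial>P)"
    using f by (intro integral_mono integrable_abs integrable_Ex) (auto simp: Ex_def integral_abs_bound)
  then show ?thesis using integrable_Ex(2)[OF integrable_abs[OF f], of A] by simp
qed

text \<open>The expansion of a component consists of 2 ^ card K averages, each a contraction of L1.
  Convergence of components is only available in this norm.\<close>

lemma hoef_L1:
  assumes f: "integrable P f" and g: "integrable P g" and K: "finite K"
  shows "(\<integral>x. \<bar>hoef K f x - hoef K g x\<bar> \<partial>P) \<le> 2 ^ card K * (\<integral>x. \<bar>f x - g x\<bar> \<partial>P)"
proof -
  have d: "integrable P (\<lambda>x. f x - g x)" using f g by simp
  have "AE x in P. \<forall>S\<in>Pow K. Ex S f x - Ex S g x = Ex S (\<lambda>x. f x - g x) x"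
  proof (intro AE_finite_allI)
    show "AE x in P. Ex S f x - Ex S g x = Ex S (\<lambda>x. f x - g x) x" for S
      using AE_integrable_section[OF f, of S] AE_integrable_section[OF g, of S]
      by eventually_elim (simp add: Ex_def)
  qed (use K in auto)
  then have "AE x in P. \<bar>hoef K f x - hoef K g x\<bar> \<le> (\<Sum>S\<in>Pow K. \<bar>Ex S (\<lambda>x. f x - g x) x\<bar>)"
  proof eventually_elim
    case (elim x)
    have "hoef K f x - hoef K g x = (\<Sum>S\<in>Pow K. (-1) ^ card S * Ex S (\<lambda>x. f x - g x) x)"
      using elim by (simp add: hoef_def sum_subtractf[symmetric] right_diff_distrib[symmetric])
    also have "\<bar>\<dots>\<bar> \<le> (\<Sum>S\<in>Pow K. \<bar>(-1) ^ card S * Ex S (\<lambda>x. f x - g x) x\<bar>)" by (rule sum_abs)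
    finally show ?case by (simp add: abs_mult power_abs)
  qed
  then have "(\<integral>x. \<bar>hoef K f x - hoef K g x\<bar> \<partial>P) \<le> (\<integral>x. (\<Sum>S\<in>Pow K. \<bar>Ex S (\<lambda>x. f x - g x) x\<bar>) \<partial>P)"
    using f g d by (intro integral_mono_AE Bochner_Integration.integrable_sum integrable_abs Bochner_Integration.integrable_diff integrable_hoef integrable_Ex)
  also have "\<dots> = (\<Sum>S\<in>Pow K. \<integral>x. \<bar>Ex S (\<lambda>x. f x - g x) x\<bar> \<partial>P)"
    using d by (intro Bochner_Integration.integral_sum integrable_abs integrable_Ex)
  also have "\<dots> \<le> (\<Sum>S\<in>Pow K. \<integral>x. \<bar>f x - g x\<bar> \<partial>P)"
    by (intro sum_mono Ex_L1 d)
  finally show ?thesis using K by (simp add: card_Pow)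
qed

end

section \<open>Exchange of one coordinate for an independent copy\<close>

context real_product_space
begin

lemma young3: fixes a b :: real assumes "a \<ge> 0" "b \<ge> 0" shows "a * b\<^sup>2 \<le> (a ^ 3 + 2 * b ^ 3) / 3"
proof -
  have "0 \<le> (a - b)\<^sup>2 * (a + 2 * b)" using assms by simp
  also have "\<dots> = a ^ 3 + 2 * b ^ 3 - 3 * (a * b\<^sup>2)" by (simp add: power2_eq_square power3_eq_cube algebra_simps)
  finally show ?thesis by simp
qed

text \<open>Replacing the \<open>i\<close>-th coordinate by an independent copy: the terms of the Taylor expansion
  around the unmodified point that are linear in \<open>D\<close> vanish on average, which gives the factor \<open>2\<close>.\<close>

lemma stein_exchange:
  fixes h h' :: "real \<Rightarrow> real"
  assumes h: "\<And>x. \<bar>h x\<bar> \<le> 1" "\<And>x. \<bar>h' x\<bar> \<le> 1" "\<And>a b. \<bar>h b - h a - (b - a) * h' a\<bar> \<le> (b - a)\<^sup>2"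
      "continuous_on UNIV h" "continuous_on UNIV h'"
    and D: "sqi D" "integrable P (\<lambda>x. \<bar>D x\<bar> ^ 3)" and c: "AE x in P. Ex {i} D x = 0"
    and F [measurable]: "F \<in> borel_measurable P" and V: "dep (- {i}) (\<lambda>x. F x - D x)"
  shows "\<bar>(\<integral>x. h' (F x) * Ex {i} (\<lambda>x. (D x)\<^sup>2) x \<partial>P) - (\<integral>x. D x * h (F x) \<partial>P)\<bar> \<le> 2 * (\<integral>x. \<bar>D x\<bar> ^ 3 \<partial>P)"
proof -
  interpret PP: pair_sigma_finite P P ..
  define PQ where "PQ = P \<Otimes>\<^sub>M P"
  define o1 where "o1 z = override_on (fst z) (snd z) {i}" for z :: "('i \<Rightarrow> real) \<times> ('i \<Rightarrow> real)"
  have [measurable]: "h \<in> borel_measurable borel" "h' \<in> borel_measurable borel"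
    using h(4,5) by (auto intro: borel_measurable_continuous_onI)
  have Dm [measurable]: "D \<in> borel_measurable P" using D(1) by (rule sqi_measurable)
  have om: "o1 \<in> PQ \<rightarrow>\<^sub>M P" unfolding o1_def[abs_def] PQ_def by measurable
  have fm: "fst \<in> PQ \<rightarrow>\<^sub>M P" unfolding PQ_def by measurable
  have m: "(\<lambda>z. f (o1 z)) \<in> borel_measurable PQ" "(\<lambda>z. f (fst z)) \<in> borel_measurable PQ"
    if "f \<in> borel_measurable P" for f :: "_ \<Rightarrow> real"
    using measurable_compose[OF om that] measurable_compose[OF fm that] by auto
  have mD [measurable]: "(\<lambda>z. D (o1 z)) \<in> borel_measurable PQ" "(\<lambda>z. D (fst z)) \<in> borel_measurable PQ"
    "(\<lambda>z. F (o1 z)) \<in> borel_measurable PQ" "(\<lambda>z. F (fst z)) \<in> borel_measurable PQ"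
    using m[OF Dm] m[OF F] by auto
  have io: "integrable PQ (\<lambda>z. f (o1 z))" "(\<integral>z. f (o1 z) \<partial>PQ) = (\<integral>x. f x \<partial>P)" if "integrable P f" for f :: "_ \<Rightarrow> real"
    using integrable_override_on[OF that, of "{i}"] by (simp_all add: PQ_def o1_def[abs_def] split_def)
  have d: "distr (P \<Otimes>\<^sub>M P) P fst = P"
    by (rule P.distr_pair_fst)
  have ifst: "integrable PQ (\<lambda>z. f (fst z))" "(\<integral>z. f (fst z) \<partial>PQ) = (\<integral>x. f x \<partial>P)" if "integrable P f" for f :: "_ \<Rightarrow> real"
  proof -
    have fm: "fst \<in> P \<Otimes>\<^sub>M P \<rightarrow>\<^sub>M P" by measurable
    have fb: "f \<in> borel_measurable P" using that by auto
    show "integrable PQ (\<lambda>z. f (fst z))" unfolding PQ_def using integrable_distr_eq[OF fm fb] that unfolding d by simp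
    show "(\<integral>z. f (fst z) \<partial>PQ) = (\<integral>x. f x \<partial>P)" unfolding PQ_def using integral_distr[OF fm fb] unfolding d by simp
  qed
  have iter: "(\<integral>z. g (fst z) (snd z) \<partial>PQ) = (\<integral>x. \<integral>y. g x y \<partial>P \<partial>P)"
    if "integrable PQ (\<lambda>z. g (fst z) (snd z))" for g :: "_ \<Rightarrow> _ \<Rightarrow> real"
    using PP.integral_fst[of g] that by (simp add: PQ_def split_def)
  have D2: "integrable P (\<lambda>x. (D x)\<^sup>2)" and D1: "integrable P D" using D(1) sqi_integrable[OF D(1)] by (simp_all add: sqi_def)
  have stein_rhs: "integrable PQ (\<lambda>z. f z * g z)"
    if "integrable PQ f" "g \<in> borel_measurable PQ" "\<And>z. \<bar>g z\<bar> \<le> 1" for f g :: "_ \<Rightarrow> real"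
  proof (rule Bochner_Integration.integrable_bound[OF that(1)])
    show "AE z in PQ. norm (f z * g z) \<le> norm (f z)"
      using mult_left_mono[OF that(3) abs_ge_zero] by (simp add: abs_mult)
  qed (intro borel_measurable_times borel_measurable_integrable that)
  have t1: "(\<integral>x. D x * h (F x) \<partial>P) = (\<integral>z. D (o1 z) * h (F (o1 z)) \<partial>PQ)"
    and t1i: "integrable PQ (\<lambda>z. D (o1 z) * h (F (o1 z)))"
  proof -
    have "integrable P (\<lambda>x. D x * h (F x))"
    proof (rule Bochner_Integration.integrable_bound[OF D1])
      show "AE x in P. norm (D x * h (F x)) \<le> norm (D x)"
        using mult_left_mono[OF h(1) abs_ge_zero] by (simp add: abs_mult)
    qed measurable
    from io[OF this] show "(\<integral>x. D x * h (F x) \<partial>P) = (\<integral>z. D (o1 z) * h (F (o1 z)) \<partial>PQ)"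
      "integrable PQ (\<lambda>z. D (o1 z) * h (F (o1 z)))" by simp_all
  qed
  have t2i: "integrable PQ (\<lambda>z. D (o1 z) * h (F (fst z)))"
    by (rule stein_rhs[OF io(1)[OF D1]]) (auto simp: h)
  have t2: "(\<integral>z. D (o1 z) * h (F (fst z)) \<partial>PQ) = 0"
  proof -
    have "(\<integral>z. D (o1 z) * h (F (fst z)) \<partial>PQ) = (\<integral>x. Ex {i} D x * h (F x) \<partial>P)"
      using t2i unfolding o1_def by (subst iter) (auto simp: Ex_def)
    also have "\<dots> = (\<integral>x. 0 \<partial>P)" by (rule integral_cong_AE) (use c in \<open>auto elim!: eventually_mono intro!: borel_measurable_times\<close>)
    finally show ?thesis by simp
  qed
  have t3i: "integrable PQ (\<lambda>z. D (o1 z) * D (fst z) * h' (F (fst z)))"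
  proof (rule stein_rhs)
    show "integrable PQ (\<lambda>z. D (o1 z) * D (fst z))"
    proof (rule Bochner_Integration.integrable_bound)
      show "integrable PQ (\<lambda>z. (D (o1 z))\<^sup>2 + (D (fst z))\<^sup>2)" using io(1)[OF D2] ifst(1)[OF D2] by simp
      show "AE z in PQ. norm (D (o1 z) * D (fst z)) \<le> norm ((D (o1 z))\<^sup>2 + (D (fst z))\<^sup>2)"
      proof (rule AE_I2)
        fix z
        show "norm (D (o1 z) * D (fst z)) \<le> norm ((D (o1 z))\<^sup>2 + (D (fst z))\<^sup>2)"
        using sum_squares_bound[of "\<bar>D (o1 z)\<bar>" "\<bar>D (fst z)\<bar>"] mult_nonneg_nonneg[of "\<bar>D (o1 z)\<bar>" "\<bar>D (fst z)\<bar>"]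
        unfolding real_norm_def abs_mult power2_abs by linarith
      qed
    qed auto
  qed (auto simp: h)
  have t3: "(\<integral>z. D (o1 z) * D (fst z) * h' (F (fst z)) \<partial>PQ) = 0"
  proof -
    have "(\<integral>z. D (o1 z) * D (fst z) * h' (F (fst z)) \<partial>PQ) = (\<integral>x. Ex {i} D x * (D x * h' (F x)) \<partial>P)"
      using t3i unfolding o1_def by (subst iter) (auto simp: Ex_def mult.assoc)
    also have "\<dots> = (\<integral>x. 0 \<partial>P)" by (rule integral_cong_AE) (use c in \<open>auto elim!: eventually_mono intro!: borel_measurable_times\<close>)
    finally show ?thesis by simp
  qed
  have t4i: "integrable PQ (\<lambda>z. (D (o1 z))\<^sup>2 * h' (F (fst z)))"
    by (rule stein_rhs[OF io(1)[OF D2]]) (auto simp: h)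
  have t4: "(\<integral>z. (D (o1 z))\<^sup>2 * h' (F (fst z)) \<partial>PQ) = (\<integral>x. h' (F x) * Ex {i} (\<lambda>x. (D x)\<^sup>2) x \<partial>P)"
    using t4i unfolding o1_def by (subst iter) (auto simp: Ex_def mult.commute)
  \<comment> \<open>W carries the cross term of |D'| (D' - D)^2, where D' is the resampled D. It
    enters linearly in D, so its contribution averages to zero.\<close>
  define W where "W x = D x * \<bar>D x\<bar>" for x
  have Wm [measurable]: "W \<in> borel_measurable P" unfolding W_def[abs_def] by (auto intro!: borel_measurable_times borel_measurable_abs)
  have Wi: "integrable P W"
    using D2 by (rule Bochner_Integration.integrable_bound) (auto simp: W_def power2_eq_square abs_mult)
  have t5i: "integrable PQ (\<lambda>z. W (o1 z) * D (fst z))"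
  proof (rule Bochner_Integration.integrable_bound)
    show "integrable PQ (\<lambda>z. (\<bar>D (fst z)\<bar> ^ 3 + 2 * \<bar>D (o1 z)\<bar> ^ 3) / 3)"
      using io(1)[OF D(2)] ifst(1)[OF D(2)] by simp
    show "AE z in PQ. norm (W (o1 z) * D (fst z)) \<le> norm ((\<bar>D (fst z)\<bar> ^ 3 + 2 * \<bar>D (o1 z)\<bar> ^ 3) / 3)"
      using young3[of "\<bar>D (fst _)\<bar>" "\<bar>D (o1 _)\<bar>"] by (intro AE_I2) (simp add: W_def abs_mult power2_eq_square mult_ac)
  qed (use m[OF Wm] in auto)
  have t5: "(\<integral>z. W (o1 z) * D (fst z) \<partial>PQ) = 0"
  proof -
    have e: "(\<integral>z. W (o1 z) * D (fst z) \<partial>PQ) = (\<integral>x. Ex {i} W x * D x \<partial>P)"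
      using t5i unfolding o1_def by (subst iter) (auto simp: Ex_def)
    have i: "integrable P (\<lambda>x. Ex {i} W x * D x)"
      using PP.integrable_fst[of "\<lambda>x y. W (o1 (x, y)) * D x"] t5i by (simp add: PQ_def o1_def Ex_def split_def)
    have dd: "dep (- {i}) (Ex {i} W)" using dep_Ex[of UNIV W "{i}"] by (auto simp: Compl_eq_Diff_UNIV dep_def fun_eq_iff[symmetric])
    have "(\<integral>x. Ex {i} W x * D x \<partial>P) = (\<integral>x. Ex {i} (\<lambda>x. Ex {i} W x * D x) x \<partial>P)" using integrable_Ex(2)[OF i] by simp
    also have "\<dots> = (\<integral>x. Ex {i} W x * Ex {i} D x \<partial>P)" using Ex_mult_dep[OF dd] by simp
    also have "\<dots> = (\<integral>x. 0 \<partial>P)" by (rule integral_cong_AE) (use c in \<open>auto elim!: eventually_mono intro!: borel_measurable_times\<close>)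
    finally show ?thesis using e by simp
  qed
  have FD: "F (o1 z) - F (fst z) = D (o1 z) - D (fst z)" for z
  proof -
    have "F (o1 z) - D (o1 z) = F (fst z) - D (fst z)" by (rule depD[OF V]) (auto simp: o1_def override_on_def)
    then show ?thesis by simp
  qed
  \<comment> \<open>Taylor remainder at the unmodified point, times the resampled D. Of the four
    terms in its expansion, the two in which \<open>h\<close> or \<open>h'\<close> at the unmodified
    point meets D' linearly have mean zero.\<close>
  define R where "R z = D (o1 z) * (h (F (o1 z)) - h (F (fst z)) - (F (o1 z) - F (fst z)) * h' (F (fst z)))" for z
  have R: "R z = D (o1 z) * h (F (o1 z)) - D (o1 z) * h (F (fst z)) - (D (o1 z))\<^sup>2 * h' (F (fst z)) + D (o1 z) * D (fst z) * h' (F (fst z))" for z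
    unfolding R_def FD by (simp add: algebra_simps power2_eq_square)
  have Ri: "integrable PQ R" unfolding R[abs_def]
    by (intro Bochner_Integration.integrable_add Bochner_Integration.integrable_diff t1i t2i t3i t4i)
  have Re: "(\<integral>z. R z \<partial>PQ) = (\<integral>x. D x * h (F x) \<partial>P) - (\<integral>x. h' (F x) * Ex {i} (\<lambda>x. (D x)\<^sup>2) x \<partial>P)"
    unfolding R using t1i t2i t3i t4i by (simp add: t1 t2 t3 t4)
  \<comment> \<open>The cube of |D'| comes with weight 1 and Young's inequality for |D'| D^2 adds
    (|D'|^3 + 2 |D|^3) / 3. As D and D' have the same law, 4/3 + 2/3 = 2.\<close>
  define Bd where "Bd z = 4 / 3 * \<bar>D (o1 z)\<bar> ^ 3 + 2 / 3 * \<bar>D (fst z)\<bar> ^ 3 - 2 * (W (o1 z) * D (fst z))" for z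
  have Bi: "integrable PQ Bd" unfolding Bd_def[abs_def]
    using io(1)[OF D(2)] ifst(1)[OF D(2)] t5i by simp
  have Be: "(\<integral>z. Bd z \<partial>PQ) = 2 * (\<integral>x. \<bar>D x\<bar> ^ 3 \<partial>P)"
    unfolding Bd_def using io[OF D(2)] ifst[OF D(2)] t5i by (simp add: t5)
  have RB: "\<bar>R z\<bar> \<le> Bd z" for z
  proof -
    have "\<bar>R z\<bar> \<le> \<bar>D (o1 z)\<bar> * (F (o1 z) - F (fst z))\<^sup>2"
      unfolding R_def abs_mult by (intro mult_left_mono h) auto
    also have "\<dots> = \<bar>D (o1 z)\<bar> * (D (o1 z))\<^sup>2 - 2 * (W (o1 z) * D (fst z)) + \<bar>D (o1 z)\<bar> * \<bar>D (fst z)\<bar>\<^sup>2"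
      unfolding FD W_def by (simp add: power2_eq_square algebra_simps)
    also have "\<bar>D (o1 z)\<bar> * \<bar>D (fst z)\<bar>\<^sup>2 \<le> (\<bar>D (o1 z)\<bar> ^ 3 + 2 * \<bar>D (fst z)\<bar> ^ 3) / 3" by (rule young3) auto
    also have "\<bar>D (o1 z)\<bar> * (D (o1 z))\<^sup>2 = \<bar>D (o1 z)\<bar> ^ 3"
      by (simp add: power3_eq_cube power2_eq_square mult.assoc abs_mult_self_eq)
    finally show ?thesis by (simp add: Bd_def field_simps)
  qed
  have "\<bar>\<integral>z. R z \<partial>PQ\<bar> \<le> (\<integral>z. \<bar>R z\<bar> \<partial>PQ)" by (rule integral_abs_bound)
  also have "\<dots> \<le> (\<integral>z. Bd z \<partial>PQ)" using RB Ri Bi by (intro integral_mono) auto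
  finally show ?thesis unfolding Re Be by linarith
qed

end

subsection \<open>Sums of degenerate summands\<close>

locale hoeffding_family = real_product_space \<nu> for \<nu> :: "nat \<Rightarrow> real measure" +
  fixes u :: "nat set \<Rightarrow> (nat \<Rightarrow> real) \<Rightarrow> real" and n :: nat
  assumes n_pos: "n \<ge> 1"
    and u_sqi: "\<And>A. finite A \<Longrightarrow> card A = n \<Longrightarrow> sqi (u A)"
    and u_dep: "\<And>A. finite A \<Longrightarrow> card A = n \<Longrightarrow> dep A (u A)"
    and u_centered: "\<And>A i. finite A \<Longrightarrow> card A = n \<Longrightarrow> i \<in> A \<Longrightarrow> AE x in P. Ex {i} (u A) x = 0"
begin

definition fam :: "nat set \<Rightarrow> nat set set" where
  "fam J = {A. A \<subseteq> J \<and> finite A \<and> card A = n}"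

lemma finite_fam: "finite J \<Longrightarrow> finite (fam J)"
  by (rule finite_subset[of _ "Pow J"]) (auto simp: fam_def)

lemma famD: "A \<in> fam J \<Longrightarrow> finite A" "A \<in> fam J \<Longrightarrow> card A = n" "A \<in> fam J \<Longrightarrow> A \<subseteq> J"
  by (auto simp: fam_def)

lemma u_fam: assumes "A \<in> fam J" shows "sqi (u A)" "dep A (u A)" "i \<in> A \<Longrightarrow> AE x in P. Ex {i} (u A) x = 0"
  using u_sqi u_dep u_centered famD[OF assms] by auto

lemma u_measurable: "A \<in> fam J \<Longrightarrow> u A \<in> borel_measurable P"
  using u_fam(1) sqi_measurable by blast

lemma uu_integrable: assumes "A \<in> fam J" "A' \<in> fam J'" shows "integrable P (\<lambda>x. u A x * u A' x)"
  using u_fam(1)[OF assms(1)] u_fam(1)[OF assms(2)] by (rule sqi_mult_integrable)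

lemma dep_uu: assumes "A \<in> fam J" "A' \<in> fam J'" shows "dep (A \<union> A') (\<lambda>x. u A x * u A' x)"
  using u_fam(2)[OF assms(1)] u_fam(2)[OF assms(2)] unfolding dep_def by (metis UnCI)

lemma Ex_u_0:
  assumes A: "A \<in> fam J" and j: "j \<in> A" "j \<in> T"
  shows "AE x in P. Ex T (u A) x = 0"
proof -
  have "AE x in P. Ex T (Ex {j} (u A)) x = Ex T (\<lambda>_. 0) x"
    using u_fam(3)[OF A j(1)] u_measurable[OF A] by (intro Ex_cong_AE) (auto intro!: measurable_Ex)
  moreover have "AE x in P. Ex T (Ex {j} (u A)) x = Ex (T \<union> {j}) (u A) x"
    using u_fam(1)[OF A] by (intro Ex_Ex_AE sqi_integrable)
  ultimately show ?thesis by eventually_elim (use j in \<open>simp add: insert_absorb Ex_def\<close>)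
qed

text \<open>The coordinate \<open>j\<close> is seen by one factor only. Averaging over
  \<open>j\<close> pulls the other factor out and leaves the degenerate one.\<close>

lemma Ex_uu_0:
  assumes A: "A \<in> fam J" "A' \<in> fam J'" and j: "j \<in> A" "j \<notin> A'" "j \<in> T"
  shows "AE x in P. Ex T (\<lambda>x. u A x * u A' x) x = 0"
proof -
  have e: "Ex {j} (\<lambda>x. u A x * u A' x) x = u A' x * Ex {j} (u A) x" for x
    using Ex_mult_dep[OF u_fam(2)[OF A(2)], of "{j}" "u A"] j by (simp add: mult.commute)
  have "AE x in P. Ex {j} (\<lambda>x. u A x * u A' x) x = 0"
    using u_fam(3)[OF A(1) j(1)] unfolding e by (rule eventually_mono) simp
  then have "AE x in P. Ex T (Ex {j} (\<lambda>x. u A x * u A' x)) x = Ex T (\<lambda>_. 0) x"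
    using borel_measurable_integrable[OF uu_integrable[OF A]] by (intro Ex_cong_AE) (auto intro!: measurable_Ex)
  moreover have "AE x in P. Ex T (Ex {j} (\<lambda>x. u A x * u A' x)) x = Ex (T \<union> {j}) (\<lambda>x. u A x * u A' x) x"
    by (rule Ex_Ex_AE[OF uu_integrable[OF A]])
  ultimately show ?thesis by eventually_elim (use j in \<open>simp add: insert_absorb Ex_def\<close>)
qed

text \<open>Two different sets of the same size \<open>n\<close> have a point that lies in the first
  only, so the product averages to zero.\<close>

lemma u_orthogonal:
  assumes "A \<in> fam J" "A' \<in> fam J'" "A \<noteq> A'"
  shows "(\<integral>x. u A x * u A' x \<partial>P) = 0"
proof -
  have "\<exists>j. j \<in> A \<and> j \<notin> A'"
    using assms card_subset_eq[of A' A] by (auto simp: fam_def)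
  then obtain j where "j \<in> A" "j \<notin> A'" by auto
  from Ex_uu_0[OF assms(1,2) this, of UNIV] show ?thesis
    by (simp add: Ex_UNIV P.AE_const)
qed

definition u_norm :: "nat set \<Rightarrow> real" where "u_norm A = (\<integral>x. (u A x)\<^sup>2 \<partial>P)"

lemma u_norm_nonneg: "u_norm A \<ge> 0" by (simp add: u_norm_def)

lemma norm_sum_u:
  assumes "finite \<A>" "\<A> \<subseteq> fam J"
  shows "sqi (\<lambda>x. \<Sum>A\<in>\<A>. u A x)" "(\<integral>x. (\<Sum>A\<in>\<A>. u A x)\<^sup>2 \<partial>P) = (\<Sum>A\<in>\<A>. u_norm A)"
proof -
  show "sqi (\<lambda>x. \<Sum>A\<in>\<A>. u A x)" using assms u_fam(1) by (intro sqi_sum) auto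
  have "(\<integral>x. (\<Sum>A\<in>\<A>. u A x)\<^sup>2 \<partial>P) = (\<integral>x. (\<Sum>A\<in>\<A>. \<Sum>A'\<in>\<A>. u A x * u A' x) \<partial>P)"
    by (simp add: power2_eq_square sum_product)
  also have "\<dots> = (\<Sum>A\<in>\<A>. \<Sum>A'\<in>\<A>. \<integral>x. u A x * u A' x \<partial>P)"
  proof -
    have "integrable P (\<lambda>x. u A x * u A' x)" if "A \<in> \<A>" "A' \<in> \<A>" for A A'
      using uu_integrable[of A J A' J] assms(2) that by auto
    then show ?thesis by simp
  qed
  also have "\<dots> = (\<Sum>A\<in>\<A>. \<Sum>A'\<in>\<A>. if A' = A then u_norm A else 0)"
  proof (intro sum.cong refl)
    fix A A' assume "A \<in> \<A>" "A' \<in> \<A>"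
    then show "(\<integral>x. u A x * u A' x \<partial>P) = (if A' = A then u_norm A else 0)"
      using u_orthogonal[of A J A' J] assms(2) by (auto simp: u_norm_def power2_eq_square)
  qed
  also have "\<dots> = (\<Sum>A\<in>\<A>. u_norm A)" using assms(1) by (simp add: sum.delta)
  finally show "(\<integral>x. (\<Sum>A\<in>\<A>. u A x)\<^sup>2 \<partial>P) = (\<Sum>A\<in>\<A>. u_norm A)" .
qed

definition S :: "nat set \<Rightarrow> (nat \<Rightarrow> real) \<Rightarrow> real" where "S J x = (\<Sum>A\<in>fam J. u A x)"
definition D :: "nat set \<Rightarrow> nat \<Rightarrow> (nat \<Rightarrow> real) \<Rightarrow> real" where "D J i x = (\<Sum>A\<in>{A\<in>fam J. i \<in> A}. u A x)"
definition a :: "nat set \<Rightarrow> real" where "a J = (\<Sum>A\<in>fam J. u_norm A)"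

context
  fixes J :: "nat set" assumes J: "finite J"
begin

lemma S_sqi: "sqi (S J)" and S_norm: "(\<integral>x. (S J x)\<^sup>2 \<partial>P) = a J"
  unfolding S_def[abs_def] a_def using norm_sum_u[OF finite_fam[OF J] order_refl] by auto

lemma D_sqi: "sqi (D J i)" and D_norm: "(\<integral>x. (D J i x)\<^sup>2 \<partial>P) = (\<Sum>A\<in>{A\<in>fam J. i \<in> A}. u_norm A)"
  unfolding D_def[abs_def] using norm_sum_u[of "{A\<in>fam J. i \<in> A}" J] finite_fam[OF J] by auto

lemma D2_integrable: "integrable P (\<lambda>x. (D J i x)\<^sup>2)" and D_measurable: "D J i \<in> borel_measurable P"
  using D_sqi[of i] by (auto simp: sqi_def)

lemma sum_over_elements:
  fixes g :: "nat set \<Rightarrow> real"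
  shows "(\<Sum>i\<in>J. \<Sum>A\<in>{A\<in>fam J. i \<in> A}. g A) = n * (\<Sum>A\<in>fam J. g A)"
proof -
  have "(\<Sum>i\<in>J. \<Sum>A\<in>{A\<in>fam J. i \<in> A}. g A) = (\<Sum>A\<in>fam J. \<Sum>i\<in>{i\<in>J. i \<in> A}. g A)"
    by (rule sum.swap_restrict[OF J finite_fam[OF J]])
  also have "\<dots> = (\<Sum>A\<in>fam J. n * g A)"
  proof (rule sum.cong)
    fix A assume "A \<in> fam J"
    then have "{i\<in>J. i \<in> A} = A" "card A = n" by (auto simp: fam_def)
    then show "(\<Sum>i\<in>{i\<in>J. i \<in> A}. g A) = n * g A" by simp
  qed simp
  finally show ?thesis by (simp add: sum_distrib_left)
qed

lemma sum_D: "(\<Sum>i\<in>J. D J i x) = n * S J x"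
  unfolding D_def S_def by (rule sum_over_elements)

lemma sum_D_norm: "(\<Sum>i\<in>J. \<integral>x. (D J i x)\<^sup>2 \<partial>P) = n * a J"
  unfolding D_norm a_def by (rule sum_over_elements)

lemma D_centered: "AE x in P. Ex {i} (D J i) x = 0"
proof -
  have "AE x in P. Ex {i} (\<lambda>x. \<Sum>A\<in>{A\<in>fam J. i \<in> A}. 1 * u A x) x = (\<Sum>A\<in>{A\<in>fam J. i \<in> A}. 1 * Ex {i} (u A) x)"
    using u_fam(1) by (intro Ex_sum_AE sqi_integrable) auto
  moreover have "AE x in P. \<forall>A\<in>{A\<in>fam J. i \<in> A}. Ex {i} (u A) x = 0"
    using finite_fam[OF J] u_fam(3) by (intro AE_finite_allI) auto
  ultimately show ?thesis by eventually_elim (simp add: D_def[abs_def])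
qed

lemma S_minus_D: "dep (- {i}) (\<lambda>x. S J x - D J i x)"
proof -
  have "S J x - D J i x = (\<Sum>A\<in>{A\<in>fam J. i \<notin> A}. u A x)" for x
  proof -
    have "fam J = {A\<in>fam J. i \<in> A} \<union> {A\<in>fam J. i \<notin> A}" by auto
    then have "S J x = (\<Sum>A\<in>{A\<in>fam J. i \<in> A} \<union> {A\<in>fam J. i \<notin> A}. u A x)" by (simp add: S_def)
    also have "\<dots> = D J i x + (\<Sum>A\<in>{A\<in>fam J. i \<notin> A}. u A x)"
      unfolding D_def using finite_fam[OF J] by (intro sum.union_disjoint) auto
    finally show ?thesis by simp
  qed
  moreover have "(\<Sum>A\<in>{A\<in>fam J. i \<notin> A}. u A x) = (\<Sum>A\<in>{A\<in>fam J. i \<notin> A}. u A y)" if "\<forall>j\<in>- {i}. x j = y j" for x y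
  proof (rule sum.cong)
    fix A assume A: "A \<in> {A\<in>fam J. i \<notin> A}"
    then show "u A x = u A y" using that by (intro depD[OF u_fam(2)[of A J]]) auto
  qed simp
  ultimately show ?thesis unfolding dep_def by simp
qed

definition Gam :: "(nat \<Rightarrow> real) \<Rightarrow> real" where "Gam x = 1 / n * (\<Sum>i\<in>J. Ex {i} (\<lambda>x. (D J i x)\<^sup>2) x)"

lemma Gam_integrable: "integrable P Gam"
  unfolding Gam_def[abs_def] using D2_integrable by (intro integrable_mult_right Bochner_Integration.integrable_sum integrable_Ex)

lemma stein_bound:
  assumes \<phi>: "1-lipschitz_on UNIV \<phi>" and D3: "\<And>i. i \<in> J \<Longrightarrow> integrable P (\<lambda>x. \<bar>D J i x\<bar> ^ 3)"
  shows "\<bar>(\<integral>x. \<phi> (S J x) \<partial>P) - (\<integral>y. \<phi> y * std_normal_density y \<partial>lborel)\<bar>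
     \<le> (\<integral>x. \<bar>1 - Gam x\<bar> \<partial>P) + 2 / n * (\<Sum>i\<in>J. \<integral>x. \<bar>D J i x\<bar> ^ 3 \<partial>P)"
proof -
  define \<mu> where "\<mu> = (\<integral>y. \<phi> y * std_normal_density y \<partial>lborel)"
  obtain h h' where h: "\<And>x. h' x - x * h x = \<phi> x - (\<integral>y. \<phi> y * std_normal_density y \<partial>lborel)"
    "\<And>x. \<bar>h x\<bar> \<le> 1" "\<And>x. \<bar>h' x\<bar> \<le> 1" "\<And>a b. \<bar>h b - h a - (b - a) * h' a\<bar> \<le> (b - a)\<^sup>2"
    "continuous_on UNIV h" "continuous_on UNIV h'"
  proof (rule stein_equation[OF \<phi>])
    fix h h' assume "\<And>x. h' x - x * h x = \<phi> x - (\<integral>y. \<phi> y * std_normal_density y \<partial>lborel)"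
      "\<And>x. \<bar>h x\<bar> \<le> 1" "\<And>x. \<bar>h' x\<bar> \<le> 1" "\<And>a b. \<bar>h b - h a - (b - a) * h' a\<bar> \<le> (b - a)\<^sup>2"
      "continuous_on UNIV h" "continuous_on UNIV h'"
    then show thesis by (rule that[of h' h])
  qed
  note h = h[folded \<mu>_def]
  have n: "real n > 0" using n_pos by simp
  have Sm [measurable]: "S J \<in> borel_measurable P" using S_sqi by (rule sqi_measurable)
  have [measurable]: "h \<in> borel_measurable borel" "h' \<in> borel_measurable borel"
    using h(5,6) by (auto intro: borel_measurable_continuous_onI)
  have stein_rhs: "integrable P (\<lambda>x. f x * g x)"
    if "integrable P f" "g \<in> borel_measurable P" "\<And>x. \<bar>g x\<bar> \<le> 1" for f g :: "_ \<Rightarrow> real"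
  proof (rule Bochner_Integration.integrable_bound[OF that(1)])
    show "AE z in P. norm (f z * g z) \<le> norm (f z)"
      using mult_left_mono[OF that(3) abs_ge_zero] by (simp add: abs_mult)
  qed (intro borel_measurable_times borel_measurable_integrable that)
  have i1: "integrable P (\<lambda>x. D J i x * h (S J x))" for i
    by (rule stein_rhs[OF sqi_integrable[OF D_sqi]]) (auto simp: h(2))
  have i2: "integrable P (\<lambda>x. h' (S J x) * Ex {i} (\<lambda>x. (D J i x)\<^sup>2) x)" for i
    using stein_rhs[OF integrable_Ex(1)[OF D2_integrable], of "\<lambda>x. h' (S J x)"] h(3) by (simp add: mult.commute)
  have i3: "integrable P (\<lambda>x. (1 - Gam x) * h' (S J x))"
    by (rule stein_rhs[OF Bochner_Integration.integrable_diff[OF _ Gam_integrable]]) (auto simp: h(3))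
  have i4: "integrable P (\<lambda>x. \<phi> (S J x))"
  proof -
    have "integrable P (\<lambda>x. h' (S J x) * 1)" "integrable P (\<lambda>x. S J x * h (S J x))"
      using stein_rhs[of "\<lambda>_. 1" "\<lambda>x. h' (S J x)"] stein_rhs[OF sqi_integrable[OF S_sqi], of "\<lambda>x. h (S J x)"] h(2,3) by auto
    then have "integrable P (\<lambda>x. h' (S J x) - S J x * h (S J x) + \<mu>)" by simp
    then show ?thesis unfolding h(1) by simp
  qed
  define e where "e i = (\<integral>x. h' (S J x) * Ex {i} (\<lambda>x. (D J i x)\<^sup>2) x \<partial>P) - (\<integral>x. D J i x * h (S J x) \<partial>P)" for i
  have e: "\<bar>e i\<bar> \<le> 2 * (\<integral>x. \<bar>D J i x\<bar> ^ 3 \<partial>P)" if "i \<in> J" for i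
    unfolding e_def by (rule stein_exchange[OF h(2-6) D_sqi D3[OF that] D_centered Sm S_minus_D])
  \<comment> \<open>The sum of the D_i is n S, because each set A is counted once for each of its n
    elements; hence S h(S) is the average 1/n of the D_i h(S).\<close>
  have pw: "\<phi> (S J x) - \<mu> = (1 - Gam x) * h' (S J x) + 1 / n * (\<Sum>i\<in>J. h' (S J x) * Ex {i} (\<lambda>x. (D J i x)\<^sup>2) x - D J i x * h (S J x))" for x
  proof -
    have "(\<Sum>i\<in>J. h' (S J x) * Ex {i} (\<lambda>x. (D J i x)\<^sup>2) x - D J i x * h (S J x)) = h' (S J x) * (n * Gam x) - n * S J x * h (S J x)"
      using n by (simp add: sum_subtractf sum_distrib_left[symmetric] sum_distrib_right[symmetric] sum_D Gam_def)
    then have "1 / n * (\<Sum>i\<in>J. h' (S J x) * Ex {i} (\<lambda>x. (D J i x)\<^sup>2) x - D J i x * h (S J x)) = h' (S J x) * Gam x - S J x * h (S J x)"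
      using n by (simp add: field_simps)
    then show ?thesis using h(1)[of "S J x"] by (simp add: algebra_simps)
  qed
  have "(\<integral>x. \<phi> (S J x) \<partial>P) - \<mu> = (\<integral>x. \<phi> (S J x) - \<mu> \<partial>P)" using i4 by simp
  also have "\<dots> = (\<integral>x. (1 - Gam x) * h' (S J x) \<partial>P) + 1 / n * (\<Sum>i\<in>J. e i)"
    unfolding pw e_def using i1 i2 i3 by (simp add: sum_subtractf)
  also have "\<bar>\<dots>\<bar> \<le> \<bar>\<integral>x. (1 - Gam x) * h' (S J x) \<partial>P\<bar> + \<bar>1 / n * (\<Sum>i\<in>J. e i)\<bar>" by (rule abs_triangle_ineq)
  also have "\<bar>\<integral>x. (1 - Gam x) * h' (S J x) \<partial>P\<bar> \<le> (\<integral>x. \<bar>(1 - Gam x) * h' (S J x)\<bar> \<partial>P)" by (rule integral_abs_bound)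
  also have "\<dots> \<le> (\<integral>x. \<bar>1 - Gam x\<bar> \<partial>P)"
    using mult_left_mono[OF h(3) abs_ge_zero] Gam_integrable
    by (intro integral_mono integrable_abs[OF i3]) (auto simp: abs_mult)
  also have "\<bar>1 / n * (\<Sum>i\<in>J. e i)\<bar> \<le> 1 / n * (\<Sum>i\<in>J. 2 * (\<integral>x. \<bar>D J i x\<bar> ^ 3 \<partial>P))"
    unfolding abs_mult using n e by (intro mult_mono order_trans[OF sum_abs] sum_mono) auto
  finally show ?thesis by (simp add: \<mu>_def sum_distrib_left mult_ac)
qed

end

text \<open>
  The component at \<open>K\<close> of the Hoeffding decomposition of \<open>E\<^sub>i(D\<^sub>i\<^sup>2)\<close> or \<open>D\<^sub>i\<^sup>2\<close> only sees products
  \<open>u\<^sub>A u\<^bsub>A'\<^esub>\<close> in which every coordinate outside \<open>K \<union> {i}\<close> is shared: a coordinate in just one of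
  \<open>A\<close>, \<open>A'\<close> is not averaged out only if it belongs to \<open>K\<close>.
\<close>

definition pairs :: "nat \<Rightarrow> nat set \<Rightarrow> nat set \<Rightarrow> (nat set \<times> nat set) set" where
  "pairs i K J = {(A, A'). A \<in> fam J \<and> A' \<in> fam J \<and> i \<in> A \<and> i \<in> A' \<and> A - K = A' - K \<and> K \<subseteq> A \<union> A'}"

definition H :: "nat \<Rightarrow> nat set \<Rightarrow> nat set \<Rightarrow> (nat \<Rightarrow> real) \<Rightarrow> real" where
  "H i K J x = (\<Sum>(A, A')\<in>pairs i K J. Ex (A - K - {i}) (\<lambda>x. u A x * u A' x) x)"

lemma pairs_subset: "pairs i K J \<subseteq> {A\<in>fam J. i \<in> A} \<times> {A\<in>fam J. i \<in> A}"
  by (auto simp: pairs_def)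

lemma finite_pairs: "finite J \<Longrightarrow> finite (pairs i K J)"
  by (rule finite_subset[OF pairs_subset]) (auto simp: finite_fam)

lemma H_integrable: "integrable P (H i K J)"
  unfolding H_def[abs_def]
  by (rule Bochner_Integration.integrable_sum) (auto simp: pairs_def intro!: integrable_Ex uu_integrable)

text \<open>Each product in the expansion of D_i^2 is treated separately: a mismatch outside
  \<open>K\<close> is removed by the inner average, a point of \<open>K\<close> missed by both sets
  by the outer projection. What survives is averaged over the shared blocks alone.\<close>

lemma hoef_conditional_square:
  assumes J: "finite J" and K: "K \<subseteq> J - {i}"
  shows "AE x in P. hoef K (Ex (J - K - {i}) (\<lambda>x. (D J i x)\<^sup>2)) x = hoef K (H i K J) x"
proof -
  define F where "F = {A\<in>fam J. i \<in> A}"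
  define T where "T = J - K - {i}"
  define uu where "uu p x = u (fst p) x * u (snd p) x" for p x
  have fF: "finite F" "F \<subseteq> fam J" using finite_fam[OF J] by (auto simp: F_def)
  have fK: "finite K" using K J by (auto intro: finite_subset)
  have uui: "integrable P (uu p)" if "p \<in> F \<times> F" for p
    unfolding uu_def[abs_def] using that fF by (intro uu_integrable[of _ J _ J]) auto
  have D2: "(D J i x)\<^sup>2 = (\<Sum>p\<in>F \<times> F. 1 * uu p x)" for x
    unfolding D_def F_def[symmetric] power2_eq_square sum_product sum.cartesian_product uu_def by (simp add: split_def)
  have 1: "AE x in P. hoef K (Ex T (\<lambda>x. (D J i x)\<^sup>2)) x = hoef K (\<lambda>x. \<Sum>p\<in>F \<times> F. 1 * Ex T (uu p) x) x"
    unfolding D2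
  proof (rule hoef_cong_AE[OF Ex_sum_AE[OF uui]])
    have "integrable P (\<lambda>x. \<Sum>p\<in>F \<times> F. 1 * uu p x)" by (intro Bochner_Integration.integrable_sum integrable_mult_right uui)
    then show "Ex T (\<lambda>x. \<Sum>p\<in>F \<times> F. 1 * uu p x) \<in> borel_measurable P"
      by (intro measurable_Ex borel_measurable_integrable)
    have "integrable P (\<lambda>x. \<Sum>p\<in>F \<times> F. 1 * Ex T (uu p) x)" by (intro Bochner_Integration.integrable_sum integrable_mult_right uui integrable_Ex)
    then show "(\<lambda>x. \<Sum>p\<in>F \<times> F. 1 * Ex T (uu p) x) \<in> borel_measurable P" by auto
  qed (use fK in auto)
  have 2: "AE x in P. hoef K (\<lambda>x. \<Sum>p\<in>F \<times> F. 1 * Ex T (uu p) x) x = (\<Sum>p\<in>F \<times> F. 1 * hoef K (Ex T (uu p)) x)"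
    using fK by (intro hoef_sum_AE integrable_Ex uui)
  have 3: "AE x in P. \<forall>p\<in>F \<times> F. hoef K (Ex T (uu p)) x = (if p \<in> pairs i K J then hoef K (Ex (fst p - K - {i}) (uu p)) x else 0)"
  proof (rule AE_finite_allI)
    fix p assume p: "p \<in> F \<times> F"
    obtain A A' where pA: "p = (A, A')" by (cases p)
    have A: "A \<in> fam J" "A' \<in> fam J" "i \<in> A" "i \<in> A'" using p by (auto simp: pA F_def)
    have dp: "dep (A \<union> A') (uu p)" unfolding uu_def[abs_def] pA using dep_uu[OF A(1,2)] by simp
    note up = uui[OF p]
    consider "p \<in> pairs i K J" | "A - K \<noteq> A' - K" | "\<not> K \<subseteq> A \<union> A'" using A by (auto simp: pA pairs_def)
    then show "AE x in P. hoef K (Ex T (uu p)) x = (if p \<in> pairs i K J then hoef K (Ex (fst p - K - {i}) (uu p)) x else 0)"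
    proof cases
      case 1
      have "T \<inter> (A \<union> A') = A - K - {i}" using 1 A by (auto simp: T_def pA pairs_def fam_def)
      then have "Ex T (uu p) = Ex (fst p - K - {i}) (uu p)" using Ex_restrict[OF dp, of T] by (auto simp: pA)
      then show ?thesis using 1 by simp
    next
      case 2
      have "AE x in P. Ex T (uu p) x = 0"
      proof -
        \<comment> \<open>The block \<open>i\<close> belongs to both sets, so a mismatch outside
          \<open>K\<close> is never \<open>i\<close> and lies among the averaged
          coordinates.\<close>
        consider j where "j \<in> A" "j \<notin> A'" "j \<in> T" | j where "j \<in> A'" "j \<notin> A" "j \<in> T"
          using 2 A by (auto simp: T_def fam_def)
        then show ?thesis
        proof cases
          case 1
          from Ex_uu_0[OF A(1,2) this] show ?thesis by (simp add: uu_def[abs_def] pA)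
        next
          case 2
          from Ex_uu_0[OF A(2,1) this] show ?thesis by (simp add: uu_def[abs_def] pA mult.commute)
        qed
      qed
      then have "AE x in P. hoef K (Ex T (uu p)) x = hoef K (\<lambda>_. 0) x"
        using up fK by (intro hoef_cong_AE) auto
      then show ?thesis using 2 by (auto simp: hoef_def Ex_def pairs_def pA)
    next
      case 3
      then obtain j where j: "j \<in> K" "j \<notin> A \<union> A'" by auto
      have "AE x in P. hoef K (Ex T (uu p)) x = 0"
        using j fK by (intro hoef_kill[OF integrable_Ex(1)[OF up] _ _ dep_Ex[OF dp]]) auto
      then show ?thesis using 3 by (auto simp: pairs_def pA)
    qed
  qed (use fF in auto)
  have 4: "AE x in P. hoef K (\<lambda>x. \<Sum>p\<in>pairs i K J. 1 * Ex (fst p - K - {i}) (uu p) x) x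
      = (\<Sum>p\<in>pairs i K J. 1 * hoef K (Ex (fst p - K - {i}) (uu p)) x)"
    using fK pairs_subset[of i K J] unfolding F_def[symmetric] by (intro hoef_sum_AE integrable_Ex uui) auto
  have Hu: "H i K J = (\<lambda>x. \<Sum>p\<in>pairs i K J. 1 * Ex (fst p - K - {i}) (uu p) x)"
    by (auto simp: H_def uu_def[abs_def] split_def)
  from 1 2 3 4 show ?thesis unfolding T_def[symmetric] Hu
  proof eventually_elim
    case (elim x)
    have "(\<Sum>p\<in>F \<times> F. 1 * hoef K (Ex T (uu p)) x) = (\<Sum>p\<in>F \<times> F. if p \<in> pairs i K J then hoef K (Ex (fst p - K - {i}) (uu p)) x else 0)"
      using elim(3) by (intro sum.cong) auto
    also have "\<dots> = (\<Sum>p\<in>F \<times> F \<inter> pairs i K J. hoef K (Ex (fst p - K - {i}) (uu p)) x)"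
      using fF by (simp add: sum.inter_restrict)
    also have "F \<times> F \<inter> pairs i K J = pairs i K J" using pairs_subset[of i K J] by (auto simp: F_def)
    finally show ?case unfolding elim(1,2,4) by simp
  qed
qed

text \<open>Hoeffding decomposition in the coordinates of \<open>N\<close> other than
  \<open>i\<close>, with x_i kept as a parameter. The index family depends on \<open>N\<close> only,
  so \<open>J\<close> can grow while the number of terms stays fixed.\<close>

lemma conditional_square:
  assumes J: "finite J" and N: "N \<subseteq> J"
  shows "AE x in P. Ex (J - N - {i}) (\<lambda>x. (D J i x)\<^sup>2) x = (\<Sum>K\<in>Pow (N - {i}). hoef K (H i K J) x)"
proof -
  have fN: "finite N" using N J by (rule finite_subset)
  define Q where "Q = Ex (J - N - {i}) (\<lambda>x. (D J i x)\<^sup>2)"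
  note D2 = D2_integrable[OF J, of i]
  have Q: "integrable P Q" unfolding Q_def by (intro integrable_Ex D2)
  have "AE x in P. \<forall>K\<in>Pow (N - {i}). hoef K (Ex (N - {i} - K) Q) x = hoef K (H i K J) x"
  proof (rule AE_finite_allI)
    fix K assume K: "K \<in> Pow (N - {i})"
    then have fK: "finite K" using fN by (auto intro: finite_subset)
    have "N - {i} - K \<union> (J - N - {i}) = J - K - {i}" using K N by auto
    then have "AE x in P. Ex (N - {i} - K) Q x = Ex (J - K - {i}) (\<lambda>x. (D J i x)\<^sup>2) x"
      using Ex_Ex_AE[OF D2, of "N - {i} - K" "J - N - {i}"] by (simp add: Q_def)
    then have "AE x in P. hoef K (Ex (N - {i} - K) Q) x = hoef K (Ex (J - K - {i}) (\<lambda>x. (D J i x)\<^sup>2)) x"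
      using Q D2 fK by (intro hoef_cong_AE borel_measurable_integrable[OF integrable_Ex(1)])
    moreover have "AE x in P. hoef K (Ex (J - K - {i}) (\<lambda>x. (D J i x)\<^sup>2)) x = hoef K (H i K J) x"
      using K N by (intro hoef_conditional_square J) auto
    ultimately show "AE x in P. hoef K (Ex (N - {i} - K) Q) x = hoef K (H i K J) x"
      by eventually_elim simp
  qed (use fN in auto)
  then show ?thesis using hoeffding[OF Q, of "N - {i}"] fN unfolding Q_def[symmetric]
    by (auto elim!: eventually_elim2)
qed

text \<open>Averaging over the blocks outside \<open>N\<close> kills every summand whose set leaves
  \<open>N\<close>, by degeneracy, and fixes the others; thus D for \<open>J\<close> is mapped to D
  for \<open>N\<close>, and Jensen's inequality applies.\<close>

lemma D_square_le:
  assumes J: "finite J" and N: "N \<subseteq> J" and i: "i \<in> N"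
  shows "AE x in P. (D N i x)\<^sup>2 \<le> Ex (J - N - {i}) (\<lambda>x. (D J i x)\<^sup>2) x"
proof -
  define T where "T = J - N - {i}"
  define F where "F = {A\<in>fam J. i \<in> A}"
  have fF: "finite F" using finite_fam[OF J] by (simp add: F_def)
  have "AE x in P. Ex T (\<lambda>x. \<Sum>A\<in>F. 1 * u A x) x = (\<Sum>A\<in>F. 1 * Ex T (u A) x)"
    using u_fam(1)[of _ J] by (intro Ex_sum_AE sqi_integrable) (auto simp: F_def)
  moreover have "AE x in P. \<forall>A\<in>F. Ex T (u A) x = (if A \<subseteq> N then u A x else 0)"
  proof (rule AE_finite_allI[OF fF])
    fix A assume A: "A \<in> F"
    then have A': "A \<in> fam J" by (simp add: F_def)
    show "AE x in P. Ex T (u A) x = (if A \<subseteq> N then u A x else 0)"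
    proof (cases "A \<subseteq> N")
      case True
      then have "T \<inter> A = {}" by (auto simp: T_def)
      then show ?thesis using True Ex_dep[OF u_fam(2)[OF A']] by simp
    next
      case False
      then obtain j where "j \<in> A" "j \<in> T" using A' i by (auto simp: T_def fam_def)
      from Ex_u_0[OF A' this] show ?thesis using False by simp
    qed
  qed
  ultimately have "AE x in P. Ex T (D J i) x = D N i x"
  proof eventually_elim
    case (elim x)
    have "Ex T (D J i) x = (\<Sum>A\<in>F. if A \<subseteq> N then u A x else 0)"
      using elim by (simp add: D_def[abs_def] F_def)
    also have "\<dots> = (\<Sum>A\<in>F \<inter> {A. A \<subseteq> N}. u A x)" using fF by (simp add: sum.inter_restrict)
    also have "F \<inter> {A. A \<subseteq> N} = {A\<in>fam N. i \<in> A}" using N by (auto simp: F_def fam_def)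
    finally show ?case by (simp add: D_def[of N])
  qed
  then show ?thesis using sqi_Ex(2)[OF D_sqi[OF J, of i], of T] unfolding T_def[symmetric]
    by eventually_elim simp
qed

end

text \<open>Interface between the probabilistic argument and the computation of the limits.
  Convergence is required in L1 only; square integrability is asked of the limits, and for
  \<open>Gh\<close> only at nonempty sets, since \<open>Gh {}\<close> will turn out to be the
  constant \<open>aL\<close>.\<close>

locale hoeffding_limit = hoeffding_family +
  fixes Hlim :: "nat \<Rightarrow> nat set \<Rightarrow> (nat \<Rightarrow> real) \<Rightarrow> real" and Gh :: "nat set \<Rightarrow> (nat \<Rightarrow> real) \<Rightarrow> real"
    and aL V B :: real
  assumes a_lim: "(\<lambda>m. a {..<m}) \<longlonglongrightarrow> aL"
    and H_lim: "\<And>i K. finite K \<Longrightarrow> i \<notin> K \<Longrightarrow> (\<lambda>m. \<integral>x. \<bar>H i K {..<m} x - Hlim i K x\<bar> \<partial>P) \<longlonglongrightarrow> 0"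
    and Hlim_sqi: "\<And>i K. finite K \<Longrightarrow> i \<notin> K \<Longrightarrow> sqi (Hlim i K)"
    and Hlim_dep: "\<And>i K. finite K \<Longrightarrow> i \<notin> K \<Longrightarrow> dep (insert i K) (Hlim i K)"
    and Gh_lim: "\<And>K. finite K \<Longrightarrow> (\<lambda>m. \<integral>x. \<bar>1 / n * (\<Sum>i\<in>{..<m} - K. Ex {i} (H i K {..<m}) x) - Gh K x\<bar> \<partial>P) \<longlonglongrightarrow> 0"
    and Gh_integrable: "\<And>K. finite K \<Longrightarrow> integrable P (Gh K)"
    and Gh_sqi: "\<And>K. finite K \<Longrightarrow> K \<noteq> {} \<Longrightarrow> sqi (Gh K)"
    and Gh_dep: "\<And>K. finite K \<Longrightarrow> dep K (Gh K)"
    and V: "\<And>N. (\<Sum>K\<in>Pow {..<N} - {{}}. \<integral>x. (Gh K x)\<^sup>2 \<partial>P) \<le> V"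
    and B: "\<And>N. (\<Sum>i<N. \<Sum>K\<in>Pow ({..<N} - {i}). \<integral>x. (Hlim i K x)\<^sup>2 \<partial>P) \<le> B"
begin

lemma a_mono: "finite J \<Longrightarrow> N \<subseteq> J \<Longrightarrow> a N \<le> a J"
  unfolding a_def by (rule sum_mono2) (auto simp: finite_fam u_norm_nonneg, auto simp: fam_def)

lemma a_le: "a {..<N} \<le> aL"
  by (rule LIMSEQ_le_const[OF a_lim]) (auto intro!: exI[of _ N] a_mono)

lemma integral_hoef_sum_tendsto:
  fixes h :: "nat \<Rightarrow> nat set \<Rightarrow> (nat \<Rightarrow> real) \<Rightarrow> real"
  assumes I: "finite I" "\<And>K. K \<in> I \<Longrightarrow> finite K"
    and i: "\<And>m K. K \<in> I \<Longrightarrow> integrable P (h m K)" "\<And>K. K \<in> I \<Longrightarrow> integrable P (h' K)"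
    and lim: "\<And>K. K \<in> I \<Longrightarrow> (\<lambda>m. \<integral>x. \<bar>h m K x - h' K x\<bar> \<partial>P) \<longlonglongrightarrow> 0"
  shows "(\<lambda>m. \<integral>x. \<bar>(\<Sum>K\<in>I. hoef K (h m K) x) - (\<Sum>K\<in>I. hoef K (h' K) x)\<bar> \<partial>P) \<longlonglongrightarrow> 0"
proof (rule tendsto_sandwich[OF always_eventually always_eventually])
  show "\<forall>m. 0 \<le> (\<integral>x. \<bar>(\<Sum>K\<in>I. hoef K (h m K) x) - (\<Sum>K\<in>I. hoef K (h' K) x)\<bar> \<partial>P)" by simp
  show "\<forall>m. (\<integral>x. \<bar>(\<Sum>K\<in>I. hoef K (h m K) x) - (\<Sum>K\<in>I. hoef K (h' K) x)\<bar> \<partial>P) \<le> (\<Sum>K\<in>I. 2 ^ card K * (\<integral>x. \<bar>h m K x - h' K x\<bar> \<partial>P))"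
  proof
    fix m
    have "(\<integral>x. \<bar>(\<Sum>K\<in>I. hoef K (h m K) x) - (\<Sum>K\<in>I. hoef K (h' K) x)\<bar> \<partial>P) \<le> (\<integral>x. (\<Sum>K\<in>I. \<bar>hoef K (h m K) x - hoef K (h' K) x\<bar>) \<partial>P)"
      using i by (intro integral_mono integrable_abs Bochner_Integration.integrable_diff Bochner_Integration.integrable_sum integrable_hoef)
        (auto simp: sum_subtractf[symmetric])
    also have "\<dots> = (\<Sum>K\<in>I. \<integral>x. \<bar>hoef K (h m K) x - hoef K (h' K) x\<bar> \<partial>P)"
      using i by (intro Bochner_Integration.integral_sum integrable_abs Bochner_Integration.integrable_diff integrable_hoef)
    also have "\<dots> \<le> (\<Sum>K\<in>I. 2 ^ card K * (\<integral>x. \<bar>h m K x - h' K x\<bar> \<partial>P))"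
      using I i by (intro sum_mono hoef_L1)
    finally show "(\<integral>x. \<bar>(\<Sum>K\<in>I. hoef K (h m K) x) - (\<Sum>K\<in>I. hoef K (h' K) x)\<bar> \<partial>P) \<le> (\<Sum>K\<in>I. 2 ^ card K * (\<integral>x. \<bar>h m K x - h' K x\<bar> \<partial>P))" .
  qed
  have "(\<lambda>m. \<Sum>K\<in>I. 2 ^ card K * (\<integral>x. \<bar>h m K x - h' K x\<bar> \<partial>P)) \<longlonglongrightarrow> (\<Sum>K\<in>I. 2 ^ card K * 0)"
    by (intro tendsto_sum tendsto_mult_left lim)
  then show "(\<lambda>m. \<Sum>K\<in>I. 2 ^ card K * (\<integral>x. \<bar>h m K x - h' K x\<bar> \<partial>P)) \<longlonglongrightarrow> 0" by simp
qed simp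

text \<open>For every \<open>m >= N\<close> the square of D is bounded by the components for
  \<open>m\<close> blocks. An almost sure inequality survives an L1 limit.\<close>

lemma D_square_le_lim:
  assumes i: "i < N"
  shows "AE x in P. (D {..<N} i x)\<^sup>2 \<le> (\<Sum>K\<in>Pow ({..<N} - {i}). hoef K (Hlim i K) x)"
proof -
  define q where "q m x = (\<Sum>K\<in>Pow ({..<N} - {i}). hoef K (H i K {..<m}) x)" for m x
  define q' where "q' x = (\<Sum>K\<in>Pow ({..<N} - {i}). hoef K (Hlim i K) x)" for x
  have fK: "finite K" "i \<notin> K" if "K \<in> Pow ({..<N} - {i})" for K using that by (auto intro: finite_subset[of _ "{..<N}"])
  have qi: "integrable P (q m)" "integrable P q'" for m
    unfolding q_def[abs_def] q'_def[abs_def]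
    using fK by (intro Bochner_Integration.integrable_sum integrable_hoef H_integrable sqi_integrable Hlim_sqi; blast)+
  have lim: "(\<lambda>m. \<integral>x. \<bar>q m x - q' x\<bar> \<partial>P) \<longlonglongrightarrow> 0"
    unfolding q_def q'_def using fK
    by (intro integral_hoef_sum_tendsto H_integrable sqi_integrable Hlim_sqi H_lim) auto
  \<comment> \<open>The positive part of the violation: its mean is bounded by the L1 distance of
    the \<open>m\<close>-block sum from the limit, hence is zero.\<close>
  define r where "r x = max 0 ((D {..<N} i x)\<^sup>2 - q' x)" for x
  have D2: "integrable P (\<lambda>x. (D {..<N} i x)\<^sup>2)" by (rule D2_integrable) simp
  have ri: "integrable P r" unfolding r_def[abs_def] using D2 qi(2) by (intro integrable_max Bochner_Integration.integrable_diff) auto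
  have "(\<integral>x. r x \<partial>P) \<le> 0"
  proof (rule LIMSEQ_le_const[OF lim], intro exI allI impI)
    fix m assume m: "N \<le> m"
    have "AE x in P. (D {..<N} i x)\<^sup>2 \<le> Ex ({..<m} - {..<N} - {i}) (\<lambda>x. (D {..<m} i x)\<^sup>2) x"
      using m i by (intro D_square_le) auto
    moreover have "AE x in P. Ex ({..<m} - {..<N} - {i}) (\<lambda>x. (D {..<m} i x)\<^sup>2) x = q m x"
      unfolding q_def using m by (intro conditional_square) auto
    ultimately have "AE x in P. r x \<le> \<bar>q m x - q' x\<bar>"
      by eventually_elim (auto simp: r_def)
    then show "(\<integral>x. r x \<partial>P) \<le> (\<integral>x. \<bar>q m x - q' x\<bar> \<partial>P)"
      using ri qi by (intro integral_mono_AE) auto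
  qed
  moreover have "(\<integral>x. r x \<partial>P) \<ge> 0" by (simp add: r_def)
  ultimately have "(\<integral>x. r x \<partial>P) = 0" by simp
  then have "AE x in P. r x = 0" using ri by (subst (asm) integral_nonneg_eq_0_iff_AE) (auto simp: r_def)
  then show ?thesis by eventually_elim (auto simp: r_def q'_def max_def split: if_splits)
qed

text \<open>The summands are only square integrable, so the existence of the fourth moment is itself
  a consequence of the comparison with the square-integrable limit. Orthogonality of the components
  then bounds it.\<close>

lemma D_fourth:
  assumes i: "i < N"
  shows "integrable P (\<lambda>x. (D {..<N} i x) ^ 4)"
    "(\<integral>x. (D {..<N} i x) ^ 4 \<partial>P) \<le> (\<Sum>K\<in>Pow ({..<N} - {i}). \<integral>x. (Hlim i K x)\<^sup>2 \<partial>P)"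
proof -
  define q where "q x = (\<Sum>K\<in>Pow ({..<N} - {i}). hoef K (Hlim i K) x)" for x
  have fK: "finite K" "i \<notin> K" if "K \<in> Pow ({..<N} - {i})" for K using that by (auto intro: finite_subset[of _ "{..<N}"])
  have q: "sqi q" unfolding q_def[abs_def] using fK by (intro sqi_sum sqi_hoef Hlim_sqi)
  then have q2: "integrable P (\<lambda>x. (q x)\<^sup>2)" by (simp add: sqi_def)
  have Dm: "D {..<N} i \<in> borel_measurable P" by (rule D_measurable) simp
  have le: "AE x in P. (D {..<N} i x) ^ 4 \<le> (q x)\<^sup>2"
    using D_square_le_lim[OF i]
  proof eventually_elim
    case (elim x)
    have "(D {..<N} i x) ^ 4 = ((D {..<N} i x)\<^sup>2)\<^sup>2" by simp
    also have "\<dots> \<le> (q x)\<^sup>2" using elim unfolding q_def[symmetric] by (intro power_mono) auto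
    finally show ?case .
  qed
  show i4: "integrable P (\<lambda>x. (D {..<N} i x) ^ 4)"
    by (rule Bochner_Integration.integrable_bound[OF q2]) (use le Dm in \<open>auto intro!: borel_measurable_power\<close>)
  have "(\<integral>x. (D {..<N} i x) ^ 4 \<partial>P) \<le> (\<integral>x. (q x)\<^sup>2 \<partial>P)" using le i4 q2 by (intro integral_mono_AE)
  also have "\<dots> \<le> (\<Sum>K\<in>Pow ({..<N} - {i}). \<integral>x. (Hlim i K x)\<^sup>2 \<partial>P)"
    unfolding q_def using fK Hlim_sqi Hlim_dep by (intro hoef_sum_norm_le[where C="{i}"]) auto
  finally show "(\<integral>x. (D {..<N} i x) ^ 4 \<partial>P) \<le> (\<Sum>K\<in>Pow ({..<N} - {i}). \<integral>x. (Hlim i K x)\<^sup>2 \<partial>P)" .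
qed

lemma D_third:
  assumes i: "i < N" shows "integrable P (\<lambda>x. \<bar>D {..<N} i x\<bar> ^ 3)"
proof (rule Bochner_Integration.integrable_bound)
  show "integrable P (\<lambda>x. (D {..<N} i x)\<^sup>2 + (D {..<N} i x) ^ 4)"
    using D_fourth(1)[OF i] D2_integrable[of "{..<N}" i] by simp
  show "AE x in P. norm (\<bar>D {..<N} i x\<bar> ^ 3) \<le> norm ((D {..<N} i x)\<^sup>2 + (D {..<N} i x) ^ 4)"
  proof (rule AE_I2)
    fix x
    have "0 \<le> (\<bar>D {..<N} i x\<bar> - 1)\<^sup>2 * \<bar>D {..<N} i x\<bar>\<^sup>2" by simp
    also have "\<dots> = \<bar>D {..<N} i x\<bar>\<^sup>2 + \<bar>D {..<N} i x\<bar> ^ 4 - 2 * \<bar>D {..<N} i x\<bar> ^ 3"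
      by (simp add: power2_eq_square power3_eq_cube power4_eq_xxxx algebra_simps del: power2_abs abs_mult_self_eq)
    finally have "2 * \<bar>D {..<N} i x\<bar> ^ 3 \<le> (D {..<N} i x)\<^sup>2 + (D {..<N} i x) ^ 4" by simp
    then have "\<bar>D {..<N} i x\<bar> ^ 3 \<le> (D {..<N} i x)\<^sup>2 + (D {..<N} i x) ^ 4"
      using zero_le_power[OF abs_ge_zero, of "D {..<N} i x" 3] by linarith
    then show "norm (\<bar>D {..<N} i x\<bar> ^ 3) \<le> norm ((D {..<N} i x)\<^sup>2 + (D {..<N} i x) ^ 4)" by simp
  qed
qed (use D_measurable[of "{..<N}" i] in \<open>auto intro!: borel_measurable_power borel_measurable_abs\<close>)

lemma hoef_Ex_commute:
  assumes "integrable P f" "finite K"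
  shows "AE x in P. Ex A (hoef K f) x = hoef K (Ex A f) x"
  using Ex_hoef_AE[OF assms, of A] hoef_Ex_AE[OF assms, of A] by eventually_elim simp

lemma sqi_Cauchy_Schwarz:
  assumes f: "sqi f" and g: "sqi g"
  shows "(\<integral>x. \<bar>f x * g x\<bar> \<partial>P) \<le> sqrt (\<integral>x. (f x)\<^sup>2 \<partial>P) * sqrt (\<integral>x. (g x)\<^sup>2 \<partial>P)"
proof -
  define p where "p = sqrt (\<integral>x. (f x)\<^sup>2 \<partial>P)"
  define q where "q = sqrt (\<integral>x. (g x)\<^sup>2 \<partial>P)"
  have pq: "p \<ge> 0" "q \<ge> 0" "p\<^sup>2 = (\<integral>x. (f x)\<^sup>2 \<partial>P)" "q\<^sup>2 = (\<integral>x. (g x)\<^sup>2 \<partial>P)" by (auto simp: p_def q_def)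
  have f2: "integrable P (\<lambda>x. (f x)\<^sup>2)" "integrable P (\<lambda>x. (g x)\<^sup>2)" using f g by (auto simp: sqi_def)
  have fg: "integrable P (\<lambda>x. \<bar>f x * g x\<bar>)" using sqi_mult_integrable[OF f g] by (rule integrable_abs)
  show ?thesis
  proof (cases "p = 0 \<or> q = 0")
    case True
    then have "(\<integral>x. (f x)\<^sup>2 \<partial>P) = 0 \<or> (\<integral>x. (g x)\<^sup>2 \<partial>P) = 0" by (simp add: p_def q_def)
    then have "(AE x in P. (f x)\<^sup>2 = 0) \<or> (AE x in P. (g x)\<^sup>2 = 0)"
      using f2 integral_nonneg_eq_0_iff_AE[OF f2(1)] integral_nonneg_eq_0_iff_AE[OF f2(2)] by auto
    then have "AE x in P. \<bar>f x * g x\<bar> = 0" by (auto elim!: eventually_mono)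
    then have "(\<integral>x. \<bar>f x * g x\<bar> \<partial>P) = 0" by (rule integral_eq_zero_AE)
    then show ?thesis by simp
  next
    case False
    have "0 \<le> (\<integral>x. (q * \<bar>f x\<bar> - p * \<bar>g x\<bar>)\<^sup>2 \<partial>P)" by simp
    also have "\<dots> = (\<integral>x. q\<^sup>2 * (f x)\<^sup>2 + p\<^sup>2 * (g x)\<^sup>2 - 2 * p * q * \<bar>f x * g x\<bar> \<partial>P)"
      by (simp add: power2_diff power_mult_distrib abs_mult mult_ac)
    also have "\<dots> = q\<^sup>2 * p\<^sup>2 + p\<^sup>2 * q\<^sup>2 - 2 * p * q * (\<integral>x. \<bar>f x * g x\<bar> \<partial>P)"
      using f2 fg by (simp add: pq)
    finally have "(p * q) * (\<integral>x. \<bar>f x * g x\<bar> \<partial>P) \<le> (p * q) * (p * q)" by (simp add: power2_eq_square mult_ac)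
    then show ?thesis using False pq by (simp add: p_def[symmetric] q_def[symmetric] mult_le_cancel_left_pos)
  qed
qed

text \<open>A version of the conditional expectation of the \<open>m\<close>-block \<Gamma> given
  the first \<open>N\<close> blocks, with the average over x_i taken last so that
  \<open>conditional_square\<close> applies inside.\<close>

definition GamC :: "nat \<Rightarrow> nat \<Rightarrow> (nat \<Rightarrow> real) \<Rightarrow> real" where
  "GamC N m x = 1 / n * (\<Sum>i<m. Ex {i} (Ex ({..<m} - {..<N} - {i}) (\<lambda>x. (D {..<m} i x)\<^sup>2)) x)"

lemma GamC_integrable: "integrable P (GamC N m)"
  unfolding GamC_def[abs_def]
  by (intro integrable_mult_right Bochner_Integration.integrable_sum integrable_Ex D2_integrable) simp

text \<open>Exchanging the sums over i and K collects, for each fixed K, all i outside K; this is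
  the average whose limit is \<open>Gh K\<close>.\<close>

lemma GamC_hoef:
  assumes "N \<le> m"
  shows "AE x in P. GamC N m x = (\<Sum>K\<in>Pow {..<N}. hoef K (\<lambda>x. 1 / n * (\<Sum>i\<in>{..<m} - K. Ex {i} (H i K {..<m}) x)) x)"
proof -
  have fK: "finite K" if "K \<in> Pow {..<N}" for K using that by (auto intro: finite_subset)
  have "AE x in P. \<forall>i\<in>{..<m}. Ex {i} (Ex ({..<m} - {..<N} - {i}) (\<lambda>x. (D {..<m} i x)\<^sup>2)) x
      = (\<Sum>K\<in>Pow ({..<N} - {i}). hoef K (Ex {i} (H i K {..<m})) x)"
  proof (rule AE_finite_allI)
    fix i assume "i \<in> {..<m}"
    have fK': "finite K" if "K \<in> Pow ({..<N} - {i})" for K using that by (auto intro: finite_subset[of _ "{..<N}"])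
    have "AE x in P. Ex {i} (Ex ({..<m} - {..<N} - {i}) (\<lambda>x. (D {..<m} i x)\<^sup>2)) x
        = Ex {i} (\<lambda>x. \<Sum>K\<in>Pow ({..<N} - {i}). 1 * hoef K (H i K {..<m}) x) x"
    proof (rule Ex_cong_AE)
      show "AE x in P. Ex ({..<m} - {..<N} - {i}) (\<lambda>x. (D {..<m} i x)\<^sup>2) x = (\<Sum>K\<in>Pow ({..<N} - {i}). 1 * hoef K (H i K {..<m}) x)"
        using conditional_square[of "{..<m}" "{..<N}" i] assms by auto
      show "Ex ({..<m} - {..<N} - {i}) (\<lambda>x. (D {..<m} i x)\<^sup>2) \<in> borel_measurable P"
        by (intro borel_measurable_integrable integrable_Ex D2_integrable) simp
      have "integrable P (\<lambda>x. \<Sum>K\<in>Pow ({..<N} - {i}). 1 * hoef K (H i K {..<m}) x)"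
        by (intro Bochner_Integration.integrable_sum integrable_mult_right integrable_hoef H_integrable)
      then show "(\<lambda>x. \<Sum>K\<in>Pow ({..<N} - {i}). 1 * hoef K (H i K {..<m}) x) \<in> borel_measurable P"
        by (rule borel_measurable_integrable)
    qed
    moreover have "AE x in P. Ex {i} (\<lambda>x. \<Sum>K\<in>Pow ({..<N} - {i}). 1 * hoef K (H i K {..<m}) x) x
       = (\<Sum>K\<in>Pow ({..<N} - {i}). 1 * Ex {i} (hoef K (H i K {..<m})) x)"
      by (intro Ex_sum_AE integrable_hoef H_integrable)
    moreover have "AE x in P. \<forall>K\<in>Pow ({..<N} - {i}). Ex {i} (hoef K (H i K {..<m})) x = hoef K (Ex {i} (H i K {..<m})) x"
      using fK' by (intro AE_finite_allI hoef_Ex_commute H_integrable) auto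
    ultimately show "AE x in P. Ex {i} (Ex ({..<m} - {..<N} - {i}) (\<lambda>x. (D {..<m} i x)\<^sup>2)) x
        = (\<Sum>K\<in>Pow ({..<N} - {i}). hoef K (Ex {i} (H i K {..<m})) x)"
      by eventually_elim simp
  qed simp
  moreover have "AE x in P. \<forall>K\<in>Pow {..<N}. hoef K (\<lambda>x. \<Sum>i\<in>{..<m} - K. 1 / n * Ex {i} (H i K {..<m}) x) x
      = (\<Sum>i\<in>{..<m} - K. 1 / n * hoef K (Ex {i} (H i K {..<m})) x)"
    using fK by (intro AE_finite_allI hoef_sum_AE integrable_Ex H_integrable) auto
  ultimately show ?thesis
  proof eventually_elim
    case (elim x)
    have "GamC N m x = (\<Sum>i<m. \<Sum>K\<in>{K\<in>Pow {..<N}. i \<notin> K}. 1 / n * hoef K (Ex {i} (H i K {..<m})) x)"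
    proof -
      have "Pow ({..<N} - {i}) = {K\<in>Pow {..<N}. i \<notin> K}" for i by auto
      then show ?thesis using elim(1) by (simp add: GamC_def sum_distrib_left)
    qed
    also have "\<dots> = (\<Sum>K\<in>Pow {..<N}. \<Sum>i\<in>{i\<in>{..<m}. i \<notin> K}. 1 / n * hoef K (Ex {i} (H i K {..<m})) x)"
      by (rule sum.swap_restrict) auto
    also have "\<dots> = (\<Sum>K\<in>Pow {..<N}. hoef K (\<lambda>x. \<Sum>i\<in>{..<m} - K. 1 / n * Ex {i} (H i K {..<m}) x) x)"
    proof (rule sum.cong)
      fix K assume "K \<in> Pow {..<N}"
      moreover have "{i\<in>{..<m}. i \<notin> K} = {..<m} - K" by auto
      ultimately show "(\<Sum>i\<in>{i\<in>{..<m}. i \<notin> K}. 1 / n * hoef K (Ex {i} (H i K {..<m})) x)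
        = hoef K (\<lambda>x. \<Sum>i\<in>{..<m} - K. 1 / n * Ex {i} (H i K {..<m}) x) x" using elim(2) by auto
    qed simp
    finally show ?case by (simp add: sum_distrib_left)
  qed
qed

text \<open>By Jensen each term with i < N increases, and the terms with i >= N are nonnegative. The
  difference therefore has a sign, and its L1 norm is the difference of the means.\<close>

lemma GamC_Gam:
  assumes "N \<le> m"
  shows "(\<integral>x. \<bar>GamC N m x - Gam {..<N} x\<bar> \<partial>P) = a {..<m} - a {..<N}"
proof -
  have n: "real n > 0" using n_pos by simp
  have D2: "integrable P (\<lambda>x. (D {..<k} i x)\<^sup>2)" for k i by (rule D2_integrable) simp
  have le: "AE x in P. Gam {..<N} x \<le> GamC N m x"
  proof -
    have "AE x in P. \<forall>i\<in>{..<N}. Ex {i} (\<lambda>x. (D {..<N} i x)\<^sup>2) x \<le> Ex {i} (Ex ({..<m} - {..<N} - {i}) (\<lambda>x. (D {..<m} i x)\<^sup>2)) x"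
    proof (rule AE_finite_allI)
      fix i assume "i \<in> {..<N}"
      then show "AE x in P. Ex {i} (\<lambda>x. (D {..<N} i x)\<^sup>2) x \<le> Ex {i} (Ex ({..<m} - {..<N} - {i}) (\<lambda>x. (D {..<m} i x)\<^sup>2)) x"
        using assms by (intro Ex_mono_AE D_square_le D2 integrable_Ex) auto
    qed simp
    then show ?thesis
    proof eventually_elim
      case (elim x)
      have "(\<Sum>i<N. Ex {i} (\<lambda>x. (D {..<N} i x)\<^sup>2) x) \<le> (\<Sum>i<N. Ex {i} (Ex ({..<m} - {..<N} - {i}) (\<lambda>x. (D {..<m} i x)\<^sup>2)) x)"
        using elim by (intro sum_mono) auto
      also have "\<dots> \<le> (\<Sum>i<m. Ex {i} (Ex ({..<m} - {..<N} - {i}) (\<lambda>x. (D {..<m} i x)\<^sup>2)) x)"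
        using assms by (intro sum_mono2) (auto simp: Ex_def intro!: Bochner_Integration.integral_nonneg)
      finally show ?case using n by (simp add: Gam_def GamC_def divide_right_mono)
    qed
  qed
  have Gi: "integrable P (Gam {..<N})" by (rule Gam_integrable) simp
  have "(\<integral>x. \<bar>GamC N m x - Gam {..<N} x\<bar> \<partial>P) = (\<integral>x. GamC N m x - Gam {..<N} x \<partial>P)"
    using le GamC_integrable Gi by (intro integral_cong_AE) (auto elim!: eventually_mono)
  also have "\<dots> = (\<integral>x. GamC N m x \<partial>P) - (\<integral>x. Gam {..<N} x \<partial>P)"
    using GamC_integrable Gi by simp
  also have "(\<integral>x. GamC N m x \<partial>P) = 1 / n * (\<Sum>i<m. \<integral>x. (D {..<m} i x)\<^sup>2 \<partial>P)"
    unfolding GamC_def using D2 by (simp add: integrable_Ex)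
  also have "\<dots> = a {..<m}" using sum_D_norm[of "{..<m}"] n by simp
  also have "(\<integral>x. Gam {..<N} x \<partial>P) = 1 / n * (\<Sum>i<N. \<integral>x. (D {..<N} i x)\<^sup>2 \<partial>P)"
    unfolding Gam_def[OF finite_lessThan] using D2 by (simp add: integrable_Ex)
  also have "\<dots> = a {..<N}" using sum_D_norm[of "{..<N}"] n by simp
  finally show ?thesis .
qed

text \<open>For K = {} only the diagonal pairs A = A' remain, and averaging over all their
  coordinates leaves the constants \<open>u_norm A\<close>; the sum is \<open>a {..<m}\<close>,
  which tends to \<open>aL\<close>.\<close>

lemma Gh_empty: "AE x in P. Gh {} x = aL"
proof -
  have n: "real n > 0" using n_pos by simp
  have H: "AE x in P. 1 / n * (\<Sum>i\<in>{..<m} - {}. Ex {i} (H i {} {..<m}) x) = a {..<m}" for m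
  proof -
    have p: "pairs i {} {..<m} = (\<lambda>A. (A, A)) ` {A\<in>fam {..<m}. i \<in> A}" for i by (auto simp: pairs_def)
    have Hi: "H i {} {..<m} = (\<lambda>x. \<Sum>A\<in>{A\<in>fam {..<m}. i \<in> A}. 1 * Ex (A - {i}) (\<lambda>x. u A x * u A x) x)" for i
      unfolding H_def[abs_def] p by (subst sum.reindex) (auto intro!: inj_onI)
    have "AE x in P. \<forall>i\<in>{..<m}. Ex {i} (H i {} {..<m}) x = (\<Sum>A\<in>{A\<in>fam {..<m}. i \<in> A}. u_norm A)"
    proof (rule AE_finite_allI)
      fix i assume i: "i \<in> {..<m}"
      have "AE x in P. Ex {i} (H i {} {..<m}) x = (\<Sum>A\<in>{A\<in>fam {..<m}. i \<in> A}. 1 * Ex {i} (Ex (A - {i}) (\<lambda>x. u A x * u A x)) x)"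
        unfolding Hi using uu_integrable by (intro Ex_sum_AE integrable_Ex) auto
      moreover have "AE x in P. \<forall>A\<in>{A\<in>fam {..<m}. i \<in> A}. Ex {i} (Ex (A - {i}) (\<lambda>x. u A x * u A x)) x = u_norm A"
      proof (rule AE_finite_allI)
        fix A assume A: "A \<in> {A\<in>fam {..<m}. i \<in> A}"
        then have A': "A \<in> fam {..<m}" by simp
        have "{i} \<union> (A - {i}) = A" using A by auto
        then have "AE x in P. Ex {i} (Ex (A - {i}) (\<lambda>x. u A x * u A x)) x = Ex A (\<lambda>x. u A x * u A x) x"
          using Ex_Ex_AE[OF uu_integrable[OF A' A'], of "{i}" "A - {i}"] by simp
        moreover have "Ex A (\<lambda>x. u A x * u A x) x = u_norm A" for x
          using Ex_restrict[OF dep_uu[OF A' A'], of UNIV x] by (simp add: Ex_UNIV u_norm_def power2_eq_square)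
        ultimately show "AE x in P. Ex {i} (Ex (A - {i}) (\<lambda>x. u A x * u A x)) x = u_norm A" by simp
      qed (simp add: finite_fam)
      ultimately show "AE x in P. Ex {i} (H i {} {..<m}) x = (\<Sum>A\<in>{A\<in>fam {..<m}. i \<in> A}. u_norm A)"
        by eventually_elim simp
    qed simp
    then show ?thesis
    proof eventually_elim
      case (elim x)
      then have "(\<Sum>i\<in>{..<m}. Ex {i} (H i {} {..<m}) x) = n * a {..<m}"
        using sum_over_elements[of "{..<m}" u_norm] by (simp add: a_def)
      then show ?case using n by simp
    qed
  qed
  have G: "integrable P (Gh {})" by (rule Gh_integrable) simp
  have "(\<integral>x. \<bar>1 / n * (\<Sum>i\<in>{..<m} - {}. Ex {i} (H i {} {..<m}) x) - Gh {} x\<bar> \<partial>P) = (\<integral>x. \<bar>a {..<m} - Gh {} x\<bar> \<partial>P)" for m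
  proof (rule integral_cong_AE)
    have "integrable P (\<lambda>x. 1 / n * (\<Sum>i\<in>{..<m} - {}. Ex {i} (H i {} {..<m}) x))"
      by (intro integrable_mult_right Bochner_Integration.integrable_sum integrable_Ex H_integrable)
    then have "integrable P (\<lambda>x. \<bar>1 / n * (\<Sum>i\<in>{..<m} - {}. Ex {i} (H i {} {..<m}) x) - Gh {} x\<bar>)"
      using G by (intro integrable_abs Bochner_Integration.integrable_diff)
    then show "(\<lambda>x. \<bar>1 / n * (\<Sum>i\<in>{..<m} - {}. Ex {i} (H i {} {..<m}) x) - Gh {} x\<bar>) \<in> borel_measurable P"
      by (rule borel_measurable_integrable)
    show "AE x in P. \<bar>1 / n * (\<Sum>i\<in>{..<m} - {}. Ex {i} (H i {} {..<m}) x) - Gh {} x\<bar> = \<bar>a {..<m} - Gh {} x\<bar>"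
      using H[of m] by eventually_elim simp
  qed (use G in auto)
  then have "(\<lambda>m. (\<integral>x. \<bar>a {..<m} - Gh {} x\<bar> \<partial>P)) \<longlonglongrightarrow> 0" using Gh_lim[of "{}"] by simp
  then have 1: "(\<lambda>m. (\<integral>x. \<bar>a {..<m} - Gh {} x\<bar> \<partial>P) + \<bar>a {..<m} - aL\<bar>) \<longlonglongrightarrow> 0 + \<bar>aL - aL\<bar>"
    by (intro tendsto_intros a_lim)
  have "(\<integral>x. \<bar>Gh {} x - aL\<bar> \<partial>P) \<le> 0 + \<bar>aL - aL\<bar>"
  proof (rule LIMSEQ_le_const[OF 1], intro exI allI impI)
    fix m :: nat
    have "(\<integral>x. \<bar>Gh {} x - aL\<bar> \<partial>P) \<le> (\<integral>x. \<bar>a {..<m} - Gh {} x\<bar> + \<bar>a {..<m} - aL\<bar> \<partial>P)"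
      using G by (intro integral_mono) auto
    also have "\<dots> = (\<integral>x. \<bar>a {..<m} - Gh {} x\<bar> \<partial>P) + \<bar>a {..<m} - aL\<bar>" using G by simp
    finally show "(\<integral>x. \<bar>Gh {} x - aL\<bar> \<partial>P) \<le> (\<integral>x. \<bar>a {..<m} - Gh {} x\<bar> \<partial>P) + \<bar>a {..<m} - aL\<bar>" .
  qed
  moreover have "(\<integral>x. \<bar>Gh {} x - aL\<bar> \<partial>P) \<ge> 0" by simp
  ultimately have "(\<integral>x. \<bar>Gh {} x - aL\<bar> \<partial>P) = 0" by simp
  then have "AE x in P. \<bar>Gh {} x - aL\<bar> = 0" using G by (subst (asm) integral_nonneg_eq_0_iff_AE) auto
  then show ?thesis by eventually_elim simp
qed

text \<open>\<Gamma> for \<open>N\<close> blocks is compared with its conditional version for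
  \<open>m\<close> blocks, at the price of the missing variance, and that one with its L1 limit.
  Only the limit, which is square integrable apart from its constant part by assumption and constant
  there, is passed to L2.\<close>

lemma one_minus_Gam:
  "(\<integral>x. \<bar>1 - Gam {..<N} x\<bar> \<partial>P) \<le> sqrt ((1 - aL)\<^sup>2 + V) + (aL - a {..<N})"
proof -
  have fK: "finite K" if "K \<in> Pow {..<N}" for K using that by (auto intro: finite_subset)
  define q where "q x = (\<Sum>K\<in>Pow {..<N}. hoef K (Gh K) x)" for x
  define h where "h m K x = 1 / n * (\<Sum>i\<in>{..<m} - K. Ex {i} (H i K {..<m}) x)" for m K x
  have hi: "integrable P (h m K)" for m K
    unfolding h_def[abs_def] by (intro integrable_mult_right Bochner_Integration.integrable_sum integrable_Ex H_integrable)
  have qi: "integrable P q" unfolding q_def[abs_def] using fK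
    by (intro Bochner_Integration.integrable_sum integrable_hoef Gh_integrable)
  have Gi: "integrable P (Gam {..<N})" by (rule Gam_integrable) simp
  have lim: "(\<lambda>m. \<integral>x. \<bar>(\<Sum>K\<in>Pow {..<N}. hoef K (h m K) x) - q x\<bar> \<partial>P) \<longlonglongrightarrow> 0"
    unfolding q_def using fK Gh_lim unfolding h_def[symmetric]
    by (intro integral_hoef_sum_tendsto hi Gh_integrable) auto
  have "(\<lambda>m. (\<integral>x. \<bar>1 - q x\<bar> \<partial>P) + (\<integral>x. \<bar>(\<Sum>K\<in>Pow {..<N}. hoef K (h m K) x) - q x\<bar> \<partial>P) + (a {..<m} - a {..<N}))
     \<longlonglongrightarrow> (\<integral>x. \<bar>1 - q x\<bar> \<partial>P) + 0 + (aL - a {..<N})"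
    by (intro tendsto_intros lim a_lim)
  then have "(\<integral>x. \<bar>1 - Gam {..<N} x\<bar> \<partial>P) \<le> (\<integral>x. \<bar>1 - q x\<bar> \<partial>P) + 0 + (aL - a {..<N})"
  proof (rule LIMSEQ_le_const, intro exI allI impI)
    fix m assume m: "N \<le> m"
    have si: "integrable P (\<lambda>x. (\<Sum>K\<in>Pow {..<N}. hoef K (h m K) x))"
      by (intro Bochner_Integration.integrable_sum integrable_hoef hi)
    have "(\<integral>x. \<bar>1 - Gam {..<N} x\<bar> \<partial>P) \<le> (\<integral>x. \<bar>1 - q x\<bar> + \<bar>(\<Sum>K\<in>Pow {..<N}. hoef K (h m K) x) - q x\<bar> + \<bar>GamC N m x - Gam {..<N} x\<bar> \<partial>P)"
    proof (rule integral_mono_AE)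
      show "AE x in P. \<bar>1 - Gam {..<N} x\<bar> \<le> \<bar>1 - q x\<bar> + \<bar>(\<Sum>K\<in>Pow {..<N}. hoef K (h m K) x) - q x\<bar> + \<bar>GamC N m x - Gam {..<N} x\<bar>"
        using GamC_hoef[OF m]
      proof eventually_elim
        case (elim x)
        then have e: "GamC N m x = (\<Sum>K\<in>Pow {..<N}. hoef K (h m K) x)" unfolding h_def[abs_def] .
        show ?case unfolding e by linarith
      qed
    qed (use qi Gi si GamC_integrable in auto)
    also have "\<dots> = (\<integral>x. \<bar>1 - q x\<bar> \<partial>P) + (\<integral>x. \<bar>(\<Sum>K\<in>Pow {..<N}. hoef K (h m K) x) - q x\<bar> \<partial>P) + (a {..<m} - a {..<N})"
      unfolding GamC_Gam[OF m, symmetric] using qi Gi si GamC_integrable by simp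
    finally show "(\<integral>x. \<bar>1 - Gam {..<N} x\<bar> \<partial>P) \<le> (\<integral>x. \<bar>1 - q x\<bar> \<partial>P) + (\<integral>x. \<bar>(\<Sum>K\<in>Pow {..<N}. hoef K (h m K) x) - q x\<bar> \<partial>P) + (a {..<m} - a {..<N})" .
  qed
  moreover have "(\<integral>x. \<bar>1 - q x\<bar> \<partial>P) \<le> sqrt ((1 - aL)\<^sup>2 + V)"
  proof -
    \<comment> \<open>The deviation 1 - aL is stored in the component of the empty set, so one
      orthogonality estimate produces both terms under the root.\<close>
    define g where "g K x = (if K = {} then 1 - aL else - Gh K x)" for K x
    have gs: "sqi (g K)" if "K \<in> Pow {..<N}" for K
    proof (cases "K = {}")
      case True then show ?thesis using sqi_const by (simp add: g_def[abs_def])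
    next
      case False then show ?thesis using sqi_cmult[OF Gh_sqi[OF fK[OF that] False], of "-1"] by (simp add: g_def[abs_def])
    qed
    have gd: "dep (K \<union> {}) (g K)" if "K \<in> Pow {..<N}" for K
      using Gh_dep[OF fK[OF that]] by (auto simp: dep_def g_def)
    have P: "Pow {..<N} = insert {} (Pow {..<N} - {{}})" by auto
    have P': "(\<Sum>K\<in>Pow {..<N}. g K) = g {} + (\<Sum>K\<in>Pow {..<N} - {{}}. g K)" for g :: "nat set \<Rightarrow> real"
      by (subst P, subst sum.insert) auto
    have gq: "AE x in P. 1 - q x = (\<Sum>K\<in>Pow {..<N}. hoef K (g K) x)"
      using Gh_empty
    proof eventually_elim
      case (elim x)
      have "(\<Sum>K\<in>Pow {..<N} - {{}}. hoef K (g K) x) = (\<Sum>K\<in>Pow {..<N} - {{}}. - hoef K (Gh K) x)"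
        by (intro sum.cong) (auto simp: g_def hoef_def Ex_def sum_negf)
      then show ?case using elim by (simp add: q_def P' hoef_empty g_def sum_negf)
    qed
    have s: "sqi (\<lambda>x. \<Sum>K\<in>Pow {..<N}. hoef K (g K) x)" using gs by (intro sqi_sum sqi_hoef)
    have "(\<integral>x. \<bar>1 - q x\<bar> \<partial>P) = (\<integral>x. \<bar>\<Sum>K\<in>Pow {..<N}. hoef K (g K) x\<bar> \<partial>P)"
      using gq qi sqi_measurable[OF s] by (intro integral_cong_AE) (auto elim!: eventually_mono)
    also have "\<dots> \<le> sqrt (\<integral>x. (\<Sum>K\<in>Pow {..<N}. hoef K (g K) x)\<^sup>2 \<partial>P)"
    proof (rule real_le_rsqrt)
      have "sqi (\<lambda>x. \<bar>\<Sum>K\<in>Pow {..<N}. hoef K (g K) x\<bar>)" using s by (auto simp: sqi_def)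
      from square_integral_le[OF this]
      show "(\<integral>x. \<bar>\<Sum>K\<in>Pow {..<N}. hoef K (g K) x\<bar> \<partial>P)\<^sup>2 \<le> (\<integral>x. (\<Sum>K\<in>Pow {..<N}. hoef K (g K) x)\<^sup>2 \<partial>P)" by simp
    qed
    also have "\<dots> \<le> sqrt (\<Sum>K\<in>Pow {..<N}. \<integral>x. (g K x)\<^sup>2 \<partial>P)"
      using gs gd fK by (intro real_sqrt_le_mono hoef_sum_norm_le[where C="{}"]) auto
    also have "(\<Sum>K\<in>Pow {..<N}. \<integral>x. (g K x)\<^sup>2 \<partial>P) = (1 - aL)\<^sup>2 + (\<Sum>K\<in>Pow {..<N} - {{}}. \<integral>x. (g K x)\<^sup>2 \<partial>P)"
      by (subst P') (simp add: g_def)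
    also have "(\<Sum>K\<in>Pow {..<N} - {{}}. \<integral>x. (g K x)\<^sup>2 \<partial>P) = (\<Sum>K\<in>Pow {..<N} - {{}}. \<integral>x. (Gh K x)\<^sup>2 \<partial>P)"
      by (intro sum.cong) (auto simp: g_def)
    also have "sqrt ((1 - aL)\<^sup>2 + \<dots>) \<le> sqrt ((1 - aL)\<^sup>2 + V)" using V[of N] by simp
    finally show ?thesis by simp
  qed
  ultimately show ?thesis by simp
qed

text \<open>Cauchy-Schwarz is used under the expectation for each i and again over i. The second
  moments add up to n times the variance, the fourth ones to at most \<open>B\<close>.\<close>

lemma sum_D_third: "(\<Sum>i<N. \<integral>x. \<bar>D {..<N} i x\<bar> ^ 3 \<partial>P) \<le> sqrt (n * aL) * sqrt B"
proof -
  define p where "p i = (\<integral>x. (D {..<N} i x)\<^sup>2 \<partial>P)" for i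
  define q where "q i = (\<integral>x. (D {..<N} i x) ^ 4 \<partial>P)" for i
  have le: "(\<integral>x. \<bar>D {..<N} i x\<bar> ^ 3 \<partial>P) \<le> sqrt (p i) * sqrt (q i)" if i: "i < N" for i
  proof -
    have s: "sqi (D {..<N} i)" by (rule D_sqi) simp
    have m: "D {..<N} i \<in> borel_measurable P" using s by (rule sqi_measurable)
    have s2: "sqi (\<lambda>x. (D {..<N} i x)\<^sup>2)" using m D_fourth(1)[OF i] by (auto simp: sqi_def intro!: borel_measurable_power)
    have "\<bar>D {..<N} i x * (D {..<N} i x)\<^sup>2\<bar> = \<bar>D {..<N} i x\<bar> ^ 3" for x
      by (simp add: abs_mult power2_eq_square power3_eq_cube mult.assoc)
    then show ?thesis using sqi_Cauchy_Schwarz[OF s s2] by (simp add: p_def q_def)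
  qed
  have pq: "p i \<ge> 0" "q i \<ge> 0" for i unfolding p_def q_def by simp_all
  have "(\<Sum>i<N. \<integral>x. \<bar>D {..<N} i x\<bar> ^ 3 \<partial>P) \<le> (\<Sum>i<N. sqrt (p i) * sqrt (q i))" using le by (intro sum_mono) auto
  also have "\<dots> \<le> L2_set (\<lambda>i. sqrt (p i)) {..<N} * L2_set (\<lambda>i. sqrt (q i)) {..<N}"
    using L2_set_mult_ineq[of "\<lambda>i. sqrt (p i)" "\<lambda>i. sqrt (q i)" "{..<N}"] pq by simp
  also have "\<dots> = sqrt (\<Sum>i<N. p i) * sqrt (\<Sum>i<N. q i)"
    using pq by (simp add: L2_set_def)
  also have "\<dots> \<le> sqrt (n * aL) * sqrt B"
  proof (intro mult_mono real_sqrt_le_mono)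
    have "(\<Sum>i<N. p i) = n * a {..<N}" using sum_D_norm[of "{..<N}"] by (simp add: p_def)
    then show "(\<Sum>i<N. p i) \<le> n * aL" using a_le[of N] by (simp add: mult_left_mono)
    have "(\<Sum>i<N. q i) \<le> (\<Sum>i<N. \<Sum>K\<in>Pow ({..<N} - {i}). \<integral>x. (Hlim i K x)\<^sup>2 \<partial>P)"
      unfolding q_def by (intro sum_mono D_fourth(2)) auto
    then show "(\<Sum>i<N. q i) \<le> B" using B[of N] by simp
  next
    have "0 \<le> a {..<N}" unfolding a_def by (intro sum_nonneg u_norm_nonneg)
    then show "0 \<le> sqrt (n * aL)" using a_le[of N] by simp
    show "0 \<le> sqrt (\<Sum>i<N. q i)" using pq by (simp add: sum_nonneg)
  qed
  finally show ?thesis .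
qed

theorem wasserstein_bound:
  assumes \<phi>: "1-lipschitz_on UNIV \<phi>"
  shows "\<bar>(\<integral>x. \<phi> (S {..<N} x) \<partial>P) - (\<integral>y. \<phi> y * std_normal_density y \<partial>lborel)\<bar>
    \<le> sqrt ((1 - aL)\<^sup>2 + V) + (aL - a {..<N}) + 2 / n * (sqrt (n * aL) * sqrt B)"
proof -
  have "\<bar>(\<integral>x. \<phi> (S {..<N} x) \<partial>P) - (\<integral>y. \<phi> y * std_normal_density y \<partial>lborel)\<bar>
     \<le> (\<integral>x. \<bar>1 - Gam {..<N} x\<bar> \<partial>P) + 2 / n * (\<Sum>i<N. \<integral>x. \<bar>D {..<N} i x\<bar> ^ 3 \<partial>P)"
    using D_third by (intro stein_bound \<phi>) auto
  also have "\<dots> \<le> (sqrt ((1 - aL)\<^sup>2 + V) + (aL - a {..<N})) + 2 / n * (sqrt (n * aL) * sqrt B)"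
    by (intro add_mono one_minus_Gam mult_left_mono sum_D_third) auto
  finally show ?thesis by simp
qed

end

subsection \<open>Uniform points in blocks of the half-line\<close>

definition blk :: "nat \<Rightarrow> real measure" where
  "blk k = uniform_measure lborel {2 * real k .. 2 * real k + 2}"

lemma emeasure_blk_base: "emeasure lborel {2 * real k .. 2 * real k + 2} = 2"
  by simp

lemma prob_space_blk: "prob_space (blk k)"
  unfolding blk_def by (rule prob_space_uniform_measure) (auto simp: emeasure_blk_base)

lemma sets_blk [measurable_cong, simp]: "sets (blk k) = sets borel"
  by (simp add: blk_def)

lemma space_blk [simp]: "space (blk k) = UNIV"
  by (simp add: blk_def)

lemma sets_leb_plus [measurable_cong, simp]: "sets leb_plus = sets borel"
  by (simp add: leb_plus_def)

lemma space_leb_plus [simp]: "space leb_plus = UNIV"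
  by (simp add: leb_plus_def)

lemma sets_half_leb [measurable_cong, simp]: "sets half_leb = sets borel"
  by (simp add: half_leb_def)

lemma nn_integral_leb_plus:
  "g \<in> borel_measurable borel \<Longrightarrow> (\<integral>\<^sup>+ t. g t \<partial>leb_plus) = (\<integral>\<^sup>+ t. indicator {0..} t * g t \<partial>lborel)"
  unfolding leb_plus_def by (subst nn_integral_density) auto

lemma nn_integral_half_leb:
  assumes "g \<in> borel_measurable borel" shows "(\<integral>\<^sup>+ t. g t \<partial>half_leb) = ennreal (1 / 2) * (\<integral>\<^sup>+ t. g t \<partial>leb_plus)"
  unfolding half_leb_def leb_plus_def using assms
  by (subst (1 2) nn_integral_density) (auto simp: mult.assoc nn_integral_cmult)

text \<open>The interval is half-open so that consecutive blocks tile the half-line; the missing end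
  point is a null set. The factor 2 is the length of a block.\<close>

lemma nn_integral_blk:
  assumes [measurable]: "g \<in> borel_measurable borel"
  shows "2 * (\<integral>\<^sup>+ t. g t \<partial>blk k) = (\<integral>\<^sup>+ t. indicator {2 * real k ..< 2 * real k + 2} t * g t \<partial>lborel)"
proof -
  have "(\<integral>\<^sup>+ t. g t \<partial>blk k) = (\<integral>\<^sup>+ t. g t * indicator {2 * real k .. 2 * real k + 2} t \<partial>lborel) / 2"
    unfolding blk_def by (subst nn_integral_uniform_measure) (auto simp: emeasure_blk_base)
  then have "2 * (\<integral>\<^sup>+ t. g t \<partial>blk k) = (\<integral>\<^sup>+ t. g t * indicator {2 * real k .. 2 * real k + 2} t \<partial>lborel)"
    by (simp add: ennreal_times_divide mult.commute[of 2] ennreal_mult_divide_eq)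
  also have "\<dots> = (\<integral>\<^sup>+ t. indicator {2 * real k ..< 2 * real k + 2} t * g t \<partial>lborel)"
  proof (rule nn_integral_cong_AE)
    have "AE t in lborel. t \<noteq> 2 * real k + 2" by (rule AE_lborel_singleton)
    then show "AE t in lborel. g t * indicator {2 * real k .. 2 * real k + 2} t = indicator {2 * real k ..< 2 * real k + 2} t * g t"
      by eventually_elim (auto simp: indicator_def)
  qed
  finally show ?thesis .
qed

lemma AE_blk: "AE t in blk k. 2 * real k < t \<and> t < 2 * real k + 2"
proof -
  have "AE t in lborel. t \<noteq> 2 * real k" "AE t in lborel. t \<noteq> 2 * real k + 2" by (rule AE_lborel_singleton)+
  then have "AE t in lborel. t \<in> {2 * real k .. 2 * real k + 2} \<longrightarrow> 2 * real k < t \<and> t < 2 * real k + 2"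
    by eventually_elim auto
  then show ?thesis unfolding blk_def by (intro AE_uniform_measureI) auto
qed

lemma nn_integral_leb_plus_truncated:
  assumes [measurable]: "g \<in> borel_measurable borel"
  shows "(\<integral>\<^sup>+ t. indicator {..<2 * real N} t * g t \<partial>leb_plus) = 2 * (\<Sum>k<N. \<integral>\<^sup>+ t. g t \<partial>blk k)"
proof -
  have "(\<integral>\<^sup>+ t. indicator {..<2 * real N} t * g t \<partial>leb_plus) = (\<integral>\<^sup>+ t. indicator {0..<2 * real N} t * g t \<partial>lborel)"
    by (subst nn_integral_leb_plus) (auto intro!: nn_integral_cong simp: indicator_def)
  also have "\<dots> = (\<Sum>k<N. \<integral>\<^sup>+ t. indicator {2 * real k ..< 2 * real k + 2} t * g t \<partial>lborel)"
  proof (induction N)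
    case (Suc N)
    have "indicator {0..<2 * real (Suc N)} t * g t = indicator {0..<2 * real N} t * g t + indicator {2 * real N ..< 2 * real N + 2} t * g t" for t
      by (auto simp: indicator_def)
    then show ?case using Suc by (simp add: nn_integral_add)
  qed simp
  also have "\<dots> = 2 * (\<Sum>k<N. \<integral>\<^sup>+ t. g t \<partial>blk k)"
    by (simp add: nn_integral_blk sum_distrib_left)
  finally show ?thesis .
qed

lemma sigma_finite_leb_plus: "sigma_finite_measure leb_plus"
  unfolding leb_plus_def by (intro sigma_finite_measure.sigma_finite_iff_density_finite[THEN iffD2] lborel.sigma_finite_measure_axioms) (auto simp: indicator_def)

lemma sigma_finite_half_leb: "sigma_finite_measure half_leb"
  unfolding half_leb_def by (intro sigma_finite_measure.sigma_finite_iff_density_finite[THEN iffD2] lborel.sigma_finite_measure_axioms) (auto simp: indicator_def)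

section \<open>Splitting off the first variable and cutting the orthant into blocks\<close>

lemma measurable_case_nat_PiM [measurable]:
  assumes "f \<in> N \<rightarrow>\<^sub>M M 0" "g \<in> N \<rightarrow>\<^sub>M (\<Pi>\<^sub>M j\<in>{..<l}. M (Suc j))"
  shows "(\<lambda>z. case_nat (f z) (g z)) \<in> N \<rightarrow>\<^sub>M (\<Pi>\<^sub>M j\<in>{..<Suc l}. M j)"
proof (rule measurable_PiM_single')
  fix j assume "j \<in> {..<Suc l}"
  then show "(\<lambda>z. case_nat (f z) (g z) j) \<in> N \<rightarrow>\<^sub>M M j"
    using assms measurable_compose[OF assms(2) measurable_component_singleton] by (cases j) auto
next
  have gf: "g z \<in> (\<Pi>\<^sub>E j\<in>{..<l}. space (M (Suc j)))" "f z \<in> space (M 0)" if "z \<in> space N" for z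
    using measurable_space[OF assms(2) that] measurable_space[OF assms(1) that] by (simp_all add: space_PiM)
  then have "case_nat (f z) (g z) j \<in> space (M j)" if "z \<in> space N" "j < Suc l" for z j
    using that by (cases j) (auto simp: PiE_iff)
  moreover have "case_nat (f z) (g z) j = undefined" if "z \<in> space N" "\<not> j < Suc l" for z j
    using that gf(1)[of z] by (cases j) (auto simp: PiE_iff extensional_def)
  ultimately show "(\<lambda>z. case_nat (f z) (g z)) \<in> space N \<rightarrow> (\<Pi>\<^sub>E j\<in>{..<Suc l}. space (M j))"
    by (simp add: PiE_iff extensional_def Pi_iff)
qed

lemma distr_case_nat:
  fixes M :: "nat \<Rightarrow> 'b measure"
  assumes sf: "\<And>i. sigma_finite_measure (M i)"
  shows "distr (M 0 \<Otimes>\<^sub>M (\<Pi>\<^sub>M j\<in>{..<l}. M (Suc j))) (\<Pi>\<^sub>M j\<in>{..<Suc l}. M j) (\<lambda>(t, z). case_nat t z) = (\<Pi>\<^sub>M j\<in>{..<Suc l}. M j)"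
proof -
  interpret M: product_sigma_finite M using sf by (simp add: product_sigma_finite_def)
  interpret MS: product_sigma_finite "\<lambda>j. M (Suc j)" using sf by (simp add: product_sigma_finite_def)
  interpret F: finite_product_sigma_finite "\<lambda>j. M (Suc j)" "{..<l}" by unfold_locales auto
  have m: "(\<lambda>(t, z). case_nat t z) \<in> M 0 \<Otimes>\<^sub>M (\<Pi>\<^sub>M j\<in>{..<l}. M (Suc j)) \<rightarrow>\<^sub>M (\<Pi>\<^sub>M j\<in>{..<Suc l}. M j)"
    by (simp add: split_def)
  show ?thesis
  proof (rule M.PiM_eqI)
    fix A assume A: "\<And>j. j \<in> {..<Suc l} \<Longrightarrow> A j \<in> sets (M j)"
    have A0: "A 0 \<in> sets (M 0)" and AS: "\<And>j. j \<in> {..<l} \<Longrightarrow> A (Suc j) \<in> sets (M (Suc j))" using A by auto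
    have "(\<lambda>(t, z). case_nat t z) -` Pi\<^sub>E {..<Suc l} A \<inter> space (M 0 \<Otimes>\<^sub>M (\<Pi>\<^sub>M j\<in>{..<l}. M (Suc j))) = A 0 \<times> (\<Pi>\<^sub>E j\<in>{..<l}. A (Suc j))"
      (is "?L = ?R")
    proof (rule set_eqI)
      fix tz :: "'b \<times> (nat \<Rightarrow> 'b)"
      obtain t z where tz: "tz = (t, z)" by (cases tz)
      have "case_nat t z \<in> Pi\<^sub>E {..<Suc l} A \<longleftrightarrow> t \<in> A 0 \<and> z \<in> (\<Pi>\<^sub>E j\<in>{..<l}. A (Suc j))"
      proof -
        have 1: "(\<forall>j<Suc l. case_nat t z j \<in> A j) \<longleftrightarrow> t \<in> A 0 \<and> (\<forall>j<l. z j \<in> A (Suc j))"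
          by (auto simp: less_Suc_eq_0_disj)
        have 2: "(\<forall>j. \<not> j < Suc l \<longrightarrow> case_nat t z j = undefined) \<longleftrightarrow> (\<forall>j. \<not> j < l \<longrightarrow> z j = undefined)"
          by (auto split: nat.split)
        show ?thesis using 1 2 by (auto simp: PiE_iff extensional_def)
      qed
      moreover have "t \<in> space (M 0)" if "t \<in> A 0" using sets.sets_into_space[OF A0] that by auto
      moreover have "z \<in> space (\<Pi>\<^sub>M j\<in>{..<l}. M (Suc j))" if "z \<in> (\<Pi>\<^sub>E j\<in>{..<l}. A (Suc j))"
        using sets.sets_into_space[OF AS] that by (fastforce simp: space_PiM PiE_iff)
      ultimately show "tz \<in> ?L \<longleftrightarrow> tz \<in> ?R" by (auto simp: tz space_pair_measure)
    qed
    then have "emeasure (distr (M 0 \<Otimes>\<^sub>M (\<Pi>\<^sub>M j\<in>{..<l}. M (Suc j))) (\<Pi>\<^sub>M j\<in>{..<Suc l}. M j) (\<lambda>(t, z). case_nat t z)) (Pi\<^sub>E {..<Suc l} A)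
       = emeasure (M 0) (A 0) * emeasure (\<Pi>\<^sub>M j\<in>{..<l}. M (Suc j)) (\<Pi>\<^sub>E j\<in>{..<l}. A (Suc j))"
      using A A0 AS m by (subst emeasure_distr) (auto intro!: sets_PiM_I_finite F.emeasure_pair_measure_Times)
    also have "\<dots> = emeasure (M 0) (A 0) * (\<Prod>j<l. emeasure (M (Suc j)) (A (Suc j)))"
      using AS by (subst MS.emeasure_PiM) auto
    also have "\<dots> = (\<Prod>j\<in>{..<Suc l}. emeasure (M j) (A j))" by (simp add: prod.lessThan_Suc_shift del: prod.lessThan_Suc)
    finally show "emeasure (distr (M 0 \<Otimes>\<^sub>M (\<Pi>\<^sub>M j\<in>{..<l}. M (Suc j))) (\<Pi>\<^sub>M j\<in>{..<Suc l}. M j) (\<lambda>(t, z). case_nat t z)) (Pi\<^sub>E {..<Suc l} A)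
       = (\<Prod>j\<in>{..<Suc l}. emeasure (M j) (A j))" .
  qed auto
qed

lemma nn_integral_case_nat:
  fixes M :: "nat \<Rightarrow> 'b measure"
  assumes sf: "\<And>i. sigma_finite_measure (M i)" and \<Phi>: "\<Phi> \<in> borel_measurable (\<Pi>\<^sub>M j\<in>{..<Suc l}. M j)"
  shows "(\<integral>\<^sup>+ z. \<Phi> z \<partial>(\<Pi>\<^sub>M j\<in>{..<Suc l}. M j)) = (\<integral>\<^sup>+ t. \<integral>\<^sup>+ z. \<Phi> (case_nat t z) \<partial>(\<Pi>\<^sub>M j\<in>{..<l}. M (Suc j)) \<partial>M 0)"
proof -
  interpret MS: product_sigma_finite "\<lambda>j. M (Suc j)" using sf by (simp add: product_sigma_finite_def)
  interpret F: finite_product_sigma_finite "\<lambda>j. M (Suc j)" "{..<l}" by unfold_locales auto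
  have m: "(\<lambda>(t, z). case_nat t z) \<in> M 0 \<Otimes>\<^sub>M (\<Pi>\<^sub>M j\<in>{..<l}. M (Suc j)) \<rightarrow>\<^sub>M (\<Pi>\<^sub>M j\<in>{..<Suc l}. M j)"
    by (simp add: split_def)
  have "(\<integral>\<^sup>+ z. \<Phi> z \<partial>(\<Pi>\<^sub>M j\<in>{..<Suc l}. M j)) = (\<integral>\<^sup>+ p. \<Phi> (case_nat (fst p) (snd p)) \<partial>(M 0 \<Otimes>\<^sub>M (\<Pi>\<^sub>M j\<in>{..<l}. M (Suc j))))"
    using nn_integral_distr[OF m, of \<Phi>] \<Phi> distr_case_nat[where M=M and l=l, OF sf] by (simp add: split_def)
  also have "\<dots> = (\<integral>\<^sup>+ t. \<integral>\<^sup>+ z. \<Phi> (case_nat t z) \<partial>(\<Pi>\<^sub>M j\<in>{..<l}. M (Suc j)) \<partial>M 0)"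
    using measurable_compose[OF m \<Phi>] by (subst F.nn_integral_fst[symmetric]) (auto simp: split_def)
  finally show ?thesis .
qed

lemma nn_integral_PiM_half_leb:
  "\<Phi> \<in> borel_measurable (\<Pi>\<^sub>M j\<in>{..<d}. leb_plus) \<Longrightarrow>
    (\<integral>\<^sup>+ z. \<Phi> z \<partial>(\<Pi>\<^sub>M j\<in>{..<d}. half_leb)) = ennreal ((1 / 2) ^ d) * (\<integral>\<^sup>+ z. \<Phi> z \<partial>(\<Pi>\<^sub>M j\<in>{..<d}. leb_plus))"
proof (induction d arbitrary: \<Phi>)
  case 0
  then show ?case by (simp add: PiM_empty nn_integral_count_space_finite)
next
  case (Suc d)
  have se: "sets (\<Pi>\<^sub>M j\<in>{..<k}. half_leb) = sets (\<Pi>\<^sub>M j\<in>{..<k::nat}. leb_plus)" for k by (intro sets_PiM_cong) auto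
  have \<Phi>: "\<Phi> \<in> borel_measurable (\<Pi>\<^sub>M j\<in>{..<Suc d}. half_leb)"
    using Suc.prems measurable_cong_sets[OF se refl] by blast
  interpret L: product_sigma_finite "\<lambda>_::nat. leb_plus" using sigma_finite_leb_plus by (simp add: product_sigma_finite_def)
  interpret F: finite_product_sigma_finite "\<lambda>_::nat. leb_plus" "{..<d}" by unfold_locales auto
  have m: "(\<lambda>p. \<Phi> (case_nat (fst p) (snd p))) \<in> borel_measurable (leb_plus \<Otimes>\<^sub>M (\<Pi>\<^sub>M j\<in>{..<d}. leb_plus))"
    by (rule measurable_compose[OF measurable_case_nat_PiM[where M="\<lambda>_. leb_plus"] Suc.prems]) auto
  have m1: "(\<lambda>z. \<Phi> (case_nat t z)) \<in> borel_measurable (\<Pi>\<^sub>M j\<in>{..<d}. leb_plus)" for t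
    by (rule measurable_compose[OF measurable_case_nat_PiM[where M="\<lambda>_. leb_plus"] Suc.prems]) auto
  have m2: "(\<lambda>t. \<integral>\<^sup>+ z. \<Phi> (case_nat t z) \<partial>(\<Pi>\<^sub>M j\<in>{..<d}. leb_plus)) \<in> borel_measurable leb_plus"
    using F.borel_measurable_nn_integral_fst[OF m] by simp
  then have m3: "(\<lambda>t. \<integral>\<^sup>+ z. \<Phi> (case_nat t z) \<partial>(\<Pi>\<^sub>M j\<in>{..<d}. leb_plus)) \<in> borel_measurable borel"
    by (simp add: measurable_cong_sets[OF sets_leb_plus refl])
  have "(\<integral>\<^sup>+ z. \<Phi> z \<partial>(\<Pi>\<^sub>M j\<in>{..<Suc d}. half_leb)) = (\<integral>\<^sup>+ t. \<integral>\<^sup>+ z. \<Phi> (case_nat t z) \<partial>(\<Pi>\<^sub>M j\<in>{..<d}. half_leb) \<partial>half_leb)"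
    by (rule nn_integral_case_nat[OF sigma_finite_half_leb \<Phi>])
  also have "\<dots> = (\<integral>\<^sup>+ t. ennreal ((1 / 2) ^ d) * (\<integral>\<^sup>+ z. \<Phi> (case_nat t z) \<partial>(\<Pi>\<^sub>M j\<in>{..<d}. leb_plus)) \<partial>half_leb)"
    by (simp add: Suc.IH[OF m1])
  also have "\<dots> = ennreal (1 / 2) * (ennreal ((1 / 2) ^ d) * (\<integral>\<^sup>+ t. \<integral>\<^sup>+ z. \<Phi> (case_nat t z) \<partial>(\<Pi>\<^sub>M j\<in>{..<d}. leb_plus) \<partial>leb_plus))"
    using m3 m2 by (subst nn_integral_half_leb) (auto simp: nn_integral_cmult)
  also have "\<dots> = ennreal ((1 / 2) ^ Suc d) * (\<integral>\<^sup>+ z. \<Phi> z \<partial>(\<Pi>\<^sub>M j\<in>{..<Suc d}. leb_plus))"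
  proof -
    have e: "ennreal ((1 / 2) ^ Suc d) = ennreal (1 / 2) * ennreal ((1 / 2) ^ d)"
      by (subst ennreal_mult[symmetric]) auto
    show ?thesis unfolding nn_integral_case_nat[OF sigma_finite_leb_plus Suc.prems] e mult.assoc ..
  qed
  finally show ?case .
qed

text \<open>There is no lower bound because \<open>leb_plus\<close> does not charge negative
  numbers. The cut at an even number runs along block boundaries.\<close>

definition trunc :: "nat \<Rightarrow> nat \<Rightarrow> (nat \<Rightarrow> real) set" where
  "trunc d N = {z. \<forall>j<d. z j < 2 * real N}"

lemma measurable_indicator_trunc [measurable]:
  "indicator (trunc k N) \<in> borel_measurable (\<Pi>\<^sub>M j\<in>{..<k}. leb_plus)"
proof -
  have "Measurable.pred (\<Pi>\<^sub>M j\<in>{..<k}. leb_plus) (\<lambda>z. \<forall>j\<in>{..<k}. z j < 2 * real N)"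
    by (intro pred_intros_finite) measurable
  then have "{z \<in> space (\<Pi>\<^sub>M j\<in>{..<k}. leb_plus). \<forall>j\<in>{..<k}. z j < 2 * real N} \<in> sets (\<Pi>\<^sub>M j\<in>{..<k}. leb_plus)"
    by (simp only: pred_def)
  from borel_measurable_indicator[OF this] show ?thesis
    by (rule measurable_cong[THEN iffD1, rotated]) (auto simp: indicator_def trunc_def)
qed

lemma sum_tuples_Suc:
  fixes g :: "(nat \<Rightarrow> nat) \<Rightarrow> 'c::comm_monoid_add"
  shows "(\<Sum>m\<in>{..<Suc d} \<rightarrow>\<^sub>E {..<N}. g m) = (\<Sum>k<N. \<Sum>m\<in>{..<d} \<rightarrow>\<^sub>E {..<N}. g (case_nat k m))"
proof -
  have "(\<Sum>k<N. \<Sum>m\<in>{..<d} \<rightarrow>\<^sub>E {..<N}. g (case_nat k m)) = (\<Sum>p\<in>{..<N} \<times> ({..<d} \<rightarrow>\<^sub>E {..<N}). g (case_nat (fst p) (snd p)))"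
    by (subst sum.cartesian_product) (simp add: split_def)
  also have "\<dots> = (\<Sum>m\<in>{..<Suc d} \<rightarrow>\<^sub>E {..<N}. g m)"
  proof (rule sum.reindex_bij_witness[where j="\<lambda>p. case_nat (fst p) (snd p)" and i="\<lambda>m. (m 0, \<lambda>j. m (Suc j))"])
    fix p :: "nat \<times> (nat \<Rightarrow> nat)" assume p: "p \<in> {..<N} \<times> ({..<d} \<rightarrow>\<^sub>E {..<N})"
    obtain k m where km: "p = (k, m)" by (cases p)
    show "case_nat (fst p) (snd p) \<in> {..<Suc d} \<rightarrow>\<^sub>E {..<N}"
    proof (rule PiE_I)
      fix j assume "j \<in> {..<Suc d}"
      then show "case_nat (fst p) (snd p) j \<in> {..<N}" using p km by (cases j) (auto simp: PiE_iff)
    next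
      fix j assume "j \<notin> {..<Suc d}"
      then show "case_nat (fst p) (snd p) j = undefined" using p km by (cases j) (auto simp: PiE_iff extensional_def)
    qed
  next
    fix m assume m: "m \<in> {..<Suc d} \<rightarrow>\<^sub>E {..<N}"
    then show "(m 0, \<lambda>j. m (Suc j)) \<in> {..<N} \<times> ({..<d} \<rightarrow>\<^sub>E {..<N})"
      by (auto simp: PiE_iff extensional_def)
    show "case_nat (fst (m 0, \<lambda>j. m (Suc j))) (snd (m 0, \<lambda>j. m (Suc j))) = m"
      by (rule ext) (simp split: nat.split)
  qed (simp, rule refl)
  finally show ?thesis ..
qed

text \<open>Each axis is tiled by \<open>N\<close> blocks of length 2, so the cube splits into block
  products; 2 ^ d converts the uniform laws back to Lebesgue measure.\<close>

lemma nn_integral_PiM_truncated: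
  "\<Phi> \<in> borel_measurable (\<Pi>\<^sub>M j\<in>{..<d}. leb_plus) \<Longrightarrow>
    (\<integral>\<^sup>+ z. indicator (trunc d N) z * \<Phi> z \<partial>(\<Pi>\<^sub>M j\<in>{..<d}. leb_plus))
     = 2 ^ d * (\<Sum>m\<in>{..<d} \<rightarrow>\<^sub>E {..<N}. \<integral>\<^sup>+ z. \<Phi> z \<partial>(\<Pi>\<^sub>M j\<in>{..<d}. blk (m j)))"
proof (induction d arbitrary: \<Phi>)
  case 0
  then show ?case by (simp add: PiM_empty nn_integral_count_space_finite trunc_def)
next
  case (Suc d)
  have sfb: "sigma_finite_measure (blk k)" for k using prob_space_blk prob_space_imp_sigma_finite by blast
  interpret L: product_sigma_finite "\<lambda>_::nat. leb_plus" using sigma_finite_leb_plus by (simp add: product_sigma_finite_def)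
  interpret F: finite_product_sigma_finite "\<lambda>_::nat. leb_plus" "{..<d}" by unfold_locales auto
  have im: "indicator (trunc k N) \<in> borel_measurable (\<Pi>\<^sub>M j\<in>{..<k}. leb_plus)" for k
    by (rule measurable_indicator_trunc)
  have m1: "(\<lambda>z. \<Phi> (case_nat t z)) \<in> borel_measurable (\<Pi>\<^sub>M j\<in>{..<d}. leb_plus)" for t
    by (rule measurable_compose[OF measurable_case_nat_PiM[where M="\<lambda>_. leb_plus"] Suc.prems]) auto
  have sb: "sets (\<Pi>\<^sub>M j\<in>{..<k}. leb_plus) = sets (\<Pi>\<^sub>M j\<in>{..<k}. blk (m j))" for m k by (intro sets_PiM_cong) auto
  have \<Phi>b: "\<Phi> \<in> borel_measurable (\<Pi>\<^sub>M j\<in>{..<Suc d}. blk (m j))" for m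
    using Suc.prems measurable_cong_sets[OF sb refl] by blast
  have mb: "(\<lambda>t. \<integral>\<^sup>+ z. \<Phi> (case_nat t z) \<partial>(\<Pi>\<^sub>M j\<in>{..<d}. blk (m j))) \<in> borel_measurable borel" for m
  proof -
    interpret L': product_sigma_finite "\<lambda>j. blk (m j)" using sfb by (simp add: product_sigma_finite_def)
    interpret F': finite_product_sigma_finite "\<lambda>j. blk (m j)" "{..<d}" by unfold_locales auto
    have "(\<lambda>p. \<Phi> (case_nat (fst p) (snd p))) \<in> borel_measurable (borel \<Otimes>\<^sub>M (\<Pi>\<^sub>M j\<in>{..<d}. blk (m j)))"
      by (rule measurable_compose[OF measurable_case_nat_PiM[where M="\<lambda>_. leb_plus"] Suc.prems])
        (auto intro!: measurable_snd simp: measurable_cong_sets[OF refl sb])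
    from F'.borel_measurable_nn_integral_fst[OF this] show ?thesis by simp
  qed
  have "(\<integral>\<^sup>+ z. indicator (trunc (Suc d) N) z * \<Phi> z \<partial>(\<Pi>\<^sub>M j\<in>{..<Suc d}. leb_plus))
     = (\<integral>\<^sup>+ t. \<integral>\<^sup>+ z. indicator (trunc (Suc d) N) (case_nat t z) * \<Phi> (case_nat t z) \<partial>(\<Pi>\<^sub>M j\<in>{..<d}. leb_plus) \<partial>leb_plus)"
    using im Suc.prems by (intro nn_integral_case_nat[OF sigma_finite_leb_plus]) auto
  also have "\<dots> = (\<integral>\<^sup>+ t. \<integral>\<^sup>+ z. indicator {..<2 * real N} t * (indicator (trunc d N) z * \<Phi> (case_nat t z)) \<partial>(\<Pi>\<^sub>M j\<in>{..<d}. leb_plus) \<partial>leb_plus)"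
    by (intro nn_integral_cong) (auto simp: indicator_def trunc_def less_Suc_eq_0_disj)
  also have "\<dots> = (\<integral>\<^sup>+ t. indicator {..<2 * real N} t * (2 ^ d * (\<Sum>m\<in>{..<d} \<rightarrow>\<^sub>E {..<N}. \<integral>\<^sup>+ z. \<Phi> (case_nat t z) \<partial>(\<Pi>\<^sub>M j\<in>{..<d}. blk (m j)))) \<partial>leb_plus)"
    using m1 im by (simp add: nn_integral_cmult Suc.IH[OF m1])
  also have "\<dots> = 2 * (\<Sum>k<N. \<integral>\<^sup>+ t. 2 ^ d * (\<Sum>m\<in>{..<d} \<rightarrow>\<^sub>E {..<N}. \<integral>\<^sup>+ z. \<Phi> (case_nat t z) \<partial>(\<Pi>\<^sub>M j\<in>{..<d}. blk (m j))) \<partial>blk k)"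
    using mb by (intro nn_integral_leb_plus_truncated) auto
  also have "\<dots> = 2 * (\<Sum>k<N. 2 ^ d * (\<Sum>m\<in>{..<d} \<rightarrow>\<^sub>E {..<N}. \<integral>\<^sup>+ t. \<integral>\<^sup>+ z. \<Phi> (case_nat t z) \<partial>(\<Pi>\<^sub>M j\<in>{..<d}. blk (m j)) \<partial>blk k))"
    using mb by (simp add: nn_integral_cmult nn_integral_sum)
  also have "\<dots> = 2 * (\<Sum>k<N. 2 ^ d * (\<Sum>m\<in>{..<d} \<rightarrow>\<^sub>E {..<N}. \<integral>\<^sup>+ z. \<Phi> z \<partial>(\<Pi>\<^sub>M j\<in>{..<Suc d}. blk (case_nat k m j))))"
    using nn_integral_case_nat[OF sfb \<Phi>b] by simp
  also have "\<dots> = 2 ^ Suc d * (\<Sum>m\<in>{..<Suc d} \<rightarrow>\<^sub>E {..<N}. \<integral>\<^sup>+ z. \<Phi> z \<partial>(\<Pi>\<^sub>M j\<in>{..<Suc d}. blk (m j)))"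
    by (simp add: sum_tuples_Suc sum_distrib_left mult.assoc)
  finally show ?case .
qed

interpretation blk: real_product_space blk
  by (rule real_product_space.intro) (rule prob_space_blk, rule sets_blk)

text \<open>The label type is left polymorphic: tuples of blocks are labelled by natural numbers,
  kernels with integrated variables by the sum type of \<open>idx\<close>.\<close>

definition pt :: "nat \<Rightarrow> (nat \<Rightarrow> 'b) \<Rightarrow> ('b \<Rightarrow> real) \<Rightarrow> nat \<Rightarrow> real" where
  "pt d m x = (\<lambda>j\<in>{..<d}. x (m j))"

lemma pt_in [simp]: "pt d m x \<in> {..<d} \<rightarrow>\<^sub>E UNIV"
  by (simp add: pt_def)

lemma measurable_PiM_leb_plus:
  assumes "\<And>j. j < d \<Longrightarrow> (\<lambda>x. g x j) \<in> borel_measurable M" "\<And>x. x \<in> space M \<Longrightarrow> g x \<in> extensional {..<d}"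
  shows "g \<in> M \<rightarrow>\<^sub>M (\<Pi>\<^sub>M j\<in>{..<d}. leb_plus)"
  using assms by (intro measurable_PiM_single') (auto simp: PiE_iff measurable_cong_sets[OF refl sets_leb_plus])

lemma measurable_pt:
  assumes "\<And>j. j < d \<Longrightarrow> (\<lambda>x. g x (m j)) \<in> borel_measurable M"
  shows "(\<lambda>x. pt d m (g x)) \<in> M \<rightarrow>\<^sub>M (\<Pi>\<^sub>M j\<in>{..<d}. leb_plus)"
  using assms by (intro measurable_PiM_leb_plus) (auto simp: pt_def)

text \<open>Distinct coordinates of \<open>blk.P\<close> are independent, so an injective choice of
  labels reproduces the finite product; a repeated label would duplicate a coordinate.\<close>

lemma nn_integral_pt:
  assumes m: "inj_on m {..<d}" and \<Phi>: "\<Phi> \<in> borel_measurable (\<Pi>\<^sub>M j\<in>{..<d}. leb_plus)"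
  shows "(\<integral>\<^sup>+ z. \<Phi> z \<partial>(\<Pi>\<^sub>M j\<in>{..<d}. blk (m j))) = (\<integral>\<^sup>+ x. \<Phi> (pt d m x) \<partial>blk.P)"
proof -
  have sb: "sets (\<Pi>\<^sub>M j\<in>{..<d}. leb_plus) = sets (\<Pi>\<^sub>M j\<in>{..<d}. blk (m j))" by (intro sets_PiM_cong) auto
  have mm: "(\<lambda>x. \<lambda>j\<in>{..<d}. x (m j)) \<in> blk.P \<rightarrow>\<^sub>M (\<Pi>\<^sub>M j\<in>{..<d}. blk (m j))"
    using measurable_pt[of d "\<lambda>x. x" m blk.P] measurable_cong_sets[OF refl sb]
    by (auto simp: pt_def[abs_def] blk.measurable_component_P)
  have "distr blk.P (\<Pi>\<^sub>M j\<in>{..<d}. blk (m j)) (\<lambda>x. \<lambda>j\<in>{..<d}. x (m j)) = (\<Pi>\<^sub>M j\<in>{..<d}. blk (m j))"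
    unfolding blk.P_def using m by (intro distr_PiM_reindex prob_space_blk) auto
  then have "(\<integral>\<^sup>+ z. \<Phi> z \<partial>(\<Pi>\<^sub>M j\<in>{..<d}. blk (m j))) = (\<integral>\<^sup>+ z. \<Phi> z \<partial>distr blk.P (\<Pi>\<^sub>M j\<in>{..<d}. blk (m j)) (\<lambda>x. \<lambda>j\<in>{..<d}. x (m j)))"
    by simp
  also have "\<dots> = (\<integral>\<^sup>+ x. \<Phi> (pt d m x) \<partial>blk.P)"
    unfolding pt_def using \<Phi> measurable_cong_sets[OF sb refl, of borel] by (intro nn_integral_distr mm) simp
  finally show ?thesis .
qed

text \<open>An interior point of a block lies in no other closed block, so the block indices
  witnessing membership in \<open>Delta d\<close> could only be \<open>m\<close>, which is not
  injective.\<close>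

lemma not_Delta:
  assumes z: "\<And>j. j < d \<Longrightarrow> 2 * real (m j) < z j \<and> z j < 2 * real (m j) + 2" and m: "\<not> inj_on m {..<d}"
  shows "z \<notin> Delta d"
proof
  assume "z \<in> Delta d"
  then obtain k :: "nat \<Rightarrow> nat" where k: "inj_on k {..<d}" "\<And>j. j < d \<Longrightarrow> 2 * real (k j) \<le> z j \<and> z j \<le> 2 * real (k j) + 2"
    by (auto simp: Delta_def PiE_iff)
  have "k j = m j" if "j < d" for j
  proof -
    have "real (k j) < real (m j) + 1" "real (m j) < real (k j) + 1" using k(2)[OF that] z[OF that] by linarith+
    then show ?thesis by linarith
  qed
  then have "inj_on m {..<d}" using k(1) by (auto simp: inj_on_def)
  then show False using m by simp
qed

lemma in_Delta:
  assumes z: "\<And>j. j < d \<Longrightarrow> 2 * real (m j) \<le> z j \<and> z j \<le> 2 * real (m j) + 2" and m: "inj_on m {..<d}" and "z \<in> {..<d} \<rightarrow>\<^sub>E UNIV"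
  shows "z \<in> Delta d"
  unfolding Delta_def using assms by (auto simp: PiE_iff intro!: exI[of _ m])

definition injs :: "nat \<Rightarrow> nat \<Rightarrow> (nat \<Rightarrow> nat) set" where
  "injs d N = {m \<in> {..<d} \<rightarrow>\<^sub>E {..<N}. inj_on m {..<d}}"

lemma finite_injs: "finite (injs d N)"
  unfolding injs_def by (rule finite_subset[of _ "{..<d} \<rightarrow>\<^sub>E {..<N}"]) (auto intro: finite_PiE)

text \<open>Tuples that use a block twice lie outside \<open>Delta d\<close> almost surely and
  contribute nothing.\<close>

lemma nn_integral_trunc_injs:
  assumes \<Phi>: "\<Phi> \<in> borel_measurable (\<Pi>\<^sub>M j\<in>{..<d}. leb_plus)" and v: "\<And>z. z \<in> {..<d} \<rightarrow>\<^sub>E UNIV \<Longrightarrow> z \<notin> Delta d \<Longrightarrow> \<Phi> z = 0"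
  shows "(\<integral>\<^sup>+ z. indicator (trunc d N) z * \<Phi> z \<partial>(\<Pi>\<^sub>M j\<in>{..<d}. leb_plus)) = 2 ^ d * (\<Sum>m\<in>injs d N. \<integral>\<^sup>+ x. \<Phi> (pt d m x) \<partial>blk.P)"
proof -
  have z: "(\<integral>\<^sup>+ z. \<Phi> z \<partial>(\<Pi>\<^sub>M j\<in>{..<d}. blk (m j))) = 0" if m: "\<not> inj_on m {..<d}" for m
  proof -
    have "AE z in (\<Pi>\<^sub>M j\<in>{..<d}. blk (m j)). \<forall>j\<in>{..<d}. 2 * real (m j) < z j \<and> z j < 2 * real (m j) + 2"
      by (intro AE_finite_allI AE_PiM_component[where P="\<lambda>t. 2 * real (m _) < t \<and> t < 2 * real (m _) + 2"] prob_space_blk AE_blk) auto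
    moreover have "AE z in (\<Pi>\<^sub>M j\<in>{..<d}. blk (m j)). z \<in> {..<d} \<rightarrow>\<^sub>E UNIV"
      by (rule AE_I2) (auto simp: space_PiM PiE_iff)
    ultimately have "AE z in (\<Pi>\<^sub>M j\<in>{..<d}. blk (m j)). \<Phi> z = 0"
    proof eventually_elim
      case (elim z)
      have "z \<notin> Delta d" using elim(1) by (intro not_Delta[OF _ m]) auto
      then show ?case using elim(2) by (intro v)
    qed
    then show ?thesis by (subst nn_integral_cong_AE[where v="\<lambda>_. 0"]) auto
  qed
  have "(\<Sum>m\<in>{..<d} \<rightarrow>\<^sub>E {..<N}. \<integral>\<^sup>+ z. \<Phi> z \<partial>(\<Pi>\<^sub>M j\<in>{..<d}. blk (m j))) = (\<Sum>m\<in>injs d N. \<integral>\<^sup>+ z. \<Phi> z \<partial>(\<Pi>\<^sub>M j\<in>{..<d}. blk (m j)))"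
    by (rule sum.mono_neutral_right) (auto simp: injs_def z intro: finite_PiE)
  also have "\<dots> = (\<Sum>m\<in>injs d N. \<integral>\<^sup>+ x. \<Phi> (pt d m x) \<partial>blk.P)"
    by (intro sum.cong refl nn_integral_pt \<Phi>) (auto simp: injs_def)
  finally show ?thesis using nn_integral_PiM_truncated[OF \<Phi>, of N] by simp
qed

lemma integral_trunc_injs:
  fixes F :: "(nat \<Rightarrow> real) \<Rightarrow> real"
  assumes F: "integrable (\<Pi>\<^sub>M j\<in>{..<d}. leb_plus) F" and v: "\<And>z. z \<in> {..<d} \<rightarrow>\<^sub>E UNIV \<Longrightarrow> z \<notin> Delta d \<Longrightarrow> F z = 0"
  shows "\<And>m. m \<in> injs d N \<Longrightarrow> integrable blk.P (\<lambda>x. F (pt d m x))"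
    and "(\<integral>z. indicator (trunc d N) z * F z \<partial>(\<Pi>\<^sub>M j\<in>{..<d}. leb_plus)) = 2 ^ d * (\<Sum>m\<in>injs d N. \<integral>x. F (pt d m x) \<partial>blk.P)"
proof -
  let ?L = "\<Pi>\<^sub>M j\<in>{..<d}. leb_plus"
  have Fm [measurable]: "F \<in> borel_measurable ?L" using F by auto
  have ptm: "pt d m \<in> blk.P \<rightarrow>\<^sub>M ?L" for m :: "nat \<Rightarrow> nat" using measurable_pt[of d "\<lambda>x. x" m blk.P] by (simp add: blk.measurable_component_P)
  have Fpt: "(\<lambda>x. F (pt d m x)) \<in> borel_measurable blk.P" for m :: "nat \<Rightarrow> nat" using measurable_compose[OF ptm Fm] .
  \<comment> \<open>Applied to the absolute value for integrability; the variant \<open>c\<close>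
    below is used for the identity and the negation, that is for the positive and negative
    parts.\<close>
  have g: "(\<integral>\<^sup>+ z. indicator (trunc d N) z * ennreal (g (F z)) \<partial>?L) = 2 ^ d * (\<Sum>m\<in>injs d N. \<integral>\<^sup>+ x. ennreal (g (F (pt d m x))) \<partial>blk.P)"
    if "g \<in> borel_measurable borel" "g 0 \<le> 0" for g :: "real \<Rightarrow> real"
    using that v by (intro nn_integral_trunc_injs) (auto simp: ennreal_neg)
  have fin: "(\<integral>\<^sup>+ z. ennreal (norm (F z)) \<partial>?L) < \<infinity>" using F by (simp add: integrable_iff_bounded)
  have "(\<integral>\<^sup>+ z. indicator (trunc d N) z * ennreal \<bar>F z\<bar> \<partial>?L) \<le> (\<integral>\<^sup>+ z. ennreal (norm (F z)) \<partial>?L)"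
    by (intro nn_integral_mono) (auto simp: indicator_def)
  then have "2 ^ d * (\<Sum>m\<in>injs d N. \<integral>\<^sup>+ x. ennreal \<bar>F (pt d m x)\<bar> \<partial>blk.P) < \<infinity>"
    using fin g[of abs] by simp
  then have "(\<Sum>m\<in>injs d N. \<integral>\<^sup>+ x. ennreal \<bar>F (pt d m x)\<bar> \<partial>blk.P) < \<infinity>"
    by (auto simp: ennreal_mult_less_top less_top[symmetric])
  then have fin': "(\<integral>\<^sup>+ x. ennreal \<bar>F (pt d m x)\<bar> \<partial>blk.P) < \<infinity>" if "m \<in> injs d N" for m
    using that finite_injs by (simp add: less_top)
  show i: "integrable blk.P (\<lambda>x. F (pt d m x))" if "m \<in> injs d N" for m
    using fin'[OF that] Fpt by (simp add: integrable_iff_bounded)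
  have ie: "(\<integral>x. F (pt d m x) \<partial>blk.P) = enn2real (\<integral>\<^sup>+ x. ennreal (F (pt d m x)) \<partial>blk.P) - enn2real (\<integral>\<^sup>+ x. ennreal (- F (pt d m x)) \<partial>blk.P)"
    if "m \<in> injs d N" for m using i[OF that] by (rule real_lebesgue_integral_def)
  have fing: "(\<integral>\<^sup>+ x. ennreal (g (F (pt d m x))) \<partial>blk.P) < \<top>" if "m \<in> injs d N" "\<And>t. g t \<le> \<bar>t\<bar>" for g :: "real \<Rightarrow> real" and m
    using fin'[OF that(1)] that(2) by (intro le_less_trans[OF nn_integral_mono fin'[OF that(1), simplified]]) (auto intro: ennreal_leI)
  have iF: "integrable ?L (\<lambda>z. indicator (trunc d N) z * F z)"
  proof (rule Bochner_Integration.integrable_bound[OF F])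
    show "(\<lambda>z. indicator (trunc d N) z * F z) \<in> borel_measurable ?L"
      by (rule borel_measurable_times[OF measurable_indicator_trunc Fm])
  qed (auto simp: indicator_def)
  have c: "enn2real (\<integral>\<^sup>+ z. ennreal (g (indicator (trunc d N) z * F z)) \<partial>?L) = 2 ^ d * (\<Sum>m\<in>injs d N. enn2real (\<integral>\<^sup>+ x. ennreal (g (F (pt d m x))) \<partial>blk.P))"
    if gm: "g \<in> borel_measurable borel" "g 0 = 0" "\<And>t. g t \<le> \<bar>t\<bar>" for g :: "real \<Rightarrow> real"
  proof -
    have "(\<integral>\<^sup>+ z. ennreal (g (indicator (trunc d N) z * F z)) \<partial>?L) = (\<integral>\<^sup>+ z. indicator (trunc d N) z * ennreal (g (F z)) \<partial>?L)"
      using gm by (intro nn_integral_cong) (auto simp: indicator_def)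
    also have "\<dots> = 2 ^ d * (\<Sum>m\<in>injs d N. \<integral>\<^sup>+ x. ennreal (g (F (pt d m x))) \<partial>blk.P)"
      using gm by (intro g) auto
    finally have "enn2real (\<integral>\<^sup>+ z. ennreal (g (indicator (trunc d N) z * F z)) \<partial>?L)
        = enn2real (2 ^ d) * enn2real (\<Sum>m\<in>injs d N. \<integral>\<^sup>+ x. ennreal (g (F (pt d m x))) \<partial>blk.P)"
      by (simp only: enn2real_mult)
    also have "enn2real (2 ^ d) = 2 ^ d"
    proof -
      have "(2::ennreal) ^ d = ennreal (2 ^ d)" by (simp add: ennreal_power[symmetric])
      then show ?thesis by simp
    qed
    also have "enn2real (\<Sum>m\<in>injs d N. \<integral>\<^sup>+ x. ennreal (g (F (pt d m x))) \<partial>blk.P)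
       = (\<Sum>m\<in>injs d N. enn2real (\<integral>\<^sup>+ x. ennreal (g (F (pt d m x))) \<partial>blk.P))"
      using fing[OF _ gm(3)] by (subst enn2real_sum) (auto simp: o_def)
    finally show ?thesis .
  qed
  have "(\<integral>z. indicator (trunc d N) z * F z \<partial>?L) = enn2real (\<integral>\<^sup>+ z. ennreal (indicator (trunc d N) z * F z) \<partial>?L) - enn2real (\<integral>\<^sup>+ z. ennreal (- (indicator (trunc d N) z * F z)) \<partial>?L)"
    using iF by (rule real_lebesgue_integral_def)
  also have "\<dots> = 2 ^ d * (\<Sum>m\<in>injs d N. \<integral>x. F (pt d m x) \<partial>blk.P)"
    using c[of "\<lambda>t. t"] c[of "\<lambda>t. - t"] by (simp add: ie sum_subtractf right_diff_distrib)
  finally show "(\<integral>z. indicator (trunc d N) z * F z \<partial>?L) = 2 ^ d * (\<Sum>m\<in>injs d N. \<integral>x. F (pt d m x) \<partial>blk.P)" .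
qed

section \<open>Enumerations of finite sets and symmetric functions of sets of points\<close>

definition Bij :: "nat \<Rightarrow> 'b set \<Rightarrow> (nat \<Rightarrow> 'b) set" where
  "Bij d A = {m \<in> {..<d} \<rightarrow>\<^sub>E A. bij_betw m {..<d} A}"

lemma bij_betw_restrict: "bij_betw (\<lambda>j\<in>{..<d}. g j) {..<d} A \<longleftrightarrow> bij_betw g {..<d} A"
  by (rule bij_betw_cong) auto

lemma permutes_bij_betw_Bij:
  assumes e: "bij_betw e {..<d} A"
  shows "bij_betw (\<lambda>p. \<lambda>j\<in>{..<d}. e (p j)) {p. p permutes {..<d}} (Bij d A)"
proof (rule bij_betw_byWitness[where f'="\<lambda>b j. if j < d then inv_into {..<d} e (b j) else j"])
  have inv: "inv_into {..<d} e (e j) = j" if "j < d" for j using e that by (simp add: bij_betw_inv_into_left)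
  show "\<forall>p\<in>{p. p permutes {..<d}}. (\<lambda>j. if j < d then inv_into {..<d} e ((\<lambda>j\<in>{..<d}. e (p j)) j) else j) = p"
  proof
    fix p assume "p \<in> {p. p permutes {..<d}}"
    then have p: "p permutes {..<d}" by simp
    show "(\<lambda>j. if j < d then inv_into {..<d} e ((\<lambda>j\<in>{..<d}. e (p j)) j) else j) = p"
      using inv permutes_in_image[OF p] permutes_not_in[OF p] by (auto simp: fun_eq_iff)
  qed
  show "\<forall>b\<in>Bij d A. (\<lambda>j\<in>{..<d}. e (if j < d then inv_into {..<d} e (b j) else j)) = b"
  proof
    fix b assume b: "b \<in> Bij d A"
    show "(\<lambda>j\<in>{..<d}. e (if j < d then inv_into {..<d} e (b j) else j)) = b"
    proof
      fix j
      show "(\<lambda>j\<in>{..<d}. e (if j < d then inv_into {..<d} e (b j) else j)) j = b j"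
      proof (cases "j < d")
        case True
        then have "b j \<in> A" using b by (auto simp: Bij_def)
        then show ?thesis using True e by (simp add: bij_betw_inv_into_right)
      qed (use b in \<open>auto simp: Bij_def PiE_iff extensional_def\<close>)
    qed
  qed
  show "(\<lambda>p. \<lambda>j\<in>{..<d}. e (p j)) ` {p. p permutes {..<d}} \<subseteq> Bij d A"
  proof
    fix b assume "b \<in> (\<lambda>p. \<lambda>j\<in>{..<d}. e (p j)) ` {p. p permutes {..<d}}"
    then obtain p where p: "p permutes {..<d}" "b = (\<lambda>j\<in>{..<d}. e (p j))" by auto
    have "bij_betw (e \<circ> p) {..<d} A" using bij_betw_trans[OF permutes_imp_bij[OF p(1)] e] .
    then have bb: "bij_betw b {..<d} A" unfolding p(2) bij_betw_restrict by (simp add: o_def)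
    then show "b \<in> Bij d A" using p(2) bij_betwE[OF bb] by (auto simp: Bij_def)
  qed
  show "(\<lambda>b j. if j < d then inv_into {..<d} e (b j) else j) ` Bij d A \<subseteq> {p. p permutes {..<d}}"
  proof
    fix p assume "p \<in> (\<lambda>b j. if j < d then inv_into {..<d} e (b j) else j) ` Bij d A"
    then obtain b where b: "b \<in> Bij d A" "p = (\<lambda>j. if j < d then inv_into {..<d} e (b j) else j)" by auto
    have "bij_betw (inv_into {..<d} e \<circ> b) {..<d} {..<d}"
      using b e by (intro bij_betw_trans[of b _ A] bij_betw_inv_into) (auto simp: Bij_def)
    then have "bij_betw p {..<d} {..<d}" by (rule bij_betw_cong[THEN iffD1, rotated]) (simp add: b(2))
    then show "p \<in> {p. p permutes {..<d}}" using bij_imp_permutes[of p "{..<d}"] by (auto simp: b(2))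
  qed
qed

lemma obtain_enum:
  assumes "finite A" "card A = d" obtains e where "bij_betw e {..<d} A"
  using ex_bij_betw_nat_finite[OF assms(1)] assms(2) by (auto simp: atLeast0LessThan)

lemma sum_permutes_Bij:
  assumes e: "bij_betw e {..<d} A"
  shows "(\<Sum>p | p permutes {..<d}. g (\<lambda>j\<in>{..<d}. e (p j))) = (\<Sum>b\<in>Bij d A. g b)"
  by (rule sum.reindex_bij_betw[OF permutes_bij_betw_Bij[OF e]])

lemma card_Bij:
  assumes "finite A" "card A = d" shows "card (Bij d A) = fact d" "finite (Bij d A)"
proof -
  obtain e where e: "bij_betw e {..<d} A" using obtain_enum[OF assms] .
  note b = permutes_bij_betw_Bij[OF e]
  show "card (Bij d A) = fact d" using bij_betw_same_card[OF b] by (simp add: card_permutations)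
  show "finite (Bij d A)" using bij_betw_finite[OF b] by (simp add: finite_permutations)
qed

text \<open>An injective tuple is the same as its image together with an enumeration of that
  image.\<close>

lemma sum_injs_sets:
  fixes g :: "(nat \<Rightarrow> nat) \<Rightarrow> 'c::comm_monoid_add"
  shows "(\<Sum>m\<in>injs d N. g m) = (\<Sum>A | A \<subseteq> {..<N} \<and> card A = d. \<Sum>m\<in>Bij d A. g m)"
proof -
  have fA: "finite A" if "A \<subseteq> {..<N}" for A using that by (rule finite_subset) simp
  have "injs d N = (\<Union>A\<in>{A. A \<subseteq> {..<N} \<and> card A = d}. Bij d A)"
  proof (rule set_eqI)
    fix m
    have "m \<in> injs d N \<longleftrightarrow> m ` {..<d} \<subseteq> {..<N} \<and> card (m ` {..<d}) = d \<and> m \<in> Bij d (m ` {..<d})"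
      by (auto simp: injs_def Bij_def PiE_iff bij_betw_def card_image)
    also have "\<dots> \<longleftrightarrow> m \<in> (\<Union>A\<in>{A. A \<subseteq> {..<N} \<and> card A = d}. Bij d A)"
      by (auto simp: Bij_def bij_betw_def)
    finally show "m \<in> injs d N \<longleftrightarrow> m \<in> (\<Union>A\<in>{A. A \<subseteq> {..<N} \<and> card A = d}. Bij d A)" .
  qed
  then have "(\<Sum>m\<in>injs d N. g m) = (\<Sum>m\<in>(\<Union>A\<in>{A. A \<subseteq> {..<N} \<and> card A = d}. Bij d A). g m)" by simp
  also have "\<dots> = (\<Sum>A | A \<subseteq> {..<N} \<and> card A = d. \<Sum>m\<in>Bij d A. g m)"
  proof (rule sum.UNION_disjoint)
    show "finite {A. A \<subseteq> {..<N} \<and> card A = d}" by (rule finite_subset[of _ "Pow {..<N}"]) auto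
    show "\<forall>A\<in>{A. A \<subseteq> {..<N} \<and> card A = d}. finite (Bij d A)" using fA card_Bij(2) by auto
    show "\<forall>A\<in>{A. A \<subseteq> {..<N} \<and> card A = d}. \<forall>A'\<in>{A. A \<subseteq> {..<N} \<and> card A = d}. A \<noteq> A' \<longrightarrow> Bij d A \<inter> Bij d A' = {}"
      by (auto simp: Bij_def bij_betw_def)
  qed
  finally show ?thesis .
qed

text \<open>\<open>sval n f \<rho> T\<close> is the value of a symmetric function at the family \<open>\<rho>\<close> indexed by an \<open>n\<close>-element set \<open>T\<close>.\<close>

definition sval :: "nat \<Rightarrow> ((nat \<Rightarrow> real) \<Rightarrow> real) \<Rightarrow> ('b \<Rightarrow> real) \<Rightarrow> 'b set \<Rightarrow> real" where
  "sval n f \<rho> T = f (pt n (SOME \<sigma>. bij_betw \<sigma> {..<n} T) \<rho>)"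

lemma some_enum: "finite T \<Longrightarrow> card T = n \<Longrightarrow> bij_betw (SOME \<sigma>. bij_betw \<sigma> {..<n} T) {..<n} T"
  using obtain_enum[of T n] by (intro someI_ex[of "\<lambda>\<sigma>. bij_betw \<sigma> {..<n} T"]) blast

lemma sval_eq:
  assumes f: "symmetric_fun n f" and \<sigma>: "bij_betw \<sigma> {..<n} T"
  shows "f (pt n \<sigma> \<rho>) = sval n f \<rho> T"
proof -
  define \<tau> where "\<tau> = (SOME \<sigma>. bij_betw \<sigma> {..<n} T)"
  have \<tau>: "bij_betw \<tau> {..<n} T" unfolding \<tau>_def by (rule someI[of "\<lambda>\<sigma>. bij_betw \<sigma> {..<n} T", OF \<sigma>])
  have "(\<lambda>j\<in>{..<n}. \<sigma> j) \<in> Bij n T" using \<sigma> by (auto simp: Bij_def bij_betw_restrict bij_betwE)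
  then obtain p where p: "p permutes {..<n}" "(\<lambda>j\<in>{..<n}. \<sigma> j) = (\<lambda>j\<in>{..<n}. \<tau> (p j))"
    using permutes_bij_betw_Bij[OF \<tau>] by (auto simp: bij_betw_def)
  have "pt n \<sigma> \<rho> = pt n \<tau> \<rho> \<circ> p"
  proof
    fix j
    show "pt n \<sigma> \<rho> j = (pt n \<tau> \<rho> \<circ> p) j"
    proof (cases "j < n")
      case True
      then have "\<sigma> j = \<tau> (p j)" using fun_cong[OF p(2), of j] by simp
      then show ?thesis using True permutes_in_image[OF p(1), of j] by (simp add: pt_def)
    next
      case False
      then show ?thesis using permutes_not_in[OF p(1), of j] by (simp add: pt_def)
    qed
  qed
  then show ?thesis using f p(1) by (simp add: symmetric_fun_def sval_def \<tau>_def)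
qed

text \<open>Symmetry allows labels to be renamed along any bijection, so later arguments need not
  track the order of the variables.\<close>

lemma sval_reindex:
  assumes f: "symmetric_fun n f" and T: "finite T" "card T = n" and \<psi>: "bij_betw \<psi> T T'"
  shows "sval n f \<rho> T' = sval n f (\<rho> \<circ> \<psi>) T"
proof -
  obtain \<sigma> where \<sigma>: "bij_betw \<sigma> {..<n} T" using obtain_enum[OF T] .
  have "sval n f \<rho> T' = f (pt n (\<psi> \<circ> \<sigma>) \<rho>)" using sval_eq[OF f bij_betw_trans[OF \<sigma> \<psi>]] by simp
  also have "\<dots> = f (pt n \<sigma> (\<rho> \<circ> \<psi>))" by (simp add: pt_def)
  also have "\<dots> = sval n f (\<rho> \<circ> \<psi>) T" by (rule sval_eq[OF f \<sigma>])
  finally show ?thesis .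
qed

lemma sval_cong:
  assumes T: "finite T" "card T = n" and e: "\<And>k. k \<in> T \<Longrightarrow> \<rho> k = \<rho>' k"
  shows "sval n f \<rho> T = sval n f \<rho>' T"
proof -
  have "pt n (SOME \<sigma>. bij_betw \<sigma> {..<n} T) \<rho> = pt n (SOME \<sigma>. bij_betw \<sigma> {..<n} T) \<rho>'"
    using bij_betwE[OF some_enum[OF T]] e by (auto simp: pt_def fun_eq_iff)
  then show ?thesis by (simp add: sval_def)
qed

lemma measurable_sval:
  assumes f: "f \<in> borel_measurable (\<Pi>\<^sub>M j\<in>{..<n}. leb_plus)" and T: "finite T" "card T = n"
    and \<rho>: "\<And>k. k \<in> T \<Longrightarrow> (\<lambda>x. \<rho> x k) \<in> borel_measurable M"
  shows "(\<lambda>x. sval n f (\<rho> x) T) \<in> borel_measurable M"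
  unfolding sval_def using bij_betwE[OF some_enum[OF T]] \<rho>
  by (intro measurable_compose[OF measurable_pt f]) auto

abbreviation Lb :: "nat \<Rightarrow> (nat \<Rightarrow> real) measure" where
  "Lb d \<equiv> \<Pi>\<^sub>M j\<in>{..<d}. leb_plus"

lemma sigma_finite_Lb: "sigma_finite_measure (Lb d)"
proof -
  interpret L: product_sigma_finite "\<lambda>_::nat. leb_plus" using sigma_finite_leb_plus by (simp add: product_sigma_finite_def)
  interpret F: finite_product_sigma_finite "\<lambda>_::nat. leb_plus" "{..<d}" by unfold_locales auto
  show ?thesis by (rule F.sigma_finite_measure_axioms)
qed

lemma space_Lb: "space (Lb d) = {..<d} \<rightarrow>\<^sub>E UNIV"
  by (simp add: space_PiM)

lemma measurable_component_Lb: "j < d \<Longrightarrow> (\<lambda>z. z j) \<in> borel_measurable (Lb d)"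
  using measurable_component_singleton[of j "{..<d}" "\<lambda>_. leb_plus"] by (simp add: measurable_cong_sets[OF refl sets_leb_plus])

definition conc :: "nat \<Rightarrow> nat \<Rightarrow> (nat \<Rightarrow> real) \<Rightarrow> (nat \<Rightarrow> real) \<Rightarrow> nat \<Rightarrow> real" where
  "conc p s z w = (\<lambda>j\<in>{..<p + s}. if j < p then z j else w (j - p))"

lemma measurable_conc:
  assumes "g \<in> N \<rightarrow>\<^sub>M Lb p" "h \<in> N \<rightarrow>\<^sub>M Lb s"
  shows "(\<lambda>x. conc p s (g x) (h x)) \<in> N \<rightarrow>\<^sub>M Lb (p + s)"
proof (rule measurable_PiM_leb_plus)
  fix j assume "j < p + s"
  then show "(\<lambda>x. conc p s (g x) (h x) j) \<in> borel_measurable N"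
    using measurable_compose[OF assms(1) measurable_component_Lb[of j]] measurable_compose[OF assms(2) measurable_component_Lb[of "j - p"]]
    by (cases "j < p") (auto simp: conc_def)
qed (simp add: conc_def)

lemma nn_integral_conc:
  "\<Phi> \<in> borel_measurable (Lb (p + s)) \<Longrightarrow>
   (\<integral>\<^sup>+ v. \<Phi> v \<partial>Lb (p + s)) = (\<integral>\<^sup>+ z. \<integral>\<^sup>+ w. \<Phi> (conc p s z w) \<partial>Lb s \<partial>Lb p)"
proof (induction p arbitrary: \<Phi>)
  case 0
  have "conc 0 s z w = w" if "w \<in> space (Lb s)" for z w
    using that by (auto simp: conc_def space_Lb PiE_iff extensional_def fun_eq_iff)
  then have "(\<integral>\<^sup>+ w. \<Phi> (conc 0 s z w) \<partial>Lb s) = (\<integral>\<^sup>+ w. \<Phi> w \<partial>Lb s)" for z by (intro nn_integral_cong) simp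
  then show ?case by (simp add: PiM_empty nn_integral_count_space_finite)
next
  case (Suc p)
  have \<Phi>: "\<Phi> \<in> borel_measurable (Lb (Suc (p + s)))" using Suc.prems by simp
  interpret S: sigma_finite_measure "Lb s" by (rule sigma_finite_Lb)
  have m1: "(\<lambda>v. \<Phi> (case_nat t v)) \<in> borel_measurable (Lb (p + s))" for t
    by (rule measurable_compose[OF measurable_case_nat_PiM[where M="\<lambda>_. leb_plus"] \<Phi>]) auto
  have "(\<lambda>q. \<Phi> (conc (Suc p) s (fst q) (snd q))) \<in> borel_measurable (Lb (Suc p) \<Otimes>\<^sub>M Lb s)"
    by (rule measurable_compose[OF measurable_conc Suc.prems]) auto
  from S.borel_measurable_nn_integral_fst[OF this]
  have m2: "(\<lambda>z. \<integral>\<^sup>+ w. \<Phi> (conc (Suc p) s z w) \<partial>Lb s) \<in> borel_measurable (Lb (Suc p))" by simp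
  have c: "case_nat t (conc p s z w) = conc (Suc p) s (case_nat t z) w" for t z w
  proof
    fix j show "case_nat t (conc p s z w) j = conc (Suc p) s (case_nat t z) w j"
      by (cases j) (auto simp: conc_def)
  qed
  have "(\<integral>\<^sup>+ v. \<Phi> v \<partial>Lb (Suc p + s)) = (\<integral>\<^sup>+ t. \<integral>\<^sup>+ v. \<Phi> (case_nat t v) \<partial>Lb (p + s) \<partial>leb_plus)"
    using nn_integral_case_nat[OF sigma_finite_leb_plus \<Phi>] by simp
  also have "\<dots> = (\<integral>\<^sup>+ t. \<integral>\<^sup>+ z. \<integral>\<^sup>+ w. \<Phi> (conc (Suc p) s (case_nat t z) w) \<partial>Lb s \<partial>Lb p \<partial>leb_plus)"
    by (simp add: Suc.IH[OF m1] c)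
  also have "\<dots> = (\<integral>\<^sup>+ z. \<integral>\<^sup>+ w. \<Phi> (conc (Suc p) s z w) \<partial>Lb s \<partial>Lb (Suc p))"
    by (rule nn_integral_case_nat[OF sigma_finite_leb_plus m2, symmetric])
  finally show ?case .
qed

lemma inj_bounded: assumes "inj_on (m::nat \<Rightarrow> nat) {..<d}"
  obtains N where "(\<lambda>j\<in>{..<d}. m j) \<in> injs d N"
proof (rule that[of "Suc (Max (insert 0 (m ` {..<d})))"])
  have "m j \<le> Max (insert 0 (m ` {..<d}))" if "j < d" for j using that by (intro Max_ge) auto
  moreover have "inj_on (\<lambda>j\<in>{..<d}. m j) {..<d}" using assms by (simp add: inj_on_def)
  ultimately show "(\<lambda>j\<in>{..<d}. m j) \<in> injs d (Suc (Max (insert 0 (m ` {..<d}))))"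
    by (auto simp: injs_def less_Suc_eq_le)
qed

lemma pt_restrict [simp]: "pt d (\<lambda>j\<in>{..<d}. m j) x = pt d m x"
  by (auto simp: pt_def)

text \<open>The left side is a single summand of the block decomposition of a large enough
  cube.\<close>

lemma nn_integral_pt_le:
  assumes m: "inj_on m {..<d}" and \<Phi>: "\<Phi> \<in> borel_measurable (Lb d)"
  shows "2 ^ d * (\<integral>\<^sup>+ x. \<Phi> (pt d m x) \<partial>blk.P) \<le> (\<integral>\<^sup>+ z. \<Phi> z \<partial>Lb d)"
proof -
  obtain N where N: "(\<lambda>j\<in>{..<d}. m j) \<in> injs d N" using inj_bounded[OF m] .
  have fin: "finite ({..<d} \<rightarrow>\<^sub>E {..<N})" by (auto intro: finite_PiE)
  have "(\<integral>\<^sup>+ x. \<Phi> (pt d m x) \<partial>blk.P) = (\<integral>\<^sup>+ x. \<Phi> (pt d (\<lambda>j\<in>{..<d}. m j) x) \<partial>blk.P)" by simp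
  also have "\<dots> = (\<integral>\<^sup>+ z. \<Phi> z \<partial>(\<Pi>\<^sub>M j\<in>{..<d}. blk ((\<lambda>j\<in>{..<d}. m j) j)))"
    using N by (intro nn_integral_pt[symmetric] \<Phi>) (simp only: injs_def mem_Collect_eq)
  also have "\<dots> \<le> (\<Sum>m\<in>{..<d} \<rightarrow>\<^sub>E {..<N}. \<integral>\<^sup>+ z. \<Phi> z \<partial>(\<Pi>\<^sub>M j\<in>{..<d}. blk (m j)))"
    using N by (intro member_le_sum[of "\<lambda>j\<in>{..<d}. m j" _ "\<lambda>m. \<integral>\<^sup>+ z. \<Phi> z \<partial>(\<Pi>\<^sub>M j\<in>{..<d}. blk (m j))"] fin) (auto simp: injs_def)
  finally have "2 ^ d * (\<integral>\<^sup>+ x. \<Phi> (pt d m x) \<partial>blk.P) \<le> 2 ^ d * (\<Sum>m\<in>{..<d} \<rightarrow>\<^sub>E {..<N}. \<integral>\<^sup>+ z. \<Phi> z \<partial>(\<Pi>\<^sub>M j\<in>{..<d}. blk (m j)))"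
    by (rule mult_left_mono) simp
  also have "\<dots> = (\<integral>\<^sup>+ z. indicator (trunc d N) z * \<Phi> z \<partial>Lb d)" by (rule nn_integral_PiM_truncated[OF \<Phi>, symmetric])
  also have "\<dots> \<le> (\<integral>\<^sup>+ z. \<Phi> z \<partial>Lb d)" by (intro nn_integral_mono) (auto simp: indicator_def)
  finally show ?thesis .
qed

lemma measurable_pt_P: "pt d m \<in> blk.P \<rightarrow>\<^sub>M Lb d"
  using measurable_pt[of d "\<lambda>x. x" m blk.P] by (simp add: blk.measurable_component_P)

text \<open>By \<open>nn_integral_pt_le\<close> the points of distinct blocks have a joint law that
  is absolutely continuous with respect to Lebesgue measure. In this way the almost everywhere
  centering condition reaches the random points.\<close>

lemma AE_pt:
  assumes R: "AE z in Lb d. R z" and m: "inj_on m {..<d}"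
  shows "AE x in blk.P. R (pt d m x)"
proof -
  obtain N where N: "\<And>z. z \<in> space (Lb d) - N \<Longrightarrow> R z" "N \<in> null_sets (Lb d)"
    by (rule AE_E3[OF R]) blast
  have Nm: "N \<in> sets (Lb d)" using N(2) by auto
  have "2 ^ d * (\<integral>\<^sup>+ x. indicator N (pt d m x) \<partial>blk.P) \<le> (\<integral>\<^sup>+ z. indicator N z \<partial>Lb d)"
    using Nm by (intro nn_integral_pt_le m) auto
  also have "\<dots> = 0" using nn_integral_indicator[OF Nm] null_setsD1[OF N(2)] by simp
  finally have "2 ^ d * (\<integral>\<^sup>+ x. indicator N (pt d m x) \<partial>blk.P) = 0" by simp
  then have "(\<integral>\<^sup>+ x. indicator N (pt d m x) \<partial>blk.P) = (0::ennreal)" by simp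
  moreover have "(\<lambda>x. indicator N (pt d m x) :: ennreal) \<in> borel_measurable blk.P"
    using Nm by (intro measurable_compose[OF measurable_pt_P]) auto
  ultimately have "AE x in blk.P. indicator N (pt d m x) = (0::ennreal)"
    by (subst (asm) nn_integral_0_iff_AE) auto
  then show ?thesis
  proof eventually_elim
    case (elim x)
    then have "pt d m x \<notin> N" by (auto simp: indicator_def split: if_splits)
    then show ?case using pt_in[of d m x] by (intro N(1)) (simp add: space_Lb)
  qed
qed

lemma AE_block: "AE x in blk.P. \<forall>k. 2 * real k < x k \<and> x k < 2 * real k + 2"
proof -
  have "AE x in blk.P. 2 * real k < x k \<and> x k < 2 * real k + 2" for k
    unfolding blk.P_def using AE_PiM_component[of UNIV blk k "\<lambda>t. 2 * real k < t \<and> t < 2 * real k + 2"] prob_space_blk AE_blk[of k] by auto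
  then show ?thesis by (simp add: AE_all_countable)
qed

lemma distr_component_P: "distr blk.P (blk i) (\<lambda>x. x i) = blk i"
  unfolding blk.P_def by (rule distr_PiM_component[OF prob_space_blk]) simp

lemma trunc_tendsto: "(\<lambda>m. indicator (trunc d m) z :: real) \<longlonglongrightarrow> 1"
proof (rule tendsto_eventually)
  obtain N :: nat where N: "Max (insert 0 (z ` {..<d})) < real N" using reals_Archimedean2 by blast
  have "z j < 2 * real m" if "m \<ge> N" "j < d" for m j
  proof -
    have "z j \<le> Max (insert 0 (z ` {..<d}))" using that by (intro Max_ge) auto
    moreover have "0 \<le> Max (insert 0 (z ` {..<d}))" by (intro Max_ge) auto
    ultimately show ?thesis using N that by linarith
  qed
  then show "\<forall>\<^sub>F m in sequentially. indicator (trunc d m) z = (1::real)"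
    by (auto simp: eventually_sequentially trunc_def indicator_def intro!: exI[of _ N])
qed

text \<open>The sum type keeps integrated variables and blocks apart, although both are numbered by
  natural numbers.\<close>

definition idx :: "nat \<Rightarrow> nat set \<Rightarrow> (nat + nat) set" where
  "idx p A = Inl ` {..<p} \<union> Inr ` A"

lemma finite_idx: "finite A \<Longrightarrow> finite (idx p A)"
  by (simp add: idx_def)

lemma card_idx: "finite A \<Longrightarrow> card (idx p A) = p + card A"
  unfolding idx_def by (subst card_Un_disjoint) (auto simp: card_image)

subsection \<open>Kernels\<close>

locale chaos_kernel =
  fixes n :: nat and f :: "(nat \<Rightarrow> real) \<Rightarrow> real"
  assumes n_pos: "n \<ge> 1" and L2hat: "L2hat n f" and centered: "centered n f"
begin

lemma f_measurable: "f \<in> borel_measurable (Lb n)" and f2_integrable: "integrable (Lb n) (\<lambda>x. (f x)\<^sup>2)"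
  and f_sym: "symmetric_fun n f" and f_van: "\<And>x. x \<in> {..<n} \<rightarrow>\<^sub>E UNIV \<Longrightarrow> x \<notin> Delta n \<Longrightarrow> f x = 0"
  using L2hat by (auto simp: L2hat_def L2_def)

definition u :: "nat set \<Rightarrow> (nat \<Rightarrow> real) \<Rightarrow> real" where
  "u A x = fact n * sval n f x A"

lemma u_pt: "bij_betw \<sigma> {..<n} A \<Longrightarrow> u A x = fact n * f (pt n \<sigma> x)"
  by (simp add: u_def sval_eq[OF f_sym])

lemma u_measurable: "finite A \<Longrightarrow> card A = n \<Longrightarrow> u A \<in> borel_measurable blk.P"
  unfolding u_def[abs_def]
  by (intro borel_measurable_times borel_measurable_const measurable_sval[OF f_measurable]) (auto simp: blk.measurable_component_P)

lemma u_dep: assumes "finite A" "card A = n" shows "blk.dep A (u A)"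
  unfolding blk.dep_def u_def
  by (intro allI impI arg_cong[where f="\<lambda>t. fact n * t"] sval_cong[OF assms]) auto

lemma u_sqi: assumes "finite A" "card A = n" shows "blk.sqi (u A)"
proof -
  obtain e where e: "bij_betw e {..<n} A" using obtain_enum[OF assms] .
  have "inj_on e {..<n}" using e by (simp add: bij_betw_def)
  then obtain N where N: "(\<lambda>j\<in>{..<n}. e j) \<in> injs n N" by (rule inj_bounded)
  have "integrable blk.P (\<lambda>x. (f (pt n (\<lambda>j\<in>{..<n}. e j) x))\<^sup>2)"
    using f_van by (intro integral_trunc_injs(1)[OF f2_integrable _ N]) auto
  then show ?thesis using u_measurable[OF assms] unfolding blk.sqi_def
    by (simp add: u_pt[OF e] power_mult_distrib)
qed

text \<open>By symmetry an enumeration of \<open>A\<close> with \<open>i\<close> in first place may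
  be chosen, since the centering condition speaks of the first variable. The average over x_i is
  then half the integral over the block.\<close>

lemma u_centered: assumes "finite A" "card A = n" "i \<in> A" shows "AE x in blk.P. blk.Ex {i} (u A) x = 0"
proof -
  have "finite (A - {i})" "card (A - {i}) = n - 1" using assms by auto
  then obtain e where e: "bij_betw e {..<n - 1} (A - {i})" by (rule obtain_enum)
  have n: "n = Suc (n - 1)" using n_pos by simp
  have \<sigma>: "bij_betw (case_nat i e) {..<n} A"
  proof -
    have 1: "bij_betw (case_nat i e) {0} {i}" by (simp add: bij_betw_def)
    have 2: "bij_betw (case_nat i e) (Suc ` {..<n - 1}) (A - {i})"
    proof -
      have "bij_betw (\<lambda>j. j - 1) (Suc ` {..<n - 1}) {..<n - 1}" by (rule bij_betw_byWitness[where f'=Suc]) auto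
      from bij_betw_trans[OF this e] show ?thesis by (rule bij_betw_cong[THEN iffD1, rotated]) auto
    qed
    have "{0} \<union> Suc ` {..<n - 1} = {..<n}" using n lessThan_Suc_eq_insert_0[of "n - 1"] by simp
    moreover have "{i} \<union> (A - {i}) = A" using assms(3) by auto
    ultimately show ?thesis using bij_betw_combine[OF 1 2] by auto
  qed
  have inj: "inj_on e {..<n - 1}" using e by (simp add: bij_betw_def)
  have "AE y in Lb (n - 1). (LBINT t:{2 * real i .. 2 * real i + 2}. f (case_nat t y)) = 0"
    using centered by (simp add: centered_def)
  from AE_pt[OF this inj] show ?thesis
  proof eventually_elim
    case (elim x)
    define w where "w = pt (n - 1) e x"
    have "pt n (case_nat i e) (override_on x y {i}) = case_nat (y i) w" for y
    proof
      fix j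
      show "pt n (case_nat i e) (override_on x y {i}) j = case_nat (y i) w j"
      proof (cases j)
        case 0 then show ?thesis using n_pos by (simp add: pt_def)
      next
        case (Suc j')
        have "e j' \<noteq> i" if "j' < n - 1" using bij_betwE[OF e] that by auto
        then show ?thesis using Suc n_pos by (auto simp: pt_def w_def)
      qed
    qed
    then have "blk.Ex {i} (u A) x = (\<integral>y. fact n * f (case_nat (y i) w) \<partial>blk.P)"
      by (simp add: blk.Ex_def u_pt[OF \<sigma>])
    also have "\<dots> = fact n * (\<integral>y. f (case_nat (y i) w) \<partial>blk.P)" by simp
    also have "(\<integral>y. f (case_nat (y i) w) \<partial>blk.P) = (\<integral>t. f (case_nat t w) \<partial>distr blk.P (blk i) (\<lambda>y. y i))"
    proof (rule integral_distr[symmetric])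
      show "(\<lambda>y. y i) \<in> blk.P \<rightarrow>\<^sub>M blk i"
        using blk.measurable_component_P[of i] by (simp add: measurable_cong_sets[OF refl sets_blk])
      have w: "w \<in> space (Lb (n - 1))" by (simp add: w_def space_Lb)
      have fm: "f \<in> borel_measurable (Lb (Suc (n - 1)))" using f_measurable n by simp
      have "(\<lambda>t. f (case_nat t w)) \<in> borel_measurable leb_plus"
        by (rule measurable_compose[OF measurable_case_nat_PiM[where M="\<lambda>_. leb_plus"] fm]) (use w in auto)
      then show "(\<lambda>t. f (case_nat t w)) \<in> borel_measurable (blk i)"
        by (simp add: measurable_cong_sets[OF sets_blk refl] measurable_cong_sets[OF sets_leb_plus refl])
    qed
    also have "\<dots> = (\<integral>t. f (case_nat t w) \<partial>blk i)" by (simp add: distr_component_P)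
    also have "\<dots> = (LBINT t:{2 * real i .. 2 * real i + 2}. f (case_nat t w)) / 2"
    proof -
      have fm: "f \<in> borel_measurable (Lb (Suc (n - 1)))" using f_measurable n by simp
      have w: "w \<in> space (Lb (n - 1))" by (simp add: w_def space_Lb)
      have "(\<lambda>t. f (case_nat t w)) \<in> borel_measurable leb_plus"
        by (rule measurable_compose[OF measurable_case_nat_PiM[where M="\<lambda>_. leb_plus"] fm]) (use w in auto)
      then have m [measurable]: "(\<lambda>t. f (case_nat t w)) \<in> borel_measurable lborel"
        by (simp add: measurable_cong_sets[OF sets_leb_plus refl])
      have "blk i = density lborel (\<lambda>t. ennreal (indicator {2 * real i .. 2 * real i + 2} t / 2))"
        unfolding blk_def uniform_measure_def emeasure_blk_base
        by (intro density_cong) (auto simp: indicator_def divide_ennreal[symmetric])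
      then have "(\<integral>t. f (case_nat t w) \<partial>blk i) = (\<integral>t. (indicator {2 * real i .. 2 * real i + 2} t / 2) *\<^sub>R f (case_nat t w) \<partial>lborel)"
        using integral_density[OF m, of "\<lambda>t. indicator {2 * real i .. 2 * real i + 2} t / 2"] by simp
      also have "\<dots> = (LBINT t:{2 * real i .. 2 * real i + 2}. f (case_nat t w)) / 2"
        unfolding set_lebesgue_integral_def by simp
      finally show ?thesis .
    qed
    finally show ?case using elim by (simp add: w_def)
  qed
qed

sublocale hoeffding_family blk u n
  using u_sqi u_dep u_centered n_pos by unfold_locales auto

end

context chaos_kernel
begin

text \<open>The value n! times the squared norm of the kernel for dx/2, which is the variance of the
  stochastic integral.\<close>

definition aL :: real where "aL = fact n * (1 / 2 ^ n) * (\<integral>x. (f x)\<^sup>2 \<partial>Lb n)"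

lemma fam_lessThan: "fam {..<N} = {A. A \<subseteq> {..<N} \<and> card A = n}"
  by (auto simp: fam_def intro: finite_subset)

text \<open>Every set has n! enumerations while \<open>u_norm\<close> carries the factor (n!)^2; one
  n! remains.\<close>

lemma a_eq: "a {..<N} = fact n * (1 / 2 ^ n) * (\<integral>x. indicator (trunc n N) x * (f x)\<^sup>2 \<partial>Lb n)"
proof -
  have "(\<integral>x. indicator (trunc n N) x * (f x)\<^sup>2 \<partial>Lb n) = 2 ^ n * (\<Sum>m\<in>injs n N. \<integral>x. (f (pt n m x))\<^sup>2 \<partial>blk.P)"
    using f_van by (intro integral_trunc_injs(2)[OF f2_integrable]) auto
  also have "(\<Sum>m\<in>injs n N. \<integral>x. (f (pt n m x))\<^sup>2 \<partial>blk.P) = (\<Sum>A\<in>fam {..<N}. \<Sum>m\<in>Bij n A. \<integral>x. (f (pt n m x))\<^sup>2 \<partial>blk.P)"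
    by (simp add: sum_injs_sets fam_lessThan)
  also have "\<dots> = (\<Sum>A\<in>fam {..<N}. u_norm A / fact n)"
  proof (rule sum.cong)
    fix A assume A: "A \<in> fam {..<N}"
    have "(\<integral>x. (f (pt n m x))\<^sup>2 \<partial>blk.P) = u_norm A / (fact n)\<^sup>2" if "m \<in> Bij n A" for m
      using that by (simp add: u_norm_def u_pt[of m A] Bij_def power_mult_distrib)
    then have "(\<Sum>m\<in>Bij n A. \<integral>x. (f (pt n m x))\<^sup>2 \<partial>blk.P) = fact n * (u_norm A / (fact n)\<^sup>2)"
      using card_Bij(1)[OF famD(1,2)[OF A]] by simp
    then show "(\<Sum>m\<in>Bij n A. \<integral>x. (f (pt n m x))\<^sup>2 \<partial>blk.P) = u_norm A / fact n"
      by (simp add: power2_eq_square)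
  qed simp
  also have "\<dots> = a {..<N} / fact n" by (simp add: a_def sum_divide_distrib)
  finally show ?thesis by simp
qed

lemma integral_trunc_tendsto:
  fixes g :: "(nat \<Rightarrow> real) \<Rightarrow> real"
  assumes "integrable (Lb d) g"
  shows "(\<lambda>m. \<integral>x. indicator (trunc d m) x * g x \<partial>Lb d) \<longlonglongrightarrow> (\<integral>x. g x \<partial>Lb d)"
proof (rule integral_dominated_convergence[where w="\<lambda>x. norm (g x)"])
  show "AE x in Lb d. (\<lambda>m. indicator (trunc d m) x * g x) \<longlonglongrightarrow> g x"
    using tendsto_mult_right[OF trunc_tendsto] by (intro AE_I2) fastforce
  show "(\<lambda>x. indicator (trunc d m) x * g x) \<in> borel_measurable (Lb d)" for m
    using assms by (intro borel_measurable_times[OF measurable_indicator_trunc]) auto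
qed (use assms in \<open>auto simp: indicator_def\<close>)

lemma a_lim: "(\<lambda>m. a {..<m}) \<longlonglongrightarrow> aL"
  unfolding a_eq aL_def by (intro tendsto_mult_left integral_trunc_tendsto f2_integrable)

text \<open>The kernel with \<open>p\<close> arguments \<open>z\<close> to be integrated (tagged \<open>Inl\<close>) and the others at the points of the blocks in \<open>A\<close>.\<close>

definition ker :: "nat \<Rightarrow> nat set \<Rightarrow> (nat \<Rightarrow> real) \<Rightarrow> (nat \<Rightarrow> real) \<Rightarrow> real" where
  "ker p A z x = sval n f (case_sum z x) (idx p A)"

lemma sval_nonzero:
  assumes T: "finite T" "card T = n" and nz: "sval n f \<rho> T \<noteq> 0"
  obtains \<kappa> :: "'b \<Rightarrow> nat" where "inj_on \<kappa> T" "\<And>k. k \<in> T \<Longrightarrow> 2 * real (\<kappa> k) \<le> \<rho> k \<and> \<rho> k \<le> 2 * real (\<kappa> k) + 2"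
proof -
  obtain \<sigma> where \<sigma>: "bij_betw \<sigma> {..<n} T" using obtain_enum[OF T] .
  have "f (pt n \<sigma> \<rho>) \<noteq> 0" using nz sval_eq[OF f_sym \<sigma>] by simp
  then have "pt n \<sigma> \<rho> \<in> Delta n" using f_van pt_in by blast
  then obtain k :: "nat \<Rightarrow> nat" where k: "inj_on k {..<n}" "\<And>j. j < n \<Longrightarrow> 2 * real (k j) \<le> \<rho> (\<sigma> j) \<and> \<rho> (\<sigma> j) \<le> 2 * real (k j) + 2"
    by (auto simp: Delta_def PiE_iff pt_def)
  define \<tau> where "\<tau> = inv_into {..<n} \<sigma>"
  have \<tau>: "bij_betw \<tau> T {..<n}" unfolding \<tau>_def using \<sigma> by (rule bij_betw_inv_into)
  have "inj_on (k \<circ> \<tau>) T" using \<tau> k(1) by (auto simp: bij_betw_def intro: comp_inj_on)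
  moreover have "2 * real ((k \<circ> \<tau>) t) \<le> \<rho> t \<and> \<rho> t \<le> 2 * real ((k \<circ> \<tau>) t) + 2" if t: "t \<in> T" for t
  proof -
    have "\<tau> t < n" using bij_betwE[OF \<tau>] t by auto
    moreover have "\<sigma> (\<tau> t) = t" unfolding \<tau>_def using \<sigma> t by (rule bij_betw_inv_into_right)
    ultimately show ?thesis using k(2)[of "\<tau> t"] by simp
  qed
  ultimately show ?thesis by (rule that)
qed

text \<open>A point in the interior of a block belongs to no other closed block, so two arguments in
  one block contradict distinctness of the block indices.\<close>

lemma sval_same_block:
  assumes T: "finite T" "card T = n" and k: "k \<in> T" "k' \<in> T" "k \<noteq> k'"
    and b: "2 * real b < \<rho> k" "\<rho> k < 2 * real b + 2" "2 * real b < \<rho> k'" "\<rho> k' < 2 * real b + 2"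
  shows "sval n f \<rho> T = 0"
proof (rule ccontr)
  assume "sval n f \<rho> T \<noteq> 0"
  from sval_nonzero[OF T this] obtain \<kappa> where \<kappa>: "inj_on \<kappa> T" "\<And>k. k \<in> T \<Longrightarrow> 2 * real (\<kappa> k) \<le> \<rho> k \<and> \<rho> k \<le> 2 * real (\<kappa> k) + 2"
    by blast
  have "real (\<kappa> k) < real b + 1" "real b < real (\<kappa> k) + 1" "real (\<kappa> k') < real b + 1" "real b < real (\<kappa> k') + 1"
    using \<kappa>(2)[OF k(1)] \<kappa>(2)[OF k(2)] b by linarith+
  then have "\<kappa> k = b" "\<kappa> k' = b" by linarith+
  then have "\<kappa> k = \<kappa> k'" by simp
  then show False using inj_onD[OF \<kappa>(1) _ k(1,2)] k(3) by blast
qed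

context
  fixes p :: nat and A :: "nat set"
  assumes A: "finite A" and pA: "p + card A = n"
begin

lemma idxA: "finite (idx p A)" "card (idx p A) = n"
  using A pA by (auto simp: finite_idx card_idx)

lemma ker_van: assumes "z \<in> {..<p} \<rightarrow>\<^sub>E UNIV" "z \<notin> Delta p" shows "ker p A z x = 0"
proof (rule ccontr)
  assume "ker p A z x \<noteq> 0"
  then have "sval n f (case_sum z x) (idx p A) \<noteq> 0" by (simp add: ker_def)
  from sval_nonzero[OF idxA this] obtain \<kappa> where \<kappa>: "inj_on \<kappa> (idx p A)" "\<And>k. k \<in> idx p A \<Longrightarrow> 2 * real (\<kappa> k) \<le> case_sum z x k \<and> case_sum z x k \<le> 2 * real (\<kappa> k) + 2"
    by blast
  have i: "Inl j \<in> idx p A" if "j < p" for j using that by (simp add: idx_def)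
  have inj: "inj_on (\<lambda>j. \<kappa> (Inl j)) {..<p}"
  proof (rule inj_onI)
    fix j j' assume "j \<in> {..<p}" "j' \<in> {..<p}" "\<kappa> (Inl j) = \<kappa> (Inl j')"
    then have "(Inl j :: nat + nat) = Inl j'" using inj_onD[OF \<kappa>(1)] i by blast
    then show "j = j'" by simp
  qed
  have "z \<in> Delta p" using \<kappa>(2)[OF i] by (intro in_Delta[OF _ inj assms(1)]) simp
  then show False using assms(2) by simp
qed

lemma ker_measurable: "(\<lambda>q. ker p A (snd q) (fst q)) \<in> borel_measurable (blk.P \<Otimes>\<^sub>M Lb p)"
  unfolding ker_def
proof (rule measurable_sval[OF f_measurable idxA])
  fix k assume "k \<in> idx p A"
  then consider j where "k = Inl j" "j < p" | a where "k = Inr a" by (auto simp: idx_def)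
  then show "(\<lambda>q. case_sum (snd q) (fst q) k) \<in> borel_measurable (blk.P \<Otimes>\<^sub>M Lb p)"
  proof cases
    case 1
    then show ?thesis using measurable_compose[OF measurable_snd measurable_component_Lb[of j p]] by simp
  next
    case 2
    then show ?thesis using measurable_compose[OF measurable_fst blk.measurable_component_P[of a]] by simp
  qed
qed

text \<open>For fixed integrated variables, the average over the block points is bounded by an
  integral over the remaining variables; Tonelli then reassembles the squared norm of the
  kernel.\<close>

lemma ker_square_integrable: "integrable (blk.P \<Otimes>\<^sub>M Lb p) (\<lambda>q. (ker p A (snd q) (fst q))\<^sup>2)"
proof -
  define s where "s = card A"
  obtain e where e: "bij_betw e {..<s} A" using obtain_enum[OF A] by (auto simp: s_def)
  have n: "n = p + s" using pA by (simp add: s_def)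
  interpret Lp: sigma_finite_measure "Lb p" by (rule sigma_finite_Lb)
  interpret PL: pair_sigma_finite blk.P "Lb p" ..
  have \<sigma>: "bij_betw (\<lambda>j. if j < p then Inl j else Inr (e (j - p))) {..<n} (idx p A)"
  proof -
    have 1: "bij_betw (\<lambda>j. if j < p then Inl j else Inr (e (j - p))) {..<p} (Inl ` {..<p})"
      by (rule bij_betw_cong[THEN iffD1, of _ Inl]) (auto simp: bij_betw_def)
    have "bij_betw (\<lambda>j. j - p) {p..<p + s} {..<s}" by (rule bij_betw_byWitness[where f'="\<lambda>j. j + p"]) auto
    moreover have "bij_betw Inr A (Inr ` A)" by (simp add: bij_betw_def)
    ultimately have "bij_betw (Inr \<circ> (e \<circ> (\<lambda>j. j - p))) {p..<p + s} (Inr ` A)"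
      using e by (metis bij_betw_trans)
    then have 2: "bij_betw (\<lambda>j. if j < p then Inl j else Inr (e (j - p))) {p..<p + s} (Inr ` A)"
      by (rule bij_betw_cong[THEN iffD1, rotated]) auto
    have "{..<p} \<union> {p..<p + s} = {..<n}" using n by auto
    then show ?thesis using bij_betw_combine[OF 1 2] unfolding idx_def by auto
  qed
  have pc: "pt n (\<lambda>j. if j < p then Inl j else Inr (e (j - p))) (case_sum z x) = conc p s z (pt s e x)" for z x
    by (auto simp: pt_def conc_def n fun_eq_iff)
  have kf: "ker p A z x = f (conc p s z (pt s e x))" for z x
    unfolding ker_def sval_eq[OF f_sym \<sigma>, symmetric] pc ..
  have m: "(\<lambda>q. ennreal ((ker p A (snd q) (fst q))\<^sup>2)) \<in> borel_measurable (blk.P \<Otimes>\<^sub>M Lb p)"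
    using ker_measurable by simp
  have fm: "f \<in> borel_measurable (Lb (p + s))" using f_measurable n by simp
  have fcm: "(\<lambda>w. ennreal ((f (conc p s z w))\<^sup>2)) \<in> borel_measurable (Lb s)" if "z \<in> space (Lb p)" for z
    using measurable_compose[OF measurable_conc[OF measurable_const[OF that] measurable_ident] fm] by simp
  have "2 ^ s * (\<integral>\<^sup>+ q. ennreal ((ker p A (snd q) (fst q))\<^sup>2) \<partial>(blk.P \<Otimes>\<^sub>M Lb p))
      = 2 ^ s * (\<integral>\<^sup>+ z. \<integral>\<^sup>+ x. ennreal ((ker p A z x)\<^sup>2) \<partial>blk.P \<partial>Lb p)"
    by (subst PL.nn_integral_snd[symmetric]) (use m in \<open>auto simp: split_def\<close>)
  also have "\<dots> = (\<integral>\<^sup>+ z. 2 ^ s * (\<integral>\<^sup>+ x. ennreal ((ker p A z x)\<^sup>2) \<partial>blk.P) \<partial>Lb p)"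
  proof (rule nn_integral_cmult[symmetric])
    have "(\<lambda>q. ennreal ((ker p A (fst q) (snd q))\<^sup>2)) \<in> borel_measurable (Lb p \<Otimes>\<^sub>M blk.P)"
      using measurable_compose[OF measurable_pair_swap' m] by (simp add: split_def)
    from blk.P.borel_measurable_nn_integral_fst[OF this]
    show "(\<lambda>z. \<integral>\<^sup>+ x. ennreal ((ker p A z x)\<^sup>2) \<partial>blk.P) \<in> borel_measurable (Lb p)" by simp
  qed
  also have "\<dots> \<le> (\<integral>\<^sup>+ z. \<integral>\<^sup>+ w. ennreal ((f (conc p s z w))\<^sup>2) \<partial>Lb s \<partial>Lb p)"
  proof (rule nn_integral_mono)
    fix z assume "z \<in> space (Lb p)"
    then show "2 ^ s * (\<integral>\<^sup>+ x. ennreal ((ker p A z x)\<^sup>2) \<partial>blk.P) \<le> (\<integral>\<^sup>+ w. ennreal ((f (conc p s z w))\<^sup>2) \<partial>Lb s)"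
      unfolding kf using nn_integral_pt_le[OF _ fcm, of e z] e by (simp add: bij_betw_def)
  qed
  also have "\<dots> = (\<integral>\<^sup>+ v. ennreal ((f v)\<^sup>2) \<partial>Lb (p + s))"
    using fm by (intro nn_integral_conc[symmetric]) simp
  also have "\<dots> < \<infinity>" using f2_integrable n by (simp add: integrable_iff_bounded)
  finally have "(\<integral>\<^sup>+ q. ennreal ((ker p A (snd q) (fst q))\<^sup>2) \<partial>(blk.P \<Otimes>\<^sub>M Lb p)) < \<infinity>"
    by (auto simp: ennreal_mult_less_top)
  then show ?thesis using ker_measurable by (intro integrableI_bounded) auto
qed

end

context
  fixes p :: nat and A A' :: "nat set"
  assumes A: "finite A" "finite A'" and pA: "p + card A = n" "p + card A' = n"
begin

lemma ker_mult_integrable: "integrable (blk.P \<Otimes>\<^sub>M Lb p) (\<lambda>q. ker p A (snd q) (fst q) * ker p A' (snd q) (fst q))"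
proof (rule Bochner_Integration.integrable_bound)
  show "integrable (blk.P \<Otimes>\<^sub>M Lb p) (\<lambda>q. (ker p A (snd q) (fst q))\<^sup>2 + (ker p A' (snd q) (fst q))\<^sup>2)"
    using A pA by (intro Bochner_Integration.integrable_add ker_square_integrable)
  show "(\<lambda>q. ker p A (snd q) (fst q) * ker p A' (snd q) (fst q)) \<in> borel_measurable (blk.P \<Otimes>\<^sub>M Lb p)"
    using A pA by (intro borel_measurable_times ker_measurable)
  have "\<bar>a * b\<bar> \<le> a\<^sup>2 + b\<^sup>2" for a b :: real
    using sum_squares_bound[of "\<bar>a\<bar>" "\<bar>b\<bar>"] mult_nonneg_nonneg[of "\<bar>a\<bar>" "\<bar>b\<bar>"]
    unfolding abs_mult power2_abs by linarith
  then show "AE q in blk.P \<Otimes>\<^sub>M Lb p. norm (ker p A (snd q) (fst q) * ker p A' (snd q) (fst q)) \<le> norm ((ker p A (snd q) (fst q))\<^sup>2 + (ker p A' (snd q) (fst q))\<^sup>2)"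
    by simp
qed

lemma AE_ker_mult_integrable: "AE x in blk.P. integrable (Lb p) (\<lambda>z. ker p A z x * ker p A' z x)"
proof -
  interpret Lp: sigma_finite_measure "Lb p" by (rule sigma_finite_Lb)
  interpret PL: pair_sigma_finite blk.P "Lb p" ..
  show ?thesis using PL.AE_integrable_fst[of "\<lambda>x z. ker p A z x * ker p A' z x"] ker_mult_integrable by (simp add: split_def)
qed

text \<open>The contraction of two kernels in \<open>p\<close> variables with the other arguments at
  block points. Restricting the integration to the first \<open>m\<close> blocks corresponds to
  choosing the \<open>p\<close> shared blocks among these.\<close>

definition W :: "nat \<Rightarrow> (nat \<Rightarrow> real) \<Rightarrow> real" where
  "W m x = 1 / 2 ^ p * (\<integral>z. indicator (trunc p m) z * (ker p A z x * ker p A' z x) \<partial>Lb p)"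

definition Winf :: "(nat \<Rightarrow> real) \<Rightarrow> real" where
  "Winf x = 1 / 2 ^ p * (\<integral>z. ker p A z x * ker p A' z x \<partial>Lb p)"

lemma trunc_ker_mult_integrable: "integrable (blk.P \<Otimes>\<^sub>M Lb p) (\<lambda>q. indicator (trunc p m) (snd q) * (ker p A (snd q) (fst q) * ker p A' (snd q) (fst q)))"
proof (rule Bochner_Integration.integrable_bound[OF ker_mult_integrable])
  show "(\<lambda>q. indicator (trunc p m) (snd q) * (ker p A (snd q) (fst q) * ker p A' (snd q) (fst q))) \<in> borel_measurable (blk.P \<Otimes>\<^sub>M Lb p)"
    using borel_measurable_integrable[OF ker_mult_integrable]
    by (intro borel_measurable_times[OF measurable_compose[OF measurable_snd measurable_indicator_trunc]])
qed (auto simp: indicator_def)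

lemma W_integrable: "integrable blk.P (W m)" and Winf_integrable: "integrable blk.P Winf"
proof -
  interpret Lp: sigma_finite_measure "Lb p" by (rule sigma_finite_Lb)
  interpret PL: pair_sigma_finite blk.P "Lb p" ..
  show "integrable blk.P (W m)" unfolding W_def[abs_def]
    using PL.integrable_fst[of "\<lambda>x z. indicator (trunc p m) z * (ker p A z x * ker p A' z x)"] trunc_ker_mult_integrable[of m] by (simp add: split_def)
  show "integrable blk.P Winf" unfolding Winf_def[abs_def]
    using PL.integrable_fst[of "\<lambda>x z. ker p A z x * ker p A' z x"] ker_mult_integrable by (simp add: split_def)
qed

text \<open>The truncation error is dominated by the product of the two kernels, which is integrable
  jointly in the block points and the contracted variables.\<close>

lemma W_tendsto: "(\<lambda>m. \<integral>x. \<bar>W m x - Winf x\<bar> \<partial>blk.P) \<longlonglongrightarrow> 0"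
proof (rule tendsto_sandwich[OF always_eventually always_eventually])
  interpret Lp: sigma_finite_measure "Lb p" by (rule sigma_finite_Lb)
  interpret PL: pair_sigma_finite blk.P "Lb p" ..
  define k where "k q = ker p A (snd q) (fst q) * ker p A' (snd q) (fst q)" for q
  define r where "r m q = \<bar>indicator (trunc p m) (snd q) * k q - k q\<bar>" for m q
  have ki: "integrable (blk.P \<Otimes>\<^sub>M Lb p) k" unfolding k_def[abs_def] by (rule ker_mult_integrable)
  have ri: "integrable (blk.P \<Otimes>\<^sub>M Lb p) (r m)" for m
    unfolding r_def[abs_def] using trunc_ker_mult_integrable[of m] ki by (intro integrable_abs Bochner_Integration.integrable_diff) (simp_all add: k_def[abs_def])
  show "\<forall>m. 0 \<le> (\<integral>x. \<bar>W m x - Winf x\<bar> \<partial>blk.P)" by simp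
  show "\<forall>m. (\<integral>x. \<bar>W m x - Winf x\<bar> \<partial>blk.P) \<le> 1 / 2 ^ p * (\<integral>q. r m q \<partial>(blk.P \<Otimes>\<^sub>M Lb p))"
  proof
    fix m
    have rx: "integrable blk.P (\<lambda>x. \<integral>z. r m (x, z) \<partial>Lb p)" using PL.integrable_fst[of "\<lambda>x z. r m (x, z)"] ri[of m] by simp
    have "(\<integral>x. \<bar>W m x - Winf x\<bar> \<partial>blk.P) \<le> (\<integral>x. 1 / 2 ^ p * (\<integral>z. r m (x, z) \<partial>Lb p) \<partial>blk.P)"
    proof (rule integral_mono_AE)
      show "integrable blk.P (\<lambda>x. \<bar>W m x - Winf x\<bar>)" using W_integrable Winf_integrable by simp
      show "integrable blk.P (\<lambda>x. 1 / 2 ^ p * (\<integral>z. r m (x, z) \<partial>Lb p))" using rx by simp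
      have "AE x in blk.P. integrable (Lb p) (\<lambda>z. indicator (trunc p m) z * (ker p A z x * ker p A' z x))"
        using PL.AE_integrable_fst[of "\<lambda>x z. indicator (trunc p m) z * (ker p A z x * ker p A' z x)"] trunc_ker_mult_integrable[of m] by (simp add: split_def)
      then show "AE x in blk.P. \<bar>W m x - Winf x\<bar> \<le> 1 / 2 ^ p * (\<integral>z. r m (x, z) \<partial>Lb p)"
        using AE_ker_mult_integrable
      proof eventually_elim
        case (elim x)
        have "W m x - Winf x = 1 / 2 ^ p * (\<integral>z. indicator (trunc p m) z * (ker p A z x * ker p A' z x) - ker p A z x * ker p A' z x \<partial>Lb p)"
          unfolding W_def Winf_def using elim by (simp add: right_diff_distrib)
        then have "\<bar>W m x - Winf x\<bar> = 1 / 2 ^ p * \<bar>\<integral>z. indicator (trunc p m) z * (ker p A z x * ker p A' z x) - ker p A z x * ker p A' z x \<partial>Lb p\<bar>"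
          by (simp add: abs_mult)
        also have "\<dots> \<le> 1 / 2 ^ p * (\<integral>z. r m (x, z) \<partial>Lb p)"
          unfolding r_def k_def by (intro mult_left_mono) (auto intro: integral_abs_bound)
        finally show ?case .
      qed
    qed
    also have "\<dots> = 1 / 2 ^ p * (\<integral>q. r m q \<partial>(blk.P \<Otimes>\<^sub>M Lb p))"
      using PL.integral_fst[of "\<lambda>x z. r m (x, z)"] ri[of m] by simp
    finally show "(\<integral>x. \<bar>W m x - Winf x\<bar> \<partial>blk.P) \<le> 1 / 2 ^ p * (\<integral>q. r m q \<partial>(blk.P \<Otimes>\<^sub>M Lb p))" .
  qed
  have "(\<lambda>m. \<integral>q. r m q \<partial>(blk.P \<Otimes>\<^sub>M Lb p)) \<longlonglongrightarrow> (\<integral>q. 0 \<partial>(blk.P \<Otimes>\<^sub>M Lb p))"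
  proof (rule integral_dominated_convergence[where w="\<lambda>q. norm (k q)"])
    show "AE q in blk.P \<Otimes>\<^sub>M Lb p. (\<lambda>m. r m q) \<longlonglongrightarrow> 0"
    proof (rule AE_I2)
      fix q
      have "(\<lambda>m. \<bar>indicator (trunc p m) (snd q) * k q - k q\<bar>) \<longlonglongrightarrow> \<bar>1 * k q - k q\<bar>"
        by (intro tendsto_intros trunc_tendsto)
      then show "(\<lambda>m. r m q) \<longlonglongrightarrow> 0" by (simp add: r_def)
    qed
    show "r m \<in> borel_measurable (blk.P \<Otimes>\<^sub>M Lb p)" for m using ri by (rule borel_measurable_integrable)
    show "integrable (blk.P \<Otimes>\<^sub>M Lb p) (\<lambda>q. norm (k q))" using ki by simp
  qed (auto simp: r_def indicator_def)
  then have "(\<lambda>m. 1 / 2 ^ p * (\<integral>q. r m q \<partial>(blk.P \<Otimes>\<^sub>M Lb p))) \<longlonglongrightarrow> 1 / 2 ^ p * 0"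
    by (intro tendsto_mult_left) simp
  then show "(\<lambda>m. 1 / 2 ^ p * (\<integral>q. r m q \<partial>(blk.P \<Otimes>\<^sub>M Lb p))) \<longlonglongrightarrow> 0" by simp
qed simp

end

text \<open>Evaluating the integrated variables at the points of an independent copy in the blocks
  \<open>E\<close> amounts to resampling the coordinates in \<open>E\<close>.\<close>

lemma ker_pt:
  assumes A: "finite A" "p + card A = n" and k: "k \<in> Bij p E" and E: "E \<inter> A = {}"
  shows "ker p A (pt p k y) x = sval n f (override_on x y E) (A \<union> E)"
proof -
  have kb: "bij_betw k {..<p} E" using k by (simp add: Bij_def)
  have "bij_betw (case_sum k (\<lambda>a. a)) (idx p A) (A \<union> E)"
    unfolding bij_betw_def
  proof
    show "inj_on (case_sum k (\<lambda>a. a)) (idx p A)"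
      using kb E by (auto simp: idx_def inj_on_def bij_betw_def)
    show "case_sum k (\<lambda>a. a) ` idx p A = A \<union> E" using kb by (auto simp: idx_def image_Un image_image bij_betw_def)
  qed
  then have "sval n f (override_on x y E) (A \<union> E) = sval n f (override_on x y E \<circ> case_sum k (\<lambda>a. a)) (idx p A)"
    by (rule sval_reindex[OF f_sym idxA[OF A]])
  also have "\<dots> = sval n f (case_sum (pt p k y) x) (idx p A)"
  proof (rule sval_cong[OF idxA[OF A]])
    fix t assume "t \<in> idx p A"
    then consider j where "t = Inl j" "j < p" | a where "t = Inr a" "a \<in> A" by (auto simp: idx_def)
    then show "(override_on x y E \<circ> case_sum k (\<lambda>a. a)) t = case_sum (pt p k y) x t"
    proof cases
      case 1
      then have "k j \<in> E" using bij_betwE[OF kb] by simp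
      then show ?thesis using 1 by (simp add: pt_def)
    next
      case 2
      then have "a \<notin> E" using E by auto
      then show ?thesis using 2 by simp
    qed
  qed
  finally show ?thesis by (simp add: ker_def)
qed

lemma ker_pt_0:
  assumes A: "finite A" "p + card A = n" and k: "k j \<in> A" "j < p"
    and x: "\<forall>k. 2 * real k < x k \<and> x k < 2 * real k + 2" and y: "\<forall>k. 2 * real k < y k \<and> y k < 2 * real k + 2"
  shows "ker p A (pt p k y) x = 0"
  unfolding ker_def
  by (rule sval_same_block[OF idxA[OF A], of "Inl j" "Inr (k j)" "k j"]) (use k x y in \<open>auto simp: idx_def pt_def\<close>)

text \<open>The integral over contracted variables becomes a sum over tuples of blocks. Each set E
  of shared blocks has p! enumerations, and (n!)^2 compensates the two factors n! in the definition
  of \<open>u\<close>.\<close>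

lemma W_eq:
  assumes A: "finite A" "finite A'" "p + card A = n" "p + card A' = n"
  shows "AE x in blk.P. W p A A' m x = fact p / (fact n)\<^sup>2 *
    (\<Sum>E | E \<subseteq> {..<m} - (A \<union> A') \<and> card E = p. blk.Ex E (\<lambda>x. u (A \<union> E) x * u (A' \<union> E) x) x)"
  using AE_ker_mult_integrable[OF A] AE_block
proof eventually_elim
  case (elim x)
  define F where "F z = ker p A z x * ker p A' z x" for z
  have Fi: "integrable (Lb p) F" using elim(1) by (simp add: F_def[abs_def])
  have Fv: "F z = 0" if "z \<in> {..<p} \<rightarrow>\<^sub>E UNIV" "z \<notin> Delta p" for z
    using ker_van[OF A(1,3) that] by (simp add: F_def)
  have "W p A A' m x = 1 / 2 ^ p * (2 ^ p * (\<Sum>k\<in>injs p m. \<integral>y. F (pt p k y) \<partial>blk.P))"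
    unfolding W_def[OF A] F_def[symmetric] using integral_trunc_injs(2)[OF Fi Fv] by simp
  also have "\<dots> = (\<Sum>k\<in>injs p m. \<integral>y. F (pt p k y) \<partial>blk.P)" by simp
  also have "\<dots> = (\<Sum>E | E \<subseteq> {..<m} \<and> card E = p. \<Sum>k\<in>Bij p E. \<integral>y. F (pt p k y) \<partial>blk.P)"
    by (rule sum_injs_sets)
  also have "\<dots> = (\<Sum>E | E \<subseteq> {..<m} \<and> card E = p. if E \<inter> (A \<union> A') = {} then fact p / (fact n)\<^sup>2 * blk.Ex E (\<lambda>x. u (A \<union> E) x * u (A' \<union> E) x) x else 0)"
  proof (rule sum.cong)
    fix E assume E: "E \<in> {E. E \<subseteq> {..<m} \<and> card E = p}"
    then have fE: "finite E" "card E = p" by (auto intro: finite_subset)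
    show "(\<Sum>k\<in>Bij p E. \<integral>y. F (pt p k y) \<partial>blk.P) = (if E \<inter> (A \<union> A') = {} then fact p / (fact n)\<^sup>2 * blk.Ex E (\<lambda>x. u (A \<union> E) x * u (A' \<union> E) x) x else 0)"
    proof (cases "E \<inter> (A \<union> A') = {}")
      case True
      then have EA: "E \<inter> A = {}" "E \<inter> A' = {}" by auto
      have "(\<integral>y. F (pt p k y) \<partial>blk.P) = 1 / (fact n)\<^sup>2 * blk.Ex E (\<lambda>x. u (A \<union> E) x * u (A' \<union> E) x) x" if k: "k \<in> Bij p E" for k
      proof -
        have "u (A \<union> E) w * u (A' \<union> E) w = (fact n)\<^sup>2 * (sval n f w (A \<union> E) * sval n f w (A' \<union> E))" for w
          by (simp add: u_def power2_eq_square mult_ac)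
        then show ?thesis unfolding F_def ker_pt[OF A(1,3) k EA(1)] ker_pt[OF A(2,4) k EA(2)] by (simp add: blk.Ex_def)
      qed
      then show ?thesis using card_Bij[OF fE] True by simp
    next
      case False
      \<comment> \<open>A shared block inside A or A' would give two arguments of one kernel in the
        same block, where it vanishes.\<close>
      then obtain i where i: "i \<in> E" "i \<in> A \<or> i \<in> A'" by auto
      have "(\<integral>y. F (pt p k y) \<partial>blk.P) = 0" if k: "k \<in> Bij p E" for k
      proof -
        obtain j where j: "j < p" "k j = i" using k i(1) by (auto simp: Bij_def bij_betw_def)
        have "AE y in blk.P. F (pt p k y) = 0"
          using AE_block
        proof eventually_elim
          case (elim y)
          show ?case using i(2) ker_pt_0[OF A(1,3), of k j x y] ker_pt_0[OF A(2,4), of k j x y] j \<open>\<forall>k. 2 * real k < x k \<and> x k < 2 * real k + 2\<close> elim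
            by (auto simp: F_def)
        qed
        then show ?thesis by (rule integral_eq_zero_AE)
      qed
      then show ?thesis using False by simp
    qed
  qed simp
  also have "\<dots> = (\<Sum>E\<in>{E. E \<subseteq> {..<m} \<and> card E = p} \<inter> {E. E \<inter> (A \<union> A') = {}}. fact p / (fact n)\<^sup>2 * blk.Ex E (\<lambda>x. u (A \<union> E) x * u (A' \<union> E) x) x)"
    by (subst sum.inter_restrict) (auto intro: finite_subset[of _ "Pow {..<m}"])
  also have "{E. E \<subseteq> {..<m} \<and> card E = p} \<inter> {E. E \<inter> (A \<union> A') = {}} = {E. E \<subseteq> {..<m} - (A \<union> A') \<and> card E = p}" by auto
  finally show ?case by (simp add: sum_distrib_left)
qed

end

subsection \<open>Contractions\<close>

text \<open>Such an enumeration consists of independent enumerations of the intersection (size s)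
  and of the two differences (size t each).\<close>

lemma card_three_blocks:
  assumes K: "finite K" "C \<union> C' = K" "card C = s + t" "card C' = s + t" and k: "k = s + t + t" "card K = k"
  shows "card {b \<in> Bij k K. b ` {..<s + t} = C \<and> b ` ({..<s} \<union> {s + t..<k}) = C'} = fact s * fact t * fact t"
proof -
  have fC: "finite C" "finite C'" using K by auto
  have cI: "card (C \<inter> C') = s"
    using card_Un_Int[OF fC] K k by simp
  have cD: "card (C - C') = t" "card (C' - C) = t"
    using card_Diff_subset_Int[of C C'] card_Diff_subset_Int[of C' C] fC K cI by (auto simp: Int_commute)
  let ?L = "{b \<in> Bij k K. b ` {..<s + t} = C \<and> b ` ({..<s} \<union> {s + t..<k}) = C'}"
  let ?R = "Bij s (C \<inter> C') \<times> Bij t (C - C') \<times> Bij t (C' - C)"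
  let ?j = "\<lambda>b. ((\<lambda>j\<in>{..<s}. b j), (\<lambda>j\<in>{..<t}. b (s + j)), (\<lambda>j\<in>{..<t}. b (s + t + j)))"
  let ?i = "\<lambda>(b1, b2, b3). \<lambda>j\<in>{..<k}. if j < s then b1 j else if j < s + t then b2 (j - s) else b3 (j - s - t)"
  have "bij_betw ?j ?L ?R"
  proof (rule bij_betw_byWitness[where f'="?i"])
    show "\<forall>b\<in>?L. ?i (?j b) = b"
    proof
      fix b assume "b \<in> ?L"
      then have e: "b \<in> extensional {..<k}" by (simp add: Bij_def PiE_iff)
      have "?i (?j b) j = b j" for j
        using k extensional_arb[OF e, of j] by auto
      then show "?i (?j b) = b" by (rule ext)
    qed
    show "\<forall>q\<in>?R. ?j (?i q) = q"
    proof
      fix q assume q: "q \<in> ?R"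
      obtain b1 b2 b3 where qb: "q = (b1, b2, b3)" by (cases q)
      have e: "b1 \<in> extensional {..<s}" "b2 \<in> extensional {..<t}" "b3 \<in> extensional {..<t}"
        using q by (simp_all add: qb Bij_def PiE_iff)
      have 1: "(\<lambda>j\<in>{..<s}. ?i (b1, b2, b3) j) = b1"
        using k extensional_arb[OF e(1)] by (intro ext) auto
      have 2: "(\<lambda>j\<in>{..<t}. ?i (b1, b2, b3) (s + j)) = b2"
        using k extensional_arb[OF e(2)] by (intro ext) auto
      have 3: "(\<lambda>j\<in>{..<t}. ?i (b1, b2, b3) (s + t + j)) = b3"
        using k extensional_arb[OF e(3)] by (intro ext) auto
      show "?j (?i q) = q" unfolding qb using 1 2 3 by simp
    qed
    show "?j ` ?L \<subseteq> ?R"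
    proof
      fix q assume "q \<in> ?j ` ?L"
      then obtain b where bL: "b \<in> ?L" and q: "q = ?j b" by (rule imageE)
      have b: "b \<in> Bij k K" "b ` {..<s + t} = C" "b ` ({..<s} \<union> {s + t..<k}) = C'" using bL by simp_all
      have inj: "inj_on b {..<k}" using b(1) by (simp add: Bij_def bij_betw_def)
      have 1: "b ` {..<s} = C \<inter> C'"
      proof -
        have "b ` ({..<s + t} \<inter> ({..<s} \<union> {s + t..<k})) = C \<inter> C'"
          unfolding b(2,3)[symmetric] using k by (intro inj_on_image_Int[OF inj]) auto
        moreover have "{..<s + t} \<inter> ({..<s} \<union> {s + t..<k}) = {..<s}" by auto
        ultimately show ?thesis by simp
      qed
      have 2: "b ` {s..<s + t} = C - C'"
      proof -
        have "b ` ({..<s + t} - ({..<s} \<union> {s + t..<k})) = C - C'"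
          unfolding b(2,3)[symmetric] using k by (intro inj_on_image_set_diff[OF inj]) auto
        moreover have "{..<s + t} - ({..<s} \<union> {s + t..<k}) = {s..<s + t}" by auto
        ultimately show ?thesis by simp
      qed
      have 3: "b ` {s + t..<k} = C' - C"
      proof -
        have "b ` (({..<s} \<union> {s + t..<k}) - {..<s + t}) = C' - C"
          unfolding b(2,3)[symmetric] using k by (intro inj_on_image_set_diff[OF inj]) auto
        moreover have "({..<s} \<union> {s + t..<k}) - {..<s + t} = {s + t..<k}" by auto
        ultimately show ?thesis by simp
      qed
      have r: "(\<lambda>j\<in>{..<c}. b (o' + j)) \<in> Bij c X" if "b ` {o'..<o' + c} = X" "o' + c \<le> k" for c o' X
      proof -
        have "bij_betw (\<lambda>j. o' + j) {..<c} {o'..<o' + c}" by (rule bij_betw_byWitness[where f'="\<lambda>j. j - o'"]) auto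
        moreover have "bij_betw b {o'..<o' + c} X" using that inj by (auto simp: bij_betw_def intro: inj_on_subset)
        ultimately have "bij_betw (b \<circ> (\<lambda>j. o' + j)) {..<c} X" by (rule bij_betw_trans)
        then have bb: "bij_betw (\<lambda>j\<in>{..<c}. b (o' + j)) {..<c} X" by (simp add: bij_betw_restrict o_def)
        then show ?thesis using bij_betwE[OF bb] by (auto simp: Bij_def)
      qed
      show "q \<in> ?R" unfolding q using r[of 0 s "C \<inter> C'"] r[of s t "C - C'"] r[of "s + t" t "C' - C"] 1 2 3 k
        by (simp add: atLeast0LessThan)
    qed
    show "?i ` ?R \<subseteq> ?L"
    proof
      fix b assume "b \<in> ?i ` ?R"
      then obtain q where q: "q \<in> ?R" "b = ?i q" by (rule imageE)
      obtain b1 b2 b3 where qb: "q = (b1, b2, b3)" by (cases q)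
      have bs: "b1 \<in> Bij s (C \<inter> C')" "b2 \<in> Bij t (C - C')" "b3 \<in> Bij t (C' - C)" using q(1) by (simp_all add: qb)
      have b: "b = (\<lambda>j\<in>{..<k}. if j < s then b1 j else if j < s + t then b2 (j - s) else b3 (j - s - t))"
        using q(2) by (simp add: qb)
      have 1: "bij_betw b {..<s} (C \<inter> C')"
      proof (rule bij_betw_cong[THEN iffD1])
        show "bij_betw b1 {..<s} (C \<inter> C')" using bs(1) by (simp add: Bij_def)
      qed (use k in \<open>simp add: b\<close>)
      have sh: "bij_betw (\<lambda>j. j - o') {o'..<o' + t} {..<t}" for o' by (rule bij_betw_byWitness[where f'="\<lambda>j. o' + j"]) auto
      have 2: "bij_betw b {s..<s + t} (C - C')"
      proof (rule bij_betw_cong[THEN iffD1])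
        show "bij_betw (b2 \<circ> (\<lambda>j. j - s)) {s..<s + t} (C - C')"
          using bs(2) by (intro bij_betw_trans[OF sh]) (simp add: Bij_def)
      qed (use k in \<open>simp add: b\<close>)
      have 3: "bij_betw b {s + t..<k} (C' - C)"
      proof (rule bij_betw_cong[THEN iffD1])
        show "bij_betw (b3 \<circ> (\<lambda>j. j - (s + t))) {s + t..<k} (C' - C)"
          using bs(3) k bij_betw_trans[OF sh[of "s + t"], of b3 "C' - C"] by (simp add: Bij_def)
      qed (use k in \<open>simp add: b\<close>)
      have "bij_betw b ({..<s} \<union> {s..<s + t}) ((C \<inter> C') \<union> (C - C'))" by (rule bij_betw_combine[OF 1 2]) auto
      moreover have "{..<s} \<union> {s..<s + t} = {..<s + t}" "(C \<inter> C') \<union> (C - C') = C" by auto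
      ultimately have 12: "bij_betw b {..<s + t} C" by simp
      have 13: "bij_betw b ({..<s} \<union> {s + t..<k}) ((C \<inter> C') \<union> (C' - C))" by (rule bij_betw_combine[OF 1 3]) auto
      have "bij_betw b ({..<s + t} \<union> {s + t..<k}) (C \<union> (C' - C))" by (rule bij_betw_combine[OF 12 3]) auto
      moreover have "{..<s + t} \<union> {s + t..<k} = {..<k}" "C \<union> (C' - C) = K" using k K by auto
      ultimately have bk: "bij_betw b {..<k} K" by simp
      then have "b \<in> Bij k K" using bij_betwE[OF bk] unfolding Bij_def by (simp add: PiE_iff b extensional_def)
      moreover have "b ` {..<s + t} = C" "b ` ({..<s} \<union> {s + t..<k}) = C'" using 12 13 by (auto simp: bij_betw_def)
      ultimately show "b \<in> ?L" by simp
    qed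
  qed
  then have "card ?L = card ?R" by (rule bij_betw_same_card)
  also have "\<dots> = fact s * fact t * fact t"
    using card_Bij[of "C \<inter> C'" s] card_Bij[of "C - C'" t] card_Bij[of "C' - C" t] fC cI cD by (simp add: card_cartesian_product)
  finally show ?thesis .
qed

text \<open>
  A pair \<open>(C, C')\<close> stands for the contractions of order \<open>r\<close> with \<open>l\<close> integrated variables whose factors
  take their remaining variables in \<open>C\<close> and \<open>C'\<close>: then \<open>d - l = card C\<close>, and \<open>r - l = card (C \<inter> C')\<close>.
\<close>

definition PK :: "nat \<Rightarrow> nat set \<Rightarrow> (nat set \<times> nat set) set" where
  "PK d K = {(C, C'). C \<union> C' = K \<and> card C = card C' \<and> card C \<le> d}"

lemma finite_PK: "finite K \<Longrightarrow> finite (PK d K)"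
  by (rule finite_subset[of _ "Pow K \<times> Pow K"]) (auto simp: PK_def)

text \<open>In a contraction of order r with l integrated variables, the first r - l positions feed
  both factors, the next d - r only the first factor, and the last d - r only the second.
  Enumerations of \<open>K\<close> are grouped by the two sets of blocks which the factors
  receive.\<close>

lemma sum_Bij_PK:
  fixes \<Psi> :: "nat set \<Rightarrow> nat set \<Rightarrow> real"
  assumes K: "finite K" "card K = k" and rl: "l \<le> r" "r \<le> d" "2 * d - r - l = k"
  shows "(\<Sum>b\<in>Bij k K. \<Psi> (b ` {..<d - l}) (b ` ({..<r - l} \<union> {d - l..<k})))
    = (\<Sum>(C, C')\<in>{q \<in> PK d K. card (fst q) = d - l}. fact (r - l) * (fact (d - r))\<^sup>2 * \<Psi> C C')"
proof -
  define s t where "s = r - l" and "t = d - r"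
  have st: "d - l = s + t" "k = s + t + t" using rl by (auto simp: s_def t_def)
  let ?g = "\<lambda>b. (b ` {..<s + t}, b ` ({..<s} \<union> {s + t..<k}))"
  let ?T = "{q \<in> PK d K. card (fst q) = s + t}"
  have fB: "finite (Bij k K)" using card_Bij(2)[OF K] .
  have fT: "finite ?T" using finite_PK[OF K(1)] by simp
  have im: "?g ` Bij k K \<subseteq> ?T"
  proof
    fix q assume "q \<in> ?g ` Bij k K"
    then obtain b where b: "b \<in> Bij k K" "q = ?g b" by auto
    have inj: "inj_on b {..<k}" and imb: "b ` {..<k} = K" using b(1) by (auto simp: Bij_def bij_betw_def)
    have "b ` {..<s + t} \<union> b ` ({..<s} \<union> {s + t..<k}) = b ` ({..<s + t} \<union> ({..<s} \<union> {s + t..<k}))" by (simp only: image_Un)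
    also have "{..<s + t} \<union> ({..<s} \<union> {s + t..<k}) = {..<k}" using st by auto
    finally have 1: "b ` {..<s + t} \<union> b ` ({..<s} \<union> {s + t..<k}) = K" using imb by simp
    have 2: "card (b ` {..<s + t}) = s + t"
      using inj st by (subst card_image) (auto intro: inj_on_subset)
    have "card ({..<s} \<union> {s + t..<k}) = s + t" using st by (subst card_Un_disjoint) auto
    then have 3: "card (b ` ({..<s} \<union> {s + t..<k})) = s + t"
      using st by (subst card_image) (auto intro!: inj_on_subset[OF inj])
    show "q \<in> ?T" using 1 2 3 st by (simp add: b(2) PK_def)
  qed
  have "(\<Sum>b\<in>Bij k K. \<Psi> (b ` {..<s + t}) (b ` ({..<s} \<union> {s + t..<k})))
     = (\<Sum>q\<in>?T. \<Sum>b\<in>{b \<in> Bij k K. ?g b = q}. \<Psi> (b ` {..<s + t}) (b ` ({..<s} \<union> {s + t..<k})))"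
    by (rule sum.group[OF fB fT im, symmetric])
  also have "\<dots> = (\<Sum>q\<in>?T. fact s * (fact t)\<^sup>2 * \<Psi> (fst q) (snd q))"
  proof (rule sum.cong)
    fix q assume q: "q \<in> ?T"
    obtain C C' where qC: "q = (C, C')" by (cases q)
    have "{b \<in> Bij k K. ?g b = q} = {b \<in> Bij k K. b ` {..<s + t} = C \<and> b ` ({..<s} \<union> {s + t..<k}) = C'}" by (auto simp: qC)
    then have c: "card {b \<in> Bij k K. ?g b = q} = fact s * fact t * fact t"
      using q st K card_three_blocks[of K C C' s t k] by (simp add: qC PK_def)
    have "(\<Sum>b\<in>{b \<in> Bij k K. ?g b = q}. \<Psi> (b ` {..<s + t}) (b ` ({..<s} \<union> {s + t..<k}))) = (\<Sum>b\<in>{b \<in> Bij k K. ?g b = q}. \<Psi> C C')"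
      by (intro sum.cong) (auto simp: qC)
    also have "\<dots> = fact s * (fact t)\<^sup>2 * \<Psi> C C'" by (simp only: sum_constant c) (simp add: power2_eq_square)
    finally show "(\<Sum>b\<in>{b \<in> Bij k K. ?g b = q}. \<Psi> (b ` {..<s + t}) (b ` ({..<s} \<union> {s + t..<k}))) = fact s * (fact t)\<^sup>2 * \<Psi> (fst q) (snd q)"
      by (simp add: qC)
  qed simp
  finally show ?thesis unfolding st(1) s_def[symmetric] t_def[symmetric] by (simp add: split_def)
qed

text \<open>After enumerations are counted, the weight in the definition of \<open>G\<close> no
  longer depends on r. The remaining l! is the number of orders of the integrated variables,
  matching p! in \<open>W_eq\<close>.\<close>

lemma coefficient_identity:
  assumes "l \<le> r" "r \<le> d"
  shows "fact r * (real (d choose r))\<^sup>2 * real (r choose l) * (fact (r - l) * (fact (d - r))\<^sup>2) = (fact d)\<^sup>2 / fact l"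
proof -
  have 1: "real (d choose r) * (fact r * fact (d - r)) = fact d"
    using binomial_fact_lemma[OF assms(2)] by (metis mult.commute of_nat_fact of_nat_mult)
  have 2: "real (r choose l) * (fact l * fact (r - l)) = fact r"
    using binomial_fact_lemma[OF assms(1)] by (metis mult.commute of_nat_fact of_nat_mult)
  have "fact r * (real (d choose r))\<^sup>2 * real (r choose l) * (fact (r - l) * (fact (d - r))\<^sup>2) * fact l
     = fact r * (real (d choose r))\<^sup>2 * (fact (d - r))\<^sup>2 * (real (r choose l) * (fact l * fact (r - l)))" by (simp add: mult_ac)
  also have "\<dots> = (real (d choose r) * (fact r * fact (d - r)))\<^sup>2" unfolding 2 by (simp add: power2_eq_square mult_ac)
  also have "\<dots> = (fact d)\<^sup>2" unfolding 1 ..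
  finally show ?thesis by (simp add: field_simps)
qed

lemma sum_symmetrized_contractions:
  fixes \<Psi> :: "nat \<Rightarrow> nat set \<Rightarrow> nat set \<Rightarrow> real"
  assumes K: "finite K" "card K = k"
  shows "(\<Sum>r\<le>d. \<Sum>l\<le>r. of_bool (2 * d - r - l = k) * fact r * (real (d choose r))\<^sup>2 * real (r choose l)
        * (\<Sum>b\<in>Bij k K. \<Psi> l (b ` {..<d - l}) (b ` ({..<r - l} \<union> {d - l..<k}))))
    = (\<Sum>(C, C')\<in>PK d K. (fact d)\<^sup>2 / fact (d - card C) * \<Psi> (d - card C) C C')"
proof -
  define T where "T = {(r, l). l \<le> r \<and> r \<le> d \<and> 2 * d - r - l = k}"
  define g where "g l q = (fact d)\<^sup>2 / fact l * \<Psi> l (fst q) (snd q)" for l and q :: "nat set \<times> nat set"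
  have fT: "finite T" by (rule finite_subset[of _ "{..d} \<times> {..d}"]) (auto simp: T_def)
  have "(\<Sum>r\<le>d. \<Sum>l\<le>r. of_bool (2 * d - r - l = k) * fact r * (real (d choose r))\<^sup>2 * real (r choose l)
        * (\<Sum>b\<in>Bij k K. \<Psi> l (b ` {..<d - l}) (b ` ({..<r - l} \<union> {d - l..<k}))))
      = (\<Sum>(r, l)\<in>(SIGMA r:{..d}. {..r}). of_bool (2 * d - r - l = k) * fact r * (real (d choose r))\<^sup>2 * real (r choose l)
        * (\<Sum>b\<in>Bij k K. \<Psi> l (b ` {..<d - l}) (b ` ({..<r - l} \<union> {d - l..<k}))))"
    by (rule sum.Sigma) auto
  also have "\<dots> = (\<Sum>(r, l)\<in>T. of_bool (2 * d - r - l = k) * fact r * (real (d choose r))\<^sup>2 * real (r choose l)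
        * (\<Sum>b\<in>Bij k K. \<Psi> l (b ` {..<d - l}) (b ` ({..<r - l} \<union> {d - l..<k}))))"
    by (rule sum.mono_neutral_right) (auto simp: T_def)
  also have "\<dots> = (\<Sum>(r, l)\<in>T. \<Sum>q\<in>{q \<in> PK d K. card (fst q) = d - l}. g l q)"
  proof (rule sum.cong)
    fix z assume z: "z \<in> T"
    obtain r l where rl: "z = (r, l)" "l \<le> r" "r \<le> d" "2 * d - r - l = k" using z by (auto simp: T_def)
    have "fact r * (real (d choose r))\<^sup>2 * real (r choose l) * (\<Sum>b\<in>Bij k K. \<Psi> l (b ` {..<d - l}) (b ` ({..<r - l} \<union> {d - l..<k})))
       = (\<Sum>q\<in>{q \<in> PK d K. card (fst q) = d - l}. (fact r * (real (d choose r))\<^sup>2 * real (r choose l) * (fact (r - l) * (fact (d - r))\<^sup>2)) * \<Psi> l (fst q) (snd q))"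
      unfolding sum_Bij_PK[OF K rl(2-4), of "\<Psi> l"] by (simp add: sum_distrib_left split_def mult_ac)
    also have "\<dots> = (\<Sum>q\<in>{q \<in> PK d K. card (fst q) = d - l}. g l q)"
      unfolding coefficient_identity[OF rl(2,3)] g_def ..
    finally show "(case z of (r, l) \<Rightarrow> of_bool (2 * d - r - l = k) * fact r * (real (d choose r))\<^sup>2 * real (r choose l)
        * (\<Sum>b\<in>Bij k K. \<Psi> l (b ` {..<d - l}) (b ` ({..<r - l} \<union> {d - l..<k})))) = (case z of (r, l) \<Rightarrow> \<Sum>q\<in>{q \<in> PK d K. card (fst q) = d - l}. g l q)"
      using rl by simp
  qed simp
  also have "\<dots> = (\<Sum>z\<in>T. \<Sum>q\<in>{q \<in> PK d K. card (fst q) = d - snd z}. g (snd z) q)" by (simp add: split_def)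
  also have "\<dots> = (\<Sum>q\<in>PK d K. \<Sum>z\<in>{z \<in> T. card (fst q) = d - snd z}. g (snd z) q)"
    by (rule sum.swap_restrict[OF fT finite_PK[OF K(1)]])
  also have "\<dots> = (\<Sum>q\<in>PK d K. g (d - card (fst q)) q)"
  proof (rule sum.cong)
    fix q assume q: "q \<in> PK d K"
    obtain C C' where qC: "q = (C, C')" by (cases q)
    have C: "C \<union> C' = K" "card C = card C'" "card C \<le> d" using q by (auto simp: qC PK_def)
    have fC: "finite C" "finite C'" using C(1) K(1) by auto
    have "card C \<le> k" using card_mono[of K C] C K by auto
    moreover have "k \<le> 2 * card C" using card_Un_le[of C C'] C K by simp
    \<comment> \<open>The pair determines both orders: l = d - card C from the size, and r from 2 d
      - r - l = k. The bounds card C <= k <= 2 * card C express r <= d and l <= r.\<close>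
    ultimately have "{z \<in> T. card (fst q) = d - snd z} = {(d + card C - k, d - card C)}"
      using C(3) by (auto simp: T_def qC)
    then show "(\<Sum>z\<in>{z \<in> T. card (fst q) = d - snd z}. g (snd z) q) = g (d - card (fst q)) q" by (simp add: qC)
  qed simp
  finally show ?thesis by (simp add: g_def split_def)
qed

lemma idx_enum:
  assumes e: "bij_betw e {..<s} A"
  shows "bij_betw (\<lambda>j. if j < p then Inl j else Inr (e (j - p))) {..<p + s} (idx p A)"
proof -
  have 1: "bij_betw (\<lambda>j. if j < p then Inl j else Inr (e (j - p))) {..<p} (Inl ` {..<p})"
    by (rule bij_betw_cong[THEN iffD1, of _ Inl]) (auto simp: bij_betw_def)
  have "bij_betw (\<lambda>j. j - p) {p..<p + s} {..<s}" by (rule bij_betw_byWitness[where f'="\<lambda>j. j + p"]) auto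
  moreover have "bij_betw Inr A (Inr ` A)" by (simp add: bij_betw_def)
  ultimately have "bij_betw (Inr \<circ> (e \<circ> (\<lambda>j. j - p))) {p..<p + s} (Inr ` A)"
    using e by (metis bij_betw_trans)
  then have 2: "bij_betw (\<lambda>j. if j < p then Inl j else Inr (e (j - p))) {p..<p + s} (Inr ` A)"
    by (rule bij_betw_cong[THEN iffD1, rotated]) auto
  have "{..<p} \<union> {p..<p + s} = {..<p + s}" by auto
  then show ?thesis using bij_betw_combine[OF 1 2] unfolding idx_def by auto
qed

lemma integral_case_nat:
  fixes F :: "(nat \<Rightarrow> real) \<Rightarrow> real"
  assumes F: "integrable (Lb (Suc l)) F"
  shows "integrable leb_plus (\<lambda>t. \<integral>z. F (case_nat t z) \<partial>Lb l)" "(\<integral>z. F z \<partial>Lb (Suc l)) = (\<integral>t. \<integral>z. F (case_nat t z) \<partial>Lb l \<partial>leb_plus)"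
proof -
  interpret L0: sigma_finite_measure leb_plus by (rule sigma_finite_leb_plus)
  interpret Ll: sigma_finite_measure "Lb l" by (rule sigma_finite_Lb)
  interpret PL: pair_sigma_finite leb_plus "Lb l" ..
  have d: "distr (leb_plus \<Otimes>\<^sub>M Lb l) (Lb (Suc l)) (\<lambda>(t, z). case_nat t z) = Lb (Suc l)"
    by (rule distr_case_nat[where M="\<lambda>_. leb_plus", OF sigma_finite_leb_plus])
  have m: "(\<lambda>(t, z). case_nat t z) \<in> leb_plus \<Otimes>\<^sub>M Lb l \<rightarrow>\<^sub>M Lb (Suc l)"
    unfolding split_def by (rule measurable_case_nat_PiM[where M="\<lambda>_. leb_plus"]) auto
  have Fm: "F \<in> borel_measurable (Lb (Suc l))" using F by auto
  have i: "integrable (leb_plus \<Otimes>\<^sub>M Lb l) (\<lambda>(t, z). F (case_nat t z))"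
    using integrable_distr_eq[OF m Fm] F unfolding d by (simp add: split_def)
  show "integrable leb_plus (\<lambda>t. \<integral>z. F (case_nat t z) \<partial>Lb l)" using PL.integrable_fst[OF i] by simp
  show "(\<integral>z. F z \<partial>Lb (Suc l)) = (\<integral>t. \<integral>z. F (case_nat t z) \<partial>Lb l \<partial>leb_plus)"
    using integral_distr[OF m Fm] PL.integral_fst[OF i] unfolding d by (simp add: split_def)
qed

section \<open>Limits of the Hoeffding components as sums of contractions\<close>

context chaos_kernel
begin

lemma PKD:
  assumes "finite K" "(C, C') \<in> PK (n - 1) K"
  shows "finite C" "finite C'" "C \<union> C' = K" "card C' = card C" "card C \<le> n - 1"
proof -
  show 1: "C \<union> C' = K" "card C' = card C" "card C \<le> n - 1" using assms(2) by (auto simp: PK_def)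
  show "finite C" "finite C'" using assms(1) 1(1) by (metis finite_Un)+
qed

text \<open>A surviving pair (A, A') is encoded by its traces on \<open>K\<close> and by its common
  remainder E outside \<open>K\<close> and \<open>i\<close>; the sizes of the traces agree because A
  and A' have the same size.\<close>

lemma H_PK:
  assumes K: "finite K" "i \<notin> K" and J: "insert i K \<subseteq> J" and fJ: "finite J"
  shows "H i K J x = (\<Sum>(C, C')\<in>PK (n - 1) K. \<Sum>E | E \<subseteq> J - (insert i C \<union> insert i C') \<and> card E = n - 1 - card C \<and> finite E.
     blk.Ex E (\<lambda>x. u (insert i C \<union> E) x * u (insert i C' \<union> E) x) x)"
proof -
  define Es where "Es q = {E. E \<subseteq> J - insert i K \<and> card E = n - 1 - card (fst q) \<and> finite E}" for q :: "nat set \<times> nat set"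
  have "H i K J x = (\<Sum>p\<in>pairs i K J. blk.Ex (fst p - K - {i}) (\<lambda>x. u (fst p) x * u (snd p) x) x)"
    by (simp add: H_def split_def)
  also have "\<dots> = (\<Sum>w\<in>(SIGMA q:PK (n - 1) K. Es q). blk.Ex (snd w) (\<lambda>x. u (insert i (fst (fst w)) \<union> snd w) x * u (insert i (snd (fst w)) \<union> snd w) x) x)"
  proof (rule sum.reindex_bij_witness[where j="\<lambda>p. ((fst p \<inter> K, snd p \<inter> K), fst p - K - {i})"
        and i="\<lambda>w. (insert i (fst (fst w)) \<union> snd w, insert i (snd (fst w)) \<union> snd w)"])
    fix p assume p: "p \<in> pairs i K J"
    obtain A A' where pA: "p = (A, A')" by (cases p)
    have A: "finite A" "card A = n" "A \<subseteq> J" "finite A'" "card A' = n" "A' \<subseteq> J" "i \<in> A" "i \<in> A'" "A - K = A' - K" "K \<subseteq> A \<union> A'"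
      using p by (auto simp: pA pairs_def fam_def)
    have i1: "insert i (A \<inter> K) \<union> (A - K - {i}) = A" using A(7) by auto
    have i2: "insert i (A' \<inter> K) \<union> (A - K - {i}) = A'" using A(8,9) by auto
    show "(insert i (fst (fst ((fst p \<inter> K, snd p \<inter> K), fst p - K - {i}))) \<union> snd ((fst p \<inter> K, snd p \<inter> K), fst p - K - {i}),
        insert i (snd (fst ((fst p \<inter> K, snd p \<inter> K), fst p - K - {i}))) \<union> snd ((fst p \<inter> K, snd p \<inter> K), fst p - K - {i})) = p"
      using i1 i2 by (simp add: pA)
    show "blk.Ex (snd ((fst p \<inter> K, snd p \<inter> K), fst p - K - {i}))
         (\<lambda>x. u (insert i (fst (fst ((fst p \<inter> K, snd p \<inter> K), fst p - K - {i}))) \<union> snd ((fst p \<inter> K, snd p \<inter> K), fst p - K - {i})) x *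
              u (insert i (snd (fst ((fst p \<inter> K, snd p \<inter> K), fst p - K - {i}))) \<union> snd ((fst p \<inter> K, snd p \<inter> K), fst p - K - {i})) x) x
       = blk.Ex (fst p - K - {i}) (\<lambda>x. u (fst p) x * u (snd p) x) x"
      using i1 i2 by (simp add: pA)
    have c: "card (A \<inter> K) + card (A - K - {i}) = n - 1" "card (A' \<inter> K) + card (A' - K - {i}) = n - 1"
    proof -
      have "card (A - {i}) = n - 1" using A by simp
      moreover have "A - {i} = (A \<inter> K) \<union> (A - K - {i})" using K(2) by auto
      ultimately show "card (A \<inter> K) + card (A - K - {i}) = n - 1" using A(1) by (subst card_Un_disjoint[symmetric]) auto
      have "card (A' - {i}) = n - 1" using A by simp
      moreover have "A' - {i} = (A' \<inter> K) \<union> (A' - K - {i})" using K(2) by auto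
      ultimately show "card (A' \<inter> K) + card (A' - K - {i}) = n - 1" using A(4) by (subst card_Un_disjoint[symmetric]) auto
    qed
    have "(A \<inter> K, A' \<inter> K) \<in> PK (n - 1) K"
      using A c by (auto simp: PK_def)
    moreover have "A - K - {i} \<in> Es (A \<inter> K, A' \<inter> K)" using A c(1) by (auto simp: Es_def)
    ultimately show "((fst p \<inter> K, snd p \<inter> K), fst p - K - {i}) \<in> (SIGMA q:PK (n - 1) K. Es q)" by (simp add: pA)
  next
    fix w assume w: "w \<in> (SIGMA q:PK (n - 1) K. Es q)"
    obtain C C' E where wC: "w = ((C, C'), E)" by (metis prod.collapse)
    have q: "(C, C') \<in> PK (n - 1) K" and E: "E \<subseteq> J - insert i K" "card E = n - 1 - card C" "finite E" using w by (auto simp: wC Es_def)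
    note C = PKD[OF K(1) q]
    have d: "insert i C \<inter> E = {}" "insert i C' \<inter> E = {}" "i \<notin> C" "i \<notin> C'" using C(3) E(1) K(2) by auto
    have e: "(insert i C \<union> E) \<inter> K = C" "(insert i C' \<union> E) \<inter> K = C'" "insert i C \<union> E - K - {i} = E"
      using C(3) E(1) K(2) by auto
    show "((fst (insert i (fst (fst w)) \<union> snd w, insert i (snd (fst w)) \<union> snd w) \<inter> K, snd (insert i (fst (fst w)) \<union> snd w, insert i (snd (fst w)) \<union> snd w) \<inter> K),
        fst (insert i (fst (fst w)) \<union> snd w, insert i (snd (fst w)) \<union> snd w) - K - {i}) = w"
      using e by (simp add: wC)
    have "card (insert i C \<union> E) = n" "card (insert i C' \<union> E) = n"
      using C E d n_pos by (simp_all add: card_Un_disjoint)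
    moreover have "(insert i C \<union> E) - K = (insert i C' \<union> E) - K" "K \<subseteq> (insert i C \<union> E) \<union> (insert i C' \<union> E)"
      "insert i C \<union> E \<subseteq> J" "insert i C' \<union> E \<subseteq> J"
      using C(3) E(1) J K(2) by auto
    ultimately show "(insert i (fst (fst w)) \<union> snd w, insert i (snd (fst w)) \<union> snd w) \<in> pairs i K J"
      using C(1,2) E(3) by (simp add: wC pairs_def fam_def)
  qed
  also have "\<dots> = (\<Sum>q\<in>PK (n - 1) K. \<Sum>E\<in>Es q. blk.Ex E (\<lambda>x. u (insert i (fst q) \<union> E) x * u (insert i (snd q) \<union> E) x) x)"
  proof -
    have "finite (Es q)" for q by (rule finite_subset[of _ "Pow J"]) (use fJ in \<open>auto simp: Es_def\<close>)
    then show ?thesis by (subst sum.Sigma) (auto simp: finite_PK K(1) split_def)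
  qed
  also have "\<dots> = (\<Sum>(C, C')\<in>PK (n - 1) K. \<Sum>E | E \<subseteq> J - (insert i C \<union> insert i C') \<and> card E = n - 1 - card C \<and> finite E.
     blk.Ex E (\<lambda>x. u (insert i C \<union> E) x * u (insert i C' \<union> E) x) x)"
  proof (rule sum.cong)
    fix q assume "q \<in> PK (n - 1) K"
    then obtain C C' where q: "q = (C, C')" "(C, C') \<in> PK (n - 1) K" by (cases q) auto
    have "insert i C \<union> insert i C' = insert i K" using PKD(3)[OF K(1) q(2)] by auto
    then show "(\<Sum>E\<in>Es q. blk.Ex E (\<lambda>x. u (insert i (fst q) \<union> E) x * u (insert i (snd q) \<union> E) x) x)
      = (case q of (C, C') \<Rightarrow> \<Sum>E | E \<subseteq> J - (insert i C \<union> insert i C') \<and> card E = n - 1 - card C \<and> finite E.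
     blk.Ex E (\<lambda>x. u (insert i C \<union> E) x * u (insert i C' \<union> E) x) x)" by (simp add: q Es_def)
  qed simp
  finally show ?thesis .
qed

text \<open>With p = n - 1 - card C shared blocks besides \<open>i\<close>, solving
  \<open>W_eq\<close> for its sum of averages gives the factor (n!)^2 / p!.\<close>

definition HL :: "nat \<Rightarrow> nat set \<Rightarrow> (nat \<Rightarrow> real) \<Rightarrow> real" where
  "HL i K x = (\<Sum>q\<in>PK (n - 1) K. (fact n)\<^sup>2 / fact (n - 1 - card (fst q)) * Winf (n - 1 - card (fst q)) (insert i (fst q)) (insert i (snd q)) x)"

text \<open>Averaging over x_i as well turns \<open>i\<close> into a shared block. There are now q =
  n - card C of them, and any one of them may be \<open>i\<close>; so 1/n * q * (n!)^2 / q!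
  simplifies to the coefficient shown, in which (q - 1)! remains.\<close>

definition GL :: "nat set \<Rightarrow> (nat \<Rightarrow> real) \<Rightarrow> real" where
  "GL K x = (\<Sum>q\<in>PK (n - 1) K. (fact n)\<^sup>2 / (real n * fact (n - 1 - card (fst q))) * Winf (n - card (fst q)) (fst q) (snd q) x)"

lemma Es_finite:
  fixes B :: "nat set"
  shows "{E. E \<subseteq> {..<m} - B \<and> card E = p \<and> finite E} = {E. E \<subseteq> {..<m} - B \<and> card E = p}"
proof -
  have "finite E" if "E \<subseteq> {..<m} - B" for E :: "nat set" using that by (rule finite_subset) simp
  then show ?thesis by auto
qed

context
  fixes K :: "nat set" assumes K: "finite K"
begin

lemma PK_args:
  assumes q: "q \<in> PK (n - 1) K"
  shows "finite (fst q)" "finite (snd q)" "n - card (fst q) + card (fst q) = n" "n - card (fst q) + card (snd q) = n"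
    "i \<notin> K \<Longrightarrow> n - 1 - card (fst q) + card (insert i (fst q)) = n" "i \<notin> K \<Longrightarrow> n - 1 - card (fst q) + card (insert i (snd q)) = n"
    "fst q \<union> snd q = K" "n - card (fst q) = Suc (n - 1 - card (fst q))"
proof -
  have "(fst q, snd q) \<in> PK (n - 1) K" using q by simp
  note C = PKD[OF K this]
  show "finite (fst q)" "finite (snd q)" "fst q \<union> snd q = K" by (fact C)+
  have "card (fst q) \<le> n" using C(5) by simp
  then show "n - card (fst q) + card (fst q) = n" "n - card (fst q) + card (snd q) = n" using C(4) by simp_all
  have "i \<notin> fst q" "i \<notin> snd q" if "i \<notin> K" using that C(3) by auto
  then show "i \<notin> K \<Longrightarrow> n - 1 - card (fst q) + card (insert i (fst q)) = n" "i \<notin> K \<Longrightarrow> n - 1 - card (fst q) + card (insert i (snd q)) = n"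
    using C n_pos by simp_all
  show "n - card (fst q) = Suc (n - 1 - card (fst q))" using C(5) n_pos by simp
qed

lemma H_W:
  assumes i: "i \<notin> K" and m: "insert i K \<subseteq> {..<m}"
  shows "AE x in blk.P. H i K {..<m} x = (\<Sum>q\<in>PK (n - 1) K. (fact n)\<^sup>2 / fact (n - 1 - card (fst q)) * W (n - 1 - card (fst q)) (insert i (fst q)) (insert i (snd q)) m x)"
proof -
  have "AE x in blk.P. \<forall>q\<in>PK (n - 1) K. W (n - 1 - card (fst q)) (insert i (fst q)) (insert i (snd q)) m x = fact (n - 1 - card (fst q)) / (fact n)\<^sup>2 *
    (\<Sum>E | E \<subseteq> {..<m} - (insert i (fst q) \<union> insert i (snd q)) \<and> card E = n - 1 - card (fst q). blk.Ex E (\<lambda>x. u (insert i (fst q) \<union> E) x * u (insert i (snd q) \<union> E) x) x)"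
    using PK_args i finite_PK[OF K] by (intro AE_finite_allI W_eq) auto
  then show ?thesis
  proof eventually_elim
    case (elim x)
    have f: "(fact n)\<^sup>2 / c * (c / (fact n)\<^sup>2 * b) = b" if "c \<noteq> 0" for b c :: real using that by simp
    show ?case unfolding H_PK[OF K i m finite_lessThan] Es_finite split_def
      using elim by (intro sum.cong refl) (simp add: f)
  qed
qed

lemma HL_integrable: "i \<notin> K \<Longrightarrow> integrable blk.P (HL i K)"
  unfolding HL_def[abs_def] using PK_args by (intro Bochner_Integration.integrable_sum integrable_mult_right Winf_integrable) auto

lemma GL_integrable: "integrable blk.P (GL K)"
  unfolding GL_def[abs_def] using PK_args by (intro Bochner_Integration.integrable_sum integrable_mult_right Winf_integrable) auto

lemma sum_W_tendsto:
  assumes "finite I" and c: "\<And>q. q \<in> I \<Longrightarrow> finite (A q) \<and> finite (A' q) \<and> p q + card (A q) = n \<and> p q + card (A' q) = n"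
    and F: "\<forall>\<^sub>F m in sequentially. AE x in blk.P. F m x = (\<Sum>q\<in>I. c q * W (p q) (A q) (A' q) m x)" "\<And>m. integrable blk.P (F m)"
  shows "(\<lambda>m. \<integral>x. \<bar>F m x - (\<Sum>q\<in>I. c q * Winf (p q) (A q) (A' q) x)\<bar> \<partial>blk.P) \<longlonglongrightarrow> 0"
proof (rule tendsto_sandwich[OF always_eventually])
  show "\<forall>m. 0 \<le> (\<integral>x. \<bar>F m x - (\<Sum>q\<in>I. c q * Winf (p q) (A q) (A' q) x)\<bar> \<partial>blk.P)" by simp
  have Wi: "integrable blk.P (W (p q) (A q) (A' q) m)" "integrable blk.P (Winf (p q) (A q) (A' q))" if "q \<in> I" for q m
    using c[OF that] W_integrable[of "A q" "A' q" "p q" m] Winf_integrable[of "A q" "A' q" "p q"] by blast+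
  show "\<forall>\<^sub>F m in sequentially. (\<integral>x. \<bar>F m x - (\<Sum>q\<in>I. c q * Winf (p q) (A q) (A' q) x)\<bar> \<partial>blk.P)
    \<le> (\<Sum>q\<in>I. \<bar>c q\<bar> * (\<integral>x. \<bar>W (p q) (A q) (A' q) m x - Winf (p q) (A q) (A' q) x\<bar> \<partial>blk.P))"
    using F(1)
  proof eventually_elim
    case (elim m)
    have i: "integrable blk.P (\<lambda>x. \<Sum>q\<in>I. c q * Winf (p q) (A q) (A' q) x)"
      by (intro Bochner_Integration.integrable_sum integrable_mult_right Wi)
    have i2: "integrable blk.P (\<lambda>x. \<Sum>q\<in>I. \<bar>c q\<bar> * \<bar>W (p q) (A q) (A' q) m x - Winf (p q) (A q) (A' q) x\<bar>)"
      by (intro Bochner_Integration.integrable_sum integrable_mult_right integrable_abs Bochner_Integration.integrable_diff Wi)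
    have "(\<integral>x. \<bar>F m x - (\<Sum>q\<in>I. c q * Winf (p q) (A q) (A' q) x)\<bar> \<partial>blk.P) \<le> (\<integral>x. (\<Sum>q\<in>I. \<bar>c q\<bar> * \<bar>W (p q) (A q) (A' q) m x - Winf (p q) (A q) (A' q) x\<bar>) \<partial>blk.P)"
    proof (rule integral_mono_AE)
      show "integrable blk.P (\<lambda>x. \<bar>F m x - (\<Sum>q\<in>I. c q * Winf (p q) (A q) (A' q) x)\<bar>)" using F(2)[of m] i by simp
      show "integrable blk.P (\<lambda>x. \<Sum>q\<in>I. \<bar>c q\<bar> * \<bar>W (p q) (A q) (A' q) m x - Winf (p q) (A q) (A' q) x\<bar>)" by (rule i2)
      show "AE x in blk.P. \<bar>F m x - (\<Sum>q\<in>I. c q * Winf (p q) (A q) (A' q) x)\<bar> \<le> (\<Sum>q\<in>I. \<bar>c q\<bar> * \<bar>W (p q) (A q) (A' q) m x - Winf (p q) (A q) (A' q) x\<bar>)"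
        using elim
      proof eventually_elim
        case (elim x)
        have "F m x - (\<Sum>q\<in>I. c q * Winf (p q) (A q) (A' q) x) = (\<Sum>q\<in>I. c q * (W (p q) (A q) (A' q) m x - Winf (p q) (A q) (A' q) x))"
          unfolding elim by (simp add: sum_subtractf right_diff_distrib)
        also have "\<bar>\<dots>\<bar> \<le> (\<Sum>q\<in>I. \<bar>c q * (W (p q) (A q) (A' q) m x - Winf (p q) (A q) (A' q) x)\<bar>)" by (rule sum_abs)
        finally show ?case by (simp add: abs_mult)
      qed
    qed
    also have "\<dots> = (\<Sum>q\<in>I. \<bar>c q\<bar> * (\<integral>x. \<bar>W (p q) (A q) (A' q) m x - Winf (p q) (A q) (A' q) x\<bar> \<partial>blk.P))"
      using Wi by simp
    finally show ?case .
  qed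
  have "(\<lambda>m. \<Sum>q\<in>I. \<bar>c q\<bar> * (\<integral>x. \<bar>W (p q) (A q) (A' q) m x - Winf (p q) (A q) (A' q) x\<bar> \<partial>blk.P)) \<longlonglongrightarrow> (\<Sum>q\<in>I. \<bar>c q\<bar> * 0)"
    using c by (intro tendsto_sum tendsto_mult_left W_tendsto) auto
  then show "(\<lambda>m. \<Sum>q\<in>I. \<bar>c q\<bar> * (\<integral>x. \<bar>W (p q) (A q) (A' q) m x - Winf (p q) (A q) (A' q) x\<bar> \<partial>blk.P)) \<longlonglongrightarrow> 0" by simp
qed simp

lemma eventually_subset_lessThan: "finite (B::nat set) \<Longrightarrow> \<forall>\<^sub>F m in sequentially. B \<subseteq> {..<m}"
proof -
  assume "finite B"
  then obtain M where "\<forall>b\<in>B. b < M" using finite_nat_set_iff_bounded by blast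
  then show ?thesis by (auto simp: eventually_sequentially intro!: exI[of _ M])
qed

lemma H_tendsto:
  assumes i: "i \<notin> K"
  shows "(\<lambda>m. \<integral>x. \<bar>H i K {..<m} x - HL i K x\<bar> \<partial>blk.P) \<longlonglongrightarrow> 0"
  unfolding HL_def
proof (rule sum_W_tendsto[OF finite_PK[OF K]])
  show "\<forall>\<^sub>F m in sequentially. AE x in blk.P. H i K {..<m} x = (\<Sum>q\<in>PK (n - 1) K. (fact n)\<^sup>2 / fact (n - 1 - card (fst q)) * W (n - 1 - card (fst q)) (insert i (fst q)) (insert i (snd q)) m x)"
    by (rule eventually_mono[OF eventually_subset_lessThan[of "insert i K"]]) (use K in simp, rule H_W[OF i])
  show "integrable blk.P (H i K {..<m})" for m by (rule H_integrable)
qed (use PK_args i in auto)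

text \<open>Here \<open>i\<close> is absorbed into the shared set E = A - K. Conversely each E is
  reached once for every choice of i in E, which is the factor n - card C.\<close>

lemma sum_pairs_PK:
  fixes \<phi> :: "nat set \<Rightarrow> nat set \<Rightarrow> real"
  assumes J: "finite J" "K \<subseteq> J"
  shows "(\<Sum>i\<in>J - K. \<Sum>p\<in>pairs i K J. \<phi> (fst p) (snd p))
    = (\<Sum>q\<in>PK (n - 1) K. \<Sum>E | E \<subseteq> J - K \<and> card E = n - card (fst q). real (n - card (fst q)) * \<phi> (fst q \<union> E) (snd q \<union> E))"
proof -
  define Es where "Es q = {E. E \<subseteq> J - K \<and> card E = n - card (fst q)}" for q :: "nat set \<times> nat set"
  have fE: "finite E" if "E \<in> Es q" for E q using that J by (auto simp: Es_def intro: finite_subset)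
  have fEs: "finite (Es q)" for q by (rule finite_subset[of _ "Pow J"]) (use J in \<open>auto simp: Es_def\<close>)
  have "(\<Sum>i\<in>J - K. \<Sum>p\<in>pairs i K J. \<phi> (fst p) (snd p)) = (\<Sum>w\<in>(SIGMA i:J - K. pairs i K J). \<phi> (fst (snd w)) (snd (snd w)))"
    using J by (subst sum.Sigma) (auto simp: finite_pairs split_def)
  also have "\<dots> = (\<Sum>v\<in>(SIGMA q:PK (n - 1) K. SIGMA E:Es q. E). \<phi> (fst (fst v) \<union> fst (snd v)) (snd (fst v) \<union> fst (snd v)))"
  proof (rule sum.reindex_bij_witness[where j="\<lambda>w. ((fst (snd w) \<inter> K, snd (snd w) \<inter> K), (fst (snd w) - K, fst w))"
        and i="\<lambda>v. (snd (snd v), (fst (fst v) \<union> fst (snd v), snd (fst v) \<union> fst (snd v)))"])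
    fix w assume w: "w \<in> (SIGMA i:J - K. pairs i K J)"
    obtain i A A' where wA: "w = (i, (A, A'))" by (metis prod.collapse)
    have A: "finite A" "card A = n" "A \<subseteq> J" "finite A'" "card A' = n" "A' \<subseteq> J" "i \<in> A" "i \<in> A'" "A - K = A' - K" "K \<subseteq> A \<union> A'" "i \<notin> K"
      using w by (auto simp: wA pairs_def fam_def)
    have e: "A \<inter> K \<union> (A - K) = A" "A' \<inter> K \<union> (A - K) = A'" using A(9) by auto
    have c: "card (A \<inter> K) + card (A - K) = n" "card (A' \<inter> K) + card (A' - K) = n"
      using card_Int_Diff[OF A(1), of K] card_Int_Diff[OF A(4), of K] A(2,5) by simp_all
    \<comment> \<open>The block \<open>i\<close> lies in A but not in K, so the trace of A on K has
      at most n - 1 elements, as membership in \<open>PK (n - 1) K\<close> requires.\<close>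
    have pos: "card (A - K) \<ge> 1" using A(1,7,11) by (metis DiffI One_nat_def Suc_leI card_gt_0_iff empty_iff finite_Diff)
    have "(A \<inter> K, A' \<inter> K) \<in> PK (n - 1) K" using A c pos by (auto simp: PK_def)
    moreover have "A - K \<in> Es (A \<inter> K, A' \<inter> K)" using A c by (auto simp: Es_def)
    ultimately show "((fst (snd w) \<inter> K, snd (snd w) \<inter> K), (fst (snd w) - K, fst w)) \<in> (SIGMA q:PK (n - 1) K. SIGMA E:Es q. E)"
      using A(7,11) by (simp add: wA)
    show "(\<lambda>v. (snd (snd v), (fst (fst v) \<union> fst (snd v), snd (fst v) \<union> fst (snd v)))) ((fst (snd w) \<inter> K, snd (snd w) \<inter> K), (fst (snd w) - K, fst w)) = w"
      using e by (simp add: wA)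
    show "(\<lambda>v. \<phi> (fst (fst v) \<union> fst (snd v)) (snd (fst v) \<union> fst (snd v))) ((fst (snd w) \<inter> K, snd (snd w) \<inter> K), (fst (snd w) - K, fst w)) = \<phi> (fst (snd w)) (snd (snd w))"
      using e by (simp add: wA)
  next
    fix v assume v: "v \<in> (SIGMA q:PK (n - 1) K. SIGMA E:Es q. E)"
    obtain C C' E i where vC: "v = ((C, C'), (E, i))" by (metis prod.collapse)
    have q: "(C, C') \<in> PK (n - 1) K" and E: "E \<subseteq> J - K" "card E = n - card C" "i \<in> E" using v by (auto simp: vC Es_def)
    have fE: "finite E" using E(1) J by (auto intro: finite_subset)
    note C = PKD[OF K q]
    have e: "(C \<union> E) \<inter> K = C" "(C' \<union> E) \<inter> K = C'" "C \<union> E - K = E" using C(3) E(1) by auto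
    show "(\<lambda>w. ((fst (snd w) \<inter> K, snd (snd w) \<inter> K), (fst (snd w) - K, fst w))) (snd (snd v), (fst (fst v) \<union> fst (snd v), snd (fst v) \<union> fst (snd v))) = v"
      using e by (simp add: vC)
    have d: "C \<inter> E = {}" "C' \<inter> E = {}" using C(3) E(1) by auto
    have "card (C \<union> E) = n" "card (C' \<union> E) = n"
      using C E d n_pos fE by (simp_all add: card_Un_disjoint)
    moreover have "C \<union> E - K = C' \<union> E - K" "K \<subseteq> (C \<union> E) \<union> (C' \<union> E)" "C \<union> E \<subseteq> J" "C' \<union> E \<subseteq> J"
      using C(3) E(1) J by auto
    ultimately show "(snd (snd v), (fst (fst v) \<union> fst (snd v), snd (fst v) \<union> fst (snd v))) \<in> (SIGMA i:J - K. pairs i K J)"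
      using E(1,3) C(1,2) fE by (auto simp: vC pairs_def fam_def)
  qed
  also have "\<dots> = (\<Sum>q\<in>PK (n - 1) K. \<Sum>w\<in>(SIGMA E:Es q. E). \<phi> (fst q \<union> fst w) (snd q \<union> fst w))"
    by (subst sum.Sigma) (auto simp: finite_PK K split_def fEs intro!: finite_SigmaI fE)
  also have "\<dots> = (\<Sum>q\<in>PK (n - 1) K. \<Sum>E\<in>Es q. \<Sum>i\<in>E. \<phi> (fst q \<union> E) (snd q \<union> E))"
    by (intro sum.cong refl, subst sum.Sigma) (auto simp: fEs split_def intro: fE)
  also have "\<dots> = (\<Sum>q\<in>PK (n - 1) K. \<Sum>E\<in>Es q. real (n - card (fst q)) * \<phi> (fst q \<union> E) (snd q \<union> E))"
    by (intro sum.cong refl) (simp add: Es_def)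
  finally show ?thesis by (simp add: Es_def)
qed

text \<open>The average over x_i merges with the average over the other shared blocks into one over
  A - K, which no longer mentions \<open>i\<close>. The sum over i then only counts.\<close>

lemma Gh_W:
  assumes m: "K \<subseteq> {..<m}"
  shows "AE x in blk.P. 1 / n * (\<Sum>i\<in>{..<m} - K. blk.Ex {i} (H i K {..<m}) x)
    = (\<Sum>q\<in>PK (n - 1) K. (fact n)\<^sup>2 / (real n * fact (n - 1 - card (fst q))) * W (n - card (fst q)) (fst q) (snd q) m x)"
proof -
  have "AE x in blk.P. \<forall>q\<in>PK (n - 1) K. W (n - card (fst q)) (fst q) (snd q) m x = fact (n - card (fst q)) / (fact n)\<^sup>2 *
    (\<Sum>E | E \<subseteq> {..<m} - (fst q \<union> snd q) \<and> card E = n - card (fst q). blk.Ex E (\<lambda>x. u (fst q \<union> E) x * u (snd q \<union> E) x) x)"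
    using PK_args finite_PK[OF K] by (intro AE_finite_allI W_eq) auto
  moreover have "AE x in blk.P. \<forall>i\<in>{..<m} - K. blk.Ex {i} (H i K {..<m}) x = (\<Sum>p\<in>pairs i K {..<m}. blk.Ex (fst p - K) (\<lambda>x. u (fst p) x * u (snd p) x) x)"
  proof (rule AE_finite_allI)
    fix i assume i: "i \<in> {..<m} - K"
    have pi: "integrable blk.P (\<lambda>x. u (fst p) x * u (snd p) x)" "{i} \<union> (fst p - K - {i}) = fst p - K" if "p \<in> pairs i K {..<m}" for p
      using that i by (auto simp: pairs_def intro: uu_integrable)
    have "AE x in blk.P. blk.Ex {i} (\<lambda>x. \<Sum>p\<in>pairs i K {..<m}. 1 * blk.Ex (fst p - K - {i}) (\<lambda>x. u (fst p) x * u (snd p) x) x) x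
        = (\<Sum>p\<in>pairs i K {..<m}. 1 * blk.Ex {i} (blk.Ex (fst p - K - {i}) (\<lambda>x. u (fst p) x * u (snd p) x)) x)"
      using pi by (intro blk.Ex_sum_AE blk.integrable_Ex) auto
    moreover have "AE x in blk.P. \<forall>p\<in>pairs i K {..<m}. blk.Ex {i} (blk.Ex (fst p - K - {i}) (\<lambda>x. u (fst p) x * u (snd p) x)) x = blk.Ex (fst p - K) (\<lambda>x. u (fst p) x * u (snd p) x) x"
    proof (rule AE_finite_allI[OF finite_pairs])
      fix p assume p: "p \<in> pairs i K {..<m}"
      show "AE x in blk.P. blk.Ex {i} (blk.Ex (fst p - K - {i}) (\<lambda>x. u (fst p) x * u (snd p) x)) x = blk.Ex (fst p - K) (\<lambda>x. u (fst p) x * u (snd p) x) x"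
        using blk.Ex_Ex_AE[OF pi(1)[OF p], of "{i}" "fst p - K - {i}"] unfolding pi(2)[OF p] .
    qed simp
    ultimately show "AE x in blk.P. blk.Ex {i} (H i K {..<m}) x = (\<Sum>p\<in>pairs i K {..<m}. blk.Ex (fst p - K) (\<lambda>x. u (fst p) x * u (snd p) x) x)"
      by eventually_elim (simp add: H_def[abs_def] split_def)
  qed simp
  ultimately show ?thesis
  proof eventually_elim
    case (elim x)
    define \<phi> where "\<phi> A A' = blk.Ex (A - K) (\<lambda>x. u A x * u A' x) x" for A A'
    have "(\<Sum>i\<in>{..<m} - K. blk.Ex {i} (H i K {..<m}) x) = (\<Sum>i\<in>{..<m} - K. \<Sum>p\<in>pairs i K {..<m}. \<phi> (fst p) (snd p))"
      using elim(2) by (simp add: \<phi>_def)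
    also have "\<dots> = (\<Sum>q\<in>PK (n - 1) K. \<Sum>E | E \<subseteq> {..<m} - K \<and> card E = n - card (fst q). real (n - card (fst q)) * \<phi> (fst q \<union> E) (snd q \<union> E))"
      by (rule sum_pairs_PK[OF finite_lessThan m])
    finally have s: "1 / n * (\<Sum>i\<in>{..<m} - K. blk.Ex {i} (H i K {..<m}) x)
      = (\<Sum>q\<in>PK (n - 1) K. 1 / n * (\<Sum>E | E \<subseteq> {..<m} - K \<and> card E = n - card (fst q). real (n - card (fst q)) * \<phi> (fst q \<union> E) (snd q \<union> E)))"
      by (simp add: sum_distrib_left)
    show ?case unfolding s
    proof (rule sum.cong)
      fix q assume q: "q \<in> PK (n - 1) K"
      note qa = PK_args[OF q]
      define l where "l = n - 1 - card (fst q)"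
      have l: "n - card (fst q) = Suc l" using qa(8) by (simp add: l_def)
      have "(\<Sum>E | E \<subseteq> {..<m} - K \<and> card E = n - card (fst q). real (n - card (fst q)) * \<phi> (fst q \<union> E) (snd q \<union> E))
         = real (Suc l) * (\<Sum>E | E \<subseteq> {..<m} - (fst q \<union> snd q) \<and> card E = Suc l. blk.Ex E (\<lambda>x. u (fst q \<union> E) x * u (snd q \<union> E) x) x)"
        unfolding sum_distrib_left l qa(7)
      proof (rule sum.cong)
        fix E assume "E \<in> {E. E \<subseteq> {..<m} - K \<and> card E = Suc l}"
        then have "fst q \<union> E - K = E" using qa(7) by auto
        then show "real (Suc l) * \<phi> (fst q \<union> E) (snd q \<union> E) = real (Suc l) * blk.Ex E (\<lambda>x. u (fst q \<union> E) x * u (snd q \<union> E) x) x"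
          by (simp add: \<phi>_def)
      qed simp
      moreover have "W (Suc l) (fst q) (snd q) m x = fact (Suc l) / (fact n)\<^sup>2 * (\<Sum>E | E \<subseteq> {..<m} - (fst q \<union> snd q) \<and> card E = Suc l. blk.Ex E (\<lambda>x. u (fst q \<union> E) x * u (snd q \<union> E) x) x)"
        using elim(1)[rule_format, OF q] unfolding l .
      moreover have "(fact n)\<^sup>2 / (real n * fact l) * (fact (Suc l) / (fact n)\<^sup>2 * b) = 1 / real n * (real (Suc l) * b)" for b :: real
        using n_pos by (simp add: field_simps)
      ultimately show "1 / n * (\<Sum>E | E \<subseteq> {..<m} - K \<and> card E = n - card (fst q). real (n - card (fst q)) * \<phi> (fst q \<union> E) (snd q \<union> E))
        = (fact n)\<^sup>2 / (real n * fact (n - 1 - card (fst q))) * W (n - card (fst q)) (fst q) (snd q) m x"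
        unfolding l l_def[symmetric] by simp
    qed simp
  qed
qed

lemma Gh_tendsto:
  "(\<lambda>m. \<integral>x. \<bar>1 / n * (\<Sum>i\<in>{..<m} - K. blk.Ex {i} (H i K {..<m}) x) - GL K x\<bar> \<partial>blk.P) \<longlonglongrightarrow> 0"
  unfolding GL_def
proof (rule sum_W_tendsto[OF finite_PK[OF K]])
  show "\<forall>\<^sub>F m in sequentially. AE x in blk.P. 1 / n * (\<Sum>i\<in>{..<m} - K. blk.Ex {i} (H i K {..<m}) x)
    = (\<Sum>q\<in>PK (n - 1) K. (fact n)\<^sup>2 / (real n * fact (n - 1 - card (fst q))) * W (n - card (fst q)) (fst q) (snd q) m x)"
    by (rule eventually_mono[OF eventually_subset_lessThan[OF K]]) (rule Gh_W)
  show "integrable blk.P (\<lambda>x. 1 / n * (\<Sum>i\<in>{..<m} - K. blk.Ex {i} (H i K {..<m}) x))" for m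
    by (intro integrable_mult_right Bochner_Integration.integrable_sum blk.integrable_Ex H_integrable)
qed (use PK_args in auto)

end

end

section \<open>Symmetry, support and block sums of the functions G and Ghat\<close>

lemma Delta_permute:
  assumes p: "p permutes {..<k}" and z: "z \<in> Delta k" shows "z \<circ> p \<in> Delta k"
proof -
  obtain \<kappa> :: "nat \<Rightarrow> nat" where \<kappa>: "inj_on \<kappa> {..<k}" "z \<in> (\<Pi>\<^sub>E i\<in>{..<k}. {2 * real (\<kappa> i) .. 2 * real (\<kappa> i) + 2})"
    using z by (auto simp: Delta_def)
  have "inj_on (\<kappa> \<circ> p) {..<k}" using \<kappa>(1) p by (intro comp_inj_on) (auto simp: permutes_image intro: permutes_inj_on)
  moreover have "z \<circ> p \<in> (\<Pi>\<^sub>E i\<in>{..<k}. {2 * real ((\<kappa> \<circ> p) i) .. 2 * real ((\<kappa> \<circ> p) i) + 2})"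
  proof (rule PiE_I)
    fix i assume "i \<in> {..<k}"
    then have "p i \<in> {..<k}" using permutes_in_image[OF p] by blast
    then show "(z \<circ> p) i \<in> {2 * real ((\<kappa> \<circ> p) i) .. 2 * real ((\<kappa> \<circ> p) i) + 2}" using PiE_mem[OF \<kappa>(2)] by simp
  next
    fix i assume "i \<notin> {..<k}"
    then show "(z \<circ> p) i = undefined" using permutes_not_in[OF p] PiE_arb[OF \<kappa>(2)] by simp
  qed
  ultimately show ?thesis unfolding Delta_def by blast
qed

lemma symmetric_G: "symmetric_fun k (G d k g)"
  unfolding symmetric_fun_def
proof (intro allI impI)
  fix p and z :: "nat \<Rightarrow> real" assume p: "p permutes {..<k}"
  have "z \<circ> p \<in> Delta k \<longleftrightarrow> z \<in> Delta k"
    using Delta_permute[OF p, of z] Delta_permute[OF permutes_inv[OF p], of "z \<circ> p"]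
    by (auto simp: o_assoc[symmetric] permutes_inv_o[OF p])
  then have 1: "indicator (Delta k) (z \<circ> p) = (indicator (Delta k) z :: real)" by (simp add: indicator_def)
  have 2: "symmetrize k F (z \<circ> p) = symmetrize k F z" for F
    unfolding symmetrize_def by (subst (2) setum_permutations_compose_left[OF p]) (simp add: o_assoc)
  have t: "of_bool (2 * d - r - l = k) * fact r * (real (d choose r))\<^sup>2 * real (r choose l) * symmetrize (2 * d - r - l) (star d g d g l r) (z \<circ> p)
    = of_bool (2 * d - r - l = k) * fact r * (real (d choose r))\<^sup>2 * real (r choose l) * symmetrize (2 * d - r - l) (star d g d g l r) z" for r l
    using 2 by (cases "2 * d - r - l = k") auto
  show "G d k g (z \<circ> p) = G d k g z" unfolding G_def 1 t ..
qed

lemma G_outside_Delta: "z \<notin> Delta k \<Longrightarrow> G d k g z = 0"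
  by (simp add: G_def)

lemma G_large: "2 * d < k \<Longrightarrow> G d k g z = 0"
  by (auto simp: G_def intro!: disjI2 sum.neutral)

lemma symmetric_Ghat: "symmetric_fun k (Ghat n k f)"
  using symmetric_G by (auto simp: symmetric_fun_def Ghat_def)

lemma Ghat_outside_Delta: "z \<notin> Delta k \<Longrightarrow> Ghat n k f z = 0"
  by (simp add: Ghat_def G_outside_Delta)

lemma Delta_sets: "Delta k \<in> sets (Lb k)"
proof -
  \<comment> \<open>Only the restriction of an injection to the first k numbers matters; extensional
    representatives make the union countable.\<close>
  let ?I = "{m \<in> {..<k} \<rightarrow>\<^sub>E (UNIV :: nat set). inj_on m {..<k}}"
  have c: "countable ?I" by (rule countable_subset[of _ "{..<k} \<rightarrow>\<^sub>E UNIV"]) (auto intro: countable_PiE)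
  have "Delta k = (\<Union>m\<in>?I. \<Pi>\<^sub>E i\<in>{..<k}. {2 * real (m i) .. 2 * real (m i) + 2})"
  proof
    show "Delta k \<subseteq> (\<Union>m\<in>?I. \<Pi>\<^sub>E i\<in>{..<k}. {2 * real (m i) .. 2 * real (m i) + 2})"
    proof
      fix z assume "z \<in> Delta k"
      then obtain \<kappa> :: "nat \<Rightarrow> nat" where \<kappa>: "inj_on \<kappa> {..<k}" "z \<in> (\<Pi>\<^sub>E i\<in>{..<k}. {2 * real (\<kappa> i) .. 2 * real (\<kappa> i) + 2})"
        by (auto simp: Delta_def)
      have "(\<lambda>j\<in>{..<k}. \<kappa> j) \<in> ?I" using \<kappa>(1) by (simp add: inj_on_def)
      moreover have "z \<in> (\<Pi>\<^sub>E i\<in>{..<k}. {2 * real ((\<lambda>j\<in>{..<k}. \<kappa> j) i) .. 2 * real ((\<lambda>j\<in>{..<k}. \<kappa> j) i) + 2})"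
        using \<kappa>(2) by (auto simp: PiE_iff)
      ultimately show "z \<in> (\<Union>m\<in>?I. \<Pi>\<^sub>E i\<in>{..<k}. {2 * real (m i) .. 2 * real (m i) + 2})" by blast
    qed
    show "(\<Union>m\<in>?I. \<Pi>\<^sub>E i\<in>{..<k}. {2 * real (m i) .. 2 * real (m i) + 2}) \<subseteq> Delta k"
      unfolding Delta_def by blast
  qed
  also have "\<dots> \<in> sets (Lb k)"
  proof (rule sets.countable_UN''[OF c])
    show "(\<Pi>\<^sub>E i\<in>{..<k}. {2 * real (m i) .. 2 * real (m i) + 2}) \<in> sets (Lb k)" for m :: "nat \<Rightarrow> nat"
      by (rule sets_PiM_I_finite) simp_all
  qed
  finally show ?thesis .
qed

text \<open>For dx/2 every block has mass one, so the integral over the first \<open>N\<close>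
  blocks is a sum over tuples of distinct blocks, k! of which belong to each set. The truncation
  accounts for the inequality.\<close>

lemma sum_sval_le:
  assumes g: "g \<in> borel_measurable (Lb k)" "symmetric_fun k g" "\<And>z. z \<in> {..<k} \<rightarrow>\<^sub>E UNIV \<Longrightarrow> z \<notin> Delta k \<Longrightarrow> g z = 0"
  shows "fact k * (\<Sum>K | K \<subseteq> {..<N} \<and> card K = k. \<integral>\<^sup>+ x. ennreal ((sval k g x K)\<^sup>2) \<partial>blk.P)
    \<le> (\<integral>\<^sup>+ z. ennreal ((g z)\<^sup>2) \<partial>(\<Pi>\<^sub>M i\<in>{..<k}. half_leb))"
proof -
  have gm: "(\<lambda>z. ennreal ((g z)\<^sup>2)) \<in> borel_measurable (Lb k)" using g(1) by simp
  have "(\<Sum>m\<in>injs k N. \<integral>\<^sup>+ x. ennreal ((g (pt k m x))\<^sup>2) \<partial>blk.P)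
      = (\<Sum>K | K \<subseteq> {..<N} \<and> card K = k. \<Sum>m\<in>Bij k K. \<integral>\<^sup>+ x. ennreal ((g (pt k m x))\<^sup>2) \<partial>blk.P)"
    by (rule sum_injs_sets)
  also have "\<dots> = (\<Sum>K | K \<subseteq> {..<N} \<and> card K = k. fact k * (\<integral>\<^sup>+ x. ennreal ((sval k g x K)\<^sup>2) \<partial>blk.P))"
  proof (rule sum.cong)
    fix K assume "K \<in> {K. K \<subseteq> {..<N} \<and> card K = k}"
    then have K: "finite K" "card K = k" by (auto intro: finite_subset[of _ "{..<N}"])
    have "(\<Sum>m\<in>Bij k K. \<integral>\<^sup>+ x. ennreal ((g (pt k m x))\<^sup>2) \<partial>blk.P) = (\<Sum>m\<in>Bij k K. \<integral>\<^sup>+ x. ennreal ((sval k g x K)\<^sup>2) \<partial>blk.P)"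
    proof (rule sum.cong[OF refl])
      fix m assume "m \<in> Bij k K"
      then have "bij_betw m {..<k} K" by (simp add: Bij_def)
      then show "(\<integral>\<^sup>+ x. ennreal ((g (pt k m x))\<^sup>2) \<partial>blk.P) = (\<integral>\<^sup>+ x. ennreal ((sval k g x K)\<^sup>2) \<partial>blk.P)"
        by (simp only: sval_eq[OF g(2)])
    qed
    then show "(\<Sum>m\<in>Bij k K. \<integral>\<^sup>+ x. ennreal ((g (pt k m x))\<^sup>2) \<partial>blk.P) = fact k * (\<integral>\<^sup>+ x. ennreal ((sval k g x K)\<^sup>2) \<partial>blk.P)"
      using card_Bij(1)[OF K] by simp
  qed simp
  also have "\<dots> = fact k * (\<Sum>K | K \<subseteq> {..<N} \<and> card K = k. \<integral>\<^sup>+ x. ennreal ((sval k g x K)\<^sup>2) \<partial>blk.P)"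
    by (simp add: sum_distrib_left)
  finally have s: "(\<Sum>m\<in>injs k N. \<integral>\<^sup>+ x. ennreal ((g (pt k m x))\<^sup>2) \<partial>blk.P)
    = fact k * (\<Sum>K | K \<subseteq> {..<N} \<and> card K = k. \<integral>\<^sup>+ x. ennreal ((sval k g x K)\<^sup>2) \<partial>blk.P)" .
  have two: "ennreal ((1 / 2) ^ k) * (2 ^ k * a) = a" for a
  proof -
    have "ennreal ((1 / 2) ^ k) * 2 ^ k = ennreal ((1 / 2) ^ k) * ennreal (2 ^ k)" by (simp add: ennreal_power[symmetric])
    also have "\<dots> = 1" by (subst ennreal_mult[symmetric]) (auto simp: power_mult_distrib[symmetric])
    finally show ?thesis by (simp add: mult.assoc[symmetric])
  qed
  have "(\<Sum>m\<in>injs k N. \<integral>\<^sup>+ x. ennreal ((g (pt k m x))\<^sup>2) \<partial>blk.P)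
     = ennreal ((1 / 2) ^ k) * (\<integral>\<^sup>+ z. indicator (trunc k N) z * ennreal ((g z)\<^sup>2) \<partial>Lb k)"
    using g(3) by (subst nn_integral_trunc_injs[OF gm]) (auto simp: two)
  also have "\<dots> \<le> ennreal ((1 / 2) ^ k) * (\<integral>\<^sup>+ z. ennreal ((g z)\<^sup>2) \<partial>Lb k)"
    by (intro mult_left_mono nn_integral_mono) (auto simp: indicator_def)
  also have "\<dots> = (\<integral>\<^sup>+ z. ennreal ((g z)\<^sup>2) \<partial>(\<Pi>\<^sub>M i\<in>{..<k}. half_leb))"
    by (rule nn_integral_PiM_half_leb[OF gm, symmetric])
  finally show ?thesis unfolding s .
qed

section \<open>Identification of the limits with G and Ghat\<close>

context chaos_kernel
begin

abbreviation fs :: "real \<Rightarrow> (nat \<Rightarrow> real) \<Rightarrow> real" where "fs t \<equiv> \<lambda>y. f (case_nat t y)"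

text \<open>Among the \<open>Suc l\<close> tagged variables the first one is frozen at
  \<open>t\<close> and only the other \<open>l\<close> are integrated. So the section of the kernel
  at \<open>t\<close> is contracted in \<open>l\<close> variables.\<close>

definition contraction :: "nat \<Rightarrow> real \<Rightarrow> (nat \<Rightarrow> real) \<Rightarrow> nat set \<Rightarrow> nat set \<Rightarrow> real" where
  "contraction l t x C C' = 1 / 2 ^ l * (\<integral>z. ker (Suc l) C (case_nat t z) x * ker (Suc l) C' (case_nat t z) x \<partial>Lb l)"

lemma star_eq:
  assumes rl: "l \<le> r" "r \<le> n - 1" "2 * (n - 1) - r - l = k" and b: "b \<in> Bij k K"
  shows "star (n - 1) (fs t) (n - 1) (fs t) l r (pt k b x) = contraction l t x (b ` {..<n - 1 - l}) (b ` ({..<r - l} \<union> {n - 1 - l..<k}))"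
proof -
  define d where "d = n - 1"
  have n: "n = Suc d" using n_pos by (simp add: d_def)
  have rl: "l \<le> r" "r \<le> d" "2 * d - r - l = k" using rl by (simp_all add: d_def)
  \<comment> \<open>The blocks seen by the second factor: the shared positions below r - l, followed
    by the positions from d - l on, skipping those that belong to the first factor alone.\<close>
  define b' where "b' a = (if a < r - l then b a else b (d - l + (a - (r - l))))" for a
  have inj: "inj_on b {..<k}" using b by (simp add: Bij_def bij_betw_def)
  have b1: "bij_betw b {..<d - l} (b ` {..<d - l})"
    using rl by (auto simp: bij_betw_def intro: inj_on_subset[OF inj])
  have b2: "bij_betw b' {..<d - l} (b ` ({..<r - l} \<union> {d - l..<k}))"
  proof -
    have "bij_betw (\<lambda>a. if a < r - l then a else d - l + (a - (r - l))) {..<d - l} ({..<r - l} \<union> {d - l..<k})"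
      using rl by (intro bij_betw_byWitness[where f'="\<lambda>a. if a < r - l then a else a - (d - l) + (r - l)"]) auto
    moreover have "bij_betw b ({..<r - l} \<union> {d - l..<k}) (b ` ({..<r - l} \<union> {d - l..<k}))"
      using rl by (auto simp: bij_betw_def intro: inj_on_subset[OF inj])
    ultimately have "bij_betw (b \<circ> (\<lambda>a. if a < r - l then a else d - l + (a - (r - l)))) {..<d - l} (b ` ({..<r - l} \<union> {d - l..<k}))"
      by (rule bij_betw_trans)
    then show ?thesis by (rule bij_betw_cong[THEN iffD1, rotated]) (simp add: b'_def)
  qed
  have sd: "Suc l + (d - l) = n" using rl n by simp
  have p1: "case_nat t (\<lambda>j\<in>{..<d}. if j < l then z j else pt k b x (j - l)) = pt n (\<lambda>j. if j < Suc l then Inl j else Inr (b (j - Suc l))) (case_sum (case_nat t z) x)" for z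
  proof
    fix j show "case_nat t (\<lambda>j\<in>{..<d}. if j < l then z j else pt k b x (j - l)) j = pt n (\<lambda>j. if j < Suc l then Inl j else Inr (b (j - Suc l))) (case_sum (case_nat t z) x) j"
      using rl by (cases j) (auto simp: pt_def n)
  qed
  have p2: "case_nat t (\<lambda>j\<in>{..<d}. if j < l then z j else if j < r then pt k b x (j - l) else pt k b x (d - l + (j - r)))
      = pt n (\<lambda>j. if j < Suc l then Inl j else Inr (b' (j - Suc l))) (case_sum (case_nat t z) x)" for z
  proof
    fix j show "case_nat t (\<lambda>j\<in>{..<d}. if j < l then z j else if j < r then pt k b x (j - l) else pt k b x (d - l + (j - r))) j
      = pt n (\<lambda>j. if j < Suc l then Inl j else Inr (b' (j - Suc l))) (case_sum (case_nat t z) x) j"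
    proof (cases j)
      case (Suc j')
      show ?thesis
      proof (cases "j' < d")
        case True
        have "d - l + (j' - r) < k" if "\<not> j' < r" using that True rl by linarith
        moreover have "j' - l - (r - l) = j' - r" if "\<not> j' < r" using that rl by linarith
        moreover have "j' - l < r - l \<longleftrightarrow> j' < r" if "\<not> j' < l" using that by linarith
        moreover have "j' - l < k" if "j' < r" "\<not> j' < l" using that rl by linarith
        ultimately show ?thesis using True Suc rl by (auto simp: pt_def n b'_def)
      qed (simp add: Suc pt_def n)
    qed (simp add: pt_def n)
  qed
  have k1: "fs t (\<lambda>j\<in>{..<d}. if j < l then z j else pt k b x (j - l)) = ker (Suc l) (b ` {..<d - l}) (case_nat t z) x" for z
    unfolding p1 ker_def using idx_enum[OF b1, of "Suc l"] unfolding sd by (rule sval_eq[OF f_sym])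
  have k2: "fs t (\<lambda>j\<in>{..<d}. if j < l then z j else if j < r then pt k b x (j - l) else pt k b x (d - l + (j - r)))
     = ker (Suc l) (b ` ({..<r - l} \<union> {d - l..<k})) (case_nat t z) x" for z
    unfolding p2 ker_def using idx_enum[OF b2, of "Suc l"] unfolding sd by (rule sval_eq[OF f_sym])
  show ?thesis unfolding star_def contraction_def d_def[symmetric] k1[unfolded] k2 ..
qed

text \<open>The factor k! cancels the normalisation of the symmetrization, whose permutations become
  the enumerations of \<open>K\<close>; these are then grouped as in
  \<open>sum_symmetrized_contractions\<close>.\<close>

lemma G_sum:
  assumes K: "finite K" and e: "bij_betw e {..<k} K" and D: "pt k e x \<in> Delta k"
  shows "fact k * G (n - 1) k (fs t) (pt k e x)
    = (\<Sum>q\<in>PK (n - 1) K. (fact (n - 1))\<^sup>2 / fact (n - 1 - card (fst q)) * contraction (n - 1 - card (fst q)) t x (fst q) (snd q))"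
proof -
  define d where "d = n - 1"
  have cK: "card K = k" using bij_betw_same_card[OF e] by simp
  have s: "fact k * symmetrize k F (pt k e x) = (\<Sum>b\<in>Bij k K. F (pt k b x))" for F
  proof -
    have "pt k e x \<circ> p = pt k (\<lambda>j\<in>{..<k}. e (p j)) x" if p: "p permutes {..<k}" for p
    proof
      fix j show "(pt k e x \<circ> p) j = pt k (\<lambda>j\<in>{..<k}. e (p j)) x j"
        using permutes_in_image[OF p, of j] permutes_not_in[OF p, of j] by (cases "j < k") (auto simp: pt_def)
    qed
    then have "(\<Sum>p | p permutes {..<k}. F (pt k e x \<circ> p)) = (\<Sum>p | p permutes {..<k}. F (pt k (\<lambda>j\<in>{..<k}. e (p j)) x))"
      by (intro sum.cong) auto
    also have "\<dots> = (\<Sum>b\<in>Bij k K. F (pt k b x))" by (rule sum_permutes_Bij[OF e, of "\<lambda>b. F (pt k b x)"])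
    finally show ?thesis by (simp add: symmetrize_def)
  qed
  have "fact k * G d k (fs t) (pt k e x) = (\<Sum>r\<le>d. \<Sum>l\<le>r. of_bool (2 * d - r - l = k) * fact r * (real (d choose r))\<^sup>2 * real (r choose l)
        * (fact k * symmetrize (2 * d - r - l) (star d (fs t) d (fs t) l r) (pt k e x)))"
    using D by (simp add: G_def sum_distrib_left mult_ac)
  also have "\<dots> = (\<Sum>r\<le>d. \<Sum>l\<le>r. of_bool (2 * d - r - l = k) * fact r * (real (d choose r))\<^sup>2 * real (r choose l)
        * (\<Sum>b\<in>Bij k K. contraction l t x (b ` {..<d - l}) (b ` ({..<r - l} \<union> {d - l..<k}))))"
  proof (intro sum.cong refl)
    fix r l assume rl: "r \<in> {..d}" "l \<in> {..r}"
    show "of_bool (2 * d - r - l = k) * fact r * (real (d choose r))\<^sup>2 * real (r choose l)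
        * (fact k * symmetrize (2 * d - r - l) (star d (fs t) d (fs t) l r) (pt k e x))
      = of_bool (2 * d - r - l = k) * fact r * (real (d choose r))\<^sup>2 * real (r choose l)
        * (\<Sum>b\<in>Bij k K. contraction l t x (b ` {..<d - l}) (b ` ({..<r - l} \<union> {d - l..<k})))"
    proof (cases "2 * d - r - l = k")
      case True
      have "fact k * symmetrize (2 * d - r - l) (star d (fs t) d (fs t) l r) (pt k e x) = (\<Sum>b\<in>Bij k K. star d (fs t) d (fs t) l r (pt k b x))"
        unfolding True by (rule s)
      also have "\<dots> = (\<Sum>b\<in>Bij k K. contraction l t x (b ` {..<d - l}) (b ` ({..<r - l} \<union> {d - l..<k})))"
        using rl True unfolding d_def by (intro sum.cong refl star_eq[where K=K]) auto
      finally show ?thesis by simp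
    qed simp
  qed
  also have "\<dots> = (\<Sum>(C, C')\<in>PK d K. (fact d)\<^sup>2 / fact (d - card C) * contraction (d - card C) t x C C')"
    by (rule sum_symmetrized_contractions[OF K cK, of d "\<lambda>l. contraction l t x"])
  finally show ?thesis by (simp add: d_def split_def)
qed

text \<open>Freezing the first tagged variable at x_i has the same effect as counting
  \<open>i\<close> among the blocks, up to a renaming of labels.\<close>

lemma ker_insert:
  assumes C: "finite C" "Suc l + card C = n" "i \<notin> C"
  shows "ker (Suc l) C (case_nat (x i) z) x = ker l (insert i C) z x"
proof -
  define \<psi> :: "nat + nat \<Rightarrow> nat + nat" where "\<psi> = case_sum (case_nat (Inr i) Inl) Inr"
  have \<psi>: "bij_betw \<psi> (idx (Suc l) C) (idx l (insert i C))"
  proof (rule bij_betw_byWitness[where f'="case_sum (\<lambda>j. Inl (Suc j)) (\<lambda>a. if a = i then Inl 0 else Inr a)"])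
    show "\<forall>a\<in>idx (Suc l) C. case_sum (\<lambda>j. Inl (Suc j)) (\<lambda>a. if a = i then Inl 0 else Inr a) (\<psi> a) = a"
      using C(3) by (auto simp: idx_def \<psi>_def split: nat.split)
    show "\<forall>a\<in>idx l (insert i C). \<psi> (case_sum (\<lambda>j. Inl (Suc j)) (\<lambda>a. if a = i then Inl 0 else Inr a) a) = a"
      by (auto simp: idx_def \<psi>_def)
    show "\<psi> ` idx (Suc l) C \<subseteq> idx l (insert i C)"
      by (auto simp: idx_def \<psi>_def split: nat.split)
    show "case_sum (\<lambda>j. Inl (Suc j)) (\<lambda>a. if a = i then Inl 0 else Inr a) ` idx l (insert i C) \<subseteq> idx (Suc l) C"
      by (auto simp: idx_def)
  qed
  have "ker l (insert i C) z x = sval n f (case_sum z x \<circ> \<psi>) (idx (Suc l) C)"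
    unfolding ker_def by (rule sval_reindex[OF f_sym idxA[OF C(1,2)] \<psi>])
  also have "case_sum z x \<circ> \<psi> = case_sum (case_nat (x i) z) x"
    by (auto simp: fun_eq_iff \<psi>_def split: sum.split nat.split)
  finally show ?thesis by (simp add: ker_def)
qed

definition Hlim :: "nat \<Rightarrow> nat set \<Rightarrow> (nat \<Rightarrow> real) \<Rightarrow> real" where
  "Hlim i K x = (real n)\<^sup>2 * fact (card K) * sval (card K) (G (n - 1) (card K) (fs (x i))) x K"

definition Gh :: "nat set \<Rightarrow> (nat \<Rightarrow> real) \<Rightarrow> real" where
  "Gh K x = real n * fact (card K) * sval (card K) (Ghat n (card K) f) x K"

lemma pt_in_Delta:
  assumes e: "bij_betw e {..<k} K" and x: "\<forall>k. 2 * real k < x k \<and> x k < 2 * real k + 2"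
  shows "pt k e x \<in> Delta k"
  using e x by (intro in_Delta[where m=e]) (auto simp: pt_def bij_betw_def less_imp_le)

lemma fact_n: "fact n = real n * fact (n - 1)"
  using n_pos by (simp add: fact_reduce)

lemma Hlim_HL:
  assumes K: "finite K" "i \<notin> K"
  shows "AE x in blk.P. Hlim i K x = HL i K x"
  using AE_block
proof eventually_elim
  case (elim x)
  obtain e where e: "bij_betw e {..<card K} K" using obtain_enum[OF K(1) refl] .
  have "Hlim i K x = (real n)\<^sup>2 * (fact (card K) * G (n - 1) (card K) (fs (x i)) (pt (card K) e x))"
    by (simp add: Hlim_def sval_eq[OF symmetric_G e])
  also have "\<dots> = (\<Sum>q\<in>PK (n - 1) K. (real n)\<^sup>2 * ((fact (n - 1))\<^sup>2 / fact (n - 1 - card (fst q)) * contraction (n - 1 - card (fst q)) (x i) x (fst q) (snd q)))"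
    unfolding G_sum[OF K(1) e pt_in_Delta[OF e elim]] by (simp only: sum_distrib_left)
  also have "\<dots> = HL i K x"
    unfolding HL_def
  proof (rule sum.cong)
    fix q assume q: "q \<in> PK (n - 1) K"
    note qa = PK_args[OF K(1) q]
    have i: "i \<notin> fst q" "i \<notin> snd q" using qa(7) K(2) by auto
    have s: "Suc (n - 1 - card (fst q)) + card (fst q) = n" "Suc (n - 1 - card (fst q)) + card (snd q) = n"
      using qa(3,4,8) by simp_all
    have "contraction (n - 1 - card (fst q)) (x i) x (fst q) (snd q) = Winf (n - 1 - card (fst q)) (insert i (fst q)) (insert i (snd q)) x"
      unfolding contraction_def ker_insert[OF qa(1) s(1) i(1)] ker_insert[OF qa(2) s(2) i(2)]
      using qa K(2) by (subst Winf_def) auto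
    then show "(real n)\<^sup>2 * ((fact (n - 1))\<^sup>2 / fact (n - 1 - card (fst q)) * contraction (n - 1 - card (fst q)) (x i) x (fst q) (snd q))
      = (fact n)\<^sup>2 / fact (n - 1 - card (fst q)) * Winf (n - 1 - card (fst q)) (insert i (fst q)) (insert i (snd q)) x"
      by (simp add: fact_n power_mult_distrib)
  qed simp
  finally show ?case .
qed

text \<open>For almost every \<open>x\<close> the products of kernels are integrable in all
  contracted variables together, so Fubini lets the integral over \<open>t\<close> in
  \<open>Ghat\<close> pass through the finite sum defining \<open>G\<close>.\<close>

lemma Gh_GL:
  assumes K: "finite K"
  shows "AE x in blk.P. Gh K x = GL K x"
proof -
  obtain e where e: "bij_betw e {..<card K} K" using obtain_enum[OF K refl] .
  have "AE x in blk.P. \<forall>q\<in>PK (n - 1) K. integrable (Lb (n - card (fst q))) (\<lambda>z. ker (n - card (fst q)) (fst q) z x * ker (n - card (fst q)) (snd q) z x)"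
    using PK_args[OF K] finite_PK[OF K] by (intro AE_finite_allI AE_ker_mult_integrable) auto
  then show ?thesis using AE_block
  proof eventually_elim
    case (elim x)
    \<comment> \<open>Integrating out \<open>t\<close> makes it one more contracted variable. The
      normalisation 1 / 2^l lacks one half of that in \<open>Winf\<close>; the resulting factor 2
      cancels the 1/2 in \<open>Ghat\<close>.\<close>
    have I: "integrable leb_plus (\<lambda>t. contraction (n - 1 - card (fst q)) t x (fst q) (snd q))"
      "(\<integral>t. contraction (n - 1 - card (fst q)) t x (fst q) (snd q) \<partial>leb_plus) = 2 * Winf (n - card (fst q)) (fst q) (snd q) x"
      if q: "q \<in> PK (n - 1) K" for q
    proof -
      define l where "l = n - 1 - card (fst q)"
      note qa = PK_args[OF K q]
      have l: "n - card (fst q) = Suc l" using qa(8) by (simp add: l_def)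
      have i: "integrable (Lb (Suc l)) (\<lambda>z. ker (Suc l) (fst q) z x * ker (Suc l) (snd q) z x)" using elim(1) q l by auto
      note c = integral_case_nat[OF i]
      show "integrable leb_plus (\<lambda>t. contraction (n - 1 - card (fst q)) t x (fst q) (snd q))"
        unfolding contraction_def l_def[symmetric] using c(1) by (rule integrable_mult_right)
      have "2 * Winf (Suc l) (fst q) (snd q) x = 1 / 2 ^ l * (\<integral>z. ker (Suc l) (fst q) z x * ker (Suc l) (snd q) z x \<partial>Lb (Suc l))"
        using qa l by (subst Winf_def) auto
      then show "(\<integral>t. contraction (n - 1 - card (fst q)) t x (fst q) (snd q) \<partial>leb_plus) = 2 * Winf (n - card (fst q)) (fst q) (snd q) x"
        unfolding contraction_def l_def[symmetric] l c(2) by simp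
    qed
    have g: "G (n - 1) (card K) (fs t) (pt (card K) e x) = 1 / fact (card K) *
       (\<Sum>q\<in>PK (n - 1) K. (fact (n - 1))\<^sup>2 / fact (n - 1 - card (fst q)) * contraction (n - 1 - card (fst q)) t x (fst q) (snd q))" for t
      unfolding G_sum[OF K e pt_in_Delta[OF e elim(2)], symmetric] by simp
    have "Gh K x = real n * fact (card K) * Ghat n (card K) f (pt (card K) e x)"
      by (simp add: Gh_def sval_eq[OF symmetric_Ghat e])
    also have "Ghat n (card K) f (pt (card K) e x) = 1 / 2 * (1 / fact (card K) *
       (\<Sum>q\<in>PK (n - 1) K. (fact (n - 1))\<^sup>2 / fact (n - 1 - card (fst q)) * (2 * Winf (n - card (fst q)) (fst q) (snd q) x)))"
      unfolding Ghat_def g using I by simp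
    also have "real n * fact (card K) * \<dots> = (\<Sum>q\<in>PK (n - 1) K. real n * ((fact (n - 1))\<^sup>2 / fact (n - 1 - card (fst q)) * Winf (n - card (fst q)) (fst q) (snd q) x))"
      by (simp add: sum_distrib_left mult_ac)
    also have "\<dots> = GL K x" unfolding GL_def
      using n_pos by (intro sum.cong refl) (simp add: fact_n power2_eq_square)
    finally show ?case .
  qed
qed

end

section \<open>Measurability and sums of squared norms\<close>

lemma esqrt_ennreal: "x \<ge> 0 \<Longrightarrow> esqrt (ennreal x) = ennreal (sqrt x)"
  by (simp add: esqrt_def)

lemma esqrt_square: "(esqrt x)\<^sup>2 = x"
proof (cases x)
  case (real r)
  then show ?thesis by (simp add: esqrt_ennreal ennreal_power)
next
  case top
  then show ?thesis by (simp add: esqrt_def)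
qed

lemma L2norm_square: "(L2norm k g)\<^sup>2 = (\<integral>\<^sup>+ z. ennreal ((g z)\<^sup>2) \<partial>(\<Pi>\<^sub>M i\<in>{..<k}. half_leb))"
  by (simp add: L2norm_def esqrt_square)

lemma sum_Pow_card:
  fixes h :: "nat set \<Rightarrow> ennreal"
  assumes "\<And>K. K \<subseteq> {..<N} \<Longrightarrow> card K \<notin> I \<Longrightarrow> K \<in> S \<Longrightarrow> h K = 0" and I: "finite I" and S: "S \<subseteq> Pow {..<N}"
  shows "(\<Sum>K\<in>S. h K) \<le> (\<Sum>k\<in>I. \<Sum>K | K \<subseteq> {..<N} \<and> card K = k. h K)"
proof -
  have fP: "finite S" using S by (rule finite_subset) simp
  have "(\<Sum>K\<in>S. h K) = (\<Sum>K\<in>{K \<in> S. card K \<in> I}. h K)"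
    using assms S by (intro sum.mono_neutral_right fP) auto
  also have "\<dots> \<le> (\<Sum>K\<in>{K \<in> Pow {..<N}. card K \<in> I}. h K)" using S by (intro sum_mono2) auto
  also have "\<dots> = (\<Sum>k\<in>I. \<Sum>K\<in>{K \<in> {K \<in> Pow {..<N}. card K \<in> I}. card K = k}. h K)"
    by (rule sum.group[symmetric]) (use I in auto)
  also have "\<dots> = (\<Sum>k\<in>I. \<Sum>K | K \<subseteq> {..<N} \<and> card K = k. h K)"
    by (intro sum.cong) auto
  finally show ?thesis .
qed

context chaos_kernel
begin

lemma measurable_star_factor:
  fixes F :: "(real \<times> (nat \<Rightarrow> real)) \<times> (nat \<Rightarrow> real) \<Rightarrow> nat \<Rightarrow> real"
  assumes "\<And>w j. j < n - 1 \<Longrightarrow> F w j = (if j < l then snd w j else snd (fst w) (c j))"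
    "\<And>j. j < n - 1 \<Longrightarrow> \<not> j < l \<Longrightarrow> c j < k" "\<And>w. F w \<in> extensional {..<n - 1}"
  shows "(\<lambda>w. f (case_nat (fst (fst w)) (F w))) \<in> borel_measurable ((leb_plus \<Otimes>\<^sub>M Lb k) \<Otimes>\<^sub>M Lb l)"
proof (rule measurable_compose[OF measurable_PiM_leb_plus f_measurable])
  fix j assume j: "j < n"
  show "(\<lambda>w. case_nat (fst (fst w)) (F w) j) \<in> borel_measurable ((leb_plus \<Otimes>\<^sub>M Lb k) \<Otimes>\<^sub>M Lb l)"
  proof (cases j)
    case 0
    have "(\<lambda>w. fst (fst w)) \<in> (leb_plus \<Otimes>\<^sub>M Lb k) \<Otimes>\<^sub>M Lb l \<rightarrow>\<^sub>M leb_plus"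
      by (rule measurable_compose[OF measurable_fst measurable_fst])
    then show ?thesis using 0 by (simp add: measurable_cong_sets[OF refl sets_leb_plus])
  next
    case (Suc j')
    then have j': "j' < n - 1" using j by simp
    show ?thesis
    proof (cases "j' < l")
      case True
      then show ?thesis using Suc j' assms(1) measurable_compose[OF measurable_snd measurable_component_Lb[OF True]] by simp
    next
      case False
      have "(\<lambda>w. snd (fst w) (c j')) \<in> borel_measurable ((leb_plus \<Otimes>\<^sub>M Lb k) \<Otimes>\<^sub>M Lb l)"
        by (rule measurable_compose[OF measurable_compose[OF measurable_fst measurable_snd] measurable_component_Lb[OF assms(2)[OF j' False]]])
      then show ?thesis using Suc j' assms(1) False by simp
    qed
  qed
next
  fix w
  show "case_nat (fst (fst w)) (F w) \<in> extensional {..<n}"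
    using assms(3)[of w] n_pos by (auto simp: extensional_def split: nat.split)
qed

text \<open>Measurability is established jointly in \<open>t\<close> and the other variables, since
  \<open>t\<close> is later replaced by the random x_i and integrated by Tonelli.\<close>

lemma measurable_G: "(\<lambda>q. G (n - 1) k (fs (fst q)) (snd q)) \<in> borel_measurable (leb_plus \<Otimes>\<^sub>M Lb k)"
proof -
  define d where "d = n - 1"
  have st: "(\<lambda>q. star d (fs (fst q)) d (fs (fst q)) l r (snd q \<circ> p)) \<in> borel_measurable (leb_plus \<Otimes>\<^sub>M Lb k)"
    if rl: "l \<le> r" "r \<le> d" "2 * d - r - l = k" and p: "p permutes {..<k}" for r l p
  proof -
    interpret L: sigma_finite_measure "Lb l" by (rule sigma_finite_Lb)
    have pk: "p j < k" if "j < k" for j using permutes_in_image[OF p, of j] that by simp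
    have 1: "(\<lambda>w. f (case_nat (fst (fst w)) (\<lambda>j\<in>{..<d}. if j < l then snd w j else (snd (fst w) \<circ> p) (j - l)))) \<in> borel_measurable ((leb_plus \<Otimes>\<^sub>M Lb k) \<Otimes>\<^sub>M Lb l)"
    proof (rule measurable_star_factor[where c="\<lambda>j. p (j - l)"])
      fix j assume "j < n - 1" "\<not> j < l"
      then have "j - l < k" using rl unfolding d_def by linarith
      then show "p (j - l) < k" by (rule pk)
    qed (auto simp: d_def)
    have 2: "(\<lambda>w. f (case_nat (fst (fst w)) (\<lambda>j\<in>{..<d}. if j < l then snd w j else if j < r then (snd (fst w) \<circ> p) (j - l) else (snd (fst w) \<circ> p) (d - l + (j - r)))))
       \<in> borel_measurable ((leb_plus \<Otimes>\<^sub>M Lb k) \<Otimes>\<^sub>M Lb l)"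
    proof (rule measurable_star_factor[where c="\<lambda>j. if j < r then p (j - l) else p (d - l + (j - r))"])
      fix j assume j: "j < n - 1" "\<not> j < l"
      have "j - l < k" if "j < r" using that j rl unfolding d_def by linarith
      moreover have "d - l + (j - r) < k" if "\<not> j < r" using that j rl unfolding d_def by linarith
      ultimately show "(if j < r then p (j - l) else p (d - l + (j - r))) < k" using pk by simp
    qed (auto simp: d_def)
    have "(\<lambda>q. \<integral>z. f (case_nat (fst q) (\<lambda>j\<in>{..<d}. if j < l then z j else (snd q \<circ> p) (j - l)))
        * f (case_nat (fst q) (\<lambda>j\<in>{..<d}. if j < l then z j else if j < r then (snd q \<circ> p) (j - l) else (snd q \<circ> p) (d - l + (j - r)))) \<partial>Lb l)
       \<in> borel_measurable (leb_plus \<Otimes>\<^sub>M Lb k)"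
      by (rule L.borel_measurable_lebesgue_integral) (unfold split_def, rule borel_measurable_times[OF 1 2, unfolded fst_conv snd_conv])
    then show ?thesis unfolding star_def by (rule borel_measurable_times[OF borel_measurable_const])
  qed
  have i: "(\<lambda>q. indicator (Delta k) (snd q) :: real) \<in> borel_measurable (leb_plus \<Otimes>\<^sub>M Lb k)"
    by (rule measurable_compose[OF measurable_snd borel_measurable_indicator[OF Delta_sets]])
  have t: "(\<lambda>q. of_bool (2 * d - r - l = k) * fact r * (real (d choose r))\<^sup>2 * real (r choose l) * symmetrize (2 * d - r - l) (star d (fs (fst q)) d (fs (fst q)) l r) (snd q))
      \<in> borel_measurable (leb_plus \<Otimes>\<^sub>M Lb k)" if "r \<in> {..d}" "l \<in> {..r}" for r l
  proof (cases "2 * d - r - l = k")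
    case True
    have "(\<lambda>q. (\<Sum>p | p permutes {..<k}. star d (fs (fst q)) d (fs (fst q)) l r (snd q \<circ> p)) / fact k) \<in> borel_measurable (leb_plus \<Otimes>\<^sub>M Lb k)"
      using that True by (intro borel_measurable_divide borel_measurable_sum borel_measurable_const st) auto
    then show ?thesis unfolding True symmetrize_def by (rule borel_measurable_times[OF borel_measurable_const])
  qed simp
  show ?thesis unfolding G_def d_def[symmetric]
    by (rule borel_measurable_times[OF i]) (rule borel_measurable_sum, rule borel_measurable_sum, rule t)
qed

lemma measurable_G1: "G (n - 1) k (fs t) \<in> borel_measurable (Lb k)"
  using measurable_compose[OF measurable_Pair1'[of t leb_plus "Lb k"] measurable_G] by simp

definition f_norm :: real where "f_norm = enn2real (L2norm n f)"

lemma L2norm_f: "L2norm n f = ennreal f_norm" and f_norm_square: "f_norm\<^sup>2 = 1 / 2 ^ n * (\<integral>x. (f x)\<^sup>2 \<partial>Lb n)" and aL_eq_f_norm: "aL = fact n * f_norm\<^sup>2"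
proof -
  have fm: "(\<lambda>x. ennreal ((f x)\<^sup>2)) \<in> borel_measurable (Lb n)" using f_measurable by simp
  have "(\<integral>\<^sup>+ z. ennreal ((f z)\<^sup>2) \<partial>(\<Pi>\<^sub>M i\<in>{..<n}. half_leb)) = ennreal ((1 / 2) ^ n) * ennreal (\<integral>x. (f x)\<^sup>2 \<partial>Lb n)"
    unfolding nn_integral_PiM_half_leb[OF fm] using f2_integrable by (subst nn_integral_eq_integral) auto
  also have "\<dots> = ennreal (1 / 2 ^ n * (\<integral>x. (f x)\<^sup>2 \<partial>Lb n))"
    by (subst ennreal_mult[symmetric]) (auto simp: power_divide)
  finally have e: "L2norm n f = ennreal (sqrt (1 / 2 ^ n * (\<integral>x. (f x)\<^sup>2 \<partial>Lb n)))"
    unfolding L2norm_def by (simp add: esqrt_ennreal)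
  then show 1: "L2norm n f = ennreal f_norm" by (simp add: f_norm_def)
  show 2: "f_norm\<^sup>2 = 1 / 2 ^ n * (\<integral>x. (f x)\<^sup>2 \<partial>Lb n)"
    unfolding f_norm_def e by simp
  show "aL = fact n * f_norm\<^sup>2" unfolding 2 aL_def by simp
qed

lemma a_le_aL: "a {..<N} \<le> aL"
proof (rule LIMSEQ_le_const[OF a_lim], intro exI allI impI)
  fix m assume "N \<le> m"
  then show "a {..<N} \<le> a {..<m}"
    unfolding a_def by (intro sum_mono2) (auto simp: finite_fam u_norm_nonneg, auto simp: fam_def)
qed

lemma Hlim_dep: assumes K: "finite K" shows "blk.dep (insert i K) (Hlim i K)"
  unfolding blk.dep_def
proof (intro allI impI)
  fix x y :: "nat \<Rightarrow> real" assume e: "\<forall>j\<in>insert i K. x j = y j"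
  have "sval (card K) (G (n - 1) (card K) (fs (y i))) x K = sval (card K) (G (n - 1) (card K) (fs (y i))) y K"
    using e by (intro sval_cong[OF K refl]) auto
  then show "Hlim i K x = Hlim i K y" using e by (simp add: Hlim_def)
qed

lemma Gh_dep: assumes K: "finite K" shows "blk.dep K (Gh K)"
  unfolding blk.dep_def Gh_def using sval_cong[OF K refl, where f="Ghat n (card K) f"] by metis

lemma Hlim_measurable: assumes K: "finite K" shows "Hlim i K \<in> borel_measurable blk.P"
proof -
  define \<sigma> where "\<sigma> = (SOME \<sigma>. bij_betw \<sigma> {..<card K} K)"
  have "(\<lambda>x. (x i, pt (card K) \<sigma> x)) \<in> blk.P \<rightarrow>\<^sub>M leb_plus \<Otimes>\<^sub>M Lb (card K)"
    using measurable_pt_P blk.measurable_component_P by (intro measurable_Pair) (simp_all add: measurable_cong_sets[OF refl sets_leb_plus])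
  from measurable_compose[OF this measurable_G]
  have "(\<lambda>x. G (n - 1) (card K) (fs (x i)) (pt (card K) \<sigma> x)) \<in> borel_measurable blk.P" by simp
  then show ?thesis unfolding Hlim_def[abs_def] sval_def \<sigma>_def[symmetric]
    by (intro borel_measurable_times borel_measurable_const)
qed

text \<open>For fixed \<open>t\<close> the integrand ignores coordinate \<open>i\<close>. Resampling
  x_i therefore separates it from the remaining coordinates.\<close>

lemma nn_integral_split_component:
  assumes \<phi>: "(\<lambda>q. \<phi> (fst q) (snd q)) \<in> borel_measurable (leb_plus \<Otimes>\<^sub>M blk.P)"
    and dep: "\<And>t x y. \<phi> t (override_on x y {i}) = \<phi> t x"
  shows "(\<integral>\<^sup>+ x. \<phi> (x i) x \<partial>blk.P) = (\<integral>\<^sup>+ t. \<integral>\<^sup>+ x. \<phi> t x \<partial>blk.P \<partial>blk i)"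
proof -
  interpret PP: pair_sigma_finite blk.P blk.P ..
  have m1: "(\<lambda>x. \<phi> (x i) x) \<in> borel_measurable blk.P"
  proof -
    have "(\<lambda>x. (x i, x)) \<in> blk.P \<rightarrow>\<^sub>M leb_plus \<Otimes>\<^sub>M blk.P"
      using blk.measurable_component_P[of i] by (intro measurable_Pair) (simp_all add: measurable_cong_sets[OF refl sets_leb_plus])
    from measurable_compose[OF this \<phi>] show ?thesis by simp
  qed
  have m2: "(\<lambda>q. \<phi> (snd q i) (fst q)) \<in> borel_measurable (blk.P \<Otimes>\<^sub>M blk.P)"
  proof -
    have "(\<lambda>q. (snd q i, fst q)) \<in> blk.P \<Otimes>\<^sub>M blk.P \<rightarrow>\<^sub>M leb_plus \<Otimes>\<^sub>M blk.P"
      using measurable_compose[OF measurable_snd blk.measurable_component_P[of i], of blk.P]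
      by (intro measurable_Pair) (simp_all add: measurable_cong_sets[OF refl sets_leb_plus])
    from measurable_compose[OF this \<phi>] show ?thesis by simp
  qed
  have mt: "(\<lambda>t. \<integral>\<^sup>+ x. \<phi> t x \<partial>blk.P) \<in> borel_measurable (blk i)"
  proof -
    have "(\<lambda>t. \<integral>\<^sup>+ x. \<phi> t x \<partial>blk.P) \<in> borel_measurable leb_plus"
      using blk.P.borel_measurable_nn_integral_fst[OF \<phi>] by simp
    then show ?thesis by (simp add: measurable_cong_sets[OF sets_leb_plus refl] measurable_cong_sets[OF sets_blk refl])
  qed
  have om: "(\<lambda>(x, y). override_on x y {i}) \<in> blk.P \<Otimes>\<^sub>M blk.P \<rightarrow>\<^sub>M blk.P"
    unfolding split_def by (rule blk.measurable_override_on) simp_all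
  have "(\<integral>\<^sup>+ x. \<phi> (x i) x \<partial>blk.P) = (\<integral>\<^sup>+ x. \<phi> (x i) x \<partial>distr (blk.P \<Otimes>\<^sub>M blk.P) blk.P (\<lambda>(x, y). override_on x y {i}))"
    by (subst blk.distr_override_on) rule
  also have "\<dots> = (\<integral>\<^sup>+ q. \<phi> (snd q i) (fst q) \<partial>(blk.P \<Otimes>\<^sub>M blk.P))"
    using m1 by (subst nn_integral_distr[OF om]) (auto simp: split_def dep)
  also have "\<dots> = (\<integral>\<^sup>+ y. \<integral>\<^sup>+ x. \<phi> (y i) x \<partial>blk.P \<partial>blk.P)"
    using PP.nn_integral_snd[of "\<lambda>q. \<phi> (snd q i) (fst q)"] m2 by (simp add: split_def)
  also have "\<dots> = (\<integral>\<^sup>+ t. \<integral>\<^sup>+ x. \<phi> t x \<partial>blk.P \<partial>distr blk.P (blk i) (\<lambda>y. y i))"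
    using mt blk.measurable_component_P[of i] by (subst nn_integral_distr) (simp_all add: measurable_cong_sets[OF refl sets_blk])
  also have "\<dots> = (\<integral>\<^sup>+ t. \<integral>\<^sup>+ x. \<phi> t x \<partial>blk.P \<partial>blk i)" by (simp add: distr_component_P)
  finally show ?thesis .
qed

lemma Hlim_nn_integral:
  assumes K: "finite K" "i \<notin> K" and k: "card K = k"
  shows "(\<integral>\<^sup>+ x. ennreal ((Hlim i K x)\<^sup>2) \<partial>blk.P)
    = ennreal (real n ^ 4 * (fact k)\<^sup>2) * (\<integral>\<^sup>+ t. \<integral>\<^sup>+ x. ennreal ((sval k (G (n - 1) k (fs t)) x K)\<^sup>2) \<partial>blk.P \<partial>blk i)"
proof -
  define \<sigma> where "\<sigma> = (SOME \<sigma>. bij_betw \<sigma> {..<k} K)"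
  define \<phi> where "\<phi> t x = ennreal ((sval k (G (n - 1) k (fs t)) x K)\<^sup>2)" for t x
  have "(\<lambda>q. (fst q, pt k \<sigma> (snd q))) \<in> leb_plus \<Otimes>\<^sub>M blk.P \<rightarrow>\<^sub>M leb_plus \<Otimes>\<^sub>M Lb k"
    by (intro measurable_Pair measurable_fst measurable_compose[OF measurable_snd measurable_pt_P])
  from measurable_compose[OF this measurable_G]
  have m: "(\<lambda>q. \<phi> (fst q) (snd q)) \<in> borel_measurable (leb_plus \<Otimes>\<^sub>M blk.P)"
    unfolding \<phi>_def sval_def \<sigma>_def[symmetric] by simp
  have dep: "\<phi> t (override_on x y {i}) = \<phi> t x" for t x y
  proof -
    have "override_on x y {i} j = x j" if "j \<in> K" for j
      using that K(2) by (cases "j = i") (auto simp: override_on_def)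
    then have "sval k (G (n - 1) k (fs t)) (override_on x y {i}) K = sval k (G (n - 1) k (fs t)) x K"
      by (intro sval_cong K(1) k)
    then show ?thesis by (simp add: \<phi>_def)
  qed
  have m1: "(\<lambda>x. \<phi> (x i) x) \<in> borel_measurable blk.P"
  proof -
    have "(\<lambda>x. (x i, x)) \<in> blk.P \<rightarrow>\<^sub>M leb_plus \<Otimes>\<^sub>M blk.P"
      using blk.measurable_component_P[of i] by (intro measurable_Pair) (simp_all add: measurable_cong_sets[OF refl sets_leb_plus])
    from measurable_compose[OF this m] show ?thesis by simp
  qed
  have "ennreal ((Hlim i K x)\<^sup>2) = ennreal (real n ^ 4 * (fact k)\<^sup>2) * \<phi> (x i) x" for x
  proof -
    have "(Hlim i K x)\<^sup>2 = (real n ^ 4 * (fact k)\<^sup>2) * (sval k (G (n - 1) k (fs (x i))) x K)\<^sup>2"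
      by (simp add: Hlim_def k power_mult_distrib)
    then show ?thesis by (simp add: \<phi>_def ennreal_mult)
  qed
  then have "(\<integral>\<^sup>+ x. ennreal ((Hlim i K x)\<^sup>2) \<partial>blk.P) = ennreal (real n ^ 4 * (fact k)\<^sup>2) * (\<integral>\<^sup>+ x. \<phi> (x i) x \<partial>blk.P)"
    using m1 by (simp add: nn_integral_cmult)
  also have "(\<integral>\<^sup>+ x. \<phi> (x i) x \<partial>blk.P) = (\<integral>\<^sup>+ t. \<integral>\<^sup>+ x. \<phi> t x \<partial>blk.P \<partial>blk i)"
    by (rule nn_integral_split_component[OF m dep])
  finally show ?thesis by (simp add: \<phi>_def)
qed

definition G_norm :: "nat \<Rightarrow> ennreal" where
  "G_norm k = (\<integral>\<^sup>+ t. (L2norm k (G (n - 1) k (fs t)))\<^sup>2 \<partial>leb_plus)"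

text \<open>The square of n^2 k! gives n^4 (k!)^2. One k! is spent when the sum over sets of size k
  is bounded by a squared norm, and summing the uniform laws over i yields the integral for dt/2,
  whence n^4 / 2.\<close>

lemma sum_Hlim_le:
  "(\<Sum>i<N. \<Sum>K\<in>Pow ({..<N} - {i}). \<integral>\<^sup>+ x. ennreal ((Hlim i K x)\<^sup>2) \<partial>blk.P)
    \<le> ennreal (real n ^ 4 / 2) * (\<Sum>k = 0..2 * n - 2. of_nat (fact k) * G_norm k)"
proof -
  define I where "I k t = (\<integral>\<^sup>+ z. ennreal ((G (n - 1) k (fs t) z)\<^sup>2) \<partial>(\<Pi>\<^sub>M i\<in>{..<k}. half_leb))" for k t
  define J where "J K t = (\<integral>\<^sup>+ x. ennreal ((sval (card K) (G (n - 1) (card K) (fs t)) x K)\<^sup>2) \<partial>blk.P)" for K t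
  have Im: "I k \<in> borel_measurable borel" for k
  proof -
    interpret L: sigma_finite_measure "Lb k" by (rule sigma_finite_Lb)
    have "(\<lambda>q. ennreal ((G (n - 1) k (fs (fst q)) (snd q))\<^sup>2)) \<in> borel_measurable (leb_plus \<Otimes>\<^sub>M Lb k)"
      using measurable_G by simp
    from L.borel_measurable_nn_integral_fst[OF this]
    have "(\<lambda>t. \<integral>\<^sup>+ z. ennreal ((G (n - 1) k (fs t) z)\<^sup>2) \<partial>Lb k) \<in> borel_measurable leb_plus" by simp
    then have "(\<lambda>t. \<integral>\<^sup>+ z. ennreal ((G (n - 1) k (fs t) z)\<^sup>2) \<partial>Lb k) \<in> borel_measurable borel"
      by (simp add: measurable_cong_sets[OF sets_leb_plus refl])
    then have "(\<lambda>t. ennreal ((1 / 2) ^ k) * (\<integral>\<^sup>+ z. ennreal ((G (n - 1) k (fs t) z)\<^sup>2) \<partial>Lb k)) \<in> borel_measurable borel"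
      by simp
    moreover have "I k = (\<lambda>t. ennreal ((1 / 2) ^ k) * (\<integral>\<^sup>+ z. ennreal ((G (n - 1) k (fs t) z)\<^sup>2) \<partial>Lb k))"
      unfolding I_def using measurable_G1 by (intro ext nn_integral_PiM_half_leb) simp
    ultimately show ?thesis by simp
  qed
  have JI: "fact k * (\<Sum>K | K \<subseteq> {..<N} \<and> card K = k. J K t) \<le> I k t" for k t
  proof -
    have "fact k * (\<Sum>K | K \<subseteq> {..<N} \<and> card K = k. \<integral>\<^sup>+ x. ennreal ((sval k (G (n - 1) k (fs t)) x K)\<^sup>2) \<partial>blk.P) \<le> I k t"
      unfolding I_def by (rule sum_sval_le[OF measurable_G1 symmetric_G G_outside_Delta])
    moreover have "(\<Sum>K | K \<subseteq> {..<N} \<and> card K = k. J K t) = (\<Sum>K | K \<subseteq> {..<N} \<and> card K = k. \<integral>\<^sup>+ x. ennreal ((sval k (G (n - 1) k (fs t)) x K)\<^sup>2) \<partial>blk.P)"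
      by (intro sum.cong) (auto simp: J_def)
    ultimately show ?thesis by simp
  qed
  have fK: "finite K" if "K \<subseteq> {..<N}" for K using that by (rule finite_subset) simp
  have Jm: "J K \<in> borel_measurable (blk i)" for K i
  proof -
    define \<sigma> where "\<sigma> = (SOME \<sigma>. bij_betw \<sigma> {..<card K} K)"
    have "(\<lambda>q. (fst q, pt (card K) \<sigma> (snd q))) \<in> leb_plus \<Otimes>\<^sub>M blk.P \<rightarrow>\<^sub>M leb_plus \<Otimes>\<^sub>M Lb (card K)"
      by (intro measurable_Pair measurable_fst measurable_compose[OF measurable_snd measurable_pt_P])
    from measurable_compose[OF this measurable_G]
    have "(\<lambda>q. ennreal ((sval (card K) (G (n - 1) (card K) (fs (fst q))) (snd q) K)\<^sup>2)) \<in> borel_measurable (leb_plus \<Otimes>\<^sub>M blk.P)"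
      unfolding sval_def \<sigma>_def[symmetric] by simp
    from blk.P.borel_measurable_nn_integral_fst[OF this]
    have "J K \<in> borel_measurable leb_plus" by (simp add: J_def[abs_def])
    then show ?thesis by (simp add: measurable_cong_sets[OF sets_leb_plus refl] measurable_cong_sets[OF sets_blk refl])
  qed
  have "(\<Sum>i<N. \<Sum>K\<in>Pow ({..<N} - {i}). \<integral>\<^sup>+ x. ennreal ((Hlim i K x)\<^sup>2) \<partial>blk.P)
     = (\<Sum>i<N. \<Sum>K\<in>Pow ({..<N} - {i}). ennreal (real n ^ 4 * (fact (card K))\<^sup>2) * (\<integral>\<^sup>+ t. J K t \<partial>blk i))"
    unfolding J_def by (intro sum.cong refl Hlim_nn_integral) (auto intro: finite_subset[of _ "{..<N}"])
  \<comment> \<open>The sets \<open>K\<close> containing \<open>i\<close> are added as well, so that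
    the sum over \<open>K\<close> no longer depends on \<open>i\<close>; all terms are
    nonnegative.\<close>
  also have "\<dots> \<le> (\<Sum>i<N. \<Sum>k\<in>{0..2 * n - 2}. \<Sum>K | K \<subseteq> {..<N} \<and> card K = k. ennreal (real n ^ 4 * (fact (card K))\<^sup>2) * (\<integral>\<^sup>+ t. J K t \<partial>blk i))"
  proof (rule sum_mono)
    fix i
    show "(\<Sum>K\<in>Pow ({..<N} - {i}). ennreal (real n ^ 4 * (fact (card K))\<^sup>2) * (\<integral>\<^sup>+ t. J K t \<partial>blk i))
      \<le> (\<Sum>k\<in>{0..2 * n - 2}. \<Sum>K | K \<subseteq> {..<N} \<and> card K = k. ennreal (real n ^ 4 * (fact (card K))\<^sup>2) * (\<integral>\<^sup>+ t. J K t \<partial>blk i))"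
    proof (rule sum_Pow_card)
      fix K :: "nat set" assume "card K \<notin> {0..2 * n - 2}"
      then have "2 * (n - 1) < card K" by auto
      then have "J K t = 0" for t by (simp add: J_def sval_def G_large)
      then show "ennreal (real n ^ 4 * (fact (card K))\<^sup>2) * (\<integral>\<^sup>+ t. J K t \<partial>blk i) = 0" by simp
    qed auto
  qed
  also have "\<dots> = (\<Sum>k\<in>{0..2 * n - 2}. \<Sum>i<N. \<Sum>K | K \<subseteq> {..<N} \<and> card K = k. ennreal (real n ^ 4 * (fact (card K))\<^sup>2) * (\<integral>\<^sup>+ t. J K t \<partial>blk i))"
    by (rule sum.swap)
  also have "\<dots> \<le> (\<Sum>k\<in>{0..2 * n - 2}. ennreal (real n ^ 4 / 2) * (of_nat (fact k) * G_norm k))"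
  proof (rule sum_mono)
    fix k
    have "(\<Sum>i<N. \<Sum>K | K \<subseteq> {..<N} \<and> card K = k. ennreal (real n ^ 4 * (fact (card K))\<^sup>2) * (\<integral>\<^sup>+ t. J K t \<partial>blk i))
      = (\<Sum>i<N. ennreal (real n ^ 4 * fact k) * (\<integral>\<^sup>+ t. fact k * (\<Sum>K | K \<subseteq> {..<N} \<and> card K = k. J K t) \<partial>blk i))"
    proof (rule sum.cong[OF refl])
      fix i
      have e: "ennreal (real n ^ 4 * (fact k)\<^sup>2) = ennreal (real n ^ 4 * fact k) * fact k"
      proof -
        have f: "ennreal (fact k) = fact k" by (metis ennreal_of_nat_eq_real_of_nat of_nat_fact)
        have "ennreal (real n ^ 4 * (fact k)\<^sup>2) = ennreal (real n ^ 4 * fact k) * ennreal (fact k)"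
          by (subst ennreal_mult[symmetric]) (auto simp: power2_eq_square mult_ac)
        then show ?thesis unfolding f .
      qed
      have "(\<Sum>K | K \<subseteq> {..<N} \<and> card K = k. ennreal (real n ^ 4 * (fact (card K))\<^sup>2) * (\<integral>\<^sup>+ t. J K t \<partial>blk i))
        = (\<Sum>K | K \<subseteq> {..<N} \<and> card K = k. ennreal (real n ^ 4 * (fact k)\<^sup>2) * (\<integral>\<^sup>+ t. J K t \<partial>blk i))"
        by (intro sum.cong) auto
      also have "\<dots> = ennreal (real n ^ 4 * fact k) * (fact k * (\<Sum>K | K \<subseteq> {..<N} \<and> card K = k. (\<integral>\<^sup>+ t. J K t \<partial>blk i)))"
        unfolding e by (simp add: sum_distrib_left mult.assoc)
      also have "(\<Sum>K | K \<subseteq> {..<N} \<and> card K = k. (\<integral>\<^sup>+ t. J K t \<partial>blk i)) = (\<integral>\<^sup>+ t. (\<Sum>K | K \<subseteq> {..<N} \<and> card K = k. J K t) \<partial>blk i)"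
        using Jm by (intro nn_integral_sum[symmetric])
      also have "fact k * \<dots> = (\<integral>\<^sup>+ t. fact k * (\<Sum>K | K \<subseteq> {..<N} \<and> card K = k. J K t) \<partial>blk i)"
        using Jm by (intro nn_integral_cmult[symmetric] borel_measurable_sum)
      finally show "(\<Sum>K | K \<subseteq> {..<N} \<and> card K = k. ennreal (real n ^ 4 * (fact (card K))\<^sup>2) * (\<integral>\<^sup>+ t. J K t \<partial>blk i))
        = ennreal (real n ^ 4 * fact k) * (\<integral>\<^sup>+ t. fact k * (\<Sum>K | K \<subseteq> {..<N} \<and> card K = k. J K t) \<partial>blk i)" .
    qed
    also have "\<dots> \<le> (\<Sum>i<N. ennreal (real n ^ 4 * fact k) * (\<integral>\<^sup>+ t. I k t \<partial>blk i))"
      by (intro sum_mono mult_left_mono nn_integral_mono JI) simp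
    also have "\<dots> = ennreal (real n ^ 4 * fact k / 2) * (2 * (\<Sum>i<N. \<integral>\<^sup>+ t. I k t \<partial>blk i))"
    proof -
      have "ennreal (real n ^ 4 * fact k / 2) * 2 = ennreal (real n ^ 4 * fact k / 2) * ennreal 2" by simp
      also have "\<dots> = ennreal (real n ^ 4 * fact k)" by (subst ennreal_mult[symmetric]) auto
      finally show ?thesis by (simp only: sum_distrib_left[symmetric] mult.assoc[symmetric])
    qed
    also have "\<dots> = ennreal (real n ^ 4 * fact k / 2) * (\<integral>\<^sup>+ t. indicator {..<2 * real N} t * I k t \<partial>leb_plus)"
      by (simp only: nn_integral_leb_plus_truncated[OF Im])
    also have "\<dots> \<le> ennreal (real n ^ 4 * fact k / 2) * G_norm k"
      unfolding G_norm_def L2norm_square I_def by (intro mult_left_mono nn_integral_mono) (auto simp: indicator_def)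
    also have "ennreal (real n ^ 4 * fact k / 2) = ennreal (real n ^ 4 / 2) * of_nat (fact k)"
    proof -
      have "ennreal (real n ^ 4 / 2) * of_nat (fact k) = ennreal (real n ^ 4 / 2) * ennreal (real (fact k))" by (simp add: ennreal_of_nat_eq_real_of_nat)
      also have "\<dots> = ennreal (real n ^ 4 * fact k / 2)" by (subst ennreal_mult[symmetric]) auto
      finally show ?thesis ..
    qed
    finally show "(\<Sum>i<N. \<Sum>K | K \<subseteq> {..<N} \<and> card K = k. ennreal (real n ^ 4 * (fact (card K))\<^sup>2) * (\<integral>\<^sup>+ t. J K t \<partial>blk i))
      \<le> ennreal (real n ^ 4 / 2) * (of_nat (fact k) * G_norm k)" by (simp add: mult.assoc)
  qed
  finally show ?thesis by (simp add: sum_distrib_left)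
qed

end

subsection \<open>The bound for truncated sums\<close>

lemma sqi_nn_integral:
  assumes "g \<in> borel_measurable blk.P" "(\<integral>\<^sup>+ x. ennreal ((g x)\<^sup>2) \<partial>blk.P) \<noteq> \<top>"
  shows "blk.sqi g" "(\<integral>\<^sup>+ x. ennreal ((g x)\<^sup>2) \<partial>blk.P) = ennreal (\<integral>x. (g x)\<^sup>2 \<partial>blk.P)"
proof -
  have i: "integrable blk.P (\<lambda>x. (g x)\<^sup>2)"
  proof (rule integrableI_bounded)
    show "(\<lambda>x. (g x)\<^sup>2) \<in> borel_measurable blk.P" using assms(1) by (rule borel_measurable_power)
    show "(\<integral>\<^sup>+ x. ennreal (norm ((g x)\<^sup>2)) \<partial>blk.P) < \<infinity>" using assms(2) by (simp add: less_top[symmetric])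
  qed
  then show "blk.sqi g" using assms(1) by (simp add: blk.sqi_def)
  show "(\<integral>\<^sup>+ x. ennreal ((g x)\<^sup>2) \<partial>blk.P) = ennreal (\<integral>x. (g x)\<^sup>2 \<partial>blk.P)"
    using i by (rule nn_integral_eq_integral) simp
qed

lemma sum_nn_integral_square:
  assumes "\<And>j. j \<in> I \<Longrightarrow> blk.sqi (g j)"
  shows "ennreal (\<Sum>j\<in>I. \<integral>x. (g j x)\<^sup>2 \<partial>blk.P) = (\<Sum>j\<in>I. \<integral>\<^sup>+ x. ennreal ((g j x)\<^sup>2) \<partial>blk.P)"
proof -
  have "(\<integral>\<^sup>+ x. ennreal ((g j x)\<^sup>2) \<partial>blk.P) = ennreal (\<integral>x. (g j x)\<^sup>2 \<partial>blk.P)" if "j \<in> I" for j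
    using assms[OF that] by (intro nn_integral_eq_integral) (auto simp: blk.sqi_def)
  then show ?thesis by (simp add: sum_ennreal)
qed

locale chaos_bound = chaos_kernel +
  assumes Ghat_L2: "\<And>k. k \<in> {1..2 * n - 2} \<Longrightarrow> L2 k (Ghat n k f)"
begin

lemma Gh_measurable: assumes K: "finite K" "K \<noteq> {}" shows "Gh K \<in> borel_measurable blk.P"
proof (cases "card K \<le> 2 * n - 2")
  case True
  have "card K \<noteq> 0" using K by simp
  then have "Ghat n (card K) f \<in> borel_measurable (Lb (card K))" using Ghat_L2[of "card K"] True by (simp add: L2_def)
  then have "(\<lambda>x. sval (card K) (Ghat n (card K) f) x K) \<in> borel_measurable blk.P"
    using K by (intro measurable_sval) (auto simp: blk.measurable_component_P)
  then show ?thesis unfolding Gh_def[abs_def] by (intro borel_measurable_times borel_measurable_const)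
next
  case False
  then have "2 * (n - 1) < card K" by simp
  then have "Gh K = (\<lambda>_. 0)" by (simp add: fun_eq_iff Gh_def sval_def Ghat_def G_large)
  then show ?thesis by simp
qed

definition Ghat_norms :: ennreal where
  "Ghat_norms = (\<Sum>k = 1..2 * n - 2. of_nat (fact k) * (L2norm k (Ghat n k f))\<^sup>2)"

lemma Ghat_norms_finite: "Ghat_norms \<noteq> \<top>"
proof -
  have "(L2norm k (Ghat n k f))\<^sup>2 \<noteq> \<top>" if "k \<in> {1..2 * n - 2}" for k
  proof -
    have m: "Ghat n k f \<in> borel_measurable (Lb k)" and i: "integrable (Lb k) (\<lambda>x. (Ghat n k f x)\<^sup>2)"
      using Ghat_L2[OF that] by (auto simp: L2_def)
    have "(\<integral>\<^sup>+ x. ennreal ((Ghat n k f x)\<^sup>2) \<partial>Lb k) = ennreal (\<integral>x. (Ghat n k f x)\<^sup>2 \<partial>Lb k)"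
      using i by (rule nn_integral_eq_integral) simp
    moreover have "(\<integral>\<^sup>+ z. ennreal ((Ghat n k f z)\<^sup>2) \<partial>(\<Pi>\<^sub>M i\<in>{..<k}. half_leb))
      = ennreal ((1 / 2) ^ k) * (\<integral>\<^sup>+ z. ennreal ((Ghat n k f z)\<^sup>2) \<partial>Lb k)"
      using m by (intro nn_integral_PiM_half_leb) simp
    ultimately show ?thesis by (simp add: L2norm_square ennreal_mult_eq_top_iff)
  qed
  then show ?thesis unfolding Ghat_norms_def by (simp add: ennreal_mult_eq_top_iff del: of_nat_fact)
qed

lemma sum_Gh_le:
  "(\<Sum>K\<in>Pow {..<N} - {{}}. \<integral>\<^sup>+ x. ennreal ((Gh K x)\<^sup>2) \<partial>blk.P) \<le> of_nat (n\<^sup>2) * Ghat_norms"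
proof -
  have "(\<Sum>K\<in>Pow {..<N} - {{}}. \<integral>\<^sup>+ x. ennreal ((Gh K x)\<^sup>2) \<partial>blk.P)
    \<le> (\<Sum>k\<in>{1..2 * n - 2}. \<Sum>K | K \<subseteq> {..<N} \<and> card K = k. \<integral>\<^sup>+ x. ennreal ((Gh K x)\<^sup>2) \<partial>blk.P)"
  proof (rule sum_Pow_card)
    fix K assume K: "K \<subseteq> {..<N}" "card K \<notin> {1..2 * n - 2}" "K \<in> Pow {..<N} - {{}}"
    then have "finite K" by (auto intro: finite_subset[of _ "{..<N}"])
    then have "card K \<noteq> 0" using K(3) by simp
    then have "2 * (n - 1) < card K" using K(2) by auto
    then have "Gh K x = 0" for x by (simp add: Gh_def sval_def Ghat_def G_large)
    then show "(\<integral>\<^sup>+ x. ennreal ((Gh K x)\<^sup>2) \<partial>blk.P) = 0" by simp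
  qed auto
  also have "\<dots> \<le> (\<Sum>k\<in>{1..2 * n - 2}. of_nat (n\<^sup>2) * (of_nat (fact k) * (L2norm k (Ghat n k f))\<^sup>2))"
  proof (rule sum_mono)
    fix k assume k: "k \<in> {1..2 * n - 2}"
    have m: "Ghat n k f \<in> borel_measurable (Lb k)" using Ghat_L2[OF k] by (simp add: L2_def)
    have "(\<Sum>K | K \<subseteq> {..<N} \<and> card K = k. \<integral>\<^sup>+ x. ennreal ((Gh K x)\<^sup>2) \<partial>blk.P)
      = (\<Sum>K | K \<subseteq> {..<N} \<and> card K = k. of_nat (n\<^sup>2) * (of_nat (fact k) * (fact k * (\<integral>\<^sup>+ x. ennreal ((sval k (Ghat n k f) x K)\<^sup>2) \<partial>blk.P))))"
    proof (rule sum.cong[OF refl])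
      fix K assume "K \<in> {K. K \<subseteq> {..<N} \<and> card K = k}"
      then have K: "finite K" "card K = k" by (auto intro: finite_subset[of _ "{..<N}"])
      have c: "ennreal ((real n)\<^sup>2 * (fact k)\<^sup>2) = of_nat (n\<^sup>2) * (of_nat (fact k) * fact k)"
      proof -
        have f: "ennreal (fact k) = fact k" by (metis ennreal_of_nat_eq_real_of_nat of_nat_fact)
        have "ennreal ((real n)\<^sup>2 * (fact k)\<^sup>2) = ennreal (real (n\<^sup>2)) * (ennreal (fact k) * ennreal (fact k))"
          by (simp only: ennreal_mult[symmetric] of_nat_0_le_iff fact_ge_zero zero_le_mult_iff simp_thms of_nat_power of_nat_mult power2_eq_square)
        then show ?thesis by (simp only: f of_nat_fact) (simp add: ennreal_of_nat_eq_real_of_nat)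
      qed
      have "(\<integral>\<^sup>+ x. ennreal ((Gh K x)\<^sup>2) \<partial>blk.P) = (\<integral>\<^sup>+ x. ennreal ((real n)\<^sup>2 * (fact k)\<^sup>2) * ennreal ((sval k (Ghat n k f) x K)\<^sup>2) \<partial>blk.P)"
        by (simp add: Gh_def K(2) power_mult_distrib ennreal_mult)
      also have "\<dots> = ennreal ((real n)\<^sup>2 * (fact k)\<^sup>2) * (\<integral>\<^sup>+ x. ennreal ((sval k (Ghat n k f) x K)\<^sup>2) \<partial>blk.P)"
      proof (rule nn_integral_cmult)
        have "(\<lambda>x. sval k (Ghat n k f) x K) \<in> borel_measurable blk.P"
          using K m by (intro measurable_sval) (auto simp: blk.measurable_component_P)
        then show "(\<lambda>x. ennreal ((sval k (Ghat n k f) x K)\<^sup>2)) \<in> borel_measurable blk.P" by simp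
      qed
      finally show "(\<integral>\<^sup>+ x. ennreal ((Gh K x)\<^sup>2) \<partial>blk.P) = of_nat (n\<^sup>2) * (of_nat (fact k) * (fact k * (\<integral>\<^sup>+ x. ennreal ((sval k (Ghat n k f) x K)\<^sup>2) \<partial>blk.P)))"
        unfolding c by (simp only: mult.assoc)
    qed
    also have "\<dots> = of_nat (n\<^sup>2) * (of_nat (fact k) * (fact k * (\<Sum>K | K \<subseteq> {..<N} \<and> card K = k. \<integral>\<^sup>+ x. ennreal ((sval k (Ghat n k f) x K)\<^sup>2) \<partial>blk.P)))"
      by (simp only: sum_distrib_left)
    also have "\<dots> \<le> of_nat (n\<^sup>2) * (of_nat (fact k) * (L2norm k (Ghat n k f))\<^sup>2)"
      unfolding L2norm_square
      by (intro mult_left_mono sum_sval_le[OF m symmetric_Ghat Ghat_outside_Delta]) simp_all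
    finally show "(\<Sum>K | K \<subseteq> {..<N} \<and> card K = k. \<integral>\<^sup>+ x. ennreal ((Gh K x)\<^sup>2) \<partial>blk.P)
      \<le> of_nat (n\<^sup>2) * (of_nat (fact k) * (L2norm k (Ghat n k f))\<^sup>2)" .
  qed
  finally show ?thesis by (simp only: Ghat_norms_def sum_distrib_left)
qed

lemma Gh_sqi: assumes K: "finite K" "K \<noteq> {}" shows "blk.sqi (Gh K)"
proof (rule sqi_nn_integral[OF Gh_measurable[OF K]])
  define N where "N = Suc (Max K)"
  have KN: "K \<in> Pow {..<N} - {{}}" using K by (auto simp: N_def less_Suc_eq_le)
  have "(\<integral>\<^sup>+ x. ennreal ((Gh K x)\<^sup>2) \<partial>blk.P) \<le> (\<Sum>K\<in>Pow {..<N} - {{}}. \<integral>\<^sup>+ x. ennreal ((Gh K x)\<^sup>2) \<partial>blk.P)"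
    using KN by (intro member_le_sum) auto
  also have "\<dots> \<le> of_nat (n\<^sup>2) * Ghat_norms" by (rule sum_Gh_le)
  finally show "(\<integral>\<^sup>+ x. ennreal ((Gh K x)\<^sup>2) \<partial>blk.P) \<noteq> \<top>"
    using Ghat_norms_finite by (auto simp: top_unique ennreal_mult_eq_top_iff ennreal_of_nat_eq_real_of_nat simp del: of_nat_power)
qed

text \<open>The assumption on \<open>Ghat\<close> starts at k = 1. For the empty set the function
  depends on no coordinate, so it is constant and integrable for a probability measure.\<close>

lemma Gh_integrable: assumes K: "finite K" shows "integrable blk.P (Gh K)"
proof (cases "K = {}")
  case True
  have "Gh {} = (\<lambda>_. Gh {} undefined)" using Gh_dep[of "{}"] unfolding blk.dep_def by blast
  then have "integrable blk.P (Gh {})" using blk.P.integrable_const by metis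
  then show ?thesis using True by simp
qed (rule blk.sqi_integrable[OF Gh_sqi[OF K]])

definition G_norms :: ennreal where "G_norms = (\<Sum>k = 0..2 * n - 2. of_nat (fact k) * G_norm k)"

lemma Hlim_sqi: assumes T: "G_norms \<noteq> \<top>" and K: "finite K" "i \<notin> K" shows "blk.sqi (Hlim i K)"
proof (rule sqi_nn_integral[OF Hlim_measurable[OF K(1)]])
  define N where "N = Suc (Max (insert i K))"
  have N: "i < N" "K \<in> Pow ({..<N} - {i})" using K by (auto simp: N_def less_Suc_eq_le)
  have "(\<integral>\<^sup>+ x. ennreal ((Hlim i K x)\<^sup>2) \<partial>blk.P) \<le> (\<Sum>K\<in>Pow ({..<N} - {i}). \<integral>\<^sup>+ x. ennreal ((Hlim i K x)\<^sup>2) \<partial>blk.P)"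
    using N by (intro member_le_sum) auto
  also have "\<dots> \<le> (\<Sum>i<N. \<Sum>K\<in>Pow ({..<N} - {i}). \<integral>\<^sup>+ x. ennreal ((Hlim i K x)\<^sup>2) \<partial>blk.P)"
    using N by (intro member_le_sum[of i "{..<N}" "\<lambda>i. \<Sum>K\<in>Pow ({..<N} - {i}). \<integral>\<^sup>+ x. ennreal ((Hlim i K x)\<^sup>2) \<partial>blk.P"]) auto
  also have "\<dots> \<le> ennreal (real n ^ 4 / 2) * G_norms" unfolding G_norms_def by (rule sum_Hlim_le)
  finally show "(\<integral>\<^sup>+ x. ennreal ((Hlim i K x)\<^sup>2) \<partial>blk.P) \<noteq> \<top>"
    using T by (auto simp: top_unique ennreal_mult_eq_top_iff)
qed

lemma wasserstein_finite:
  assumes T: "G_norms \<noteq> \<top>" and \<phi>: "1-lipschitz_on UNIV \<phi>"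
  shows "\<bar>(\<integral>x. \<phi> (S {..<N} x) \<partial>blk.P) - (\<integral>y. \<phi> y * std_normal_density y \<partial>lborel)\<bar>
    \<le> sqrt ((1 - aL)\<^sup>2 + (real n)\<^sup>2 * enn2real Ghat_norms) + (aL - a {..<N})
      + (real n)\<^sup>2 * sqrt (2 * fact (n - 1)) * f_norm * sqrt (enn2real G_norms)"
proof -
  define V where "V = (real n)\<^sup>2 * enn2real Ghat_norms"
  \<comment> \<open>The bound of \<open>sum_Hlim_le\<close>, finite by the assumption on
    \<open>G_norms\<close>.\<close>
  define B where "B = real n ^ 4 / 2 * enn2real G_norms"
  interpret hoeffding_limit blk u n Hlim Gh aL V B
  proof unfold_locales
    show "(\<lambda>m. a {..<m}) \<longlonglongrightarrow> aL" by (rule a_lim)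
    show "(\<lambda>m. \<integral>x. \<bar>H i K {..<m} x - Hlim i K x\<bar> \<partial>blk.P) \<longlonglongrightarrow> 0" if K: "finite K" "i \<notin> K" for i K
    proof -
      have "(\<integral>x. \<bar>H i K {..<m} x - Hlim i K x\<bar> \<partial>blk.P) = (\<integral>x. \<bar>H i K {..<m} x - HL i K x\<bar> \<partial>blk.P)" for m
      proof (rule integral_cong_AE)
        show "AE x in blk.P. \<bar>H i K {..<m} x - Hlim i K x\<bar> = \<bar>H i K {..<m} x - HL i K x\<bar>"
          using Hlim_HL[OF K] by eventually_elim simp
      qed (use Hlim_measurable[OF K(1), of i] borel_measurable_integrable[OF H_integrable[of i K "{..<m}"]]
            borel_measurable_integrable[OF HL_integrable[OF K]] in simp_all)
      then show ?thesis using H_tendsto[OF K] by simp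
    qed
    show "blk.sqi (Hlim i K)" if "finite K" "i \<notin> K" for i K by (rule Hlim_sqi[OF T that])
    show "blk.dep (insert i K) (Hlim i K)" if "finite K" for i K by (rule Hlim_dep[OF that])
    show "(\<lambda>m. \<integral>x. \<bar>1 / n * (\<Sum>i\<in>{..<m} - K. blk.Ex {i} (H i K {..<m}) x) - Gh K x\<bar> \<partial>blk.P) \<longlonglongrightarrow> 0" if K: "finite K" for K
    proof -
      have m: "(\<lambda>x. 1 / n * (\<Sum>i\<in>{..<m} - K. blk.Ex {i} (H i K {..<m}) x)) \<in> borel_measurable blk.P" for m
        by (intro borel_measurable_times borel_measurable_const borel_measurable_sum blk.measurable_Ex borel_measurable_integrable[OF H_integrable])
      have "(\<integral>x. \<bar>1 / n * (\<Sum>i\<in>{..<m} - K. blk.Ex {i} (H i K {..<m}) x) - Gh K x\<bar> \<partial>blk.P)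
        = (\<integral>x. \<bar>1 / n * (\<Sum>i\<in>{..<m} - K. blk.Ex {i} (H i K {..<m}) x) - GL K x\<bar> \<partial>blk.P)" for m
      proof (rule integral_cong_AE)
        show "AE x in blk.P. \<bar>1 / n * (\<Sum>i\<in>{..<m} - K. blk.Ex {i} (H i K {..<m}) x) - Gh K x\<bar>
            = \<bar>1 / n * (\<Sum>i\<in>{..<m} - K. blk.Ex {i} (H i K {..<m}) x) - GL K x\<bar>"
          using Gh_GL[OF K] by eventually_elim simp
        show "(\<lambda>x. \<bar>1 / n * (\<Sum>i\<in>{..<m} - K. blk.Ex {i} (H i K {..<m}) x) - Gh K x\<bar>) \<in> borel_measurable blk.P"
          by (rule borel_measurable_abs[OF borel_measurable_diff[OF m borel_measurable_integrable[OF Gh_integrable[OF K]]]])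
        show "(\<lambda>x. \<bar>1 / n * (\<Sum>i\<in>{..<m} - K. blk.Ex {i} (H i K {..<m}) x) - GL K x\<bar>) \<in> borel_measurable blk.P"
          by (rule borel_measurable_abs[OF borel_measurable_diff[OF m borel_measurable_integrable[OF GL_integrable[OF K]]]])
      qed
      then show ?thesis using Gh_tendsto[OF K] by simp
    qed
    show "integrable blk.P (Gh K)" if "finite K" for K by (rule Gh_integrable[OF that])
    show "blk.sqi (Gh K)" if "finite K" "K \<noteq> {}" for K by (rule Gh_sqi[OF that])
    show "blk.dep K (Gh K)" if "finite K" for K by (rule Gh_dep[OF that])
    show "(\<Sum>K\<in>Pow {..<N} - {{}}. \<integral>x. (Gh K x)\<^sup>2 \<partial>blk.P) \<le> V" for N
    proof -
      have "ennreal (\<Sum>K\<in>Pow {..<N} - {{}}. \<integral>x. (Gh K x)\<^sup>2 \<partial>blk.P) = (\<Sum>K\<in>Pow {..<N} - {{}}. \<integral>\<^sup>+ x. ennreal ((Gh K x)\<^sup>2) \<partial>blk.P)"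
        by (intro sum_nn_integral_square Gh_sqi) (auto intro: finite_subset[of _ "{..<N}"])
      also have "\<dots> \<le> of_nat (n\<^sup>2) * Ghat_norms" by (rule sum_Gh_le)
      also have "\<dots> = ennreal (real (n\<^sup>2)) * ennreal (enn2real Ghat_norms)"
        using Ghat_norms_finite by (simp add: ennreal_of_nat_eq_real_of_nat less_top)
      also have "\<dots> = ennreal V" unfolding V_def by (subst ennreal_mult[symmetric]) simp_all
      finally show ?thesis by (simp add: V_def)
    qed
    show "(\<Sum>i<N. \<Sum>K\<in>Pow ({..<N} - {i}). \<integral>x. (Hlim i K x)\<^sup>2 \<partial>blk.P) \<le> B" for N
    proof -
      have "ennreal (\<Sum>i<N. \<Sum>K\<in>Pow ({..<N} - {i}). \<integral>x. (Hlim i K x)\<^sup>2 \<partial>blk.P)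
        = (\<Sum>i<N. ennreal (\<Sum>K\<in>Pow ({..<N} - {i}). \<integral>x. (Hlim i K x)\<^sup>2 \<partial>blk.P))"
        by (rule sum_ennreal[symmetric]) (auto intro!: sum_nonneg)
      also have "\<dots> = (\<Sum>i<N. \<Sum>K\<in>Pow ({..<N} - {i}). \<integral>\<^sup>+ x. ennreal ((Hlim i K x)\<^sup>2) \<partial>blk.P)"
        by (intro sum.cong refl sum_nn_integral_square Hlim_sqi[OF T]) (auto intro: finite_subset[of _ "{..<N}"])
      also have "\<dots> \<le> ennreal (real n ^ 4 / 2) * G_norms" unfolding G_norms_def by (rule sum_Hlim_le)
      also have "\<dots> = ennreal (real n ^ 4 / 2) * ennreal (enn2real G_norms)"
        using T by (simp add: less_top)
      also have "\<dots> = ennreal B" unfolding B_def by (subst ennreal_mult[symmetric]) simp_all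
      finally show ?thesis by (simp add: B_def)
    qed
  qed
  \<comment> \<open>With aL = n! * f_norm^2 the product n * aL is n^2 (n - 1)! * f_norm^2. The
    powers of n combine to n^2, and 2 / sqrt 2 is the sqrt 2 of the theorem.\<close>
  have c: "2 / n * (sqrt (n * aL) * sqrt B) = (real n)\<^sup>2 * sqrt (2 * fact (n - 1)) * f_norm * sqrt (enn2real G_norms)"
  proof -
    have n: "f_norm \<ge> 0" by (simp add: f_norm_def)
    have "n * aL = (real n)\<^sup>2 * (fact (n - 1) * f_norm\<^sup>2)" by (simp add: aL_eq_f_norm fact_n power2_eq_square)
    then have 1: "sqrt (n * aL) = real n * (sqrt (fact (n - 1)) * f_norm)" using n by (simp only: real_sqrt_mult real_sqrt_abs abs_of_nat abs_of_nonneg)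
    have "real n ^ 4 = ((real n)\<^sup>2)\<^sup>2" by simp
    then have 2: "sqrt B = (real n)\<^sup>2 / sqrt 2 * sqrt (enn2real G_norms)"
      unfolding B_def by (simp only: real_sqrt_mult real_sqrt_divide real_sqrt_abs abs_power2 abs_of_nat)
    have 3: "2 / sqrt 2 = sqrt (2::real)" by (simp add: real_div_sqrt)
    have "2 / n * (sqrt (n * aL) * sqrt B) = (2 / sqrt 2) * ((real n)\<^sup>2 * sqrt (fact (n - 1)) * f_norm * sqrt (enn2real G_norms))"
      unfolding 1 2 using n_pos by simp
    then show ?thesis unfolding 3 by (simp add: real_sqrt_mult)
  qed
  show ?thesis using wasserstein_bound[OF \<phi>, of N] unfolding c V_def by simp
qed

definition stein_rhs :: ennreal where
  "stein_rhs = esqrt (ennreal ((1 - fact n * f_norm\<^sup>2)\<^sup>2) + of_nat (n\<^sup>2) * Ghat_norms)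
     + of_nat (n\<^sup>2) * ennreal (sqrt (2 * fact (n - 1))) * L2norm n f * esqrt G_norms"

text \<open>In \<open>ennreal\<close> zero times infinity is zero, so infinite
  \<open>G_norms\<close> make the right side infinite only if the kernel has positive norm. A kernel
  of norm zero needs an argument of its own.\<close>

lemma wasserstein_truncated:
  assumes \<phi>: "1-lipschitz_on UNIV \<phi>"
  shows "ennreal \<bar>(\<integral>x. \<phi> (S {..<N} x) \<partial>blk.P) - (\<integral>y. \<phi> y * std_normal_density y \<partial>lborel)\<bar> \<le> stein_rhs + ennreal (aL - a {..<N})"
proof -
  have nn: "f_norm \<ge> 0" by (simp add: f_norm_def)
  have "ennreal ((1 - fact n * f_norm\<^sup>2)\<^sup>2) + of_nat (n\<^sup>2) * Ghat_norms = ennreal ((1 - aL)\<^sup>2 + (real n)\<^sup>2 * enn2real Ghat_norms)"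
  proof -
    have "of_nat (n\<^sup>2) * Ghat_norms = ennreal (real (n\<^sup>2)) * ennreal (enn2real Ghat_norms)"
      using Ghat_norms_finite by (simp add: ennreal_of_nat_eq_real_of_nat less_top)
    also have "\<dots> = ennreal ((real n)\<^sup>2 * enn2real Ghat_norms)" by (subst ennreal_mult[symmetric]) simp_all
    finally show ?thesis by (simp add: aL_eq_f_norm)
  qed
  then have e1: "esqrt (ennreal ((1 - fact n * f_norm\<^sup>2)\<^sup>2) + of_nat (n\<^sup>2) * Ghat_norms) = ennreal (sqrt ((1 - aL)\<^sup>2 + (real n)\<^sup>2 * enn2real Ghat_norms))"
    by (simp only: esqrt_ennreal add_nonneg_nonneg mult_nonneg_nonneg zero_le_power2 enn2real_nonneg)
  have al: "0 \<le> aL - a {..<N}" using a_le_aL[of N] by simp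
  consider "G_norms \<noteq> \<top>" | "G_norms = \<top>" "f_norm > 0" | "f_norm = 0" using nn by linarith
  then show ?thesis
  proof cases
    case 1
    have "of_nat (n\<^sup>2) * ennreal (sqrt (2 * fact (n - 1))) * L2norm n f * esqrt G_norms
      = ennreal (real (n\<^sup>2)) * ennreal (sqrt (2 * fact (n - 1))) * ennreal f_norm * ennreal (sqrt (enn2real G_norms))"
      using 1 by (simp add: ennreal_of_nat_eq_real_of_nat L2norm_f esqrt_def)
    also have "\<dots> = ennreal ((real n)\<^sup>2 * sqrt (2 * fact (n - 1)) * f_norm * sqrt (enn2real G_norms))"
      using nn by (simp add: ennreal_mult)
    finally have "stein_rhs + ennreal (aL - a {..<N}) = ennreal (sqrt ((1 - aL)\<^sup>2 + (real n)\<^sup>2 * enn2real Ghat_norms) + (aL - a {..<N})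
      + (real n)\<^sup>2 * sqrt (2 * fact (n - 1)) * f_norm * sqrt (enn2real G_norms))"
      unfolding stein_rhs_def e1 using nn al by (simp add: ennreal_plus[symmetric] add_ac del: ennreal_plus)
    then show ?thesis using wasserstein_finite[OF 1 \<phi>, of N] by (simp add: ennreal_leI)
  next
    case 2
    have "of_nat (n\<^sup>2) * ennreal (sqrt (2 * fact (n - 1))) * L2norm n f * esqrt G_norms = \<top>"
      using 2 n_pos by (simp add: L2norm_f esqrt_def ennreal_mult_eq_top_iff ennreal_mult_top)
    then show ?thesis by (simp add: stein_rhs_def)
  next
    \<comment> \<open>The sum vanishes almost surely, and the distance from 0 to a standard normal Z
      is at most E |Z| <= 1. As aL = 0, the first root on the right is at least 1.\<close>
    case 3
    have aL: "aL = 0" using 3 by (simp add: aL_eq_f_norm)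
    have "a {..<N} \<ge> 0" unfolding a_def by (intro sum_nonneg u_norm_nonneg)
    then have "(\<integral>x. (S {..<N} x)\<^sup>2 \<partial>blk.P) = 0" using a_le_aL[of N] aL S_norm[of "{..<N}"] by simp
    then have S0: "AE x in blk.P. S {..<N} x = 0"
      using S_sqi[of "{..<N}"] by (subst (asm) integral_nonneg_eq_0_iff_AE) (auto simp: blk.sqi_def)
    have m: "\<phi> \<in> borel_measurable borel"
      using lipschitz_on_continuous_on[OF \<phi>] by (rule borel_measurable_continuous_onI)
    have "(\<integral>x. \<phi> (S {..<N} x) \<partial>blk.P) = (\<integral>x. \<phi> 0 \<partial>blk.P)"
    proof (rule integral_cong_AE)
      show "(\<lambda>x. \<phi> (S {..<N} x)) \<in> borel_measurable blk.P"
        using S_sqi[of "{..<N}"] by (intro measurable_compose[OF blk.sqi_measurable m]) simp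
      show "AE x in blk.P. \<phi> (S {..<N} x) = \<phi> 0" using S0 by eventually_elim simp
    qed simp
    then have E: "(\<integral>x. \<phi> (S {..<N} x) \<partial>blk.P) = \<phi> 0" by (simp add: blk.P.prob_space)
    have c: "integrable lborel (\<lambda>y. \<phi> 0 * std_normal_density y)" "(\<integral>y. \<phi> 0 * std_normal_density y \<partial>lborel) = \<phi> 0"
      using integrable_normal_moment[of 1 0 0] integral_normal_moment_even[of 1 0 0] by simp_all
    note i = lipschitz_normal_integrable[OF \<phi>]
    have "(\<integral>y. (\<phi> 0 - \<phi> y) * std_normal_density y \<partial>lborel) = \<phi> 0 - (\<integral>y. \<phi> y * std_normal_density y \<partial>lborel)"
      using Bochner_Integration.integral_diff[OF c(1) i] unfolding c(2) by (simp only: left_diff_distrib)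
    then have "\<bar>\<phi> 0 - (\<integral>y. \<phi> y * std_normal_density y \<partial>lborel)\<bar> = \<bar>\<integral>y. (\<phi> 0 - \<phi> y) * std_normal_density y \<partial>lborel\<bar>"
      by simp
    also have "\<dots> \<le> (\<integral>y. \<bar>0 - y\<bar> * std_normal_density y \<partial>lborel)"
    proof (rule integral_abs_bound_integral)
      show "integrable lborel (\<lambda>y. (\<phi> 0 - \<phi> y) * std_normal_density y)"
        using Bochner_Integration.integrable_diff[OF c(1) i] by (simp only: left_diff_distrib)
      show "integrable lborel (\<lambda>y. \<bar>0 - y\<bar> * std_normal_density y)"
        using integrable_std_normal_moment_abs[of 1] by (simp add: mult.commute)
      fix y :: real
      have "\<bar>\<phi> 0 - \<phi> y\<bar> \<le> \<bar>0 - y\<bar>" using lipschitz_onD[OF \<phi>, of 0 y] by (simp add: dist_real_def)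
      then show "\<bar>(\<phi> 0 - \<phi> y) * std_normal_density y\<bar> \<le> \<bar>0 - y\<bar> * std_normal_density y"
        by (simp add: abs_mult mult_right_mono)
    qed
    also have "\<dots> \<le> 1" using abs_moment_le_sqrt[of 0] by simp
    also have "\<dots> \<le> sqrt ((1 - aL)\<^sup>2 + (real n)\<^sup>2 * enn2real Ghat_norms)" by (simp add: aL)
    finally have "ennreal \<bar>\<phi> 0 - (\<integral>y. \<phi> y * std_normal_density y \<partial>lborel)\<bar> \<le> ennreal (sqrt ((1 - aL)\<^sup>2 + (real n)\<^sup>2 * enn2real Ghat_norms))"
      by (rule ennreal_leI)
    also have "\<dots> \<le> stein_rhs + ennreal (aL - a {..<N})" unfolding stein_rhs_def e1 by (simp add: add.assoc)
    finally show ?thesis unfolding E .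
  qed
qed

end

subsection \<open>The multiple stochastic integral\<close>

text \<open>The sum over the first \<open>N\<close> blocks with the kernel as an argument, so that
  different kernels can be compared.\<close>

definition chaos :: "nat \<Rightarrow> ((nat \<Rightarrow> real) \<Rightarrow> real) \<Rightarrow> nat \<Rightarrow> (nat \<Rightarrow> real) \<Rightarrow> real" where
  "chaos n g N x = (\<Sum>A | A \<subseteq> {..<N} \<and> card A = n. fact n * sval n g x A)"

lemma (in chaos_kernel) S_eq_chaos: "S {..<N} = chaos n f N"
  by (simp add: fun_eq_iff S_def fam_lessThan chaos_def u_def)

text \<open>The differences of the summands form a degenerate family again. Orthogonality turns the
  left side into a sum over sets, and \<open>sum_sval_le\<close> bounds that by the norm of the
  difference kernel.\<close>

lemma chaos_diff_norm:
  assumes g: "chaos_kernel n g" and f: "chaos_kernel n f"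
  shows "(\<integral>\<^sup>+ x. ennreal ((chaos n g N x - chaos n f N x)\<^sup>2) \<partial>blk.P) \<le> fact n * (L2norm n (\<lambda>z. g z - f z))\<^sup>2"
proof -
  define h where "h z = g z - f z" for z
  define w where "w A x = fact n * sval n h x A" for A :: "nat set" and x
  interpret g: chaos_kernel n g by (rule g)
  interpret f: chaos_kernel n f by (rule f)
  have w: "w A = (\<lambda>x. g.u A x - f.u A x)" for A
    by (simp add: fun_eq_iff w_def g.u_def f.u_def sval_def h_def algebra_simps)
  \<comment> \<open>Degeneracy is inherited from the two given families, at points where both
    sections are integrable.\<close>
  interpret w: hoeffding_family blk w n
  proof unfold_locales
    show "n \<ge> 1" by (rule g.n_pos)
  next
    fix A :: "nat set" assume A: "finite A" "card A = n"
    show "blk.sqi (w A)"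
      using blk.sqi_add[OF g.u_sqi[OF A] blk.sqi_cmult[OF f.u_sqi[OF A], of "-1"]] by (simp add: w)
    show "blk.dep A (w A)"
      using g.u_dep[OF A] f.u_dep[OF A] unfolding blk.dep_def w by metis
  next
    fix A :: "nat set" and i assume A: "finite A" "card A = n" "i \<in> A"
    show "AE x in blk.P. blk.Ex {i} (w A) x = 0"
      using g.u_centered[OF A] f.u_centered[OF A]
        blk.AE_integrable_section[OF blk.sqi_integrable[OF g.u_sqi[OF A(1,2)]], of "{i}"]
        blk.AE_integrable_section[OF blk.sqi_integrable[OF f.u_sqi[OF A(1,2)]], of "{i}"]
      by eventually_elim (simp add: blk.Ex_def w)
  qed
  have S: "chaos n g N x - chaos n f N x = w.S {..<N} x" for x
    unfolding w.S_def g.fam_lessThan chaos_def w g.u_def f.u_def by (simp add: sum_subtractf)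
  have hm: "h \<in> borel_measurable (Lb n)"
    unfolding h_def[abs_def] by (rule borel_measurable_diff[OF g.f_measurable f.f_measurable])
  have hs: "symmetric_fun n h" using g.f_sym f.f_sym by (simp add: symmetric_fun_def h_def)
  have hv: "h z = 0" if "z \<in> {..<n} \<rightarrow>\<^sub>E UNIV" "z \<notin> Delta n" for z
    using g.f_van[OF that] f.f_van[OF that] by (simp add: h_def)
  have fe: "ennreal (fact n) = fact n" by (metis ennreal_of_nat_eq_real_of_nat of_nat_fact)
  have "(\<integral>\<^sup>+ x. ennreal ((chaos n g N x - chaos n f N x)\<^sup>2) \<partial>blk.P) = ennreal (\<integral>x. (w.S {..<N} x)\<^sup>2 \<partial>blk.P)"
    unfolding S using w.S_sqi[of "{..<N}"] by (intro nn_integral_eq_integral) (simp_all add: blk.sqi_def)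
  also have "\<dots> = ennreal (\<Sum>A\<in>w.fam {..<N}. \<integral>x. (w A x)\<^sup>2 \<partial>blk.P)"
    by (simp add: w.S_norm w.a_def w.u_norm_def)
  also have "\<dots> = (\<Sum>A\<in>w.fam {..<N}. \<integral>\<^sup>+ x. ennreal ((w A x)\<^sup>2) \<partial>blk.P)"
    by (intro sum_nn_integral_square w.u_fam(1))
  also have "\<dots> = (\<Sum>A\<in>{A. A \<subseteq> {..<N} \<and> card A = n}. fact n * (fact n * (\<integral>\<^sup>+ x. ennreal ((sval n h x A)\<^sup>2) \<partial>blk.P)))"
    unfolding g.fam_lessThan
  proof (rule sum.cong[OF refl])
    fix A assume "A \<in> {A. A \<subseteq> {..<N} \<and> card A = n}"
    then have A: "finite A" "card A = n" by (auto intro: finite_subset[of _ "{..<N}"])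
    have m: "(\<lambda>x. sval n h x A) \<in> borel_measurable blk.P"
      using A hm by (intro measurable_sval) (auto simp: blk.measurable_component_P)
    have "(\<integral>\<^sup>+ x. ennreal ((w A x)\<^sup>2) \<partial>blk.P) = (\<integral>\<^sup>+ x. ennreal ((fact n)\<^sup>2) * ennreal ((sval n h x A)\<^sup>2) \<partial>blk.P)"
      by (simp add: w_def power_mult_distrib ennreal_mult)
    also have "\<dots> = ennreal ((fact n)\<^sup>2) * (\<integral>\<^sup>+ x. ennreal ((sval n h x A)\<^sup>2) \<partial>blk.P)"
      using m by (intro nn_integral_cmult) simp
    also have "ennreal ((fact n)\<^sup>2) = ennreal (fact n) * ennreal (fact n)"
      unfolding power2_eq_square by (rule ennreal_mult) simp_all
    finally show "(\<integral>\<^sup>+ x. ennreal ((w A x)\<^sup>2) \<partial>blk.P) = fact n * (fact n * (\<integral>\<^sup>+ x. ennreal ((sval n h x A)\<^sup>2) \<partial>blk.P))"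
      unfolding fe by (simp only: mult.assoc)
  qed
  also have "\<dots> = fact n * (fact n * (\<Sum>A | A \<subseteq> {..<N} \<and> card A = n. \<integral>\<^sup>+ x. ennreal ((sval n h x A)\<^sup>2) \<partial>blk.P))"
    by (simp only: sum_distrib_left)
  also have "\<dots> \<le> fact n * (L2norm n h)\<^sup>2"
    unfolding L2norm_square by (intro mult_left_mono sum_sval_le[OF hm hs hv]) simp_all
  finally show ?thesis by (simp add: h_def[abs_def])
qed

definition points :: "(nat \<Rightarrow> 'a \<Rightarrow> real) \<Rightarrow> 'a \<Rightarrow> nat \<Rightarrow> real" where
  "points U \<omega> k = 2 * real k + 1 + U k \<omega>"

text \<open>A tuple using a block with number at least \<open>J\<close> has a coordinate beyond the
  support, so the infinite sum reduces to the finitely many tuples below \<open>J\<close>, that is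
  to n! equal terms per set.\<close>

lemma stoch_sum_eq:
  assumes g: "chaos_kernel n g" and b: "\<And>z i. z \<in> {..<n} \<rightarrow>\<^sub>E UNIV \<Longrightarrow> g z \<noteq> 0 \<Longrightarrow> i < n \<Longrightarrow> z i \<le> b"
    and J: "b \<le> 2 * real J" and x: "\<forall>k. 2 * real k < points U \<omega> k \<and> points U \<omega> k < 2 * real k + 2"
  shows "stoch_sum U n g \<omega> = chaos n g J (points U \<omega>)"
proof -
  interpret g: chaos_kernel n g by (rule g)
  let ?I = "{m \<in> {..<n} \<rightarrow>\<^sub>E (UNIV :: nat set). inj_on m {..<n}}"
  have "stoch_sum U n g \<omega> = (\<Sum>\<^sub>\<infinity>m\<in>?I. g (pt n m (points U \<omega>)))"
    by (simp add: stoch_sum_def pt_def points_def)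
  also have "\<dots> = (\<Sum>\<^sub>\<infinity>m\<in>injs n J. g (pt n m (points U \<omega>)))"
  proof (rule infsum_cong_neutral)
    fix m assume m: "m \<in> ?I - injs n J"
    then have "\<exists>i<n. J \<le> m i" by (auto simp: injs_def PiE_iff not_less)
    then obtain i where i: "i < n" "J \<le> m i" by auto
    have "2 * real J < pt n m (points U \<omega>) i"
      using i x[rule_format, of "m i"] by (simp add: pt_def)
    then show "g (pt n m (points U \<omega>)) = 0" using b[OF pt_in, of m "points U \<omega>" i] J i(1) by force
  qed (auto simp: injs_def)
  also have "\<dots> = (\<Sum>m\<in>injs n J. g (pt n m (points U \<omega>)))" by (rule infsum_finite[OF finite_injs])
  also have "\<dots> = (\<Sum>A | A \<subseteq> {..<J} \<and> card A = n. \<Sum>m\<in>Bij n A. g (pt n m (points U \<omega>)))" by (rule sum_injs_sets)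
  also have "\<dots> = chaos n g J (points U \<omega>)"
    unfolding chaos_def
  proof (rule sum.cong[OF refl])
    fix A assume "A \<in> {A. A \<subseteq> {..<J} \<and> card A = n}"
    then have A: "finite A" "card A = n" by (auto intro: finite_subset[of _ "{..<J}"])
    have "(\<Sum>m\<in>Bij n A. g (pt n m (points U \<omega>))) = (\<Sum>m\<in>Bij n A. sval n g (points U \<omega>) A)"
      by (rule sum.cong[OF refl], rule sval_eq[OF g.f_sym]) (simp add: Bij_def)
    then show "(\<Sum>m\<in>Bij n A. g (pt n m (points U \<omega>))) = fact n * sval n g (points U \<omega>) A"
      using card_Bij(1)[OF A] by simp
  qed
  finally show ?thesis .
qed

lemma chaos_trunc:
  assumes x: "\<forall>k. 2 * real k < x k \<and> x k < 2 * real k + 2"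
  shows "chaos n (\<lambda>z. indicator (trunc n N) z * f z) N x = chaos n f N x"
  unfolding chaos_def
proof (rule sum.cong[OF refl])
  fix A assume "A \<in> {A. A \<subseteq> {..<N} \<and> card A = n}"
  then have A: "finite A" "card A = n" "A \<subseteq> {..<N}" by (auto intro: finite_subset[of _ "{..<N}"])
  define \<sigma> where "\<sigma> = (SOME \<sigma>. bij_betw \<sigma> {..<n} A)"
  have \<sigma>: "bij_betw \<sigma> {..<n} A" unfolding \<sigma>_def by (rule some_enum[OF A(1,2)])
  have "x (\<sigma> j) < 2 * real N" if "j < n" for j
  proof -
    have "\<sigma> j < N" using bij_betwE[OF \<sigma>] that A(3) by auto
    then have "real (\<sigma> j) + 1 \<le> real N" by linarith
    then show ?thesis using x[rule_format, of "\<sigma> j"] by linarith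
  qed
  then have "pt n \<sigma> x \<in> trunc n N" by (simp add: trunc_def pt_def)
  then show "fact n * sval n (\<lambda>z. indicator (trunc n N) z * f z) x A = fact n * sval n f x A"
    by (simp add: sval_def \<sigma>_def[symmetric])
qed

section \<open>Truncated kernels and convergence of the truncated sums\<close>

context chaos_kernel
begin

lemma trunc_f2_integrable: "integrable (Lb n) (\<lambda>z. indicator (trunc n N) z * (f z)\<^sup>2)"
proof (rule Bochner_Integration.integrable_bound[OF f2_integrable])
  show "(\<lambda>z. indicator (trunc n N) z * (f z)\<^sup>2) \<in> borel_measurable (Lb n)"
    by (rule borel_measurable_times[OF measurable_indicator_trunc borel_measurable_power[OF f_measurable]])
qed (simp add: indicator_def)

text \<open>The cut at 2 * N falls between blocks: on each block the truncated kernel is, up to a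
  null set, either the old one or zero. Hence centering survives.\<close>

lemma trunc_kernel: "chaos_kernel n (\<lambda>z. indicator (trunc n N) z * f z)"
proof unfold_locales
  show "n \<ge> 1" by (rule n_pos)
  have n: "n = Suc (n - 1)" using n_pos by simp
  have m: "(\<lambda>z. indicator (trunc n N) z * f z) \<in> borel_measurable (Lb n)"
    by (rule borel_measurable_times[OF measurable_indicator_trunc f_measurable])
  have "((indicator (trunc n N) z :: real) * f z)\<^sup>2 = indicator (trunc n N) z * (f z)\<^sup>2" for z
    by (simp add: indicator_def)
  then have "L2 n (\<lambda>z. indicator (trunc n N) z * f z)" using m trunc_f2_integrable by (simp add: L2_def)
  moreover have "symmetric_fun n (\<lambda>z. indicator (trunc n N) z * f z)"
    unfolding symmetric_fun_def
  proof (intro allI impI)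
    fix p and z :: "nat \<Rightarrow> real" assume p: "p permutes {..<n}" and z: "z \<in> {..<n} \<rightarrow>\<^sub>E UNIV"
    have "(\<forall>j<n. z (p j) < 2 * real N) \<longleftrightarrow> (\<forall>j\<in>p ` {..<n}. z j < 2 * real N)" by auto
    then have "z \<circ> p \<in> trunc n N \<longleftrightarrow> z \<in> trunc n N" unfolding permutes_image[OF p] by (auto simp: trunc_def)
    moreover have "f (z \<circ> p) = f z" using f_sym p z by (simp add: symmetric_fun_def)
    ultimately show "indicator (trunc n N) (z \<circ> p) * f (z \<circ> p) = indicator (trunc n N) z * f z" by (simp add: indicator_def)
  qed
  ultimately show "L2hat n (\<lambda>z. indicator (trunc n N) z * f z)" using f_van by (auto simp: L2hat_def)
  show "centered n (\<lambda>z. indicator (trunc n N) z * f z)"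
    unfolding centered_def
  proof
    fix k :: nat
    have "AE y in Lb (n - 1). (LBINT t:{2 * real k .. 2 * real k + 2}. f (case_nat t y)) = 0"
      using centered by (simp add: centered_def)
    moreover have "AE y in Lb (n - 1). y \<in> space (Lb (n - 1))" by (rule AE_space)
    ultimately show "AE y in Lb (n - 1). (LBINT t:{2 * real k .. 2 * real k + 2}. indicator (trunc n N) (case_nat t y) * f (case_nat t y)) = 0"
    proof eventually_elim
      case (elim y)
      have fm: "f \<in> borel_measurable (Lb (Suc (n - 1)))" using f_measurable n by simp
      have "(\<lambda>t. f (case_nat t y)) \<in> borel_measurable leb_plus"
        by (rule measurable_compose[OF measurable_case_nat_PiM[where M="\<lambda>_. leb_plus"] fm]) (use elim in auto)
      then have fm [measurable]: "(\<lambda>t. f (case_nat t y)) \<in> borel_measurable lborel"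
        by (simp add: measurable_cong_sets[OF sets_leb_plus refl])
      have tr: "case_nat t y \<in> trunc n N \<longleftrightarrow> t < 2 * real N \<and> y \<in> trunc (n - 1) N" for t
        by (subst n) (auto simp: trunc_def less_Suc_eq_0_disj)
      define c :: real where "c = of_bool (k < N) * indicator (trunc (n - 1) N) y"
      have ne: "AE t in lborel. t \<noteq> 2 * real k + 2" by (rule AE_lborel_singleton)
      have "(LBINT t:{2 * real k .. 2 * real k + 2}. indicator (trunc n N) (case_nat t y) * f (case_nat t y))
        = (LBINT t:{2 * real k .. 2 * real k + 2}. c * f (case_nat t y))"
        unfolding set_lebesgue_integral_def
      proof (rule integral_cong_AE)
        show "AE t in lborel. indicator {2 * real k .. 2 * real k + 2} t *\<^sub>R (indicator (trunc n N) (case_nat t y) * f (case_nat t y))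
          = indicator {2 * real k .. 2 * real k + 2} t *\<^sub>R (c * f (case_nat t y))"
          using ne
        proof eventually_elim
          case (elim t)
          have "(indicator (trunc n N) (case_nat t y) :: real) = c" if "t \<in> {2 * real k .. 2 * real k + 2}"
          proof -
            \<comment> \<open>The right end point of the block, where this can fail, has been
              excluded as a null set.\<close>
            have "t < 2 * real N \<longleftrightarrow> k < N"
            proof
              assume "t < 2 * real N" then show "k < N" using that by auto
            next
              assume "k < N" then have "real k + 1 \<le> real N" by linarith
              then show "t < 2 * real N" using that elim by auto
            qed
            then show ?thesis by (simp add: tr c_def indicator_def)
          qed
          then show ?case by (simp add: indicator_def)
        qed
        have "(\<lambda>t. indicator (trunc n N) (case_nat t y) :: real) = (\<lambda>t. indicator {..<2 * real N} t * indicator (trunc (n - 1) N) y)"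
          by (auto simp: fun_eq_iff indicator_def tr)
        then have im [measurable]: "(\<lambda>t. indicator (trunc n N) (case_nat t y) :: real) \<in> borel_measurable lborel" by simp
        show "(\<lambda>t. indicator {2 * real k .. 2 * real k + 2} t *\<^sub>R (indicator (trunc n N) (case_nat t y) * f (case_nat t y))) \<in> borel_measurable lborel"
          by measurable
        show "(\<lambda>t. indicator {2 * real k .. 2 * real k + 2} t *\<^sub>R (c * f (case_nat t y))) \<in> borel_measurable lborel"
          by measurable
      qed
      also have "\<dots> = 0" using elim(1) by simp
      finally show ?case .
    qed
  qed
qed

lemma trunc_bounded:
  "(\<lambda>z. indicator (trunc n N) z * f z) z \<noteq> 0 \<Longrightarrow> i < n \<Longrightarrow> z i \<le> 2 * real N"
  by (auto simp: trunc_def indicator_def split: if_splits)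

lemma L2norm_trunc:
  "L2norm n (\<lambda>z. indicator (trunc n N) z * f z - f z) = ennreal (sqrt ((aL - a {..<N}) / fact n))"
proof -
  let ?g = "\<lambda>z. (f z)\<^sup>2 - indicator (trunc n N) z * (f z)\<^sup>2"
  have e: "((indicator (trunc n N) z :: real) * f z - f z)\<^sup>2 = ?g z" for z
    by (simp add: indicator_def)
  have gi: "integrable (Lb n) ?g" by (rule Bochner_Integration.integrable_diff[OF f2_integrable trunc_f2_integrable])
  have gn: "0 \<le> ?g z" for z by (simp add: indicator_def)
  have gm: "(\<lambda>z. ennreal (?g z)) \<in> borel_measurable (Lb n)" using borel_measurable_integrable[OF gi] by simp
  have "(\<integral>\<^sup>+ z. ennreal (?g z) \<partial>(\<Pi>\<^sub>M i\<in>{..<n}. half_leb)) = ennreal ((1 / 2) ^ n) * ennreal (\<integral>z. ?g z \<partial>Lb n)"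
    unfolding nn_integral_PiM_half_leb[OF gm] using gi gn by (subst nn_integral_eq_integral) auto
  also have "\<dots> = ennreal ((1 / 2) ^ n * (\<integral>z. ?g z \<partial>Lb n))"
    using gn by (intro ennreal_mult[symmetric]) auto
  also have "(\<integral>z. ?g z \<partial>Lb n) = (\<integral>z. (f z)\<^sup>2 \<partial>Lb n) - (\<integral>z. indicator (trunc n N) z * (f z)\<^sup>2 \<partial>Lb n)"
    by (rule Bochner_Integration.integral_diff[OF f2_integrable trunc_f2_integrable])
  also have "(1 / 2) ^ n * ((\<integral>z. (f z)\<^sup>2 \<partial>Lb n) - (\<integral>z. indicator (trunc n N) z * (f z)\<^sup>2 \<partial>Lb n)) = (aL - a {..<N}) / fact n"
    by (simp add: aL_eq_f_norm f_norm_square a_eq power_divide diff_divide_distrib right_diff_distrib)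
  finally show ?thesis unfolding L2norm_def e using a_le_aL[of N] by (simp add: esqrt_ennreal)
qed

lemma S_diff_norm:
  assumes "N \<le> N'"
  shows "blk.sqi (\<lambda>x. S {..<N'} x - S {..<N} x)" "(\<integral>x. (S {..<N'} x - S {..<N} x)\<^sup>2 \<partial>blk.P) = a {..<N'} - a {..<N}"
proof -
  have sub: "fam {..<N} \<subseteq> fam {..<N'}" using assms by (auto simp: fam_def)
  have S: "S {..<N'} x - S {..<N} x = (\<Sum>A\<in>fam {..<N'} - fam {..<N}. u A x)" for x
    unfolding S_def using sub by (subst sum_diff) (auto simp: finite_fam)
  have a: "a {..<N'} - a {..<N} = (\<Sum>A\<in>fam {..<N'} - fam {..<N}. u_norm A)"
    unfolding a_def using sub by (subst sum_diff) (auto simp: finite_fam)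
  note n = norm_sum_u[of "fam {..<N'} - fam {..<N}" "{..<N'}"]
  show "blk.sqi (\<lambda>x. S {..<N'} x - S {..<N} x)" unfolding S by (rule n(1)) (auto simp: finite_fam)
  show "(\<integral>x. (S {..<N'} x - S {..<N} x)\<^sup>2 \<partial>blk.P) = a {..<N'} - a {..<N}"
    unfolding S a by (rule n(2)) (auto simp: finite_fam)
qed

text \<open>The Riesz-Fischer argument made explicit: along a subsequence the increments have
  summable L1 norms, so the sums converge almost surely, and Fatou's lemma turns the missing
  variance into an error bound for every N.\<close>

lemma S_limit:
  "\<exists>Y\<in>borel_measurable blk.P. \<forall>N. (\<integral>\<^sup>+ x. ennreal ((S {..<N} x - Y x)\<^sup>2) \<partial>blk.P) \<le> ennreal (aL - a {..<N})"
proof -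
  have "\<exists>N. \<forall>m\<ge>N. aL - a {..<m} \<le> (1 / 4) ^ k" for k :: nat
  proof -
    have "eventually (\<lambda>m. aL - (1 / 4) ^ k < a {..<m}) sequentially"
      by (rule order_tendstoD(1)[OF a_lim]) simp
    then obtain N where N: "\<And>m. N \<le> m \<Longrightarrow> aL - (1 / 4) ^ k < a {..<m}" unfolding eventually_sequentially by auto
    have "aL - a {..<m} \<le> (1 / 4) ^ k" if "N \<le> m" for m using N[OF that] by linarith
    then show ?thesis by (intro exI[of _ N]) simp
  qed
  then obtain N0 where N0: "\<And>k m. N0 k \<le> m \<Longrightarrow> aL - a {..<m} \<le> (1 / 4) ^ k" by metis
  \<comment> \<open>Summing the thresholds makes the subsequence nondecreasing, and adding k makes
    it unbounded, as the passage to the lower limit requires.\<close>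
  define r where "r k = (\<Sum>i\<le>k. N0 i) + k" for k :: nat
  have r0: "N0 k \<le> r k" for k
    unfolding r_def using member_le_sum[of k "{..k}" N0] by simp
  have r1: "r k \<le> r (Suc k)" and r2: "k \<le> r k" for k by (auto simp: r_def)
  define \<delta> where "\<delta> k x = \<bar>S {..<r (Suc k)} x - S {..<r k} x\<bar>" for k x
  have Sm: "S {..<N} \<in> borel_measurable blk.P" for N using S_sqi[of "{..<N}"] by (intro blk.sqi_measurable) simp
  have \<delta>m: "\<delta> k \<in> borel_measurable blk.P" for k
    unfolding \<delta>_def[abs_def] by (intro borel_measurable_abs borel_measurable_diff Sm)
  have \<delta>i: "(\<integral>\<^sup>+ x. ennreal (\<delta> k x) \<partial>blk.P) \<le> ennreal ((1 / 2) ^ k)" for k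
  proof -
    have q: "blk.sqi (\<delta> k)"
      using S_diff_norm(1)[OF r1[of k]] \<delta>m[of k] by (simp add: blk.sqi_def \<delta>_def[abs_def])
    have "(\<integral>x. \<delta> k x \<partial>blk.P)\<^sup>2 \<le> (\<integral>x. (\<delta> k x)\<^sup>2 \<partial>blk.P)" by (rule blk.square_integral_le[OF q])
    also have "\<dots> = a {..<r (Suc k)} - a {..<r k}" using S_diff_norm(2)[OF r1[of k]] by (simp add: \<delta>_def[abs_def])
    also have "\<dots> \<le> (1 / 4) ^ k" using N0[OF r0, of k] a_le_aL[of "r (Suc k)"] by linarith
    also have "\<dots> = ((1 / 2) ^ k)\<^sup>2" by (simp add: power2_eq_square power_mult_distrib[symmetric])
    finally have "(\<integral>x. \<delta> k x \<partial>blk.P) \<le> (1 / 2) ^ k" by (rule power2_le_imp_le) simp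
    moreover have "(\<integral>\<^sup>+ x. ennreal (\<delta> k x) \<partial>blk.P) = ennreal (\<integral>x. \<delta> k x \<partial>blk.P)"
      by (rule nn_integral_eq_integral[OF blk.sqi_integrable[OF q]]) (simp add: \<delta>_def)
    ultimately show ?thesis by (simp add: ennreal_leI)
  qed
  have "(\<integral>\<^sup>+ x. (\<Sum>k. ennreal (\<delta> k x)) \<partial>blk.P) = (\<Sum>k. \<integral>\<^sup>+ x. ennreal (\<delta> k x) \<partial>blk.P)"
    using \<delta>m by (intro nn_integral_suminf) simp
  also have "\<dots> \<le> (\<Sum>k. ennreal ((1 / 2) ^ k))" by (intro suminf_le \<delta>i summableI)
  finally have le: "(\<integral>\<^sup>+ x. (\<Sum>k. ennreal (\<delta> k x)) \<partial>blk.P) \<le> (\<Sum>k. ennreal ((1 / 2) ^ k))" .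
  have "summable (\<lambda>k. (1 / 2 :: real) ^ k)" by (rule summable_geometric) simp
  then have "(\<Sum>k. ennreal ((1 / 2) ^ k)) \<noteq> \<top>" by (rule ennreal_suminf_neq_top) simp
  then have fin: "(\<integral>\<^sup>+ x. (\<Sum>k. ennreal (\<delta> k x)) \<partial>blk.P) \<noteq> \<infinity>"
    using neq_top_trans[OF _ le] by simp
  have "(\<lambda>x. \<Sum>k. ennreal (\<delta> k x)) \<in> borel_measurable blk.P"
    by (rule borel_measurable_suminf_order) (rule measurable_compose[OF \<delta>m measurable_ennreal])
  from nn_integral_PInf_AE[OF this fin] have "AE x in blk.P. (\<Sum>k. ennreal (\<delta> k x)) \<noteq> \<infinity>" .
  then have conv: "AE x in blk.P. convergent (\<lambda>k. S {..<r k} x)"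
  proof eventually_elim
    case (elim x)
    have "summable (\<lambda>k. \<delta> k x)" using elim by (intro summable_suminf_not_top) (auto simp: \<delta>_def)
    then have "summable (\<lambda>k. S {..<r (Suc k)} x - S {..<r k} x)" unfolding \<delta>_def by (rule summable_rabs_cancel)
    then have "convergent (\<lambda>m. \<Sum>k<m. S {..<r (Suc k)} x - S {..<r k} x)" by (simp add: summable_iff_convergent)
    then have "convergent (\<lambda>m. S {..<r m} x - S {..<r 0} x)" by (simp only: sum_lessThan_telescope[of "\<lambda>k. S {..<r k} x"])
    then have "convergent (\<lambda>m. (S {..<r m} x - S {..<r 0} x) + S {..<r 0} x)" by (rule convergent_add[OF _ convergent_const])
    then show ?case by simp
  qed
  define Y where "Y x = lim (\<lambda>k. S {..<r k} x)" for x
  show ?thesis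
  proof (intro bexI[of _ Y] allI)
    show "Y \<in> borel_measurable blk.P" unfolding Y_def[abs_def] by (intro borel_measurable_lim_metric Sm)
    fix N
    have "AE x in blk.P. ennreal ((S {..<N} x - Y x)\<^sup>2) = liminf (\<lambda>k. ennreal ((S {..<r k} x - S {..<N} x)\<^sup>2))"
      using conv
    proof eventually_elim
      case (elim x)
      then have "(\<lambda>k. S {..<r k} x) \<longlonglongrightarrow> Y x" unfolding Y_def by (simp add: convergent_LIMSEQ_iff)
      then have "(\<lambda>k. ennreal ((S {..<r k} x - S {..<N} x)\<^sup>2)) \<longlonglongrightarrow> ennreal ((Y x - S {..<N} x)\<^sup>2)"
        by (intro tendsto_ennrealI tendsto_intros)
      then have "liminf (\<lambda>k. ennreal ((S {..<r k} x - S {..<N} x)\<^sup>2)) = ennreal ((Y x - S {..<N} x)\<^sup>2)"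
        by (rule lim_imp_Liminf[OF sequentially_bot])
      then show ?case by (simp add: power2_commute)
    qed
    then have "(\<integral>\<^sup>+ x. ennreal ((S {..<N} x - Y x)\<^sup>2) \<partial>blk.P) = (\<integral>\<^sup>+ x. liminf (\<lambda>k. ennreal ((S {..<r k} x - S {..<N} x)\<^sup>2)) \<partial>blk.P)"
      by (rule nn_integral_cong_AE)
    also have "\<dots> \<le> liminf (\<lambda>k. \<integral>\<^sup>+ x. ennreal ((S {..<r k} x - S {..<N} x)\<^sup>2) \<partial>blk.P)"
    proof (rule nn_integral_liminf)
      show "(\<lambda>x. ennreal ((S {..<r k} x - S {..<N} x)\<^sup>2)) \<in> borel_measurable blk.P" for k
        using borel_measurable_diff[OF Sm[of "r k"] Sm[of N]] by simp
    qed
    also have "\<dots> \<le> liminf (\<lambda>k. ennreal (aL - a {..<N}))"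
    proof (rule Liminf_mono, rule eventually_mono[OF eventually_ge_at_top[of N]])
      fix k assume "N \<le> k"
      then have Nr: "N \<le> r k" using r2[of k] by simp
      have "(\<integral>\<^sup>+ x. ennreal ((S {..<r k} x - S {..<N} x)\<^sup>2) \<partial>blk.P) = ennreal (a {..<r k} - a {..<N})"
        unfolding S_diff_norm(2)[OF Nr, symmetric]
        using S_diff_norm(1)[OF Nr] by (intro nn_integral_eq_integral) (simp_all add: blk.sqi_def)
      also have "\<dots> \<le> ennreal (aL - a {..<N})" using a_le_aL[of "r k"] by (intro ennreal_leI) simp
      finally show "(\<integral>\<^sup>+ x. ennreal ((S {..<r k} x - S {..<N} x)\<^sup>2) \<partial>blk.P) \<le> ennreal (aL - a {..<N})" .
    qed
    also have "\<dots> = ennreal (aL - a {..<N})" by (rule Liminf_const[OF sequentially_bot])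
    finally show "(\<integral>\<^sup>+ x. ennreal ((S {..<N} x - Y x)\<^sup>2) \<partial>blk.P) \<le> ennreal (aL - a {..<N})" .
  qed
qed

end

section \<open>Transfer from the sequence U to the product space\<close>

lemma blk_translation:
  "distr (uniform_measure lborel {-1..1}) borel (\<lambda>t. 2 * real k + 1 + t) = blk k"
proof (rule measure_eqI)
  fix A :: "real set" assume "A \<in> sets (distr (uniform_measure lborel {-1..1}) borel (\<lambda>t. 2 * real k + 1 + t))"
  then have A [measurable]: "A \<in> sets borel" by simp
  let ?s = "(+) (2 * real k + 1)"
  have vs: "?s -` A \<in> sets borel"
    using measurable_sets_borel[of ?s borel A] A by simp
  have "?s \<in> borel_measurable (uniform_measure lborel {-1..1})"
    by (simp add: measurable_cong_sets[OF sets_uniform_measure refl])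
  then have "emeasure (distr (uniform_measure lborel {-1..1}) borel ?s) A = emeasure (uniform_measure lborel {-1..1}) (?s -` A)"
    by (subst emeasure_distr) auto
  also have "\<dots> = emeasure lborel ({-1..1} \<inter> ?s -` A) / 2"
    using vs by (subst emeasure_uniform_measure) auto
  also have "{-1..1} \<inter> ?s -` A = ?s -` ({2 * real k..2 * real k + 2} \<inter> A)" by auto
  also have "emeasure lborel \<dots> = emeasure (distr lborel borel ?s) ({2 * real k..2 * real k + 2} \<inter> A)"
    by (subst emeasure_distr) auto
  also have "\<dots> / 2 = emeasure (blk k) A"
    unfolding lborel_distr_plus blk_def by (subst emeasure_uniform_measure) auto
  finally show "emeasure (distr (uniform_measure lborel {-1..1}) borel (\<lambda>t. 2 * real k + 1 + t)) A = emeasure (blk k) A" .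
qed simp

locale uniform_sequence = prob_space M for M :: "'a measure" +
  fixes U :: "nat \<Rightarrow> 'a \<Rightarrow> real"
  assumes U_indep: "indep_vars (\<lambda>_. borel) U UNIV"
    and U_distr: "\<And>k. distr M borel (U k) = uniform_measure lborel {-1..1}"
begin

lemma U_measurable: "U k \<in> borel_measurable M"
  using U_indep by (auto simp: indep_vars_def)

lemma points_measurable: "points U \<in> M \<rightarrow>\<^sub>M blk.P"
  unfolding points_def[abs_def] by (intro blk.measurable_into_P borel_measurable_add borel_measurable_const U_measurable)

lemma distr_points: "distr M blk.P (points U) = blk.P"
proof -
  have d: "distr M borel (\<lambda>\<omega>. 2 * real k + 1 + U k \<omega>) = blk k" for k
  proof -
    have "distr (distr M borel (U k)) borel (\<lambda>t. 2 * real k + 1 + t) = distr M borel ((\<lambda>t. 2 * real k + 1 + t) \<circ> U k)"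
      by (rule distr_distr[OF _ U_measurable]) simp
    then show ?thesis unfolding U_distr blk_translation by (simp add: comp_def)
  qed
  have "indep_vars (\<lambda>_. borel) (\<lambda>k \<omega>. 2 * real k + 1 + U k \<omega>) UNIV"
    using indep_vars_compose2[OF U_indep, of "\<lambda>k t. 2 * real k + 1 + t" "\<lambda>_. borel"] by simp
  then have "distr M (\<Pi>\<^sub>M k\<in>UNIV. borel) (\<lambda>\<omega>. \<lambda>k\<in>UNIV. 2 * real k + 1 + U k \<omega>) = (\<Pi>\<^sub>M k\<in>UNIV. blk k)"
    using U_measurable by (subst (asm) indep_vars_iff_distr_eq_PiM) (auto simp: d)
  moreover have "distr M blk.P (points U) = distr M (\<Pi>\<^sub>M k\<in>UNIV. borel) (\<lambda>\<omega>. \<lambda>k\<in>UNIV. 2 * real k + 1 + U k \<omega>)"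
    by (rule distr_cong[OF refl blk.sets_P]) (simp add: points_def fun_eq_iff)
  ultimately show ?thesis by (simp add: blk.P_def)
qed

lemma AE_points: "AE \<omega> in M. \<forall>k. 2 * real k < points U \<omega> k \<and> points U \<omega> k < 2 * real k + 2"
proof (rule AE_distrD[OF points_measurable])
  show "AE x in distr M blk.P (points U). \<forall>k. 2 * real k < x k \<and> x k < 2 * real k + 2"
    unfolding distr_points by (rule AE_block)
qed

lemma nn_integral_points: "g \<in> borel_measurable blk.P \<Longrightarrow> (\<integral>\<^sup>+ \<omega>. g (points U \<omega>) \<partial>M) = (\<integral>\<^sup>+ x. g x \<partial>blk.P)"
  using nn_integral_distr[OF points_measurable, of g] by (simp add: distr_points)

text \<open>\<open>stoch_int\<close> is a choice among admissible variables, so one must exist. The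
  L2 limit of the truncated sums serves, with the truncated kernels as the approximating
  sequence.\<close>

lemma is_stoch_int_exists:
  assumes f: "chaos_kernel n f" shows "\<exists>X. is_stoch_int M U n f X"
proof -
  interpret f: chaos_kernel n f by (rule f)
  from f.S_limit obtain Y where Ym: "Y \<in> borel_measurable blk.P"
    and Y: "\<And>N. (\<integral>\<^sup>+ x. ennreal ((f.S {..<N} x - Y x)\<^sup>2) \<partial>blk.P) \<le> ennreal (f.aL - f.a {..<N})"
    by (elim bexE) simp
  have Sm: "f.S {..<N} \<in> borel_measurable blk.P" for N using f.S_sqi[of "{..<N}"] by (intro blk.sqi_measurable) simp
  have a0: "(\<lambda>N. f.aL - f.a {..<N}) \<longlonglongrightarrow> 0" using tendsto_diff[OF tendsto_const f.a_lim, of f.aL] by simp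
  have "is_stoch_int M U n f (\<lambda>\<omega>. Y (points U \<omega>))"
    unfolding is_stoch_int_def
  proof (intro conjI exI[of _ "\<lambda>N z. indicator (trunc n N) z * f z"] allI)
    show "(\<lambda>\<omega>. Y (points U \<omega>)) \<in> borel_measurable M" by (rule measurable_compose[OF points_measurable Ym])
    have "f.fam {..<0} = {}" using f.n_pos by (auto simp: f.fam_def)
    then have "f.S {..<0} x = 0" for x by (simp add: f.S_def)
    then have "(\<integral>\<^sup>+ x. ennreal ((Y x)\<^sup>2) \<partial>blk.P) \<le> ennreal (f.aL - f.a {..<0})" using Y[of 0] by simp
    then have "(\<integral>\<^sup>+ x. ennreal ((Y x)\<^sup>2) \<partial>blk.P) \<noteq> \<top>" by (auto simp: top_unique)
    then have "integrable blk.P (\<lambda>x. (Y x)\<^sup>2)" using sqi_nn_integral(1)[OF Ym] by (simp add: blk.sqi_def)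
    then have "integrable (distr M blk.P (points U)) (\<lambda>x. (Y x)\<^sup>2)" by (simp only: distr_points)
    then show "integrable M (\<lambda>\<omega>. (Y (points U \<omega>))\<^sup>2)" by (rule integrable_distr[OF points_measurable])
    fix N
    interpret g: chaos_kernel n "\<lambda>z. indicator (trunc n N) z * f z" by (rule f.trunc_kernel)
    show "L2hat n (\<lambda>z. indicator (trunc n N) z * f z)" "centered n (\<lambda>z. indicator (trunc n N) z * f z)"
      by (rule g.L2hat g.centered)+
    show "bounded_support n (\<lambda>z. indicator (trunc n N) z * f z)"
      unfolding bounded_support_def by (intro exI[of _ "2 * real N"] ballI impI allI) (rule f.trunc_bounded)
  next
    have "(\<lambda>N. sqrt ((f.aL - f.a {..<N}) / fact n)) \<longlonglongrightarrow> sqrt (0 / fact n)"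
      by (intro tendsto_real_sqrt tendsto_divide a0 tendsto_const) simp
    then have "(\<lambda>N. ennreal (sqrt ((f.aL - f.a {..<N}) / fact n))) \<longlonglongrightarrow> 0"
      using f.a_le_aL by (subst ennreal_tendsto_0_iff) auto
    then show "(\<lambda>N. L2norm n (\<lambda>z. indicator (trunc n N) z * f z - f z)) \<longlonglongrightarrow> 0" by (simp only: f.L2norm_trunc)
  next
    have le: "(\<integral>\<^sup>+ \<omega>. ennreal ((stoch_sum U n (\<lambda>z. indicator (trunc n N) z * f z) \<omega> - Y (points U \<omega>))\<^sup>2) \<partial>M) \<le> ennreal (f.aL - f.a {..<N})" for N
    proof -
      have "AE \<omega> in M. ennreal ((stoch_sum U n (\<lambda>z. indicator (trunc n N) z * f z) \<omega> - Y (points U \<omega>))\<^sup>2)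
          = ennreal ((f.S {..<N} (points U \<omega>) - Y (points U \<omega>))\<^sup>2)"
        using AE_points
      proof eventually_elim
        case (elim \<omega>)
        have "stoch_sum U n (\<lambda>z. indicator (trunc n N) z * f z) \<omega> = chaos n (\<lambda>z. indicator (trunc n N) z * f z) N (points U \<omega>)"
          by (rule stoch_sum_eq[OF f.trunc_kernel _ order_refl elim]) (rule f.trunc_bounded)
        also have "\<dots> = f.S {..<N} (points U \<omega>)" unfolding f.S_eq_chaos by (rule chaos_trunc[OF elim])
        finally show ?case by simp
      qed
      then have "(\<integral>\<^sup>+ \<omega>. ennreal ((stoch_sum U n (\<lambda>z. indicator (trunc n N) z * f z) \<omega> - Y (points U \<omega>))\<^sup>2) \<partial>M)
        = (\<integral>\<^sup>+ \<omega>. ennreal ((f.S {..<N} (points U \<omega>) - Y (points U \<omega>))\<^sup>2) \<partial>M)" by (rule nn_integral_cong_AE)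
      also have "\<dots> = (\<integral>\<^sup>+ x. ennreal ((f.S {..<N} x - Y x)\<^sup>2) \<partial>blk.P)"
        using borel_measurable_diff[OF Sm[of N] Ym] by (intro nn_integral_points[where g="\<lambda>x. ennreal ((f.S {..<N} x - Y x)\<^sup>2)"]) simp
      finally show ?thesis using Y[of N] by simp
    qed
    have l: "(\<lambda>N. ennreal (f.aL - f.a {..<N})) \<longlonglongrightarrow> 0"
      using a0 f.a_le_aL by (subst ennreal_tendsto_0_iff) auto
    show "(\<lambda>N. \<integral>\<^sup>+ \<omega>. ennreal ((stoch_sum U n (\<lambda>z. indicator (trunc n N) z * f z) \<omega> - Y (points U \<omega>))\<^sup>2) \<partial>M) \<longlonglongrightarrow> 0"
      by (rule tendsto_sandwich[OF _ _ tendsto_const l]; intro always_eventually allI zero_le le)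
  qed
  then show ?thesis by (rule exI[where x="\<lambda>\<omega>. Y (points U \<omega>)"])
qed

text \<open>An admissible X comes with an arbitrary approximating sequence g. For each
  \<open>g j\<close> the truncated sum is eventually the full sum, and replacing f by
  \<open>g j\<close> costs at most the norm of the difference, uniformly in N; so every admissible X
  is the limit of the same sums.\<close>

lemma chaos_tendsto:
  assumes f: "chaos_kernel n f" and X: "is_stoch_int M U n f X"
  shows "(\<lambda>N. \<integral>\<^sup>+ \<omega>. ennreal ((chaos n f N (points U \<omega>) - X \<omega>)\<^sup>2) \<partial>M) \<longlonglongrightarrow> 0"
proof (rule order_tendstoI)
  fix e :: ennreal assume e: "0 < e"
  interpret f: chaos_kernel n f by (rule f)
  obtain g where g: "\<And>j. L2hat n (g j)" "\<And>j. centered n (g j)" "\<And>j. bounded_support n (g j)"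
    and gf: "(\<lambda>j. L2norm n (\<lambda>x. g j x - f x)) \<longlonglongrightarrow> 0"
    and gX: "(\<lambda>j. \<integral>\<^sup>+ \<omega>. ennreal ((stoch_sum U n (g j) \<omega> - X \<omega>)\<^sup>2) \<partial>M) \<longlonglongrightarrow> 0"
    and Xm: "X \<in> borel_measurable M"
    using X unfolding is_stoch_int_def by auto
  have gk: "chaos_kernel n (g j)" for j using f.n_pos g by unfold_locales auto
  have cm: "chaos n h N \<in> borel_measurable blk.P" if h: "chaos_kernel n h" for h N
  proof -
    interpret h: chaos_kernel n h by (rule h)
    show ?thesis unfolding h.S_eq_chaos[symmetric] by (rule blk.sqi_measurable[OF h.S_sqi]) simp
  qed
  \<comment> \<open>Error of replacing the kernel plus error of the approximating integral. Both
    vanish as j grows, so a single j is fixed before N is taken beyond the support of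
    \<open>g j\<close>.\<close>
  let ?e = "\<lambda>j. 2 * (fact n * (L2norm n (\<lambda>x. g j x - f x) * L2norm n (\<lambda>x. g j x - f x)))
      + 2 * (\<integral>\<^sup>+ \<omega>. ennreal ((stoch_sum U n (g j) \<omega> - X \<omega>)\<^sup>2) \<partial>M)"
  have "?e \<longlonglongrightarrow> 2 * (fact n * (0 * 0)) + 2 * 0"
    using gf gX by (intro tendsto_add tendsto_mult_ennreal tendsto_const) auto
  then have "eventually (\<lambda>j. ?e j < e) sequentially" using e by (intro order_tendstoD(2)) simp_all
  then obtain j where j: "?e j < e" using eventually_happens'[OF sequentially_bot] by blast
  obtain b where b: "\<And>z i. z \<in> {..<n} \<rightarrow>\<^sub>E UNIV \<Longrightarrow> g j z \<noteq> 0 \<Longrightarrow> i < n \<Longrightarrow> z i \<le> b"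
    using g(3)[of j] unfolding bounded_support_def by blast
  obtain J where J: "b \<le> real J" using real_arch_simple by blast
  show "eventually (\<lambda>N. (\<integral>\<^sup>+ \<omega>. ennreal ((chaos n f N (points U \<omega>) - X \<omega>)\<^sup>2) \<partial>M) < e) sequentially"
  proof (rule eventually_mono[OF eventually_ge_at_top[of J]])
    fix N assume "J \<le> N"
    then have N: "b \<le> 2 * real N" using J by simp
    have sm: "(\<lambda>\<omega>. chaos n (g j) N (points U \<omega>)) \<in> borel_measurable M" "(\<lambda>\<omega>. chaos n f N (points U \<omega>)) \<in> borel_measurable M"
      by (rule measurable_compose[OF points_measurable cm[OF gk]] measurable_compose[OF points_measurable cm[OF f]])+
    have sq: "(a - c)\<^sup>2 \<le> 2 * (b - a)\<^sup>2 + 2 * (b - c)\<^sup>2" for a b c :: real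
    proof -
      have "2 * (b - a)\<^sup>2 + 2 * (b - c)\<^sup>2 - (a - c)\<^sup>2 = (2 * b - a - c)\<^sup>2" by (simp add: power2_eq_square algebra_simps)
      then show ?thesis using zero_le_power2[of "2 * b - a - c"] by linarith
    qed
    have sqe: "ennreal ((a - c)\<^sup>2) \<le> 2 * ennreal ((b - a)\<^sup>2) + 2 * ennreal ((b - c)\<^sup>2)" for a b c :: real
    proof -
      have "ennreal ((a - c)\<^sup>2) \<le> ennreal (2 * (b - a)\<^sup>2 + 2 * (b - c)\<^sup>2)" by (rule ennreal_leI[OF sq])
      also have "\<dots> = 2 * ennreal ((b - a)\<^sup>2) + 2 * ennreal ((b - c)\<^sup>2)" by (simp add: ennreal_plus ennreal_mult)
      finally show ?thesis .
    qed
    have "(\<integral>\<^sup>+ \<omega>. ennreal ((chaos n f N (points U \<omega>) - X \<omega>)\<^sup>2) \<partial>M)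
      \<le> (\<integral>\<^sup>+ \<omega>. 2 * ennreal ((chaos n (g j) N (points U \<omega>) - chaos n f N (points U \<omega>))\<^sup>2) + 2 * ennreal ((chaos n (g j) N (points U \<omega>) - X \<omega>)\<^sup>2) \<partial>M)"
      by (intro nn_integral_mono sqe)
    also have "\<dots> = (\<integral>\<^sup>+ \<omega>. 2 * ennreal ((chaos n (g j) N (points U \<omega>) - chaos n f N (points U \<omega>))\<^sup>2) \<partial>M)
        + (\<integral>\<^sup>+ \<omega>. 2 * ennreal ((chaos n (g j) N (points U \<omega>) - X \<omega>)\<^sup>2) \<partial>M)"
      using sm Xm by (intro nn_integral_add) simp_all
    also have "(\<integral>\<^sup>+ \<omega>. 2 * ennreal ((chaos n (g j) N (points U \<omega>) - chaos n f N (points U \<omega>))\<^sup>2) \<partial>M)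
        = 2 * (\<integral>\<^sup>+ \<omega>. ennreal ((chaos n (g j) N (points U \<omega>) - chaos n f N (points U \<omega>))\<^sup>2) \<partial>M)"
      using sm by (intro nn_integral_cmult) simp
    also have "(\<integral>\<^sup>+ \<omega>. ennreal ((chaos n (g j) N (points U \<omega>) - chaos n f N (points U \<omega>))\<^sup>2) \<partial>M)
        = (\<integral>\<^sup>+ x. ennreal ((chaos n (g j) N x - chaos n f N x)\<^sup>2) \<partial>blk.P)"
      using borel_measurable_diff[OF cm[OF gk[of j], of N] cm[OF f, of N]]
      by (intro nn_integral_points[where g="\<lambda>x. ennreal ((chaos n (g j) N x - chaos n f N x)\<^sup>2)"]) simp
    also have "(\<integral>\<^sup>+ \<omega>. 2 * ennreal ((chaos n (g j) N (points U \<omega>) - X \<omega>)\<^sup>2) \<partial>M) = 2 * (\<integral>\<^sup>+ \<omega>. ennreal ((chaos n (g j) N (points U \<omega>) - X \<omega>)\<^sup>2) \<partial>M)"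
      using sm Xm by (intro nn_integral_cmult) simp
    also have "(\<integral>\<^sup>+ \<omega>. ennreal ((chaos n (g j) N (points U \<omega>) - X \<omega>)\<^sup>2) \<partial>M) = (\<integral>\<^sup>+ \<omega>. ennreal ((stoch_sum U n (g j) \<omega> - X \<omega>)\<^sup>2) \<partial>M)"
    proof (rule nn_integral_cong_AE)
      show "AE \<omega> in M. ennreal ((chaos n (g j) N (points U \<omega>) - X \<omega>)\<^sup>2) = ennreal ((stoch_sum U n (g j) \<omega> - X \<omega>)\<^sup>2)"
        using AE_points
      proof eventually_elim
        case (elim \<omega>)
        have "stoch_sum U n (g j) \<omega> = chaos n (g j) N (points U \<omega>)"
          by (rule stoch_sum_eq[OF gk[of j] _ N elim]) (rule b)
        then show ?case by simp
      qed
    qed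
    also have "2 * (\<integral>\<^sup>+ x. ennreal ((chaos n (g j) N x - chaos n f N x)\<^sup>2) \<partial>blk.P) + 2 * (\<integral>\<^sup>+ \<omega>. ennreal ((stoch_sum U n (g j) \<omega> - X \<omega>)\<^sup>2) \<partial>M) \<le> ?e j"
      using chaos_diff_norm[OF gk f, of j N] by (intro add_right_mono mult_left_mono) (simp_all add: power2_eq_square)
    also note j
    finally show "(\<integral>\<^sup>+ \<omega>. ennreal ((chaos n f N (points U \<omega>) - X \<omega>)\<^sup>2) \<partial>M) < e" .
  qed
qed simp

text \<open>The Lipschitz condition reduces the claim to convergence in L1, which follows from
  convergence in L2 by nonnegativity of the variance.\<close>

lemma expectation_chaos_tendsto:
  fixes \<phi> :: "real \<Rightarrow> real"
  assumes f: "chaos_kernel n f" and X: "is_stoch_int M U n f X" and \<phi>: "1-lipschitz_on UNIV \<phi>"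
  shows "(\<lambda>N. \<integral>x. \<phi> (chaos n f N x) \<partial>blk.P) \<longlonglongrightarrow> (\<integral>\<omega>. \<phi> (X \<omega>) \<partial>M)"
proof -
  interpret f: chaos_kernel n f by (rule f)
  have Xm: "X \<in> borel_measurable M" and X2: "integrable M (\<lambda>\<omega>. (X \<omega>)\<^sup>2)"
    using X by (auto simp: is_stoch_int_def)
  have Xi: "integrable M X" by (rule square_integrable_imp_integrable[OF Xm X2])
  have \<phi>m: "\<phi> \<in> borel_measurable borel"
    using lipschitz_on_continuous_on[OF \<phi>] by (rule borel_measurable_continuous_onI)
  have \<phi>i: "integrable M (\<lambda>\<omega>. \<phi> (Z \<omega>))" if Z: "integrable M Z" for Z
  proof (rule Bochner_Integration.integrable_bound)
    show "integrable M (\<lambda>\<omega>. \<bar>\<phi> 0\<bar> + \<bar>Z \<omega>\<bar>)" using Z by simp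
    show "(\<lambda>\<omega>. \<phi> (Z \<omega>)) \<in> borel_measurable M" by (rule measurable_compose[OF borel_measurable_integrable[OF Z] \<phi>m])
    have "\<bar>\<phi> t\<bar> \<le> \<bar>\<phi> 0\<bar> + \<bar>t\<bar>" for t using lipschitz_onD[OF \<phi>, of t 0] by (auto simp: dist_real_def)
    then show "AE \<omega> in M. norm (\<phi> (Z \<omega>)) \<le> norm (\<bar>\<phi> 0\<bar> + \<bar>Z \<omega>\<bar>)" by (auto intro!: always_eventually)
  qed
  have S: "blk.sqi (chaos n f N)" for N unfolding f.S_eq_chaos[symmetric] by (rule f.S_sqi) simp
  have Si: "integrable M (\<lambda>\<omega>. chaos n f N (points U \<omega>))" for N
    by (rule integrable_distr[OF points_measurable], unfold distr_points, rule blk.sqi_integrable[OF S])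
  have S2: "integrable M (\<lambda>\<omega>. (chaos n f N (points U \<omega>))\<^sup>2)" for N
  proof -
    have "integrable (distr M blk.P (points U)) (\<lambda>x. (chaos n f N x)\<^sup>2)" unfolding distr_points using S by (simp add: blk.sqi_def)
    then show ?thesis by (rule integrable_distr[OF points_measurable])
  qed
  have b: "\<bar>(\<integral>x. \<phi> (chaos n f N x) \<partial>blk.P) - (\<integral>\<omega>. \<phi> (X \<omega>) \<partial>M)\<bar> \<le> sqrt (enn2real (\<integral>\<^sup>+ \<omega>. ennreal ((chaos n f N (points U \<omega>) - X \<omega>)\<^sup>2) \<partial>M))" for N
  proof -
    let ?d = "\<lambda>\<omega>. chaos n f N (points U \<omega>) - X \<omega>"
    have dm: "?d \<in> borel_measurable M" using borel_measurable_integrable[OF Si] Xm by (rule borel_measurable_diff)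
    have d2: "integrable M (\<lambda>\<omega>. (?d \<omega>)\<^sup>2)"
    proof (rule Bochner_Integration.integrable_bound)
      show "integrable M (\<lambda>\<omega>. 2 * (chaos n f N (points U \<omega>))\<^sup>2 + 2 * (X \<omega>)\<^sup>2)" using S2 X2 by simp
      have "(a - c)\<^sup>2 \<le> 2 * a\<^sup>2 + 2 * c\<^sup>2" for a c :: real
        using zero_le_power2[of "a + c"] by (simp add: power2_eq_square algebra_simps)
      then show "AE \<omega> in M. norm ((?d \<omega>)\<^sup>2) \<le> norm (2 * (chaos n f N (points U \<omega>))\<^sup>2 + 2 * (X \<omega>)\<^sup>2)" by simp
    qed (use dm in simp)
    have di: "integrable M ?d" by (rule square_integrable_imp_integrable[OF dm d2])
    have "(\<integral>x. \<phi> (chaos n f N x) \<partial>distr M blk.P (points U)) = (\<integral>\<omega>. \<phi> (chaos n f N (points U \<omega>)) \<partial>M)"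
      by (rule integral_distr[OF points_measurable]) (rule measurable_compose[OF blk.sqi_measurable[OF S] \<phi>m])
    then have "(\<integral>x. \<phi> (chaos n f N x) \<partial>blk.P) - (\<integral>\<omega>. \<phi> (X \<omega>) \<partial>M) = (\<integral>\<omega>. \<phi> (chaos n f N (points U \<omega>)) - \<phi> (X \<omega>) \<partial>M)"
      unfolding distr_points using \<phi>i[OF Si] \<phi>i[OF Xi] by simp
    also have "\<bar>\<dots>\<bar> \<le> (\<integral>\<omega>. \<bar>\<phi> (chaos n f N (points U \<omega>)) - \<phi> (X \<omega>)\<bar> \<partial>M)"
      by (rule integral_abs_bound)
    also have "\<dots> \<le> (\<integral>\<omega>. \<bar>?d \<omega>\<bar> \<partial>M)"
    proof (rule integral_mono)
      show "integrable M (\<lambda>\<omega>. \<bar>\<phi> (chaos n f N (points U \<omega>)) - \<phi> (X \<omega>)\<bar>)" using \<phi>i[OF Si] \<phi>i[OF Xi] by simp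
      show "integrable M (\<lambda>\<omega>. \<bar>?d \<omega>\<bar>)" using di by (rule integrable_abs)
      show "\<bar>\<phi> (chaos n f N (points U \<omega>)) - \<phi> (X \<omega>)\<bar> \<le> \<bar>?d \<omega>\<bar>" for \<omega>
        using lipschitz_onD[OF \<phi>, of "chaos n f N (points U \<omega>)" "X \<omega>"] by (simp add: dist_real_def)
    qed
    also have "\<dots> \<le> sqrt (\<integral>\<omega>. (?d \<omega>)\<^sup>2 \<partial>M)"
    proof (rule real_le_rsqrt)
      have "0 \<le> variance (\<lambda>\<omega>. \<bar>?d \<omega>\<bar>)" by (rule variance_positive)
      also have "\<dots> = expectation (\<lambda>\<omega>. \<bar>?d \<omega>\<bar>\<^sup>2) - (expectation (\<lambda>\<omega>. \<bar>?d \<omega>\<bar>))\<^sup>2"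
        using di d2 by (intro variance_eq) simp_all
      finally show "(\<integral>\<omega>. \<bar>?d \<omega>\<bar> \<partial>M)\<^sup>2 \<le> (\<integral>\<omega>. (?d \<omega>)\<^sup>2 \<partial>M)" by simp
    qed
    also have "(\<integral>\<omega>. (?d \<omega>)\<^sup>2 \<partial>M) = enn2real (\<integral>\<^sup>+ \<omega>. ennreal ((?d \<omega>)\<^sup>2) \<partial>M)"
      using d2 by (intro integral_eq_nn_integral) auto
    finally show ?thesis .
  qed
  have "(\<lambda>N. enn2real (\<integral>\<^sup>+ \<omega>. ennreal ((chaos n f N (points U \<omega>) - X \<omega>)\<^sup>2) \<partial>M)) \<longlonglongrightarrow> 0"
    using chaos_tendsto[OF f X] by (intro tendsto_enn2real) simp_all
  from tendsto_real_sqrt[OF this]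
  have "(\<lambda>N. sqrt (enn2real (\<integral>\<^sup>+ \<omega>. ennreal ((chaos n f N (points U \<omega>) - X \<omega>)\<^sup>2) \<partial>M))) \<longlonglongrightarrow> 0"
    by (simp only: real_sqrt_zero)
  then have "(\<lambda>N. (\<integral>x. \<phi> (chaos n f N x) \<partial>blk.P) - (\<integral>\<omega>. \<phi> (X \<omega>) \<partial>M)) \<longlonglongrightarrow> 0"
    by (rule Lim_null_comparison[rotated]) (simp add: b)
  then show ?thesis by (simp only: LIM_zero_iff)
qed

end

theorem corollary5p2:
  fixes M :: "'a measure" and U :: "nat \<Rightarrow> 'a \<Rightarrow> real"
    and N :: "'b measure" and Z :: "'b \<Rightarrow> real"
    and n :: nat and f :: "(nat \<Rightarrow> real) \<Rightarrow> real"
  assumes "prob_space M"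
    and "prob_space.indep_vars M (\<lambda>_. borel) U UNIV"
    and "\<And>k. distr M borel (U k) = uniform_measure lborel {-1..1}"
    and "prob_space N" and "distributed N lborel Z std_normal_density"
    and "n \<ge> 1"
    and "L2hat n f" and "centered n f"
    and "\<And>k. k \<in> {1..2 * n - 2} \<Longrightarrow> L2 k (Ghat n k f)"
  shows "d_W M (stoch_int M U n f) N Z
    \<le> esqrt (ennreal ((1 - fact n * (enn2real (L2norm n f))\<^sup>2)\<^sup>2)
          + of_nat (n\<^sup>2) * (\<Sum>k = 1..2 * n - 2. of_nat (fact k) * (L2norm k (Ghat n k f))\<^sup>2))
      + of_nat (n\<^sup>2) * ennreal (sqrt (2 * fact (n - 1))) * L2norm n f
          * esqrt (\<Sum>k = 0..2 * n - 2. of_nat (fact k)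
              * (\<integral>\<^sup>+ t. (L2norm k (G (n - 1) k (\<lambda>y. f (case_nat t y))))\<^sup>2 \<partial>leb_plus))"
proof -
  interpret M: prob_space M by (rule assms(1))
  interpret uniform_sequence M U by unfold_locales (rule assms)+
  interpret f: chaos_bound n f using assms(6-9) by unfold_locales
  have X: "is_stoch_int M U n f (stoch_int M U n f)"
    unfolding stoch_int_def by (rule someI_ex[OF is_stoch_int_exists[OF f.chaos_kernel_axioms]])
  have "ennreal \<bar>(\<integral>\<omega>. \<phi> (stoch_int M U n f \<omega>) \<partial>M) - (\<integral>\<omega>. \<phi> (Z \<omega>) \<partial>N)\<bar> \<le> f.stein_rhs" if \<phi>: "1-lipschitz_on UNIV \<phi>" for \<phi>
  proof -
    have \<phi>m: "\<phi> \<in> borel_measurable borel"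
      using lipschitz_on_continuous_on[OF \<phi>] by (rule borel_measurable_continuous_onI)
    have "(\<integral>y. std_normal_density y * \<phi> y \<partial>lborel) = (\<integral>\<omega>. \<phi> (Z \<omega>) \<partial>N)"
      using \<phi>m by (intro distributed_integral[OF assms(5)]) simp_all
    then have Z: "(\<integral>\<omega>. \<phi> (Z \<omega>) \<partial>N) = (\<integral>y. \<phi> y * std_normal_density y \<partial>lborel)" by (simp only: mult.commute)
    \<comment> \<open>The missing variance tends to zero, so no trace of the truncation is left on
      the right side.\<close>
    have l: "(\<lambda>J. f.stein_rhs + ennreal (f.aL - f.a {..<J})) \<longlonglongrightarrow> f.stein_rhs + ennreal (f.aL - f.aL)"
      by (intro tendsto_add tendsto_ennrealI tendsto_diff tendsto_const f.a_lim)
    have "(\<lambda>J. ennreal \<bar>(\<integral>x. \<phi> (f.S {..<J} x) \<partial>blk.P) - (\<integral>y. \<phi> y * std_normal_density y \<partial>lborel)\<bar>)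
      \<longlonglongrightarrow> ennreal \<bar>(\<integral>\<omega>. \<phi> (stoch_int M U n f \<omega>) \<partial>M) - (\<integral>y. \<phi> y * std_normal_density y \<partial>lborel)\<bar>"
      unfolding f.S_eq_chaos
      by (intro tendsto_ennrealI tendsto_rabs tendsto_diff tendsto_const expectation_chaos_tendsto[OF f.chaos_kernel_axioms X \<phi>])
    from LIMSEQ_le[OF this l] have "ennreal \<bar>(\<integral>\<omega>. \<phi> (stoch_int M U n f \<omega>) \<partial>M) - (\<integral>y. \<phi> y * std_normal_density y \<partial>lborel)\<bar>
        \<le> f.stein_rhs + ennreal (f.aL - f.aL)"
      using f.wasserstein_truncated[OF \<phi>] by (simp del: diff_self)
    then show ?thesis unfolding Z by simp
  qed
  then have "d_W M (stoch_int M U n f) N Z \<le> f.stein_rhs"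
    unfolding d_W_def by (intro SUP_least) simp
  then show ?thesis
    unfolding f.stein_rhs_def f.f_norm_def f.Ghat_norms_def f.G_norms_def f.G_norm_def .
qed

end
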